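(* Let $((A,\mu),(A^*,\gamma))$ be a Lie bialgebroid over a manifold $M$. Let $N:A\to A$ be a vector bundle endomorphism, and let $\mathcal N$ be the skew-symmetric endomorphism of $A\oplus A^*$ with matrix $\begin{pmatrix}N&0\\0&-{}^tN\end{pmatrix}$. (i) The element $\{\{\widetilde{\mathcal N},\mu+\gamma\},\widetilde{\mathcal N}\}$ is in $\mathcal A^3$ and is equal to $\{\{N,\mu+\gamma\},N\}$. (ii) If $N$ is proportional to an almost cps structure on $A$, then $$\widetilde{T_{\mu+\gamma}\mathcal N}=\widetilde{T_\mu N}+\widetilde{T_\gamma\,{}^tN},$$ that is, explicitly, for all sections $X+\xi,\,Y+\eta,\,Z+\zeta$ of $A\oplus A^*$, $$\begin{aligned}(T_{\mu+\gamma}\mathcal N)(X+\xi,Y+\eta,Z+\zeta)=\;&(T_\mu N)(X,Y,\zeta)+(T_\mu N)(Y,Z,\xi)+(T_\mu N)(Z,X,\eta)\\&+(T_\gamma{}^tN)(\xi,\eta,Z)+(T_\gamma{}^tN)(\eta,\zeta,X)+(T_\gamma{}^tN)(\zeta,\xi,Y).\end{aligned}$$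
   Context: Let $A$ be a (smooth, real, finite rank) vector bundle over $M$, and equip $E=A\oplus A^*$ with the canonical symmetric bilinear form $\langle X+\xi,Y+\eta\rangle=\xi(Y)+\eta(X)$. $\mathcal A=\bigoplus_k\mathcal A^k$ is the graded algebra of functions on the graded manifold $T^*[2]A[1]$, with its canonical Poisson bracket $\{\cdot,\cdot\}$ of degree $-2$ (the big bracket), with $\{a,b\}=-(-1)^{|a||b|}\{b,a\}$ and the graded Leibniz and Jacobi identities. For a local basis $(e_\alpha)$ of $\Gamma A$ with dual basis $(\epsilon^\alpha)$, local coordinates are $(x^i,\tau^\alpha,p_i,\theta_\alpha)$ of degrees $0,1,2,1$, with non-vanishing brackets $\{x^i,p_j\}=\delta^i_j$, $\{\tau^\alpha,\theta_\beta\}=\delta^\alpha_\beta$. $\mathcal A^0=C^\infty(M)$; $\mathcal A^1=\Gamma(A\oplus A^* )$, with $X=X^\alpha e_\alpha$ identified with $X^\alpha\theta_\alpha$ and $\xi=\xi_\alpha\epsilon^\alpha$ with $\xi_\alpha\tau^\alpha$; $\{u,v\}=\langle u,v\rangle$ for sections $u,v$ of $E$. A Lie algebroid structure on $A$ is given by $\mu\in\mathcal A^3$, locally a combination with coefficients in $C^\infty(M)$ of terms $\tau^\alpha p_i$ and $\tau^\alpha\tau^\beta\theta_\gamma$, with $\{\mu,\mu\}=0$: anchor $\rho(X)f=\{\{X,\mu\},f\}$, bracket $[X,Y]^\mu=\{\{X,\mu\},Y\}$. A Lie algebroid structure on $A^*$ is given similarly by $\gamma\in\mathcal A^3$ (terms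 $\theta_\alpha p_i$ and $\theta_\alpha\theta_\beta\tau^\gamma$), $\{\gamma,\gamma\}=0$, $[\xi,\eta]^\gamma=\{\{\xi,\gamma\},\eta\}$. They form a Lie bialgebroid iff moreover $\{\mu,\gamma\}=0$. Then $\Theta=\mu+\gamma$ makes $E=A\oplus A^*$ a Courant algebroid (the double), with (Dorfman) bracket $[u,v]=\{\{u,\mu+\gamma\},v\}$. A vector bundle endomorphism $N$ of $A$, considered as an element of $A^*\otimes A$, is identified with the element of $\mathcal A^2$ given locally by $N^\alpha_\beta\tau^\beta\theta_\alpha$ where $N=N^\alpha_\beta\epsilon^\beta e_\alpha$. For a skew-symmetric endomorphism $\mathcal N$ of $E$ ($\langle\mathcal Nu,v\rangle+\langle u,\mathcal Nv\rangle=0$), $\widetilde{\mathcal N}\in\mathcal A^2$ is the unique element with $\mathcal N(u)=\{u,\widetilde{\mathcal N}\}$ for all $u\in\Gamma E$. For an endomorphism $P$ of a vector space with bracket $[\cdot,\cdot]$ the torsion is $(u,v)\mapsto[Pu,Pv]-P([Pu,v]+[u,Pv]-P[u,v])$. $T_\mu N$, $T_\gamma{}^tN$, $T_{\mu+\gamma}\mathcal N$ denote the torsions of $N$, ${}^tN$, $\mathcal N$ for $[\cdot,\cdot]^\mu$ on $\Gamma A$, $[\cdot,\cdot]^\gamma$ on $\Gamma(A^* )$, and the Dorfman bracket on $\Gamma(A\oplus A^* )$ respectively. One writes $(T_\mu N)(X,Y,\zeta)=\langle(T_\mu N)(X,Y),\zeta\rangle$, $(T_\gamma{}^tN)(\xi,\eta,Z)=\langle(T_\gamma{}^tN)(\xi,\eta),Z\rangle$,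 and $\widetilde{T_{\mu+\gamma}\mathcal N}(u,v,w)=(T_{\mu+\gamma}\mathcal N)(u,v,w)=\langle(T_{\mu+\gamma}\mathcal N)(u,v),w\rangle$. For $t\in\Gamma(\wedge^2A^*\otimes A)$, $\widetilde t\in\Gamma(\wedge^3(A\oplus A^* ))$ is $\widetilde t(X+\xi,Y+\eta,Z+\zeta)=\langle t(X,Y),\zeta\rangle+\langle t(Y,Z),\xi\rangle+\langle t(Z,X),\eta\rangle$; for $t\in\Gamma(\wedge^2A\otimes A^* )$, $\widetilde t(X+\xi,Y+\eta,Z+\zeta)=\langle t(\xi,\eta),Z\rangle+\langle t(\eta,\zeta),X\rangle+\langle t(\zeta,\xi),Y\rangle$. Such skew-symmetric $3$-tensors are viewed in $\mathcal A^3$ via $\widetilde t(u,v,w)=\{\{\{u,\widetilde t\},v\},w\}$. An almost cps structure on $A$ is an endomorphism $N$ with $N^2=\epsilon\,\mathrm{Id}_A$, $\epsilon\in\{-1,1,0\}$; "proportional to" means equal to a real constant multiple of. *)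

theory Defs
  imports "HOL-Analysis.Analysis" "HOL-Library.Function_Algebras" "HOL-Library.Multiset"
begin

section \<open>Smooth manifolds and vector bundles\<close>

text \<open>
  Points of \<open>\<real>^n\<close> are functions \<open>nat \<Rightarrow> real\<close> vanishing from index \<open>n\<close> on, as in
  \<^const>\<open>Euclidean_space\<close>, so that dimension and rank are natural numbers and \<open>0\<close> is allowed
  (over a point one gets Lie bialgebras).
\<close>

definition partial :: "nat \<Rightarrow> ((nat \<Rightarrow> real) \<Rightarrow> real) \<Rightarrow> (nat \<Rightarrow> real) \<Rightarrow> real" where
  "partial i f y = deriv (\<lambda>t. f (y(i := t))) (y i)"

primrec Ck_on :: "nat \<Rightarrow> nat \<Rightarrow> (nat \<Rightarrow> real) set \<Rightarrow> ((nat \<Rightarrow> real) \<Rightarrow> real) \<Rightarrow> bool" where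
  "Ck_on 0 n V f \<longleftrightarrow> continuous_on V f"
| "Ck_on (Suc k) n V f \<longleftrightarrow> continuous_on V f \<and>
     (\<forall>i<n. (\<forall>y\<in>V. (\<lambda>t. f (y(i := t))) differentiable (at (y i))) \<and> Ck_on k n V (partial i f))"

definition smooth_on :: "nat \<Rightarrow> (nat \<Rightarrow> real) set \<Rightarrow> ((nat \<Rightarrow> real) \<Rightarrow> real) \<Rightarrow> bool" where
  "smooth_on n V f \<longleftrightarrow> (\<forall>k. Ck_on k n V f)"

text \<open>
  A chart \<open>(U, x)\<close> is an open set with its coordinate functions \<open>x\<^sup>i\<close> (\<open>i < n\<close>);
  a frame \<open>(W, e)\<close> is an open set with a local basis \<open>e\<^sub>\<alpha>\<close> (\<open>\<alpha> < r\<close>) of sections.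
  The manifold is the whole type of points. All fibres are subspaces of one ambient real vector
  space, of unrestricted dimension (for instance the direct sum of all the fibres).
\<close>

type_synonym 'm chart = "'m set \<times> (nat \<Rightarrow> 'm \<Rightarrow> real)"
type_synonym ('m, 'v) frame = "'m set \<times> (nat \<Rightarrow> 'm \<Rightarrow> 'v)"

record ('m, 'v) vbundle =
  bdim :: nat
  atlas :: "'m chart set"
  brank :: nat
  fibre :: "'m \<Rightarrow> 'v set"
  frames :: "('m, 'v) frame set"

definition coord_map :: "nat \<Rightarrow> 'm chart \<Rightarrow> 'm \<Rightarrow> nat \<Rightarrow> real" where
  "coord_map n ch q = (\<lambda>i. if i < n then snd ch i q else 0)"

definition is_chart :: "nat \<Rightarrow> ('m::topological_space) chart \<Rightarrow> bool" where
  "is_chart n ch \<longleftrightarrow> open (fst ch) \<and> openin (Euclidean_space n) (coord_map n ch ` fst ch) \<and>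
     homeomorphism (fst ch) (coord_map n ch ` fst ch) (coord_map n ch)
       (inv_into (fst ch) (coord_map n ch))"

definition in_chart :: "nat \<Rightarrow> 'm chart \<Rightarrow> ('m \<Rightarrow> real) \<Rightarrow> (nat \<Rightarrow> real) \<Rightarrow> real" where
  "in_chart n ch f = f \<circ> inv_into (fst ch) (coord_map n ch)"

text \<open>Smoothness on an open subset \<open>W\<close> of the manifold, and \<open>\<partial>f/\<partial>x\<^sup>i\<close> as a function on the
  manifold (meaningful on the domain of the chart).\<close>

definition smooth_fun :: "('m, 'v) vbundle \<Rightarrow> 'm set \<Rightarrow> ('m \<Rightarrow> real) \<Rightarrow> bool" where
  "smooth_fun B W f \<longleftrightarrow> (\<forall>ch\<in>atlas B.
     smooth_on (bdim B) (coord_map (bdim B) ch ` (fst ch \<inter> W)) (in_chart (bdim B) ch f))"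

definition pd :: "('m, 'v) vbundle \<Rightarrow> 'm chart \<Rightarrow> nat \<Rightarrow> ('m \<Rightarrow> real) \<Rightarrow> 'm \<Rightarrow> real" where
  "pd B ch i f q = partial i (in_chart (bdim B) ch f) (coord_map (bdim B) ch q)"

definition smooth_manifold ::
  "('m::{t2_space, second_countable_topology}, 'v) vbundle \<Rightarrow> bool" where
  "smooth_manifold B \<longleftrightarrow> (\<forall>ch\<in>atlas B. is_chart (bdim B) ch) \<and> (\<Union>ch\<in>atlas B. fst ch) = UNIV \<and>
     (\<forall>ch\<in>atlas B. \<forall>i<bdim B. smooth_fun B (fst ch) (snd ch i))"

text \<open>The component \<open>\<epsilon>\<^sup>\<alpha>(v)\<close> of \<open>v\<close> in a frame; it is \<open>0\<close> if \<open>v\<close> is not in the fibre over \<open>q\<close>.\<close>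

definition dual_frame ::
  "('m, 'v::real_vector) vbundle \<Rightarrow> ('m, 'v) frame \<Rightarrow> nat \<Rightarrow> 'm \<Rightarrow> 'v \<Rightarrow> real" where
  "dual_frame B fr \<alpha> q v = representation ((\<lambda>\<beta>. snd fr \<beta> q) ` {..<brank B}) v (snd fr \<alpha> q)"

definition vector_bundle ::
  "('m::{t2_space, second_countable_topology}, 'v::real_vector) vbundle \<Rightarrow> bool" where
  "vector_bundle B \<longleftrightarrow> smooth_manifold B \<and>
     (\<Union>fr\<in>frames B. fst fr) = UNIV \<and>
     (\<forall>fr\<in>frames B. open (fst fr)) \<and>
     (\<forall>fr\<in>frames B. \<forall>q\<in>fst fr. inj_on (\<lambda>\<alpha>. snd fr \<alpha> q) {..<brank B} \<and>
        independent ((\<lambda>\<alpha>. snd fr \<alpha> q) ` {..<brank B}) \<and>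
        span ((\<lambda>\<alpha>. snd fr \<alpha> q) ` {..<brank B}) = fibre B q) \<and>
     (\<forall>fr\<in>frames B. \<forall>fr'\<in>frames B. \<forall>\<alpha><brank B. \<forall>\<beta><brank B.
        smooth_fun B (fst fr \<inter> fst fr') (\<lambda>q. dual_frame B fr' \<alpha> q (snd fr \<beta> q)))"

section \<open>Sections and endomorphisms\<close>

definition linear_from :: "'a::real_vector set \<Rightarrow> ('a \<Rightarrow> 'b::real_vector) \<Rightarrow> bool" where
  "linear_from V f \<longleftrightarrow>
     (\<forall>v\<in>V. \<forall>w\<in>V. f (v + w) = f v + f w) \<and> (\<forall>v\<in>V. \<forall>a. f (a *\<^sub>R v) = a *\<^sub>R f v)"

definition dual_fibre :: "('m, 'v::real_vector) vbundle \<Rightarrow> 'm \<Rightarrow> ('v \<Rightarrow> real) set" where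
  "dual_fibre B q = {\<phi>. linear_from (fibre B q) \<phi> \<and> (\<forall>v. v \<notin> fibre B q \<longrightarrow> \<phi> v = 0)}"

definition sections_A :: "('m, 'v::real_vector) vbundle \<Rightarrow> ('m \<Rightarrow> 'v) set" where
  "sections_A B = {X. (\<forall>q. X q \<in> fibre B q) \<and>
     (\<forall>fr\<in>frames B. \<forall>\<alpha><brank B. smooth_fun B (fst fr) (\<lambda>q. dual_frame B fr \<alpha> q (X q)))}"

definition sections_As :: "('m, 'v::real_vector) vbundle \<Rightarrow> ('m \<Rightarrow> 'v \<Rightarrow> real) set" where
  "sections_As B = {\<xi>. (\<forall>q. \<xi> q \<in> dual_fibre B q) \<and>
     (\<forall>fr\<in>frames B. \<forall>\<alpha><brank B. smooth_fun B (fst fr) (\<lambda>q. \<xi> q (snd fr \<alpha> q)))}"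

type_synonym ('m, 'v) esec = "('m \<Rightarrow> 'v) \<times> ('m \<Rightarrow> 'v \<Rightarrow> real)"

definition sections_E :: "('m, 'v::real_vector) vbundle \<Rightarrow> ('m, 'v) esec set" where
  "sections_E B = sections_A B \<times> sections_As B"

definition pairing :: "('m, 'v) esec \<Rightarrow> ('m, 'v) esec \<Rightarrow> 'm \<Rightarrow> real" where
  "pairing u v = (\<lambda>q. snd u q (fst v q) + snd v q (fst u q))"

definition bundle_endo :: "('m, 'v::real_vector) vbundle \<Rightarrow> ('m \<Rightarrow> 'v \<Rightarrow> 'v) \<Rightarrow> bool" where
  "bundle_endo B N \<longleftrightarrow>
     (\<forall>q. linear_from (fibre B q) (N q) \<and> N q ` fibre B q \<subseteq> fibre B q) \<and>
     (\<forall>fr\<in>frames B. \<forall>\<alpha><brank B. \<forall>\<beta><brank B.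
        smooth_fun B (fst fr) (\<lambda>q. dual_frame B fr \<alpha> q (N q (snd fr \<beta> q))))"

definition endo_A :: "('m \<Rightarrow> 'v \<Rightarrow> 'v) \<Rightarrow> ('m \<Rightarrow> 'v) \<Rightarrow> 'm \<Rightarrow> 'v" where
  "endo_A N X = (\<lambda>q. N q (X q))"

definition transpose_A ::
  "('m, 'v) vbundle \<Rightarrow> ('m \<Rightarrow> 'v \<Rightarrow> 'v) \<Rightarrow> ('m \<Rightarrow> 'v \<Rightarrow> real) \<Rightarrow> 'm \<Rightarrow> 'v \<Rightarrow> real" where
  "transpose_A B N \<xi> = (\<lambda>q v. if v \<in> fibre B q then \<xi> q (N q v) else 0)"

definition endo_E :: "('m, 'v) vbundle \<Rightarrow> ('m \<Rightarrow> 'v \<Rightarrow> 'v) \<Rightarrow> ('m, 'v) esec \<Rightarrow> ('m, 'v) esec" where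
  "endo_E B N u = (endo_A N (fst u), - transpose_A B N (snd u))"

definition almost_cps :: "('m, 'v::real_vector) vbundle \<Rightarrow> ('m \<Rightarrow> 'v \<Rightarrow> 'v) \<Rightarrow> bool" where
  "almost_cps B N \<longleftrightarrow> bundle_endo B N \<and>
     (\<exists>\<epsilon>\<in>{-1, 1, 0 :: real}. \<forall>q. \<forall>v\<in>fibre B q. N q (N q v) = \<epsilon> *\<^sub>R v)"

definition proportional_to_cps :: "('m, 'v::real_vector) vbundle \<Rightarrow> ('m \<Rightarrow> 'v \<Rightarrow> 'v) \<Rightarrow> bool" where
  "proportional_to_cps B N \<longleftrightarrow>
     (\<exists>N\<^sub>0 c. almost_cps B N\<^sub>0 \<and> (\<forall>q. \<forall>v\<in>fibre B q. N q v = c *\<^sub>R N\<^sub>0 q v))"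

section \<open>The graded Poisson algebra in local coordinates\<close>

text \<open>
  A monomial \<open>(S, K)\<close> stands for \<open>\<zeta>\<^sub>S p\<^sub>K\<close>, where \<open>\<zeta>\<^sub>a = \<tau>\<^sup>a\<close> for \<open>a < r\<close>, \<open>\<zeta>\<^bsub>r+\<alpha>\<^esub> = \<theta>\<^sub>\<alpha>\<close> for
  \<open>\<alpha> < r\<close>, \<open>\<zeta>\<^sub>S\<close> is the product of the \<open>\<zeta>\<^sub>a\<close>, \<open>a \<in> S\<close>, in increasing order of \<open>a\<close>, and \<open>p\<^sub>K\<close>
  is the product of the \<open>p\<^sub>i\<close>, \<open>i \<in># K\<close>. A local function assigns to each monomial its coefficient,
  a function on the base (the coordinates \<open>x\<^sup>i\<close> enter through it).
\<close>

type_synonym mon = "nat set \<times> nat multiset"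
type_synonym 'm loc = "mon \<Rightarrow> 'm \<Rightarrow> real"

definition mon_el :: "mon \<Rightarrow> 'm loc" where
  "mon_el m = (\<lambda>m' q. if m' = m then 1 else 0)"

definition smul :: "('m \<Rightarrow> real) \<Rightarrow> 'm loc \<Rightarrow> 'm loc" where
  "smul f F = (\<lambda>m q. f q * F m q)"

text \<open>\<open>\<zeta>\<^sub>S \<zeta>\<^sub>T = ksign S T \<zeta>\<^bsub>S \<union> T\<^esub>\<close> for disjoint \<open>S\<close>, \<open>T\<close>.\<close>

definition ksign :: "nat set \<Rightarrow> nat set \<Rightarrow> real" where
  "ksign S T = (-1) ^ card {(s, t). s \<in> S \<and> t \<in> T \<and> t < s}"

definition lmul :: "'m loc \<Rightarrow> 'm loc \<Rightarrow> 'm loc" where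
  "lmul F G = (\<lambda>(S, K) q. \<Sum>S\<^sub>1\<in>Pow S. \<Sum>K\<^sub>1\<in>{K\<^sub>1. K\<^sub>1 \<subseteq># K}.
     ksign S\<^sub>1 (S - S\<^sub>1) * F (S\<^sub>1, K\<^sub>1) q * G (S - S\<^sub>1, K - K\<^sub>1) q)"

definition d_x :: "('m, 'v) vbundle \<Rightarrow> 'm chart \<Rightarrow> nat \<Rightarrow> 'm loc \<Rightarrow> 'm loc" where
  "d_x B ch i F = (\<lambda>m. pd B ch i (F m))"

definition d_p :: "nat \<Rightarrow> 'm loc \<Rightarrow> 'm loc" where
  "d_p i F = (\<lambda>(S, K) q. real (count K i + 1) * F (S, add_mset i K) q)"

text \<open>Left and right derivatives with respect to the odd variable \<open>\<zeta>\<^sub>a\<close>.\<close>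

definition d_left :: "nat \<Rightarrow> 'm loc \<Rightarrow> 'm loc" where
  "d_left a F = (\<lambda>(S, K) q. if a \<in> S then 0 else ksign {a} S * F (insert a S, K) q)"

definition d_right :: "nat \<Rightarrow> 'm loc \<Rightarrow> 'm loc" where
  "d_right a F = (\<lambda>(S, K) q. if a \<in> S then 0 else ksign S {a} * F (insert a S, K) q)"

text \<open>The biderivation with \<open>{x\<^sup>i, p\<^sub>j} = \<delta>\<^sup>i\<^sub>j\<close> and \<open>{\<tau>\<^sup>\<alpha>, \<theta>\<^sub>\<beta>} = \<delta>\<^sup>\<alpha>\<^sub>\<beta>\<close>: it satisfies
  \<open>{a, b} = -(-1)^(|a||b|) {b, a}\<close> and \<open>{a, bc} = {a, b}c + (-1)^(|a||b|) b{a, c}\<close>.\<close>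

definition local_bracket :: "('m, 'v) vbundle \<Rightarrow> 'm chart \<Rightarrow> 'm loc \<Rightarrow> 'm loc \<Rightarrow> 'm loc" where
  "local_bracket B ch F G =
     (\<Sum>i<bdim B. lmul (d_x B ch i F) (d_p i G) - lmul (d_p i F) (d_x B ch i G)) +
     (\<Sum>\<alpha><brank B. lmul (d_right \<alpha> F) (d_left (brank B + \<alpha>) G) +
                    lmul (d_right (brank B + \<alpha>) F) (d_left \<alpha> G))"

section \<open>Functions on the graded manifold \<open>T\<^sup>*[2]A[1]\<close>\<close>

text \<open>
  A coordinate patch is a chart together with a frame, over the intersection of their domains.
  A function on \<open>T\<^sup>*[2]A[1]\<close> is a family of local functions, one for each patch, which agree
  under the changes of coordinates. Coefficients are \<open>0\<close> wherever they are not meaningful, so that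
  equality of functions is equality in HOL.
\<close>

type_synonym ('m, 'v) patch = "'m chart \<times> ('m, 'v) frame"
type_synonym ('m, 'v) gfun = "('m, 'v) patch \<Rightarrow> 'm loc"

definition patches :: "('m, 'v) vbundle \<Rightarrow> ('m, 'v) patch set" where
  "patches B = atlas B \<times> frames B"

definition pdom :: "('m, 'v) patch \<Rightarrow> 'm set" where
  "pdom c = fst (fst c) \<inter> fst (snd c)"

definition monomials :: "('m, 'v) vbundle \<Rightarrow> nat \<Rightarrow> mon set" where
  "monomials B k = {(S, K). S \<subseteq> {..<2 * brank B} \<and> set_mset K \<subseteq> {..<bdim B} \<and>
     card S + 2 * size K = k}"

text \<open>
  The coordinates of the patch \<open>c'\<close> in terms of those of \<open>c\<close>. With \<open>C\<^sup>\<alpha>\<^sub>\<beta> = \<epsilon>'\<^sup>\<alpha>(e\<^sub>\<beta>)\<close> and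
  \<open>D\<^sup>\<beta>\<^sub>\<alpha> = \<epsilon>\<^sup>\<beta>(e'\<^sub>\<alpha>)\<close>: \<open>\<tau>'\<^sup>\<alpha> = C\<^sup>\<alpha>\<^sub>\<beta> \<tau>\<^sup>\<beta>\<close>, \<open>\<theta>'\<^sub>\<alpha> = D\<^sup>\<beta>\<^sub>\<alpha> \<theta>\<^sub>\<beta>\<close> and
  \<open>p'\<^sub>i = (\<partial>x\<^sup>j/\<partial>x'\<^sup>i) p\<^sub>j + D\<^sup>\<gamma>\<^sub>\<alpha> (\<partial>C\<^sup>\<alpha>\<^sub>\<delta>/\<partial>x'\<^sup>i) \<tau>\<^sup>\<delta> \<theta>\<^sub>\<gamma>\<close>, the last term being the cotangent lift
  of the change of coordinates on \<open>A[1]\<close>: it is what makes \<open>{\<tau>'\<^sup>\<alpha>, p'\<^sub>i} = {\<theta>'\<^sub>\<alpha>, p'\<^sub>i} = 0\<close>.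
\<close>

definition frame_change :: "('m, 'v::real_vector) vbundle \<Rightarrow>
    ('m, 'v) frame \<Rightarrow> ('m, 'v) frame \<Rightarrow> nat \<Rightarrow> nat \<Rightarrow> 'm \<Rightarrow> real" where
  "frame_change B fr fr' \<alpha> \<beta> q = dual_frame B fr' \<alpha> q (snd fr \<beta> q)"

definition odd_change :: "('m, 'v::real_vector) vbundle \<Rightarrow>
    ('m, 'v) patch \<Rightarrow> ('m, 'v) patch \<Rightarrow> nat \<Rightarrow> 'm loc" where
  "odd_change B c c' a =
     (if a < brank B
      then (\<Sum>\<beta><brank B. smul (frame_change B (snd c) (snd c') a \<beta>) (mon_el ({\<beta>}, {#})))
      else (\<Sum>\<beta><brank B. smul (frame_change B (snd c') (snd c) \<beta> (a - brank B))
             (mon_el ({brank B + \<beta>}, {#}))))"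

definition p_change :: "('m, 'v::real_vector) vbundle \<Rightarrow>
    ('m, 'v) patch \<Rightarrow> ('m, 'v) patch \<Rightarrow> nat \<Rightarrow> 'm loc" where
  "p_change B c c' i =
     (\<Sum>j<bdim B. smul (pd B (fst c') i (snd (fst c) j)) (mon_el ({}, {#j#}))) +
     (\<Sum>\<gamma><brank B. \<Sum>\<delta><brank B. smul
        (\<lambda>q. \<Sum>\<alpha><brank B. frame_change B (snd c') (snd c) \<gamma> \<alpha> q *
               pd B (fst c') i (frame_change B (snd c) (snd c') \<alpha> \<delta>) q)
        (mon_el ({\<delta>, brank B + \<gamma>}, {#})))"

definition monomial_change :: "('m, 'v::real_vector) vbundle \<Rightarrow>
    ('m, 'v) patch \<Rightarrow> ('m, 'v) patch \<Rightarrow> mon \<Rightarrow> 'm loc" where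
  "monomial_change B c c' m = foldr lmul
     (map (odd_change B c c') (sorted_list_of_set (fst m)) @
      map (p_change B c c') (sorted_list_of_multiset (snd m)))
     (mon_el ({}, {#}))"

text \<open>The space \<open>\<A>^k\<close> of functions of degree \<open>k\<close>.\<close>

definition graded :: "('m, 'v::real_vector) vbundle \<Rightarrow> nat \<Rightarrow> ('m, 'v) gfun set" where
  "graded B k = {F.
     (\<forall>c m q. F c m q \<noteq> 0 \<longrightarrow> c \<in> patches B \<and> m \<in> monomials B k \<and> q \<in> pdom c) \<and>
     (\<forall>c\<in>patches B. \<forall>m\<in>monomials B k. smooth_fun B (pdom c) (F c m)) \<and>
     (\<forall>c\<in>patches B. \<forall>c'\<in>patches B. \<forall>m. \<forall>q\<in>pdom c \<inter> pdom c'.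
        F c m q = (\<Sum>m'\<in>monomials B k. F c' m' q * monomial_change B c c' m' m q))}"

definition big_bracket :: "('m, 'v) vbundle \<Rightarrow> ('m, 'v) gfun \<Rightarrow> ('m, 'v) gfun \<Rightarrow> ('m, 'v) gfun"
    ("\<lbrace>_, _\<rbrace>\<index>") where
  "\<lbrace>F, G\<rbrace>\<^bsub>B\<^esub> = (\<lambda>c. local_bracket B (fst c) (F c) (G c))"

section \<open>Functions, sections and endomorphisms as elements of the algebra\<close>

definition on_patches :: "('m, 'v) vbundle \<Rightarrow> ('m, 'v) gfun \<Rightarrow> ('m, 'v) gfun" where
  "on_patches B F = (\<lambda>c m q. if c \<in> patches B \<and> q \<in> pdom c then F c m q else 0)"

definition fun_el :: "('m, 'v) vbundle \<Rightarrow> ('m \<Rightarrow> real) \<Rightarrow> ('m, 'v) gfun" where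
  "fun_el B f = on_patches B (\<lambda>c. smul f (mon_el ({}, {#})))"

definition sec_el :: "('m, 'v::real_vector) vbundle \<Rightarrow> ('m, 'v) esec \<Rightarrow> ('m, 'v) gfun" where
  "sec_el B u = on_patches B (\<lambda>c. \<Sum>\<alpha><brank B.
     smul (\<lambda>q. dual_frame B (snd c) \<alpha> q (fst u q)) (mon_el ({brank B + \<alpha>}, {#})) +
     smul (\<lambda>q. snd u q (snd (snd c) \<alpha> q)) (mon_el ({\<alpha>}, {#})))"

definition endo_el :: "('m, 'v::real_vector) vbundle \<Rightarrow> ('m \<Rightarrow> 'v \<Rightarrow> 'v) \<Rightarrow> ('m, 'v) gfun" where
  "endo_el B N = on_patches B (\<lambda>c. \<Sum>\<alpha><brank B. \<Sum>\<beta><brank B.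
     smul (\<lambda>q. dual_frame B (snd c) \<alpha> q (N q (snd (snd c) \<beta> q)))
       (mon_el ({\<beta>, brank B + \<alpha>}, {#})))"

definition tilde_endo :: "('m, 'v::real_vector) vbundle \<Rightarrow>
    (('m, 'v) esec \<Rightarrow> ('m, 'v) esec) \<Rightarrow> ('m, 'v) gfun" where
  "tilde_endo B P =
     (THE a. a \<in> graded B 2 \<and> (\<forall>u\<in>sections_E B. sec_el B (P u) = \<lbrace>sec_el B u, a\<rbrace>\<^bsub>B\<^esub>))"

type_synonym ('m, 'v) tensor3 =
  "('m, 'v) esec \<Rightarrow> ('m, 'v) esec \<Rightarrow> ('m, 'v) esec \<Rightarrow> 'm \<Rightarrow> real"

definition tensor_el ::
  "('m, 'v::real_vector) vbundle \<Rightarrow> ('m, 'v) tensor3 \<Rightarrow> ('m, 'v) gfun" where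
  "tensor_el B t =
     (THE a. a \<in> graded B 3 \<and>
        (\<forall>u\<in>sections_E B. \<forall>v\<in>sections_E B. \<forall>w\<in>sections_E B.
           fun_el B (t u v w) =
             \<lbrace>\<lbrace>\<lbrace>sec_el B u, a\<rbrace>\<^bsub>B\<^esub>, sec_el B v\<rbrace>\<^bsub>B\<^esub>, sec_el B w\<rbrace>\<^bsub>B\<^esub>))"

section \<open>Lie bialgebroids\<close>

definition lie_algebroid :: "('m, 'v::real_vector) vbundle \<Rightarrow> ('m, 'v) gfun \<Rightarrow> bool" where
  "lie_algebroid B \<mu> \<longleftrightarrow> \<mu> \<in> graded B 3 \<and>
     (\<forall>c m q. \<mu> c m q \<noteq> 0 \<longrightarrow>
        (\<exists>\<alpha><brank B. \<exists>i<bdim B. m = ({\<alpha>}, {#i#})) \<or>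
        (\<exists>\<alpha><brank B. \<exists>\<beta><brank B. \<exists>\<gamma><brank B. \<alpha> \<noteq> \<beta> \<and> m = ({\<alpha>, \<beta>, brank B + \<gamma>}, {#}))) \<and>
     \<lbrace>\<mu>, \<mu>\<rbrace>\<^bsub>B\<^esub> = 0"

definition lie_algebroid_dual :: "('m, 'v::real_vector) vbundle \<Rightarrow> ('m, 'v) gfun \<Rightarrow> bool" where
  "lie_algebroid_dual B \<gamma> \<longleftrightarrow> \<gamma> \<in> graded B 3 \<and>
     (\<forall>c m q. \<gamma> c m q \<noteq> 0 \<longrightarrow>
        (\<exists>\<alpha><brank B. \<exists>i<bdim B. m = ({brank B + \<alpha>}, {#i#})) \<or>
        (\<exists>\<alpha><brank B. \<exists>\<beta><brank B. \<exists>\<delta><brank B.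
           \<alpha> \<noteq> \<beta> \<and> m = ({brank B + \<alpha>, brank B + \<beta>, \<delta>}, {#}))) \<and>
     \<lbrace>\<gamma>, \<gamma>\<rbrace>\<^bsub>B\<^esub> = 0"

definition lie_bialgebroid ::
  "('m, 'v::real_vector) vbundle \<Rightarrow> ('m, 'v) gfun \<Rightarrow> ('m, 'v) gfun \<Rightarrow> bool" where
  "lie_bialgebroid B \<mu> \<gamma> \<longleftrightarrow>
     lie_algebroid B \<mu> \<and> lie_algebroid_dual B \<gamma> \<and> \<lbrace>\<mu>, \<gamma>\<rbrace>\<^bsub>B\<^esub> = 0"

text \<open>The brackets on sections are the derived brackets, read back through the identification
  of \<open>\<A>^1\<close> with the sections of \<open>A \<oplus> A\<^sup>*\<close>.\<close>

definition dorfman :: "('m, 'v::real_vector) vbundle \<Rightarrow> ('m, 'v) gfun \<Rightarrow>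
    ('m, 'v) esec \<Rightarrow> ('m, 'v) esec \<Rightarrow> ('m, 'v) esec" where
  "dorfman B \<Theta> u v =
     inv_into (sections_E B) (sec_el B) \<lbrace>\<lbrace>sec_el B u, \<Theta>\<rbrace>\<^bsub>B\<^esub>, sec_el B v\<rbrace>\<^bsub>B\<^esub>"

definition bracket_A :: "('m, 'v::real_vector) vbundle \<Rightarrow> ('m, 'v) gfun \<Rightarrow>
    ('m \<Rightarrow> 'v) \<Rightarrow> ('m \<Rightarrow> 'v) \<Rightarrow> 'm \<Rightarrow> 'v" where
  "bracket_A B \<mu> X Y = inv_into (sections_A B) (\<lambda>Z. sec_el B (Z, 0))
     \<lbrace>\<lbrace>sec_el B (X, 0), \<mu>\<rbrace>\<^bsub>B\<^esub>, sec_el B (Y, 0)\<rbrace>\<^bsub>B\<^esub>"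

definition bracket_As :: "('m, 'v::real_vector) vbundle \<Rightarrow> ('m, 'v) gfun \<Rightarrow>
    ('m \<Rightarrow> 'v \<Rightarrow> real) \<Rightarrow> ('m \<Rightarrow> 'v \<Rightarrow> real) \<Rightarrow> 'm \<Rightarrow> 'v \<Rightarrow> real" where
  "bracket_As B \<gamma> \<xi> \<eta> = inv_into (sections_As B) (\<lambda>\<zeta>. sec_el B (0, \<zeta>))
     \<lbrace>\<lbrace>sec_el B (0, \<xi>), \<gamma>\<rbrace>\<^bsub>B\<^esub>, sec_el B (0, \<eta>)\<rbrace>\<^bsub>B\<^esub>"

definition torsion :: "('a::ab_group_add \<Rightarrow> 'a \<Rightarrow> 'a) \<Rightarrow> ('a \<Rightarrow> 'a) \<Rightarrow> 'a \<Rightarrow> 'a \<Rightarrow> 'a" where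
  "torsion br P u v = br (P u) (P v) - P (br (P u) v + br u (P v) - P (br u v))"

definition tilde_A ::
  "(('m \<Rightarrow> 'v) \<Rightarrow> ('m \<Rightarrow> 'v) \<Rightarrow> 'm \<Rightarrow> 'v) \<Rightarrow> ('m, 'v) tensor3" where
  "tilde_A t = (\<lambda>(X, \<xi>) (Y, \<eta>) (Z, \<zeta>) q. \<zeta> q (t X Y q) + \<xi> q (t Y Z q) + \<eta> q (t Z X q))"

definition tilde_As ::
  "(('m \<Rightarrow> 'v \<Rightarrow> real) \<Rightarrow> ('m \<Rightarrow> 'v \<Rightarrow> real) \<Rightarrow> 'm \<Rightarrow> 'v \<Rightarrow> real) \<Rightarrow> ('m, 'v) tensor3" where
  "tilde_As t = (\<lambda>(X, \<xi>) (Y, \<eta>) (Z, \<zeta>) q. t \<xi> \<eta> q (Z q) + t \<eta> \<zeta> q (X q) + t \<zeta> \<xi> q (Y q))"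

definition tilde_E ::
  "(('m, 'v) esec \<Rightarrow> ('m, 'v) esec \<Rightarrow> ('m, 'v) esec) \<Rightarrow> ('m, 'v) tensor3" where
  "tilde_E t = (\<lambda>u v w. pairing (t u v) w)"

end

theory Submission
  imports Defs
begin

text \<open>
  Functions of degree 2 and 3 are determined by their brackets with sections of \<open>A \<oplus> A\<^sup>*\<close>, and obey the
  transformation law as soon as these brackets do: such a bracket involves only the 1-jet of the
  section, and bump functions provide sections with any given 1-jet at a point. So everything reduces
  to the pointwise algebra of the operators \<open>{u, \<cdot>}\<close> and \<open>{N, \<cdot>}\<close>, and the one instance of the Jacobi
  identity that matters is \<open>{u, {N, F}} = {\<N> u, F} + {N, {u, F}}\<close>. Part (i) is the uniqueness of the
  function representing \<open>\<N>\<close>. Next, the bracket derived from \<open>{N, \<Theta>}\<close> is \<open>[\<N> u, v] + [u, \<N> v] - \<N> [u, v]\<close>;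
  if \<open>N\<^sup>2 = \<lambda>\<close>, iterating this shows that twice the torsion of \<open>\<N>\<close> is the bracket derived from
  \<open>{N, {N, \<Theta>}} - \<lambda> \<Theta>\<close>. In this function the terms with a \<open>p\<^sub>i\<close> cancel, hence the torsion is an
  alternating tensor, additive in \<open>\<Theta>\<close>. Counting the variables \<open>\<theta>\<close> and \<open>p\<close> shows that for \<open>\<mu>\<close> it
  vanishes on two sections of \<open>A\<^sup>*\<close> and restricts to the torsion of \<open>N\<close> on sections of \<open>A\<close>, and dually
  for \<open>\<gamma>\<close>; expanding the alternating tensors gives (ii).
\<close>

section \<open>Products and derivatives of local functions\<close>

text \<open>The momenta of two patches differ by quadratic terms with derivatives of the frame
  change, so the invariance of a bracket is laborious to verify directly. Sections avoid this: they
  contain no momentum, hence bracketing with them never differentiates the coefficients of the other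
  function. With the base point frozen, the value and the derivatives of a section become free
  parameters of a constant-coefficient operator, and only its effect on the generators has to be
  compared between patches; the quadratic correction is exactly what makes this comparison succeed.
  In rank 0 the only section is 0 and functions linear in the momenta escape detection, so
  \<open>tilde_endo\<close> need not be determined by its defining property. There \<A>^3 is 0,
  because an odd degree needs an odd variable; this case is treated apart. The cancellation of the
  momenta in the torsion has a simple cause: bracketing with N acts on the coefficients of the terms
  with a momentum through minus the matrix of the skew endomorphism, and doing so twice multiplies
  them by its square. The splitting at the end uses that A and its dual are isotropic.\<close>

lemma ksign_prod:
  assumes "finite S" "finite T"
  shows "ksign S T = (\<Prod>s\<in>S. \<Prod>t\<in>T. if t < s then -1 else 1)"
proof -
  have "{(s, t). s \<in> S \<and> t \<in> T \<and> t < s} = {x \<in> S \<times> T. snd x < fst x}" by auto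
  then have "ksign S T = (\<Prod>x\<in>{x \<in> S \<times> T. snd x < fst x}. -1)"
    by (simp add: ksign_def del: prod.inter_filter)
  also have "\<dots> = (\<Prod>x\<in>S \<times> T. if snd x < fst x then -1 else 1)"
    by (rule prod.inter_filter) (use assms in auto)
  also have "\<dots> = (\<Prod>s\<in>S. \<Prod>t\<in>T. if t < s then -1 else 1)"
    by (simp add: prod.cartesian_product case_prod_beta)
  finally show ?thesis .
qed

lemma ksign_Un_left:
  assumes "finite A" "finite B" "finite C" "A \<inter> B = {}"
  shows "ksign (A \<union> B) C = ksign A C * ksign B C"
  using assms by (simp add: ksign_prod prod.union_disjoint)

lemma ksign_Un_right:
  assumes "finite A" "finite B" "finite C" "B \<inter> C = {}"
  shows "ksign A (B \<union> C) = ksign A B * ksign A C"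
  using assms by (simp add: ksign_prod prod.union_disjoint prod.distrib)

lemma ksign_insert_left:
  assumes "finite A" "finite C" "a \<notin> A"
  shows "ksign (insert a A) C = ksign {a} C * ksign A C"
  using assms ksign_Un_left[of "{a}" A C] by simp

lemma ksign_insert_right:
  assumes "finite A" "finite C" "a \<notin> C"
  shows "ksign A (insert a C) = ksign A {a} * ksign A C"
  using assms ksign_Un_right[of A "{a}" C] by simp

lemma ksign_empty [simp]: "ksign {} T = 1" "ksign S {} = 1"
  by (simp_all add: ksign_def)

lemma ksign_singletons [simp]: "ksign {a} {b} = (if b < a then -1 else 1)"
  by (simp add: ksign_prod)

lemma ksign_square [simp]: "ksign S T * ksign S T = 1" "ksign S T * (ksign S T * x) = x"
  by (simp_all add: ksign_def flip: power_add mult.assoc)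

text \<open>Two distinct indices are an inversion in exactly one of the two orders, so the two signs
  multiply to one factor -1 per pair.\<close>

lemma ksign_swap:
  assumes "finite S" "finite T" "S \<inter> T = {}"
  shows "ksign S T = (-1) ^ (card S * card T) * ksign T S"
proof -
  have "ksign S T * ksign T S = (\<Prod>s\<in>S. \<Prod>t\<in>T. (if t < s then -1 else 1) * (if s < t then -1 else 1))"
    using assms by (simp add: ksign_prod prod.distrib prod.swap[of _ T S])
  also have "\<dots> = (\<Prod>s\<in>S. \<Prod>t\<in>T. -1)"
    using assms(3) by (intro prod.cong refl) (auto simp: disjoint_iff not_less_iff_gr_or_eq)
  also have "\<dots> = (-1) ^ (card S * card T)"
    by (simp flip: power_mult add: mult.commute)
  finally have "ksign S T * ksign T S = (-1) ^ (card S * card T)" .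
  then have "ksign S T * ksign T S * ksign T S = (-1) ^ (card S * card T) * ksign T S" by simp
  then show ?thesis by (simp add: mult.assoc)
qed

lemma ksign_singleton_swap:
  assumes "finite S" "a \<notin> S"
  shows "ksign S {a} = (-1) ^ card S * ksign {a} S"
  using ksign_swap[of S "{a}"] assms by simp

section \<open>The product as a sum over factorizations of a monomial\<close>

lemma finite_submultisets [simp]: "finite {L. L \<subseteq># K}"
proof (induction K)
  case (add x K)
  have "{L. L \<subseteq># add_mset x K} \<subseteq> {L. L \<subseteq># K} \<union> add_mset x ` {L. L \<subseteq># K}"
  proof
    fix L assume "L \<in> {L. L \<subseteq># add_mset x K}"
    then have L: "L \<subseteq># add_mset x K" by simp
    show "L \<in> {L. L \<subseteq># K} \<union> add_mset x ` {L. L \<subseteq># K}"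
    proof (cases "x \<in># L")
      case True
      then obtain M where "L = add_mset x M" by (metis insert_DiffM)
      then show ?thesis using L by auto
    next
      case False
      then have "L \<subseteq># K" using L
        by (metis add_mset_remove_trivial diff_single_trivial minus_add_mset_if_not_in_lhs
            subset_eq_diff_conv union_mset_add_mset_right add.right_neutral diff_empty
            mset_subset_eqI add_mset_diff_bothsides insert_subset_eq_iff Diff_eq_empty_iff_mset)
      then show ?thesis by simp
    qed
  qed
  then show ?case using add finite_subset by blast
qed simp

definition splits :: "mon \<Rightarrow> mon set" where
  "splits m = Pow (fst m) \<times> {L. L \<subseteq># snd m}"

lemma lmul_splits:
  "lmul F G (S, K) q = (\<Sum>(S\<^sub>1, K\<^sub>1)\<in>splits (S, K).
     ksign S\<^sub>1 (S - S\<^sub>1) * F (S\<^sub>1, K\<^sub>1) q * G (S - S\<^sub>1, K - K\<^sub>1) q)"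
  by (simp add: lmul_def splits_def sum.cartesian_product)

lemma finite_splits: "finite (fst m) \<Longrightarrow> finite (splits m)"
  by (simp add: splits_def)

text \<open>The power set of an infinite set is infinite, and a sum over an infinite index set is 0
  by convention. This is why several identities below treat finite and infinite \<open>S\<close>
  separately.\<close>

lemma lmul_infinite: "infinite S \<Longrightarrow> lmul F G (S, K) q = 0"
  by (simp add: lmul_def finite_Pow_iff)

lemma loc_eqI: "(\<And>S K q. F (S, K) q = G (S, K) q) \<Longrightarrow> F = (G :: 'm loc)"
  by (intro ext) (metis surj_pair)

text \<open>Both sides sum over the factorizations of \<open>(S, K)\<close> into three monomials:
  the left side indexes them by the product of the first two factors together with the first, the
  right side by the first factor and then the second. The signs match because \<open>ksign\<close>
  is multiplicative under disjoint unions in either argument.\<close>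

lemma lmul_assoc: "lmul (lmul F G) H = lmul F (lmul G H)"
proof (rule loc_eqI)
  fix S K q
  show "lmul (lmul F G) H (S, K) q = lmul F (lmul G H) (S, K) q"
  proof (cases "finite S")
    case False
    then show ?thesis by (simp add: lmul_infinite)
  next
    case fin: True
    define l where "l = (\<lambda>((S\<^sub>1, K\<^sub>1), (S\<^sub>2, K\<^sub>2)). ksign S\<^sub>1 (S - S\<^sub>1) * (ksign S\<^sub>2 (S\<^sub>1 - S\<^sub>2)
       * F (S\<^sub>2, K\<^sub>2) q * G (S\<^sub>1 - S\<^sub>2, K\<^sub>1 - K\<^sub>2) q) * H (S - S\<^sub>1, K - K\<^sub>1) q)"
    define r where "r = (\<lambda>((S\<^sub>2, K\<^sub>2), (S\<^sub>3, K\<^sub>3)). ksign S\<^sub>2 (S - S\<^sub>2) * F (S\<^sub>2, K\<^sub>2) q *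
       (ksign S\<^sub>3 (S - S\<^sub>2 - S\<^sub>3) * G (S\<^sub>3, K\<^sub>3) q * H (S - S\<^sub>2 - S\<^sub>3, K - K\<^sub>2 - K\<^sub>3) q))"
    have "lmul (lmul F G) H (S, K) q = (\<Sum>x\<in>splits (S, K). \<Sum>y\<in>splits x. l (x, y))"
      by (simp add: lmul_splits l_def sum_distrib_left sum_distrib_right case_prod_beta
          cong: sum.cong)
    also have "\<dots> = (\<Sum>z\<in>Sigma (splits (S, K)) splits. l z)"
      using fin by (subst sum.Sigma)
        (auto simp: finite_splits splits_def case_prod_beta finite_subset)
    also have "\<dots> = (\<Sum>z\<in>Sigma (splits (S, K)) (\<lambda>(S\<^sub>2, K\<^sub>2). splits (S - S\<^sub>2, K - K\<^sub>2)). r z)"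
    proof (rule sum.reindex_bij_witness[where
          i = "\<lambda>((S\<^sub>2, K\<^sub>2), (S\<^sub>3, K\<^sub>3)). ((S\<^sub>2 \<union> S\<^sub>3, K\<^sub>2 + K\<^sub>3), (S\<^sub>2, K\<^sub>2))" and
          j = "\<lambda>((S\<^sub>1, K\<^sub>1), (S\<^sub>2, K\<^sub>2)). ((S\<^sub>2, K\<^sub>2), (S\<^sub>1 - S\<^sub>2, K\<^sub>1 - K\<^sub>2))"], goal_cases)
      case (1 a) then show ?case by (auto simp: splits_def)
    next
      case (2 a) then show ?case
        by (fastforce simp: splits_def subseteq_mset_def intro: diff_le_mono order_trans)
    next
      case (3 b) then show ?case by (auto simp: splits_def)
    next
      case (4 b)
      obtain S\<^sub>2 K\<^sub>2 S\<^sub>3 K\<^sub>3 where b: "b = ((S\<^sub>2, K\<^sub>2), (S\<^sub>3, K\<^sub>3))" by (metis surj_pair)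
      then have "S\<^sub>2 \<subseteq> S" "K\<^sub>2 \<subseteq># K" "S\<^sub>3 \<subseteq> S - S\<^sub>2" "K\<^sub>3 \<subseteq># K - K\<^sub>2"
        using 4 by (auto simp: splits_def)
      moreover from this have "K\<^sub>2 + K\<^sub>3 \<subseteq># K"
        by (metis add.commute subset_mset.le_diff_conv2)
      ultimately show ?case by (auto simp: b splits_def)
    next
      case (5 a)
      obtain S\<^sub>1 K\<^sub>1 S\<^sub>2 K\<^sub>2 where a: "a = ((S\<^sub>1, K\<^sub>1), (S\<^sub>2, K\<^sub>2))" by (metis surj_pair)
      have sub: "S\<^sub>2 \<subseteq> S\<^sub>1" "S\<^sub>1 \<subseteq> S" "K\<^sub>2 \<subseteq># K\<^sub>1" "K\<^sub>1 \<subseteq># K" using 5 a by (auto simp: splits_def)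
      have f: "finite S\<^sub>1" "finite S\<^sub>2"
        using finite_subset[OF sub(2) fin] finite_subset[OF sub(1)] by auto
      have e: "S - S\<^sub>2 - (S\<^sub>1 - S\<^sub>2) = S - S\<^sub>1" "K - K\<^sub>2 - (K\<^sub>1 - K\<^sub>2) = K - K\<^sub>1"
        using sub by (auto simp: multiset_eq_iff subseteq_mset_def)
      have k1: "ksign S\<^sub>1 (S - S\<^sub>1) = ksign S\<^sub>2 (S - S\<^sub>1) * ksign (S\<^sub>1 - S\<^sub>2) (S - S\<^sub>1)"
        using ksign_Un_left[of S\<^sub>2 "S\<^sub>1 - S\<^sub>2" "S - S\<^sub>1"] sub f fin by (simp add: Un_absorb1)
      have "S - S\<^sub>2 = (S\<^sub>1 - S\<^sub>2) \<union> (S - S\<^sub>1)" using sub by auto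
      then have k2: "ksign S\<^sub>2 (S - S\<^sub>2) = ksign S\<^sub>2 (S\<^sub>1 - S\<^sub>2) * ksign S\<^sub>2 (S - S\<^sub>1)"
        using ksign_Un_right[of S\<^sub>2 "S\<^sub>1 - S\<^sub>2" "S - S\<^sub>1"] f fin
        by (auto simp del: Un_Diff_cancel)
      have "K\<^sub>2 + (K\<^sub>1 - K\<^sub>2) = K\<^sub>1" using sub by simp
      then show ?case by (simp add: a l_def r_def e k1 k2 algebra_simps)
    qed
    also have "\<dots> = (\<Sum>x\<in>splits (S, K). \<Sum>y\<in>(\<lambda>(S\<^sub>2, K\<^sub>2). splits (S - S\<^sub>2, K - K\<^sub>2)) x. r (x, y))"
      using fin by (subst sum.Sigma) (auto simp: finite_splits case_prod_beta)
    also have "\<dots> = lmul F (lmul G H) (S, K) q"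
      by (simp add: lmul_splits r_def sum_distrib_left sum_distrib_right case_prod_beta
          cong: sum.cong)
    finally show ?thesis .
  qed
qed

text \<open>The parity automorphism. It carries the signs of the graded commutation and Leibniz
  rules without assuming homogeneous factors; the momenta are even and do not count.\<close>

definition par :: "'m loc \<Rightarrow> 'm loc" where
  "par F = (\<lambda>(S, K) q. (-1) ^ card S * F (S, K) q)"

lemma par_apply: "par F (S, K) q = (-1) ^ card S * F (S, K) q"
  by (simp add: par_def)

lemma d_left_apply: "d_left a F (S, K) q = (if a \<in> S then 0 else ksign {a} S * F (insert a S, K) q)"
  by (simp add: d_left_def)

text \<open>Passing to complements exchanges the two factors, and \<open>ksign_swap\<close> supplies
  the sign. When one factor is purely even or purely odd, the parity of the exponent gives the
  commutation rules that follow.\<close>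

lemma lmul_swap:
  "lmul F G (S, K) q = (\<Sum>(S\<^sub>1, K\<^sub>1)\<in>splits (S, K).
     (-1) ^ (card S\<^sub>1 * card (S - S\<^sub>1)) * ksign S\<^sub>1 (S - S\<^sub>1) * G (S\<^sub>1, K\<^sub>1) q * F (S - S\<^sub>1, K - K\<^sub>1) q)"
proof (cases "finite S")
  case False
  then have "infinite (splits (S, K))"
    unfolding splits_def by (auto simp: finite_cartesian_product_iff finite_Pow_iff)
  with False show ?thesis by (simp add: lmul_infinite)
next
  case fin: True
  show ?thesis unfolding lmul_splits
  proof (rule sum.reindex_bij_witness[where i = "\<lambda>(A, L). (S - A, K - L)" and j = "\<lambda>(A, L). (S - A, K - L)"],
      goal_cases)
    case (5 a)
    obtain A L where a: "a = (A, L)" by (metis surj_pair)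
    then have sub: "A \<subseteq> S" "L \<subseteq># K" using 5 by (auto simp: splits_def)
    have e: "S - (S - A) = A" "K - (K - L) = L" using sub by (auto simp: multiset_eq_iff subseteq_mset_def)
    have "finite A" using fin sub finite_subset by blast
    have "ksign (S - A) A = (-1) ^ (card (S - A) * card A) * ksign A (S - A)"
      by (rule ksign_swap) (use fin \<open>finite A\<close> in auto)
    then have "(-1) ^ (card (S - A) * card A) * ksign (S - A) A = ksign A (S - A)"
      by (simp flip: mult.assoc power_add)
    then show ?case by (simp add: a e algebra_simps)
  qed (auto simp: splits_def multiset_eq_iff subseteq_mset_def)
qed

lemma lmul_comm_even:
  assumes "\<And>S K q. odd (card S) \<Longrightarrow> F (S, K) q = 0"
  shows "lmul F G = lmul G F"
proof (rule loc_eqI)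
  fix S K q
  show "lmul F G (S, K) q = lmul G F (S, K) q"
    unfolding lmul_swap[of F G] unfolding lmul_splits
    using assms by (intro sum.cong refl) (auto simp: minus_one_power_iff)
qed

lemma lmul_comm_odd:
  assumes "\<And>S K q. even (card S) \<Longrightarrow> F (S, K) q = 0"
  shows "lmul F G = lmul (par G) F"
proof (rule loc_eqI)
  fix S K q
  show "lmul F G (S, K) q = lmul (par G) F (S, K) q"
    unfolding lmul_swap[of F G] unfolding lmul_splits
    using assms by (intro sum.cong refl) (auto simp: minus_one_power_iff par_apply)
qed

lemma lmul_add_left: "lmul (F + G) H = lmul F H + lmul G H"
  by (rule loc_eqI) (simp add: lmul_splits sum.distrib case_prod_beta algebra_simps)

lemma lmul_add_right: "lmul H (F + G) = lmul H F + lmul H G"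
  by (rule loc_eqI) (simp add: lmul_splits sum.distrib case_prod_beta algebra_simps)

lemma lmul_uminus_left: "lmul (- F) H = - lmul F H"
  by (rule loc_eqI) (simp add: lmul_splits sum_negf case_prod_beta)

lemma lmul_uminus_right: "lmul H (- F) = - lmul H F"
  by (rule loc_eqI) (simp add: lmul_splits sum_negf case_prod_beta)

lemma lmul_diff_right: "lmul H (F - G) = lmul H F - lmul H G"
  by (rule loc_eqI) (simp add: lmul_splits sum_subtractf case_prod_beta algebra_simps)

lemma lmul_zero [simp]: "lmul 0 H = 0" "lmul H 0 = 0"
  by (rule loc_eqI, simp add: lmul_splits case_prod_beta)+

lemma lmul_sum_left: "lmul (\<Sum>i\<in>I. F i) H = (\<Sum>i\<in>I. lmul (F i) H)"
  by (induction I rule: infinite_finite_induct) (simp_all add: lmul_add_left del: plus_fun_apply zero_fun_apply)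

lemma lmul_sum_right: "lmul H (\<Sum>i\<in>I. F i) = (\<Sum>i\<in>I. lmul H (F i))"
  by (induction I rule: infinite_finite_induct)
      (simp_all add: lmul_add_right del: plus_fun_apply zero_fun_apply)

lemma smul_apply: "smul f F m q = f q * F m q"
  by (simp add: smul_def)

lemma lmul_smul_left: "lmul (smul f F) H = smul f (lmul F H)"
  by (rule loc_eqI) (simp add: lmul_splits smul_apply sum_distrib_left case_prod_beta algebra_simps)

lemma lmul_smul_right: "lmul F (smul f H) = smul f (lmul F H)"
  by (rule loc_eqI) (simp add: lmul_splits smul_apply sum_distrib_left case_prod_beta algebra_simps)

lemma smul_add: "smul f (F + G) = smul f F + smul f G"
  by (rule loc_eqI) (simp add: smul_apply algebra_simps)

lemma smul_diff: "smul f (F - G) = smul f F - smul f G"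
  by (rule loc_eqI) (simp add: smul_apply algebra_simps)

lemma smul_uminus: "smul f (- F) = - smul f F"
  by (rule loc_eqI) (simp add: smul_apply)

lemma smul_zero [simp]: "smul f 0 = 0" "smul 0 F = 0"
  by (rule loc_eqI, simp add: smul_apply)+

lemma smul_sum: "smul f (\<Sum>i\<in>I. F i) = (\<Sum>i\<in>I. smul f (F i))"
  by (induction I rule: infinite_finite_induct) (simp_all add: smul_add del: plus_fun_apply zero_fun_apply)

abbreviation one_el :: "'m loc" where "one_el \<equiv> mon_el ({}, {#})"

lemma lmul_one_left: "(\<And>S K q. infinite S \<Longrightarrow> F (S, K) q = 0) \<Longrightarrow> lmul one_el F = F"
proof (rule loc_eqI)
  fix S K q assume fin: "\<And>S K q. infinite S \<Longrightarrow> F (S, K) q = 0"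
  show "lmul one_el F (S, K) q = F (S, K) q"
  proof (cases "finite S")
    case True
    have "lmul one_el F (S, K) q = (\<Sum>x\<in>splits (S, K). if x = ({}, {#}) then F (S, K) q else 0)"
      unfolding lmul_splits by (intro sum.cong) (auto simp: mon_el_def split: if_splits)
    also have "\<dots> = F (S, K) q" using True by (subst sum.delta) (auto simp: finite_splits splits_def)
    finally show ?thesis .
  qed (simp add: fin lmul_infinite)
qed

lemma lmul_one_right:
  assumes "\<And>S K q. infinite S \<Longrightarrow> F (S, K) q = 0"
  shows "lmul F one_el = F"
proof -
  have "lmul one_el F = lmul F one_el" by (rule lmul_comm_even) (auto simp: mon_el_def)
  then show ?thesis using lmul_one_left[of F] assms by simp
qed

section \<open>The graded Leibniz rule for odd derivatives\<close>

lemma sum_Pow_insert: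
  assumes "finite S" "a \<notin> S"
  shows "(\<Sum>A\<in>Pow (insert a S). f A) = (\<Sum>A\<in>Pow S. f A) + (\<Sum>A\<in>Pow S. f (insert a A))"
proof -
  have "(\<Sum>A\<in>Pow (insert a S). f A) = (\<Sum>A\<in>Pow S. f A) + (\<Sum>A\<in>insert a ` Pow S. f A)"
    unfolding Pow_insert using assms by (intro sum.union_disjoint) auto
  also have "(\<Sum>A\<in>insert a ` Pow S. f A) = (\<Sum>A\<in>Pow S. f (insert a A))"
    using assms by (subst sum.reindex) (auto simp: inj_on_def)
  finally show ?thesis .
qed

lemma lmul_apply:
  "lmul F G (S, K) q = (\<Sum>A\<in>Pow S. \<Sum>L\<in>{L. L \<subseteq># K}.
     ksign A (S - A) * F (A, L) q * G (S - A, K - L) q)"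
  by (simp add: lmul_def)

lemma d_left_lmul: "d_left a (lmul F G) = lmul (d_left a F) G + lmul (par F) (d_left a G)"
proof (rule loc_eqI)
  fix S and K :: "nat multiset" and q
  let ?L = "{L. L \<subseteq># K}"
  have "d_left a (lmul F G) (S, K) q = lmul (d_left a F) G (S, K) q + lmul (par F) (d_left a G) (S, K) q"
  proof (cases "finite S")
    case False
    then show ?thesis by (simp add: lmul_infinite d_left_apply)
  next
    case fin: True
    show ?thesis
    proof (cases "a \<in> S")
      case False
      \<comment> \<open>The factorizations of \<open>insert a S\<close> are sorted by whether
        \<open>a\<close> falls into the second factor or into the first; the two groups become the
        two terms of the Leibniz rule.\<close>
      have "lmul F G (insert a S, K) q = (\<Sum>A\<in>Pow S. \<Sum>L\<in>?L.
              ksign A (insert a S - A) * F (A, L) q * G (insert a S - A, K - L) q) +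
            (\<Sum>A\<in>Pow S. \<Sum>L\<in>?L. ksign (insert a A) (insert a S - insert a A) *
              F (insert a A, L) q * G (insert a S - insert a A, K - L) q)"
        unfolding lmul_apply by (rule sum_Pow_insert[OF fin False])
      moreover have "ksign {a} S * (\<Sum>A\<in>Pow S. \<Sum>L\<in>?L.
              ksign A (insert a S - A) * F (A, L) q * G (insert a S - A, K - L) q)
         = lmul (par F) (d_left a G) (S, K) q"
        unfolding lmul_apply sum_distrib_left
      proof (intro sum.cong refl)
        fix A L assume "A \<in> Pow S"
        then have A: "A \<subseteq> S" "a \<notin> A" "finite A" using False fin by (auto intro: finite_subset)
        have e: "insert a S - A = insert a (S - A)" using A by auto
        have 1: "ksign A (insert a (S - A)) = (-1) ^ card A * ksign {a} A * ksign A (S - A)"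
          using A False fin ksign_singleton_swap[of A a] ksign_insert_right[of A "S - A" a] by simp
        have 2: "ksign {a} S = ksign {a} A * ksign {a} (S - A)"
          using ksign_Un_right[of "{a}" A "S - A"] A fin by (simp add: Un_absorb1)
        show "ksign {a} S * (ksign A (insert a S - A) * F (A, L) q * G (insert a S - A, K - L) q) =
          ksign A (S - A) * par F (A, L) q * d_left a G (S - A, K - L) q"
          using False by (simp add: e 1 2 par_apply d_left_apply mult_ac)
      qed
      moreover have "ksign {a} S * (\<Sum>A\<in>Pow S. \<Sum>L\<in>?L. ksign (insert a A) (insert a S - insert a A) *
              F (insert a A, L) q * G (insert a S - insert a A, K - L) q)
         = lmul (d_left a F) G (S, K) q"
        unfolding lmul_apply sum_distrib_left
      proof (intro sum.cong refl)
        fix A L assume "A \<in> Pow S"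
        then have A: "A \<subseteq> S" "a \<notin> A" "finite A" using False fin by (auto intro: finite_subset)
        have e: "insert a S - insert a A = S - A" using A False by auto
        have 1: "ksign (insert a A) (S - A) = ksign {a} (S - A) * ksign A (S - A)"
          using A False fin ksign_insert_left[of A "S - A" a] by simp
        have 2: "ksign {a} S = ksign {a} A * ksign {a} (S - A)"
          using ksign_Un_right[of "{a}" A "S - A"] A fin by (simp add: Un_absorb1)
        show "ksign {a} S * (ksign (insert a A) (insert a S - insert a A) *
              F (insert a A, L) q * G (insert a S - insert a A, K - L) q) =
          ksign A (S - A) * d_left a F (A, L) q * G (S - A, K - L) q"
          unfolding e 1 2 using A by (simp add: d_left_apply mult_ac)
      qed
      ultimately show ?thesis using False by (simp add: d_left_apply algebra_simps)
    next
      case True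
      \<comment> \<open>Here the left side is 0 because \<open>d_left a\<close> never leaves the
        variable \<open>a\<close> behind. On the right, \<open>a\<close> must lie in the factor that
        is not differentiated, and the two terms cancel when \<open>a\<close> is moved from the
        second factor to the first.\<close>
      define T where "T = S - {a}"
      have T: "S = insert a T" "a \<notin> T" "finite T" using True fin by (auto simp: T_def)
      have "lmul (d_left a F) G (S, K) q = (\<Sum>A\<in>Pow T. \<Sum>L\<in>?L.
          ksign A (insert a T - A) * d_left a F (A, L) q * G (insert a T - A, K - L) q)"
        unfolding lmul_apply T(1) sum_Pow_insert[OF T(3,2)] by (simp add: d_left_apply)
      moreover have "lmul (par F) (d_left a G) (S, K) q = (\<Sum>A\<in>Pow T. \<Sum>L\<in>?L.
          ksign (insert a A) (insert a T - insert a A) * par F (insert a A, L) q *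
          d_left a G (insert a T - insert a A, K - L) q)"
      proof -
        have "(\<Sum>A\<in>Pow T. \<Sum>L\<in>?L. ksign A (insert a T - A) * par F (A, L) q * d_left a G (insert a T - A, K -
            L) q) = 0"
          using T by (intro sum.neutral ballI) (auto simp: d_left_apply)
        then show ?thesis unfolding lmul_apply T(1) sum_Pow_insert[OF T(3,2)] by simp
      qed
      moreover have "(\<Sum>A\<in>Pow T. \<Sum>L\<in>?L.
          ksign A (insert a T - A) * d_left a F (A, L) q * G (insert a T - A, K - L) q) =
          - (\<Sum>A\<in>Pow T. \<Sum>L\<in>?L.
          ksign (insert a A) (insert a T - insert a A) * par F (insert a A, L) q *
          d_left a G (insert a T - insert a A, K - L) q)"
        unfolding sum_negf[symmetric]
      proof (intro sum.cong refl)
        fix A L assume "A \<in> Pow T"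
        then have A: "A \<subseteq> T" "a \<notin> A" "finite A" using T by (auto intro: finite_subset)
        have e: "insert a T - insert a A = T - A" "insert a T - A = insert a (T - A)" using A T by auto
        have 1: "ksign (insert a A) (T - A) = ksign {a} (T - A) * ksign A (T - A)"
          using A T ksign_insert_left[of A "T - A" a] by simp
        have 2: "ksign A (insert a (T - A)) = (-1) ^ card A * ksign {a} A * ksign A (T - A)"
          using A T ksign_singleton_swap[of A a] ksign_insert_right[of A "T - A" a] by simp
        show "ksign A (insert a T - A) * d_left a F (A, L) q * G (insert a T - A, K - L) q =
           - (ksign (insert a A) (insert a T - insert a A) * par F (insert a A, L) q *
          d_left a G (insert a T - insert a A, K - L) q)"
          unfolding e 1 2 using A T
          by (simp add: d_left_apply par_apply mult_ac)
      qed
      ultimately show ?thesis using True by (simp add: d_left_apply)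
    qed
  qed
  then show "d_left a (lmul F G) (S, K) q = (lmul (d_left a F) G + lmul (par F) (d_left a G)) (S, K) q"
    by simp
qed

lemma d_left_anticomm: "\<lbrakk>\<And>S K q. infinite S \<Longrightarrow> F (S, K) q = 0\<rbrakk> \<Longrightarrow> d_left a (d_left b F) = - d_left b (d_left a F)"
proof (rule loc_eqI)
  fix S K q assume inf: "\<And>S K q. infinite S \<Longrightarrow> F (S, K) q = 0"
  show "d_left a (d_left b F) (S, K) q = (- d_left b (d_left a F)) (S, K) q"
  proof (cases "finite S")
    case True
    then show ?thesis
      using ksign_insert_right[of "{a}" S b] ksign_insert_right[of "{b}" S a]
      by (cases "a \<in> S"; cases "b \<in> S"; cases "a < b"; cases "a = b")
        (auto simp: d_left_apply insert_commute)
  qed (simp add: d_left_apply inf)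
qed

section \<open>Brackets with sections and with quadratic functions\<close>

text \<open>A local function is an arbitrary coefficient function, whereas products vanish on
  infinite sets of odd indices. On this class \<open>one_el\<close> is a unit and left and right
  derivatives differ by parity only.\<close>

definition finsupp :: "'m loc \<Rightarrow> bool" where
  "finsupp F \<longleftrightarrow> (\<forall>S K q. infinite S \<longrightarrow> F (S, K) q = 0)"

text \<open>Exterior forms of degree \<open>k\<close> on A plus its dual, with no momenta: sections
  have \<open>k\<close> = 1, endomorphisms \<open>k\<close> = 2, and the same holds for their
  derivatives along the base.\<close>

definition pfree :: "nat \<Rightarrow> 'm loc \<Rightarrow> bool" where
  "pfree k F \<longleftrightarrow> (\<forall>S K q. F (S, K) q \<noteq> 0 \<longrightarrow> finite S \<and> card S = k \<and> K = {#})"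

lemma pfree_zero: "pfree k F \<Longrightarrow> \<not> (finite S \<and> card S = k \<and> K = {#}) \<Longrightarrow> F (S, K) q = 0"
  unfolding pfree_def by metis

lemma pfreeI:
  "(\<And>S K q. F (S, K) q \<noteq> 0 \<Longrightarrow> finite S \<and> card S = k \<and> K = {#}) \<Longrightarrow> pfree k F"
  unfolding pfree_def by blast

lemma pfreeD: "F (S, K) q \<noteq> 0 \<Longrightarrow> pfree k F \<Longrightarrow> finite S \<and> card S = k \<and> K = {#}"
  unfolding pfree_def by blast

lemma pfree_finsupp: "pfree k F \<Longrightarrow> finsupp F"
  by (auto simp: finsupp_def pfree_zero)

lemma finsupp_lmul [simp]: "finsupp (lmul F G)"
  by (simp add: finsupp_def lmul_infinite)

lemma finsupp_mon_el [simp]: "finite (fst m) \<Longrightarrow> finsupp (mon_el m)"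
  by (auto simp: finsupp_def mon_el_def)

lemma finsupp_d_left [simp]: "finsupp F \<Longrightarrow> finsupp (d_left a F)"
  by (auto simp: finsupp_def d_left_apply)

lemma d_p_apply: "d_p i F (S, K) q = real (count K i + 1) * F (S, add_mset i K) q"
  by (simp add: d_p_def)

lemma finsupp_d_p [simp]: "finsupp F \<Longrightarrow> finsupp (d_p i F)"
  by (auto simp: finsupp_def d_p_apply)

lemma finsupp_add [simp]: "finsupp F \<Longrightarrow> finsupp G \<Longrightarrow> finsupp (F + G)"
  by (auto simp: finsupp_def)

lemma finsupp_smul [simp]: "finsupp F \<Longrightarrow> finsupp (smul f F)"
  by (auto simp: finsupp_def smul_apply)

lemma finsupp_zero [simp]: "finsupp 0"
  by (auto simp: finsupp_def)

lemma finsupp_sum [simp]: "(\<And>i. i \<in> I \<Longrightarrow> finsupp (F i)) \<Longrightarrow> finsupp (\<Sum>i\<in>I. F i)"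
  by (induction I rule: infinite_finite_induct) (simp_all del: plus_fun_apply zero_fun_apply)

lemma loc_sum_apply: "(\<Sum>i\<in>I. F i :: 'm loc) m q = (\<Sum>i\<in>I. F i m q)"
  by (induction I rule: infinite_finite_induct) auto

lemma d_left_linear:
  "d_left a (F + G) = d_left a F + d_left a G" "d_left a (- F) = - d_left a F"
  "d_left a (F - G) = d_left a F - d_left a G" "d_left a (smul f F) = smul f (d_left a F)"
  "d_left a 0 = 0"
  by (rule loc_eqI, simp add: d_left_apply smul_apply algebra_simps)+

lemma d_p_linear:
  "d_p a (F + G) = d_p a F + d_p a G" "d_p a (- F) = - d_p a F"
  "d_p a (F - G) = d_p a F - d_p a G" "d_p a (smul f F) = smul f (d_p a F)"
  "d_p a 0 = 0"
  by (rule loc_eqI, simp add: d_p_apply smul_apply algebra_simps)+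

lemma par_linear:
  "par (F + G) = par F + par G" "par (- F) = - par F"
  "par (F - G) = par F - par G" "par (smul f F) = smul f (par F)"
  "par 0 = 0"
  by (rule loc_eqI, simp add: par_apply smul_apply algebra_simps)+

lemma d_left_sum: "d_left a (\<Sum>i\<in>I. F i) = (\<Sum>i\<in>I. d_left a (F i))"
  by (induction I rule: infinite_finite_induct) (simp_all add: d_left_linear del: plus_fun_apply zero_fun_apply)

lemma d_p_sum: "d_p a (\<Sum>i\<in>I. F i) = (\<Sum>i\<in>I. d_p a (F i))"
  by (induction I rule: infinite_finite_induct) (simp_all add: d_p_linear del: plus_fun_apply zero_fun_apply)

lemma d_left_d_p: "d_left a (d_p i F) = d_p i (d_left a F)"
  by (rule loc_eqI) (simp add: d_left_apply d_p_apply)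

lemma d_p_d_p: "d_p i (d_p j F) = d_p j (d_p i F)"
  by (rule loc_eqI) (simp add: d_p_apply add_mset_commute)

lemma par_d_left: "finsupp F \<Longrightarrow> par (d_left a F) = - d_left a (par F)"
proof (rule loc_eqI)
  fix S K q assume "finsupp F"
  then show "par (d_left a F) (S, K) q = (- d_left a (par F)) (S, K) q"
    by (cases "finite S") (auto simp: par_apply d_left_apply finsupp_def)
qed

text \<open>Taking the variable out on the right rather than on the left moves it past the
  \<open>card S\<close> remaining odd factors.\<close>

lemma d_right_par: "d_right a F (S, K) q = par (d_left a F) (S, K) q" if "finite S"
  using ksign_singleton_swap[OF that, of a]
      by (cases "a \<in> S") (simp_all add: d_right_def par_apply d_left_apply)

lemma d_right_eq: "finsupp F \<Longrightarrow> d_right a F = par (d_left a F)"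
proof (rule loc_eqI)
  fix S K q assume "finsupp F"
  then show "d_right a F (S, K) q = par (d_left a F) (S, K) q"
    by (cases "finite S", simp only: d_right_par) (auto simp: finsupp_def par_apply d_left_apply d_right_def)
qed

lemma par_pfree: "pfree k F \<Longrightarrow> par F = smul (\<lambda>_. (-1) ^ k) F"
  by (rule loc_eqI) (metis (no_types, lifting) par_apply smul_apply pfree_zero mult_zero_right)

lemma par_pfree_odd: "pfree 1 F \<Longrightarrow> par F = - F"
  by (subst par_pfree, assumption) (rule loc_eqI, simp add: smul_apply)

lemma par_pfree_even: "pfree 2 F \<Longrightarrow> par F = F"
  by (subst par_pfree, assumption) (rule loc_eqI, simp add: smul_apply)

lemma pfree_d_left: "pfree (Suc k) F \<Longrightarrow> pfree k (d_left a F)"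
proof (rule pfreeI)
  fix S K q assume F: "pfree (Suc k) F" and nz: "d_left a F (S, K) q \<noteq> 0"
  then have "a \<notin> S" "F (insert a S, K) q \<noteq> 0" by (auto simp: d_left_apply split: if_splits)
  with pfreeD[OF this(2) F] show "finite S \<and> card S = k \<and> K = {#}" by auto
qed

lemma pfree_0: "pfree 0 F \<Longrightarrow> F = smul (F ({}, {#})) one_el"
  by (rule loc_eqI) (auto simp: smul_apply mon_el_def dest: pfreeD)

lemma d_p_pfree: "pfree k F \<Longrightarrow> d_p i F = 0"
  by (rule loc_eqI) (auto simp: d_p_apply pfree_zero)

lemma pfree_combine:
  "(\<And>S K q. F (S, K) q = 0 \<Longrightarrow> G (S, K) q = 0 \<Longrightarrow> H (S, K) q = 0) \<Longrightarrow> pfree k F \<Longrightarrow> pfree k G \<Longrightarrow> pfree k H"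
  unfolding pfree_def by metis

lemma pfree_linear [simp]:
  fixes F G :: "'a loc"
  shows "pfree k (0 :: 'a loc)" "pfree k F \<Longrightarrow> pfree k G \<Longrightarrow> pfree k (F + G)" "pfree k F \<Longrightarrow> pfree k (- F)"
  "pfree k F \<Longrightarrow> pfree k G \<Longrightarrow> pfree k (F - G)" "pfree k F \<Longrightarrow> pfree k (smul f F)"
proof -
  show "pfree k (0 :: 'a loc)" by (simp add: pfree_def)
  show "pfree k F \<Longrightarrow> pfree k G \<Longrightarrow> pfree k (F + G)" by (rule pfree_combine[of F G]) auto
  show "pfree k F \<Longrightarrow> pfree k (- F)" by (rule pfree_combine[of F F]) auto
  show "pfree k F \<Longrightarrow> pfree k G \<Longrightarrow> pfree k (F - G)" by (rule pfree_combine[of F G]) auto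
  show "pfree k F \<Longrightarrow> pfree k (smul f F)" by (rule pfree_combine[of F F]) (auto simp: smul_apply)
qed

lemma pfree_sum: "(\<And>i. i \<in> I \<Longrightarrow> pfree k (F i)) \<Longrightarrow> pfree k (\<Sum>i\<in>I. F i)"
  by (induction I rule: infinite_finite_induct) (simp_all del: plus_fun_apply zero_fun_apply)

lemma pfree_mon_el: "finite S \<Longrightarrow> card S = k \<Longrightarrow> pfree k (mon_el (S, {#}))"
  by (auto simp: pfree_def mon_el_def)

lemma lmul_pfree0: "pfree 0 F \<Longrightarrow> finsupp G \<Longrightarrow> lmul F G = smul (F ({}, {#})) G"
  by (subst pfree_0, assumption) (simp add: lmul_smul_left lmul_one_left finsupp_def)

lemma lmul_pfree:
  assumes "pfree k F"
  shows "lmul F G (S, K) q = (\<Sum>A\<in>Pow S. ksign A (S - A) * F (A, {#}) q * G (S - A, K) q)"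
proof -
  have "(\<Sum>L | L \<subseteq># K. ksign A (S - A) * F (A, L) q * G (S - A, K - L) q) =
        (\<Sum>L | L \<subseteq># K. if L = {#} then ksign A (S - A) * F (A, {#}) q * G (S - A, K) q else 0)" for A
    using assms by (intro sum.cong) (auto simp: pfree_zero)
  then show ?thesis by (simp add: lmul_apply)
qed

lemma d_p_lmul: "pfree k X \<Longrightarrow> d_p i (lmul X F) = lmul X (d_p i F)"
  by (rule loc_eqI) (simp add: lmul_pfree d_p_apply sum_distrib_left algebra_simps)

lemma lmul_comm1: "pfree 1 X \<Longrightarrow> lmul X G = lmul (par G) X"
  by (rule lmul_comm_odd) (metis One_nat_def odd_one pfree_zero)

lemma lmul_comm2: "pfree 2 X \<Longrightarrow> lmul X G = lmul G X"
  by (rule lmul_comm_even) (metis even_numeral pfree_zero)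

text \<open>The index of the conjugate variable: \<tau>^\<alpha> and \<theta>_\<alpha> are
  exchanged. With it the two odd parts of the bracket become a single sum over all odd
  indices.\<close>

definition star :: "('m, 'v) vbundle \<Rightarrow> nat \<Rightarrow> nat" where
  "star B a = (if a < brank B then brank B + a else a - brank B)"

lemma star_star [simp]: "a < 2 * brank B \<Longrightarrow> star B (star B a) = a"
  by (auto simp: star_def)

lemma star_less [simp]: "a < 2 * brank B \<Longrightarrow> star B a < 2 * brank B"
  by (auto simp: star_def)

lemma bij_star: "bij_betw (star B) {..<2 * brank B} {..<2 * brank B}"
  by (rule bij_betw_byWitness[of _ "star B"]) auto

lemma sum_star: "(\<Sum>a<2 * brank B. f (star B a)) = (\<Sum>a<2 * brank B. f a)"
  using sum.reindex_bij_betw[OF bij_star] .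

text \<open>\<open>Lop\<close> is \<open>{u, \<cdot>}\<close> for a section \<open>u\<close> with components \<open>u\<^sub>a\<close> and first derivatives \<open>U\<^sub>i\<close>, and
  \<open>Dop\<close> is \<open>{N, \<cdot>}\<close> for a quadratic \<open>N\<close> with first derivatives \<open>Nx\<^sub>i\<close>. Keeping the 1-jets as
  independent data makes both operators algebraic.\<close>

definition Lop :: "('m, 'v) vbundle \<Rightarrow> (nat \<Rightarrow> 'm \<Rightarrow> real) \<Rightarrow> (nat \<Rightarrow> 'm loc) \<Rightarrow> 'm loc \<Rightarrow> 'm loc" where
  "Lop B u U G = (\<Sum>a<2 * brank B. smul (u a) (d_left (star B a) G)) + (\<Sum>i<bdim B. lmul (U i) (d_p i G))"

definition Dop :: "('m, 'v) vbundle \<Rightarrow> 'm loc \<Rightarrow> (nat \<Rightarrow> 'm loc) \<Rightarrow> 'm loc \<Rightarrow> 'm loc" where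
  "Dop B N Nx G = (\<Sum>i<bdim B. lmul (Nx i) (d_p i G)) -
     (\<Sum>a<2 * brank B. lmul (d_left a N) (d_left (star B a) G))"

lemma Lop_linear:
  "Lop B u U (F + G) = Lop B u U F + Lop B u U G" "Lop B u U (- F) = - Lop B u U F"
  "Lop B u U (F - G) = Lop B u U F - Lop B u U G"
  "Lop B u U (smul f F) = smul f (Lop B u U F)" "Lop B u U 0 = 0"
  by (rule loc_eqI, simp add: Lop_def loc_sum_apply d_left_linear d_p_linear lmul_add_right
      lmul_uminus_right lmul_diff_right lmul_smul_right smul_apply sum.distrib sum_negf sum_subtractf
      sum_distrib_left algebra_simps)+

lemma Lop_sum: "Lop B u U (\<Sum>i\<in>I. F i) = (\<Sum>i\<in>I. Lop B u U (F i))"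
  by (induction I rule: infinite_finite_induct) (simp_all add: Lop_linear del: plus_fun_apply zero_fun_apply)

lemma Dop_linear:
  "Dop B u U (F + G) = Dop B u U F + Dop B u U G" "Dop B u U (- F) = - Dop B u U F"
  "Dop B u U (F - G) = Dop B u U F - Dop B u U G"
  "Dop B u U (smul f F) = smul f (Dop B u U F)" "Dop B u U 0 = 0"
  by (rule loc_eqI, simp add: Dop_def loc_sum_apply d_left_linear d_p_linear lmul_add_right
      lmul_uminus_right lmul_diff_right lmul_smul_right smul_apply sum.distrib sum_negf sum_subtractf
      sum_distrib_left algebra_simps)+

lemma Lop_pfree: "pfree k X \<Longrightarrow> Lop B u U X = (\<Sum>a<2 * brank B. smul (u a) (d_left (star B a) X))"
  by (simp add: Lop_def d_p_pfree del: plus_fun_apply zero_fun_apply)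

text \<open>\<open>Lop\<close> is an odd derivation. Its momentum part shares the sign of the odd
  derivatives because the odd factor \<open>U i\<close> has to be moved past
  \<open>X\<close>.\<close>

lemma Lop_lmul:
  assumes X: "pfree k X" and U: "\<And>i. i < bdim B \<Longrightarrow> pfree 1 (U i)"
  shows "Lop B u U (lmul X G) = lmul (Lop B u U X) G + lmul (par X) (Lop B u U G)"
proof -
  have "lmul (U i) (lmul X (d_p i G)) = lmul (par X) (lmul (U i) (d_p i G))" if "i < bdim B" for i
    using lmul_comm1[OF U[OF that], of X] by (metis lmul_assoc)
  then show ?thesis
    unfolding Lop_pfree[OF X] unfolding Lop_def
    by (simp add: d_left_lmul d_p_lmul[OF X] smul_add sum.distrib lmul_sum_left lmul_smul_left
        lmul_add_right lmul_sum_right lmul_smul_right add_ac del: plus_fun_apply zero_fun_apply)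
qed

text \<open>The Jacobi identity for u, N, G at the level of jets. The last term is
  \<open>Lop\<close> for the 1-jet of {u, N}: its components are those of {u, N}, and its
  derivatives are {u, N_i} + {u_i, N} by the Leibniz rule, an index i denoting a derivative along
  the base.\<close>

lemma Lop_Dop:
  fixes N :: "'m loc"
  assumes N: "pfree 2 N" and Nx: "\<And>i. i < bdim B \<Longrightarrow> pfree 2 (Nx i)"
    and U: "\<And>i. i < bdim B \<Longrightarrow> pfree 1 (U i)" and G: "finsupp G"
  shows "Lop B u U (Dop B N Nx G) = Dop B N Nx (Lop B u U G) +
    Lop B (\<lambda>c q. \<Sum>a<2 * brank B. u a q * d_left c (d_left (star B a) N) ({}, {#}) q)
     (\<lambda>i. (\<Sum>a<2 * brank B. smul (u a) (d_left (star B a) (Nx i))) +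
          (\<Sum>c<2 * brank B. smul (d_left (star B c) (U i) ({}, {#})) (d_left c N))) G"
proof -
  let ?r = "2 * brank B" and ?n = "bdim B"
  have dN: "pfree 1 (d_left a N)" for a using pfree_d_left[of 1 N] N by (simp add: numeral_2_eq_2)
  have dNx: "pfree 1 (d_left a (Nx i))" if "i < ?n" for a i
    using pfree_d_left[of 1 "Nx i"] Nx[OF that] by (simp add: numeral_2_eq_2)
  note lin = Lop_def Dop_def d_left_linear d_p_linear d_left_sum d_p_sum lmul_add_left lmul_add_right
    lmul_diff_right lmul_sum_left lmul_sum_right lmul_smul_left lmul_smul_right smul_add smul_diff smul_sum
    lmul_uminus_left lmul_uminus_right smul_uminus
  \<comment> \<open>\<open>E2\<close>, \<open>E4\<close>, \<open>E5\<close> and \<open>E6\<close>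
    contain second derivatives of \<open>G\<close> and occur on both sides. \<open>E1\<close> and
    \<open>E3\<close>, where a derivative falls on \<open>Nx\<close> or \<open>N\<close>, are what
    remains. \<open>E7\<close>, where a derivative falls on \<open>U\<close>, occurs only on the
    right, in both terms with opposite signs.\<close>
  define E1 where "E1 = (\<Sum>a<?r. \<Sum>i<?n. smul (u a) (lmul (d_left (star B a) (Nx i)) (d_p i G)))"
  define E2 where "E2 = (\<Sum>a<?r. \<Sum>i<?n. smul (u a) (lmul (Nx i) (d_p i (d_left (star B a) G))))"
  define E3 where "E3 = (\<Sum>a<?r. \<Sum>c<?r. smul (u a)
      (lmul (d_left (star B a) (d_left c N)) (d_left (star B c) G)))"
  define E4 where "E4 = (\<Sum>a<?r. \<Sum>c<?r. smul (u a)
      (lmul (d_left c N) (d_left (star B a) (d_left (star B c) G))))"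
  define E5 where "E5 = (\<Sum>j<?n. \<Sum>i<?n. lmul (U j) (lmul (Nx i) (d_p j (d_p i G))))"
  define E6 where "E6 = (\<Sum>j<?n. \<Sum>c<?r. lmul (U j) (lmul (d_left c N) (d_p j (d_left (star B c) G))))"
  define E7 where "E7 = (\<Sum>j<?n. \<Sum>c<?r. lmul (d_left (star B c) (U j)) (lmul (d_left c N) (d_p j G)))"
  have a1: "(\<Sum>a<?r. smul (u a) (d_left (star B a) (\<Sum>i<?n. lmul (Nx i) (d_p i G)))) = E1 + E2"
    unfolding E1_def E2_def sum.distrib[symmetric]
    by (simp add: lin d_left_lmul par_pfree_even[OF Nx] d_left_d_p del: plus_fun_apply zero_fun_apply)
  have a2: "(\<Sum>a<?r. smul (u a) (d_left (star B a) (\<Sum>c<?r. lmul (d_left c N) (d_left (star B c) G)))) = E3 - E4"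
    unfolding E3_def E4_def sum_subtractf[symmetric]
    by (simp add: lin d_left_lmul par_pfree_odd[OF dN] del: plus_fun_apply zero_fun_apply minus_apply
        uminus_apply)
  have a3: "(\<Sum>j<?n. lmul (U j) (d_p j (\<Sum>i<?n. lmul (Nx i) (d_p i G)))) = E5"
    unfolding E5_def by (simp add: lin d_p_lmul[OF Nx] del: plus_fun_apply zero_fun_apply)
  have a4: "(\<Sum>j<?n. lmul (U j) (d_p j (\<Sum>c<?r. lmul (d_left c N) (d_left (star B c) G)))) = E6"
    unfolding E6_def by (simp add: lin d_p_lmul[OF dN] del: plus_fun_apply zero_fun_apply)
  have A1: "Lop B u U (Dop B N Nx G) = E1 + E2 - (E3 - E4) + (E5 - E6)"
    unfolding Dop_def Lop_linear unfolding Lop_def a1 a2 a3 a4 by (simp add: algebra_simps)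
  have A2: "Dop B N Nx (Lop B u U G) = E2 + E5 + E4 - (E7 + E6)"
  proof -
    have b1: "(\<Sum>i<?n. lmul (Nx i) (d_p i (\<Sum>a<?r. smul (u a) (d_left (star B a) G)))) = E2"
      unfolding E2_def by (subst sum.swap) (simp add: lin del: plus_fun_apply zero_fun_apply)
    have b2: "(\<Sum>i<?n. lmul (Nx i) (d_p i (\<Sum>j<?n. lmul (U j) (d_p j G)))) = E5"
    proof -
      have "lmul (Nx i) (d_p i (lmul (U j) (d_p j G))) = lmul (U j) (lmul (Nx i) (d_p j (d_p i G)))"
        if "i < ?n" "j < ?n" for i j
        using that U Nx by (simp add: d_p_lmul[OF U] lmul_comm2[OF Nx, of i "U j"] d_p_d_p flip: lmul_assoc)
      then show ?thesis unfolding E5_def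
        by (subst sum.swap) (simp add: lin del: plus_fun_apply zero_fun_apply)
    qed
    have b3: "(\<Sum>c<?r. lmul (d_left c N) (d_left (star B c) (\<Sum>a<?r. smul (u a) (d_left (star B a) G)))) = - E4"
    proof -
      have "lmul (d_left c N) (d_left (star B c) (smul (u a) (d_left (star B a) G))) =
          - smul (u a) (lmul (d_left c N) (d_left (star B a) (d_left (star B c) G)))" for a c
      proof -
        have "d_left (star B c) (d_left (star B a) G) = - d_left (star B a) (d_left (star B c) G)"
          by (rule d_left_anticomm) (use G in \<open>auto simp: finsupp_def\<close>)
        then show ?thesis by (simp only: d_left_linear lmul_uminus_right lmul_smul_right smul_uminus)
      qed
      moreover have "E4 = (\<Sum>c<?r. \<Sum>a<?r. smul (u a)
          (lmul (d_left c N) (d_left (star B a) (d_left (star B c) G))))"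
        unfolding E4_def by (rule sum.swap)
      ultimately show ?thesis
        by (simp add: d_left_sum lmul_sum_right sum_negf del: plus_fun_apply zero_fun_apply uminus_apply)
    qed
    have b4: "(\<Sum>c<?r. lmul (d_left c N) (d_left (star B c) (\<Sum>j<?n. lmul (U j) (d_p j G)))) = E7 + E6"
    proof -
      have k0: "pfree 0 (d_left (star B c) (U j))" if "j < ?n" for c j
        using pfree_d_left[of 0 "U j"] U[OF that] by simp
      have k: "lmul (d_left c N) (d_left (star B c) (lmul (U j) (d_p j G))) =
          lmul (d_left (star B c) (U j)) (lmul (d_left c N) (d_p j G)) +
          lmul (U j) (lmul (d_left c N) (d_p j (d_left (star B c) G)))" if j: "j < ?n" for c j
      proof -
        have "lmul (d_left c N) (U j) = lmul (- U j) (d_left c N)"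
          using lmul_comm1[OF dN, of c "U j"] par_pfree_odd[OF U[OF j]] by simp
        then have "lmul (d_left c N) (lmul (U j) X) = - lmul (U j) (lmul (d_left c N) X)" for X
          by (metis lmul_assoc lmul_uminus_left)
        moreover have "lmul (d_left c N) (lmul (d_left (star B c) (U j)) (d_p j G)) =
            lmul (d_left (star B c) (U j)) (lmul (d_left c N) (d_p j G))"
          using k0[OF j] G by (simp add: lmul_pfree0 lmul_smul_right)
        ultimately show ?thesis
          by (simp add: d_left_lmul par_pfree_odd[OF U[OF j]] lmul_add_right lmul_diff_right lmul_uminus_left
              lmul_uminus_right
              d_left_d_p del: plus_fun_apply)
      qed
      show ?thesis unfolding E7_def E6_def sum.distrib[symmetric]
        by (subst sum.swap) (simp add: d_left_sum lmul_sum_right k del: plus_fun_apply zero_fun_apply)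
    qed
    show ?thesis unfolding Dop_def unfolding Lop_def d_p_linear d_left_linear lmul_add_right sum.distrib b1 b2
        b3 b4
      by (simp add: algebra_simps)
  qed
  have A3: "Lop B (\<lambda>c q. \<Sum>a<?r. u a q * d_left c (d_left (star B a) N) ({}, {#}) q)
     (\<lambda>i. (\<Sum>a<?r. smul (u a) (d_left (star B a) (Nx i))) +
          (\<Sum>c<?r. smul (d_left (star B c) (U i) ({}, {#})) (d_left c N))) G = E1 - E3 + E7"
  proof -
    have c1: "(\<Sum>c<?r. smul (\<lambda>q. \<Sum>a<?r. u a q * d_left c (d_left (star B a) N) ({}, {#}) q)
        (d_left (star B c) G)) = - E3"
    proof -
      have "smul (u a) (lmul (d_left (star B a) (d_left c N)) (d_left (star B c) G)) m q =
         - (u a q * d_left c (d_left (star B a) N) ({}, {#}) q * d_left (star B c) G m q)" for a c m q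
      proof -
        have f: "finsupp N" using N pfree_finsupp by blast
        have p: "pfree 0 (d_left (star B a) (d_left c N))" by (rule pfree_d_left) (use dN in simp)
        have "d_left (star B a) (d_left c N) = - d_left c (d_left (star B a) N)"
          by (rule d_left_anticomm) (use f in \<open>auto simp: finsupp_def\<close>)
        then show ?thesis using lmul_pfree0[OF p finsupp_d_left[OF G]] by (simp add: smul_apply)
      qed
      then show ?thesis unfolding E3_def
        by (subst sum.swap, intro loc_eqI)
            (simp add: loc_sum_apply smul_apply sum_distrib_right sum_negf mult.assoc)
    qed
    have c2: "(\<Sum>i<?n. lmul (\<Sum>a<?r. smul (u a) (d_left (star B a) (Nx i))) (d_p i G)) = E1"
      unfolding E1_def by (subst sum.swap) (simp add: lin del: plus_fun_apply zero_fun_apply)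
    have c3: "(\<Sum>i<?n. lmul (\<Sum>c<?r. smul (d_left (star B c) (U i) ({}, {#})) (d_left c N)) (d_p i G)) = E7"
      unfolding E7_def using U G
      by (simp add: pfree_d_left lmul_sum_left lmul_smul_left lmul_pfree0 del: plus_fun_apply zero_fun_apply)
    show ?thesis unfolding Lop_def lmul_add_left sum.distrib c1 c2 c3 by (simp add: algebra_simps)
  qed
  show ?thesis unfolding A1 A2 A3 by (simp add: algebra_simps)
qed

section \<open>Changes of coordinates\<close>

definition word_el :: "(nat \<Rightarrow> 'm loc) \<Rightarrow> (nat \<Rightarrow> 'm loc) \<Rightarrow> mon \<Rightarrow> 'm loc" where
  "word_el oc pc m = foldr lmul
     (map oc (sorted_list_of_set (fst m)) @ map pc (sorted_list_of_multiset (snd m))) one_el"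

lemma monomial_change_word: "monomial_change B c c' m = word_el (odd_change B c c') (p_change B c c') m"
  by (simp add: monomial_change_def word_el_def)

text \<open>Substitution of the images of the generators into a function of degree \<open>k\<close>.
  The coefficients stay functions of the base point, so \<open>phi\<close> is linear over
  them.\<close>

definition phi :: "('m, 'v) vbundle \<Rightarrow> nat \<Rightarrow> (nat \<Rightarrow> 'm loc) \<Rightarrow> (nat \<Rightarrow> 'm loc) \<Rightarrow> 'm loc \<Rightarrow> 'm loc" where
  "phi B k oc pc F = (\<Sum>m\<in>monomials B k. smul (F m) (word_el oc pc m))"

lemma finite_monomials: "finite (monomials B k)"
proof -
  have "monomials B k \<subseteq> Pow {..<2 * brank B} \<times> (\<Union>l\<in>{..k}. {K. set_mset K \<subseteq> {..<bdim B} \<and> size K = l})"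
    by (auto simp: monomials_def)
  moreover have "finite (Pow {..<2 * brank B} \<times> (\<Union>l\<in>{..k}. {K. set_mset K \<subseteq> {..<bdim B} \<and> size K = l}))"
    using finite_multisets_of_size[of "{..<bdim B}"]
    by (intro finite_cartesian_product finite_UN_I) (auto simp: multisets_of_size_def conj_commute)
  ultimately show ?thesis by (rule finite_subset)
qed

lemma phi_linear:
  "phi B k oc pc (F + G) = phi B k oc pc F + phi B k oc pc G"
  "phi B k oc pc (F - G) = phi B k oc pc F - phi B k oc pc G"
  "phi B k oc pc (- F) = - phi B k oc pc F"
  "phi B k oc pc (smul f F) = smul f (phi B k oc pc F)"
  "phi B k oc pc 0 = 0"
  by (rule loc_eqI, simp add: phi_def loc_sum_apply smul_apply sum.distrib sum_subtractf sum_negf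
      sum_distrib_left algebra_simps)+

lemma phi_sum: "phi B k oc pc (\<Sum>i\<in>I. F i) = (\<Sum>i\<in>I. phi B k oc pc (F i))"
  by (induction I rule: infinite_finite_induct) (simp_all add: phi_linear del: plus_fun_apply zero_fun_apply)

lemma phi_mon_el: "m \<in> monomials B k \<Longrightarrow> phi B k oc pc (mon_el m) = word_el oc pc m"
proof (rule loc_eqI)
  fix S K q assume m: "m \<in> monomials B k"
  have "phi B k oc pc (mon_el m) (S, K) q = (\<Sum>m'\<in>monomials B k. if m' = m then word_el oc pc m (S, K) q else 0)"
    unfolding phi_def loc_sum_apply by (intro sum.cong) (auto simp: mon_el_def smul_apply)
  then show "phi B k oc pc (mon_el m) (S, K) q = word_el oc pc m (S, K) q"
    using m by (simp add: finite_monomials)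
qed

section \<open>Generators, and the monomials of degree at most 3\<close>

definition zeta :: "nat \<Rightarrow> 'm loc" where "zeta a = mon_el ({a}, {#})"
definition pvar :: "nat \<Rightarrow> 'm loc" where "pvar i = mon_el ({}, {#i#})"

lemma pfree_zeta [simp]: "pfree 1 (zeta a)" "pfree (Suc 0) (zeta a)"
  by (auto simp: zeta_def intro!: pfree_mon_el)

lemma lmul_zeta:
  assumes "finite S"
  shows "lmul (zeta a) G (S, K) q = (if a \<in> S then ksign {a} (S - {a}) * G (S - {a}, K) q else 0)"
proof -
  have "lmul (zeta a) G (S, K) q = (\<Sum>A\<in>Pow S. if A = {a} then ksign {a} (S - {a}) * G (S - {a}, K) q else 0)"
    unfolding lmul_pfree[OF pfree_zeta(1)] by (intro sum.cong) (auto simp: zeta_def mon_el_def)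
  then show ?thesis using assms by simp
qed

lemma lmul_zeta_mon_el:
  assumes "finite S" "a \<notin> S"
  shows "lmul (zeta a) (mon_el (S, K)) = smul (\<lambda>_. ksign {a} S) (mon_el (insert a S, K))"
proof (rule loc_eqI)
  fix T L q
  show "lmul (zeta a) (mon_el (S, K)) (T, L) q = smul (\<lambda>_. ksign {a} S) (mon_el (insert a S, K)) (T, L) q"
  proof (cases "finite T")
    case True
    then show ?thesis using assms by (auto simp: lmul_zeta smul_apply mon_el_def)
  qed (use assms in \<open>auto simp: lmul_infinite smul_apply mon_el_def\<close>)
qed

lemma ksign_lt:
  assumes "finite S" "\<And>b. b \<in> S \<Longrightarrow> a < b"
  shows "ksign {a} S = 1"
  using assms by (auto simp: ksign_prod intro!: prod.neutral dest!: order.asym)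

lemma smul_one [simp]: "smul (\<lambda>_. 1) F = F"
  by (rule loc_eqI) (simp add: smul_apply)

lemma zeta_pvar: "lmul (zeta a) (pvar i) = mon_el ({a}, {#i#})"
  by (simp add: pvar_def lmul_zeta_mon_el)

lemma zeta2: "a < b \<Longrightarrow> lmul (zeta a) (zeta b) = mon_el ({a, b}, {#})"
  unfolding zeta_def[of b] by (subst lmul_zeta_mon_el) (auto simp: ksign_lt)

lemma zeta3: "a < b \<Longrightarrow> b < c \<Longrightarrow> lmul (zeta a) (lmul (zeta b) (zeta c)) = mon_el ({a, b, c}, {#})"
proof -
  assume "a < b" "b < c"
  moreover from this have "ksign {a} {b, c} = 1" by (intro ksign_lt) auto
  ultimately show ?thesis unfolding zeta2[OF \<open>b < c\<close>] by (subst lmul_zeta_mon_el) auto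
qed

lemma pfree1_anticomm: "pfree 1 X \<Longrightarrow> pfree 1 Y \<Longrightarrow> lmul X Y = - lmul Y X"
  by (simp add: lmul_comm1[of X] par_pfree_odd lmul_uminus_left del: uminus_apply)

lemma pfree1_square: "pfree 1 X \<Longrightarrow> lmul X X = 0"
proof -
  assume "pfree 1 X"
  from pfree1_anticomm[OF this this] have "lmul X X m q = - lmul X X m q" for m q
    by (metis uminus_apply)
  then show ?thesis by (intro loc_eqI) (simp only: zero_fun_apply, metis equal_neg_zero)
qed

lemma monomials1: "m \<in> monomials B 1 \<longleftrightarrow> (\<exists>a<2 * brank B. m = ({a}, {#}))"
proof
  assume "m \<in> monomials B 1"
  then obtain S K where m: "m = (S, K)" "S \<subseteq> {..<2 * brank B}" "card S + 2 * size K = 1"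
    by (auto simp: monomials_def)
  then have "card S = 1" "size K = 0" by arith+
  then have "card S = 1" "K = {#}" by simp_all
  then show "\<exists>a<2 * brank B. m = ({a}, {#})" using m by (auto simp: card_1_singleton_iff)
qed (auto simp: monomials_def)

lemma card2_ordered:
  assumes "card (S :: nat set) = 2" obtains a b where "a < b" "S = {a, b}"
proof -
  obtain a b where "S = {a, b}" "a \<noteq> b" using assms by (meson card_2_iff)
  then show thesis using that[of a b] that[of b a] by (cases "a < b") auto
qed

lemma card3_ordered:
  assumes "card (S :: nat set) = 3" obtains a b c where "a < b" "b < c" "S = {a, b, c}"
proof -
  have f: "finite S" "S \<noteq> {}" using assms by (auto intro: card_ge_0_finite)
  then have m: "Min S \<in> S" by simp
  have "card (S - {Min S}) = 2" using assms f m by simp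
  then obtain b c where bc: "b < c" "S - {Min S} = {b, c}" by (rule card2_ordered)
  have "b \<in> S" "b \<noteq> Min S" using bc by auto
  then have "Min S < b" using f by (metis Min_le le_neq_implies_less)
  moreover have "S = {Min S, b, c}" using bc m by auto
  ultimately show thesis using that bc by blast
qed

lemma monomials2: "m \<in> monomials B 2 \<longleftrightarrow> (\<exists>i<bdim B. m = ({}, {#i#})) \<or>
    (\<exists>b<2 * brank B. \<exists>a<b. m = ({a, b}, {#}))"
proof
  assume "m \<in> monomials B 2"
  then obtain S K where m: "m = (S, K)" "S \<subseteq> {..<2 * brank B}" "set_mset K \<subseteq> {..<bdim B}"
      "card S + 2 * size K = 2"
    by (auto simp: monomials_def)
  have f: "finite S" using m finite_subset by blast
  from m(4) have "card S = 2 \<and> size K = 0 \<or> card S = 0 \<and> size K = 1" by presburger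
  then consider "card S = 2" "size K = 0" | "card S = 0" "size K = 1" by fastforce
  then show "(\<exists>i<bdim B. m = ({}, {#i#})) \<or> (\<exists>b<2 * brank B. \<exists>a<b. m = ({a, b}, {#}))"
  proof cases
    case 1
    then show ?thesis using m by (elim card2_ordered) auto
  next
    case 2
    then obtain i where "K = {#i#}" using size_1_singleton_mset by auto
    with 2 m f show ?thesis by auto
  qed
qed (auto simp: monomials_def)

lemma monomials3: "m \<in> monomials B 3 \<longleftrightarrow> (\<exists>a<2 * brank B. \<exists>i<bdim B. m = ({a}, {#i#})) \<or>
    (\<exists>c<2 * brank B. \<exists>b<c. \<exists>a<b. m = ({a, b, c}, {#}))"
proof
  assume "m \<in> monomials B 3"
  then obtain S K where m: "m = (S, K)" "S \<subseteq> {..<2 * brank B}" "set_mset K \<subseteq> {..<bdim B}"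
      "card S + 2 * size K = 3"
    by (auto simp: monomials_def)
  have f: "finite S" using m finite_subset by blast
  from m(4) have "card S = 3 \<and> size K = 0 \<or> card S = 1 \<and> size K = 1" by presburger
  then consider "card S = 3" "size K = 0" | "card S = 1" "size K = 1" by blast
  then show "(\<exists>a<2 * brank B. \<exists>i<bdim B. m = ({a}, {#i#})) \<or>
    (\<exists>c<2 * brank B. \<exists>b<c. \<exists>a<b. m = ({a, b, c}, {#}))"
  proof cases
    case 1
    then obtain a b c where "a < b" "b < c" "S = {a, b, c}" by (elim card3_ordered)
    then show ?thesis using m 1 by auto
  next
    case 2
    then obtain i where "K = {#i#}" using size_1_singleton_mset by auto
    moreover obtain a where "S = {a}" using 2 by (auto simp: card_1_singleton_iff)
    ultimately show ?thesis using m by auto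
  qed
qed (auto simp: monomials_def)

lemma lmul_one: "finsupp F \<Longrightarrow> lmul one_el F = F" "finsupp F \<Longrightarrow> lmul F one_el = F"
  by (simp_all add: finsupp_def lmul_one_left lmul_one_right)

lemma finsupp_zeta [simp]: "finsupp (zeta a)" "finsupp (pvar i)"
  by (simp_all add: zeta_def pvar_def)

lemma Lop_zeta: "a < 2 * brank B \<Longrightarrow> Lop B u U (zeta a :: 'm loc) = smul (u (star B a)) one_el"
proof -
  assume a: "a < 2 * brank B"
  have d: "d_left (star B b) (zeta a :: 'm loc) = (if b = star B a then one_el else 0)" if "b < 2 * brank B"
      for b
  proof -
    have "star B b = a \<longleftrightarrow> b = star B a" using that a by auto
    then show ?thesis by (intro loc_eqI) (auto simp: d_left_apply zeta_def mon_el_def)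
  qed
  have "Lop B u U (zeta a :: 'm loc) = (\<Sum>b<2 * brank B. if b = star B a then smul (u b) one_el else 0)"
    unfolding Lop_pfree[OF pfree_zeta(1)] using d by (intro sum.cong) auto
  then show ?thesis using a by (simp del: zero_fun_apply)
qed

lemma Lop_pvar:
  assumes i: "i < bdim B" and U: "\<And>i. i < bdim B \<Longrightarrow> finsupp (U i)"
  shows "Lop B u U (pvar i :: 'm loc) = U i"
proof -
  have "d_left a (pvar i :: 'm loc) = 0" for a by (intro loc_eqI) (auto simp: d_left_apply pvar_def mon_el_def)
  moreover have "d_p j (pvar i :: 'm loc) = (if j = i then one_el else 0)" for j
    by (intro loc_eqI) (auto simp: d_p_apply pvar_def mon_el_def)
  moreover have "lmul (U i) one_el = U i" using U i by (intro lmul_one)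
  moreover have "(\<Sum>j<bdim B. lmul (U j) (if j = i then one_el else 0)) =
      (\<Sum>j<bdim B. if j = i then lmul (U j) one_el else 0)"
    by (intro sum.cong) auto
  ultimately show ?thesis using i by (simp add: Lop_def del: zero_fun_apply plus_fun_apply)
qed

context
  fixes B :: "('m, 'v) vbundle" and oc pc :: "nat \<Rightarrow> 'm loc"
  assumes oc: "\<And>a. a < 2 * brank B \<Longrightarrow> pfree 1 (oc a)"
    and pc: "\<And>i. i < bdim B \<Longrightarrow> finsupp (pc i)"
begin

lemma word_el_1: "a < 2 * brank B \<Longrightarrow> word_el oc pc ({a}, {#}) = oc a"
  using pfree_finsupp[OF oc] by (simp add: word_el_def lmul_one)

lemma word_el_p: "i < bdim B \<Longrightarrow> word_el oc pc ({}, {#i#}) = pc i"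
  using pc by (simp add: word_el_def lmul_one)

lemma word_el_2: "a < b \<Longrightarrow> b < 2 * brank B \<Longrightarrow> word_el oc pc ({a, b}, {#}) = lmul (oc a) (oc b)"
  using pfree_finsupp[OF oc] by (simp add: word_el_def lmul_one)

lemma word_el_1p: "a < 2 * brank B \<Longrightarrow> i < bdim B \<Longrightarrow> word_el oc pc ({a}, {#i#}) = lmul (oc a) (pc i)"
  using pc by (simp add: word_el_def lmul_one)

lemma word_el_3: "a < b \<Longrightarrow> b < c \<Longrightarrow> c < 2 * brank B \<Longrightarrow>
    word_el oc pc ({a, b, c}, {#}) = lmul (oc a) (lmul (oc b) (oc c))"
  using pfree_finsupp[OF oc] by (simp add: word_el_def lmul_one)

lemma phi_zeta: "a < 2 * brank B \<Longrightarrow> phi B 1 oc pc (zeta a) = oc a"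
  by (simp add: zeta_def phi_mon_el monomials1[unfolded One_nat_def] word_el_1)

lemma phi_pvar: "i < bdim B \<Longrightarrow> phi B 2 oc pc (pvar i) = pc i"
  by (simp add: pvar_def phi_mon_el monomials2 word_el_p)

text \<open>Monomials list their odd variables in increasing order. The other orders follow because
  odd elements anticommute both before and after the substitution.\<close>

lemma phi_zeta2:
  assumes "a < 2 * brank B" "b < 2 * brank B"
  shows "phi B 2 oc pc (lmul (zeta a) (zeta b)) = lmul (oc a) (oc b)"
proof -
  have less: "phi B 2 oc pc (lmul (zeta a) (zeta b)) = lmul (oc a) (oc b)" if "a < b" "b < 2 * brank B" for a b
    unfolding zeta2[OF that(1)] using that by (subst phi_mon_el) (auto simp: monomials2 word_el_2)
  consider "a < b" | "a = b" | "b < a" by linarith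
  then show ?thesis
  proof cases
    case 1 then show ?thesis using less assms by blast
  next
    case 2 then show ?thesis using assms
      by (simp add: pfree1_square[OF pfree_zeta(1)] pfree1_square[OF oc] phi_linear del: zero_fun_apply)
  next
    case 3 
    then have "phi B 2 oc pc (lmul (zeta b) (zeta a)) = lmul (oc b) (oc a)" using less assms by blast
    then show ?thesis using assms
      by (simp only: pfree1_anticomm[OF pfree_zeta(1), of "zeta b" a, OF pfree_zeta(1)]
          pfree1_anticomm[OF oc oc, of a b] phi_linear)
  qed
qed

text \<open>The change of coordinates intertwines \<open>{u, \<cdot>}\<close> in the two patches as soon as it does so on
  the generators.\<close>

context
  fixes u u' :: "nat \<Rightarrow> 'm \<Rightarrow> real" and U :: "nat \<Rightarrow> 'm loc" and V :: "nat \<Rightarrow> nat \<Rightarrow> 'm \<Rightarrow> real"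
  assumes U: "\<And>i. i < bdim B \<Longrightarrow> pfree 1 (U i)"
    and Loc: "\<And>a. a < 2 * brank B \<Longrightarrow> Lop B u U (oc a) = smul (u' (star B a)) one_el"
    and Lpc: "\<And>i. i < bdim B \<Longrightarrow> Lop B u U (pc i) = (\<Sum>b<2 * brank B. smul (V i b) (oc b))"
begin

abbreviation "U' i \<equiv> (\<Sum>b<2 * brank B. smul (V i b) (zeta b))"

lemma pfree_U': "pfree 1 (U' i)"
  by (intro pfree_sum pfree_linear pfree_zeta)

lemma Lop_phi_mon2:
  assumes "m \<in> monomials B 2"
  shows "Lop B u U (word_el oc pc m) = phi B 1 oc pc (Lop B u' U' (mon_el m))"
proof -
  from assms consider (p) i where "i < bdim B" "m = ({}, {#i#})" |
    (z) a b where "a < b" "b < 2 * brank B" "m = ({a, b}, {#})" unfolding monomials2 by auto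
  then show ?thesis
  proof cases
    case p
    then show ?thesis using Lop_pvar[of i B U' u']
      by (simp add: word_el_p Lpc pvar_def[symmetric] phi_sum phi_linear phi_zeta[unfolded One_nat_def] del:
          plus_fun_apply)
  next
    case z
    then show ?thesis
      by (simp add: word_el_2 zeta2[symmetric] Lop_lmul[OF oc U] Lop_lmul[OF pfree_zeta(1) pfree_U'] Loc
          Lop_zeta
          par_pfree_odd[OF oc] par_pfree_odd[OF pfree_zeta(1)] oc phi_linear phi_zeta[unfolded One_nat_def]
              lmul_smul_left lmul_smul_right lmul_uminus_left
          lmul_one pfree_finsupp[OF oc]
          smul_uminus del: plus_fun_apply)
  qed
qed

text \<open>Both kinds of monomials of degree 3 are products of generators, so the Leibniz rule
  reduces the claim to \<open>Loc\<close> and \<open>Lpc\<close>. What it leaves has degree 2, where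
  \<open>phi\<close> is known on products and momenta.\<close>

lemma Lop_phi_mon3:
  assumes "m \<in> monomials B 3"
  shows "Lop B u U (word_el oc pc m) = phi B 2 oc pc (Lop B u' U' (mon_el m))"
proof -
  note simps = Lop_lmul[OF oc U] Lop_lmul[OF pfree_zeta(1) pfree_U'] Loc Lop_zeta
          par_pfree_odd[OF oc] par_pfree_odd[OF pfree_zeta(1)] oc phi_linear lmul_smul_left lmul_smul_right
              lmul_uminus_left lmul_uminus_right
          lmul_one pfree_finsupp[OF oc]
          smul_uminus lmul_add_right lmul_diff_right smul_add smul_diff
  from assms consider (p) a i where "a < 2 * brank B" "i < bdim B" "m = ({a}, {#i#})" |
    (z) a b c where "a < b" "b < c" "c < 2 * brank B" "m = ({a, b, c}, {#})" unfolding monomials3 by auto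
  then show ?thesis
  proof cases
    case p
    then show ?thesis
      by (simp add: pc word_el_1p zeta_pvar[symmetric] simps Lpc Lop_pvar phi_pvar lmul_sum_right phi_sum
          phi_zeta2
          del: plus_fun_apply)
  next
    case z
    then show ?thesis
      by (simp add: word_el_3 zeta3[symmetric] simps phi_zeta2 del: plus_fun_apply)
  qed
qed

text \<open>\<open>Lop\<close> does not differentiate the coefficients of its argument. It is
  therefore linear over functions, like \<open>phi\<close>, and monomials suffice.\<close>

lemma Lop_phi:
  assumes F: "\<And>m q. F m q \<noteq> 0 \<Longrightarrow> m \<in> monomials B k" and k: "k = 2 \<or> k = 3"
  shows "Lop B u U (phi B k oc pc F) = phi B (k - 1) oc pc (Lop B u' U' F)"
proof -
  have "F = (\<Sum>m\<in>monomials B k. smul (F m) (mon_el m))"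
  proof (rule loc_eqI)
    fix S K q
    have "(\<Sum>m\<in>monomials B k. smul (F m) (mon_el m)) (S, K) q =
      (\<Sum>m\<in>monomials B k. if m = (S, K) then F (S, K) q else 0)"
      unfolding loc_sum_apply by (intro sum.cong) (auto simp: smul_apply mon_el_def)
    then show "F (S, K) q = (\<Sum>m\<in>monomials B k. smul (F m) (mon_el m)) (S, K) q"
      using F by (auto simp: finite_monomials)
  qed
  then have "phi B (k - 1) oc pc (Lop B u' U' F) =
      phi B (k - 1) oc pc (Lop B u' U' (\<Sum>m\<in>monomials B k. smul (F m) (mon_el m)))"
    by (rule arg_cong)
  also have "\<dots> = (\<Sum>m\<in>monomials B k. smul (F m) (phi B (k - 1) oc pc (Lop B u' U' (mon_el m))))"
    by (simp only: Lop_sum Lop_linear phi_sum phi_linear)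
  also have "\<dots> = (\<Sum>m\<in>monomials B k. smul (F m) (Lop B u U (word_el oc pc m)))"
    using k Lop_phi_mon2 Lop_phi_mon3 by (intro sum.cong) auto
  finally show ?thesis by (simp add: phi_def Lop_sum Lop_linear del: plus_fun_apply)
qed

end
end

section \<open>Calculus in several real variables\<close>

abbreviation Eucl :: "nat \<Rightarrow> (nat \<Rightarrow> real) set" where
  "Eucl n \<equiv> {z. \<forall>j\<ge>n. z j = 0}"

lemma Euclidean_space_eq: "Euclidean_space n = top_of_set (Eucl n)"
  by (simp add: Euclidean_space_def euclidean_product_topology)

lemma openin_Eucl_box:
  assumes "openin (Euclidean_space n) V" "y \<in> V"
  obtains e where "e > 0" "\<And>z. (\<And>j. j < n \<Longrightarrow> \<bar>z j - y j\<bar> < e) \<Longrightarrow> z \<in> Eucl n \<Longrightarrow> z \<in> V"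
proof -
  obtain U where U: "openin (powertop_real UNIV) U" "V = U \<inter> Eucl n"
    using assms(1) by (auto simp: Euclidean_space_def openin_subtopology)
  then obtain W where W: "\<And>j. open (W j)" "y \<in> PiE UNIV W" "PiE UNIV W \<subseteq> U"
    using assms(2) unfolding openin_product_topology_alt by simp (metis IntD1)
  have "\<exists>e>0. \<forall>t. \<bar>t - y j\<bar> < e \<longrightarrow> t \<in> W j" for j
    using W(1)[of j] W(2) unfolding open_dist by (auto simp: dist_real_def PiE_iff)
  then obtain e where e: "\<And>j. e j > 0" "\<And>j t. \<bar>t - y j\<bar> < e j \<Longrightarrow> t \<in> W j" by metis
  \<comment> \<open>The coordinates from \<open>n\<close> on are 0 at every point considered and
    impose no bound. Inserting 1 keeps the minimum meaningful for \<open>n\<close> = 0.\<close>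
  define d where "d = Min (insert 1 (e ` {..<n}))"
  have d: "d > 0" "\<And>j. j < n \<Longrightarrow> d \<le> e j" using e by (auto simp: d_def)
  show thesis
  proof
    fix z assume z: "\<And>j. j < n \<Longrightarrow> \<bar>z j - y j\<bar> < d" "z \<in> Eucl n"
    have "z j \<in> W j" for j
    proof (cases "j < n")
      case True then show ?thesis using z(1)[OF True] d(2)[OF True] by (intro e(2)) simp
    next
      case False 
      then have "z j = y j" using z(2) assms(2) U(2) by auto
      then show ?thesis using e(1)[of j] by (intro e(2)) simp
    qed
    then have "z \<in> PiE UNIV W" by (auto simp: PiE_iff)
    then show "z \<in> V" using W U z by auto
  qed (rule d(1))
qed

lemma openin_Eucl_subset: "openin (Euclidean_space n) V \<Longrightarrow> V \<subseteq> Eucl n"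
  by (simp add: Euclidean_space_eq openin_imp_subset)

lemma eventually_upd:
  assumes "openin (Euclidean_space n) V" "y \<in> V" "i < n"
  shows "\<forall>\<^sub>F t in nhds (y i). y(i := t) \<in> V"
proof -
  obtain e where e: "e > 0" "\<And>z. (\<And>j. j < n \<Longrightarrow> \<bar>z j - y j\<bar> < e) \<Longrightarrow> z \<in> Eucl n \<Longrightarrow> z \<in> V"
    using openin_Eucl_box[OF assms(1,2)] by blast
  have "y \<in> Eucl n" using openin_Eucl_subset assms by blast
  then have "y(i := t) \<in> V" if "dist t (y i) < e" for t
    using that assms(3) e(1) by (intro e(2)) (auto simp: dist_real_def)
  then show ?thesis using e(1) eventually_nhds_metric by blast
qed

text \<open>A partial derivative is taken along a coordinate line, which stays in the open set
  \<open>V\<close> near \<open>y\<close>; hence the values on \<open>V\<close> determine it.\<close>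

lemma partial_cong:
  assumes "openin (Euclidean_space n) V" "y \<in> V" "i < n" "\<And>z. z \<in> V \<Longrightarrow> f z = g z"
  shows "partial i f y = partial i g y"
    and "(\<lambda>t. f (y(i := t))) differentiable at (y i) \<longleftrightarrow> (\<lambda>t. g (y(i := t))) differentiable at (y i)"
proof -
  have ev: "\<forall>\<^sub>F t in nhds (y i). f (y(i := t)) = g (y(i := t))"
    using eventually_upd[OF assms(1-3)] by eventually_elim (rule assms(4))
  then show "partial i f y = partial i g y"
    unfolding partial_def by (intro deriv_cong_ev refl)
  have "(f' has_field_derivative D) (at (y i)) = (g' has_field_derivative D) (at (y i))"
    if "\<forall>\<^sub>F t in nhds (y i). f' t = g' t" for f' g' D
    using that by (intro DERIV_cong_ev refl)
  from this[OF ev] show "(\<lambda>t. f (y(i := t))) differentiable at (y i) \<longleftrightarrow>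
      (\<lambda>t. g (y(i := t))) differentiable at (y i)"
    by (simp add: real_differentiable_def)
qed

lemma Ck_on_cong:
  assumes "openin (Euclidean_space n) V" "\<And>z. z \<in> V \<Longrightarrow> f z = g z" "Ck_on k n V f"
  shows "Ck_on k n V g"
  using assms(2,3)
proof (induction k arbitrary: f g)
  case 0
  then show ?case using continuous_on_cong[of V V f g] by simp
next
  case (Suc k)
  have "Ck_on k n V (partial i g)" if i: "i < n" for i
  proof (rule Suc.IH)
    show "partial i f z = partial i g z" if "z \<in> V" for z
      by (rule partial_cong(1)[OF assms(1) that i Suc.prems(1)])
    show "Ck_on k n V (partial i f)" using Suc.prems i by simp
  qed
  moreover have "(\<lambda>t. g (y(i := t))) differentiable at (y i)" if "i < n" "y \<in> V" for i y
    using partial_cong(2)[OF assms(1) that(2,1), of f g, OF Suc.prems(1)] Suc.prems(2) that by simp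
  ultimately show ?case using Suc.prems continuous_on_cong[of V V f g] by simp
qed

lemma Ck_on_subset: "Ck_on k n V f \<Longrightarrow> W \<subseteq> V \<Longrightarrow> Ck_on k n W f"
  by (induction k arbitrary: f) (auto intro: continuous_on_subset)

lemma Ck_on_less: "Ck_on (Suc k) n V f \<Longrightarrow> Ck_on k n V f"
  by (induction k arbitrary: f) auto

lemma Ck_on_continuous: "Ck_on k n V f \<Longrightarrow> continuous_on V f"
  by (cases k) auto

lemma Ck_on_local:
  assumes "V \<subseteq> Eucl n" "\<And>y. y \<in> V \<Longrightarrow> \<exists>W. openin (Euclidean_space n) W \<and> y \<in> W \<and> Ck_on k n (W \<inter> V) f"
  shows "Ck_on k n V f"
  using assms(2)
proof (induction k arbitrary: f)
  case 0
  show ?case unfolding Ck_on.simps continuous_on_eq_continuous_within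
  proof
    fix y assume "y \<in> V"
    with 0 obtain W where W: "openin (Euclidean_space n) W" "y \<in> W" "continuous_on (W \<inter> V) f" by auto
    then obtain U where U: "open U" "W = Eucl n \<inter> U"
      by (auto simp: Euclidean_space_eq openin_open)
    have eq: "W \<inter> V \<inter> U - {y} = V \<inter> U - {y}" using U assms(1) by auto
    have "continuous (at y within (W \<inter> V)) f"
      using W \<open>y \<in> V\<close> by (simp add: continuous_on_eq_continuous_within)
    then show "continuous (at y within V) f"
      using at_within_nhd[OF _ U(1) eq] U(2) W(2) by simp
  qed
next
  case (Suc k)
  have "Ck_on k n V f"
  proof (rule Suc.IH)
    fix y assume "y \<in> V"
    then show "\<exists>W. openin (Euclidean_space n) W \<and> y \<in> W \<and> Ck_on k n (W \<inter> V) f"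
      using Suc.prems[of y] Ck_on_less[of k n _ f] by auto
  qed
  then have "continuous_on V f" by (rule Ck_on_continuous)
  moreover have "Ck_on k n V (partial i f)" if i: "i < n" for i
  proof (rule Suc.IH)
    fix y assume "y \<in> V"
    then show "\<exists>W. openin (Euclidean_space n) W \<and> y \<in> W \<and> Ck_on k n (W \<inter> V) (partial i f)"
      using Suc.prems[of y] i by auto
  qed
  moreover have "(\<lambda>t. f (y(i := t))) differentiable at (y i)" if "i < n" "y \<in> V" for i y
    using Suc.prems[OF that(2)] that by auto
  ultimately show ?case by simp
qed

section \<open>Rules for functions of class C^k\<close>

lemma Ck_on_const [simp]: "Ck_on k n V (\<lambda>_. c)"
proof (induction k arbitrary: c)
  case (Suc k)
  have "partial i (\<lambda>_. c) = (\<lambda>_. 0)" for i by (auto simp: partial_def)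
  then show ?case using Suc by auto
qed auto

lemma has_partial:
  "(\<lambda>t. f (y(i := t))) differentiable at (y i) \<Longrightarrow>
   ((\<lambda>t. f (y(i := t))) has_field_derivative partial i f y) (at (y i))"
  unfolding partial_def by (metis DERIV_imp_deriv real_differentiable_def)

lemma Ck_on_SucD:
  assumes "Ck_on (Suc k) n V f" "i < n"
  shows "Ck_on k n V (partial i f)"
    and "y \<in> V \<Longrightarrow> ((\<lambda>t. f (y(i := t))) has_field_derivative partial i f y) (at (y i))"
  using assms has_partial by auto

lemma Ck_on_SucI:
  assumes V: "openin (Euclidean_space n) V" and "continuous_on V f"
    and "\<And>i. i < n \<Longrightarrow> Ck_on k n V (f' i)"
    and d: "\<And>i y. i < n \<Longrightarrow> y \<in> V \<Longrightarrow> ((\<lambda>t. f (y(i := t))) has_field_derivative f' i y) (at (y i))"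
  shows "Ck_on (Suc k) n V f"
proof -
  have "Ck_on k n V (partial i f)" if "i < n" for i
    by (rule Ck_on_cong[OF V _ assms(3)[OF that]])
        (unfold partial_def, rule DERIV_imp_deriv[symmetric], rule d[OF that])
  moreover have "(\<lambda>t. f (y(i := t))) differentiable at (y i)" if "i < n" "y \<in> V" for i y
    using d[OF that] real_differentiable_def by blast
  ultimately show ?thesis using assms(2) by simp
qed

lemma Ck_on_add:
  assumes V: "openin (Euclidean_space n) V"
  shows "Ck_on k n V f \<Longrightarrow> Ck_on k n V g \<Longrightarrow> Ck_on k n V (\<lambda>y. f y + g y)"
proof (induction k arbitrary: f g)
  case (Suc k)
  show ?case
  proof (rule Ck_on_SucI[OF V, where f' = "\<lambda>i y. partial i f y + partial i g y"])
    show "continuous_on V (\<lambda>y. f y + g y)" using Suc.prems by (auto intro: continuous_on_add)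
    fix i assume i: "i < n"
    show "Ck_on k n V (\<lambda>y. partial i f y + partial i g y)"
      using Suc.prems i by (intro Suc.IH) auto
    fix y assume "y \<in> V"
    then show "((\<lambda>t. f (y(i := t)) + g (y(i := t))) has_field_derivative partial i f y +
        partial i g y) (at (y i))"
      using Suc.prems i by (intro DERIV_add Ck_on_SucD(2)) auto
  qed
qed (auto intro: continuous_on_add)

lemma Ck_on_mult:
  assumes V: "openin (Euclidean_space n) V"
  shows "Ck_on k n V f \<Longrightarrow> Ck_on k n V g \<Longrightarrow> Ck_on k n V (\<lambda>y. f y * g y)"
proof (induction k arbitrary: f g)
  case (Suc k)
  show ?case
  proof (rule Ck_on_SucI[OF V, where f' = "\<lambda>i y. partial i f y * g y + partial i g y * f y"])
    show "continuous_on V (\<lambda>y. f y * g y)" using Suc.prems by (auto intro: continuous_on_mult)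
    fix i assume i: "i < n"
    show "Ck_on k n V (\<lambda>y. partial i f y * g y + partial i g y * f y)"
      using Suc.prems i Ck_on_less by (intro Ck_on_add[OF V] Suc.IH) auto
    fix y assume y: "y \<in> V"
    show "((\<lambda>t. f (y(i := t)) * g (y(i := t))) has_field_derivative partial i f y * g y +
        partial i g y * f y) (at (y i))"
      by (rule DERIV_cong[OF DERIV_mult[OF Ck_on_SucD(2)[OF Suc.prems(1) i y]
          Ck_on_SucD(2)[OF Suc.prems(2) i y]]]) simp
  qed
qed (auto intro: continuous_on_mult)

lemma Ck_on_sum:
  assumes V: "openin (Euclidean_space n) V"
  shows "(\<And>j. j \<in> J \<Longrightarrow> Ck_on k n V (f j)) \<Longrightarrow> Ck_on k n V (\<lambda>y. \<Sum>j\<in>J. f j y)"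
  by (induction J rule: infinite_finite_induct) (auto intro: Ck_on_add[OF V])

text \<open>The outer function is given with the sequence of all its derivatives, so that the
  induction on \<open>k\<close> can move one step along the sequence.\<close>

lemma Ck_on_comp_real:
  assumes V: "openin (Euclidean_space n) V"
    and d: "\<And>j x. (d j has_field_derivative d (Suc j) x) (at x)"
  shows "Ck_on k n V f \<Longrightarrow> Ck_on k n V (\<lambda>y. d j (f y))"
proof (induction k arbitrary: j)
  have c: "continuous_on UNIV (d j)" for j
    using d[of j] by (meson DERIV_isCont continuous_at_imp_continuous_on)
  have c': "continuous_on V (\<lambda>y. d j (f y))" if "continuous_on V f" for j
    using continuous_on_compose2[OF c that] by auto
  { case 0 then show ?case using c' by simp }
  { case (Suc k)
    show ?case
    proof (rule Ck_on_SucI[OF V, where f' = "\<lambda>i y. d (Suc j) (f y) * partial i f y"])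
      show "continuous_on V (\<lambda>y. d j (f y))" using Suc.prems c' by simp
      fix i assume i: "i < n"
      show "Ck_on k n V (\<lambda>y. d (Suc j) (f y) * partial i f y)"
        using Suc.prems i Ck_on_less[OF Suc.prems] by (intro Ck_on_mult[OF V] Suc.IH) auto
      fix y assume y: "y \<in> V"
      show "((\<lambda>t. d j (f (y(i := t)))) has_field_derivative d (Suc j) (f y) * partial i f y) (at (y i))"
        by (rule DERIV_chain2[OF _ Ck_on_SucD(2)[OF Suc.prems i y]]) (use d[of j "f y"] in simp)
    qed }
qed

text \<open>Continuous partial derivatives imply differentiability: the increment of
  \<open>F\<close> along \<open>g\<close> is telescoped through the points \<open>Z k t\<close>,
  which move one coordinate at a time, and each step is controlled by the mean value
  theorem.\<close>

lemma C1_chain: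
  assumes V: "openin (Euclidean_space n) V" and F: "Ck_on 1 n V F"
    and g: "g t0 \<in> V" "\<And>j. j < n \<Longrightarrow> ((\<lambda>t. g t j) has_field_derivative g' j) (at t0)"
    and gE: "\<forall>\<^sub>F t in nhds t0. g t \<in> Eucl n"
  shows "((\<lambda>t. F (g t)) has_field_derivative (\<Sum>j<n. partial j F (g t0) * g' j)) (at t0)"
proof -
  define Z where "Z = (\<lambda>k t j. if j < k then g t j else g t0 j)"
  have Z0: "Z 0 t = g t0" "Z k t0 = g t0" for k t by (auto simp: Z_def fun_eq_iff)
  have ZS: "Z (Suc k) t = (Z k t)(k := g t k)" for k t by (auto simp: Z_def fun_eq_iff)
  have E0: "g t0 \<in> Eucl n" using g(1) V openin_Eucl_subset by blast
  have lim: "((\<lambda>t. g t j) \<longlongrightarrow> g t0 j) (nhds t0)" if "j < n" for j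
  proof -
    have "isCont (\<lambda>t. g t j) t0" using g(2)[OF that] DERIV_isCont by blast
    then show ?thesis by (simp add: isCont_def tendsto_nhds_iff)
  qed
  have step: "((\<lambda>t. F (Z (Suc k) t) - F (Z k t)) has_field_derivative partial k F (g t0) * g' k) (at t0)"
      if k: "k < n" for k
  proof -
    let ?L = "partial k F (g t0)"
    \<comment> \<open>The slope of \<open>F\<close> in the k-th coordinate. Its default value when
      that coordinate does not move is the expected limit, so that \<open>cD\<close> holds for every
      \<open>t\<close> and the limit is not disturbed.\<close>
    define c where "c t = (if g t k = g t0 k then ?L else (F (Z (Suc k) t) - F (Z k t)) / (g t k - g t0 k))"
        for t
    have cD: "F (Z (Suc k) t) - F (Z k t) = c t * (g t k - g t0 k)" for t
    proof (cases "g t k = g t0 k")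
      case True
      then have "Z (Suc k) t = Z k t" unfolding ZS by (auto simp: Z_def)
      then show ?thesis using True by simp
    qed (simp add: c_def)
    have "(c \<longlongrightarrow> ?L) (nhds t0)"
    proof (rule tendstoI)
      fix e :: real assume e: "e > 0"
      have cont: "continuous_on V (partial k F)" using F k by simp
      \<comment> \<open>Continuity gives a box around \<open>g t0\<close> on which the partial
        derivative is close to its value there. For \<open>t\<close> near \<open>t0\<close> the
        whole segment from \<open>Z k t\<close> to \<open>Z (Suc k) t\<close> lies in this box,
        including the intermediate point of the mean value theorem.\<close>
      have "openin (top_of_set V) (V \<inter> partial k F -` ball ?L e)"
        using continuous_openin_preimage_gen[OF cont open_ball] by blast
      then have "openin (Euclidean_space n) (V \<inter> partial k F -` ball ?L e)"
        using V unfolding Euclidean_space_eq by (rule openin_trans)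
      moreover have "g t0 \<in> V \<inter> partial k F -` ball ?L e" using g e by simp
      ultimately obtain r where r: "r > 0" "\<And>z. (\<And>j. j < n \<Longrightarrow> \<bar>z j - g t0 j\<bar> < r) \<Longrightarrow> z \<in> Eucl n \<Longrightarrow>
          z \<in> V \<inter> partial k F -` ball ?L e" using openin_Eucl_box by blast
      have "\<forall>\<^sub>F t in nhds t0. \<forall>j\<in>{..<n}. dist (g t j) (g t0 j) < r"
        using lim r(1) by (intro eventually_ball_finite) (auto intro: tendstoD)
      then show "\<forall>\<^sub>F t in nhds t0. dist (c t) ?L < e" using gE
      proof eventually_elim
        case (elim t)
        have box: "(Z k t)(k := s) \<in> V \<inter> partial k F -` ball ?L e" if "\<bar>s - g t0 k\<bar> \<le> \<bar>g t k - g t0 k\<bar>" for s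
        proof (rule r(2))
          fix j assume "j < n"
          then show "\<bar>((Z k t)(k := s)) j - g t0 j\<bar> < r"
            using elim(1) that r(1) k by (force simp: Z_def dist_real_def)
        next
          show "(Z k t)(k := s) \<in> Eucl n" using E0 elim(2) k by (auto simp: Z_def)
        qed
        show ?case
        proof (cases "g t k = g t0 k")
          case True then show ?thesis using e by (simp add: c_def)
        next
          case False
          define h where "h = (\<lambda>s. F ((Z k t)(k := s)))"
          have h: "(h has_field_derivative partial k F ((Z k t)(k := s))) (at s)"
            if "\<bar>s - g t0 k\<bar> \<le> \<bar>g t k - g t0 k\<bar>" for s
            using Ck_on_SucD(2)[of 0 n V F k "(Z k t)(k := s)"] F k box[OF that] by (simp add: h_def)
          have "\<exists>s. \<bar>s - g t0 k\<bar> \<le> \<bar>g t k - g t0 k\<bar> \<and>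
              h (g t k) - h (g t0 k) = (g t k - g t0 k) * partial k F ((Z k t)(k := s))"
          proof (cases "g t0 k < g t k")
            case True
            then obtain s where "g t0 k < s" "s < g t k"
              "h (g t k) - h (g t0 k) = (g t k - g t0 k) * partial k F ((Z k t)(k := s))"
              using MVT2[of "g t0 k" "g t k" h "\<lambda>s. partial k F ((Z k t)(k := s))"] h by auto
            then show ?thesis by (intro exI[of _ s]) auto
          next
            case gt: False
            then obtain s where "g t k < s" "s < g t0 k"
              "h (g t0 k) - h (g t k) = (g t0 k - g t k) * partial k F ((Z k t)(k := s))"
              using MVT2[of "g t k" "g t0 k" h "\<lambda>s. partial k F ((Z k t)(k := s))"] h False by auto
            then show ?thesis by (intro exI[of _ s]) (auto simp: algebra_simps)
          qed
          then obtain s where s: "\<bar>s - g t0 k\<bar> \<le> \<bar>g t k - g t0 k\<bar>"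
              "h (g t k) - h (g t0 k) = (g t k - g t0 k) * partial k F ((Z k t)(k := s))" by blast
          have "h (g t0 k) = F (Z k t)" unfolding h_def by (rule arg_cong[of _ _ F]) (auto simp: Z_def)
          then have "c t = partial k F ((Z k t)(k := s))"
            using s(2) False by (simp add: c_def ZS h_def)
          then show ?thesis using box[OF s(1)] by (simp add: dist_commute)
        qed
      qed
    qed
    then have c0: "c \<midarrow>t0\<rightarrow> ?L" by (rule tendsto_mono[rotated]) (simp add: at_within_le_nhds)
    have "((\<lambda>t. (g t k - g t0 k) / (t - t0)) \<longlongrightarrow> g' k) (at t0)"
      using g(2)[OF k] by (simp add: has_field_derivative_iff)
    then have "((\<lambda>t. c t * ((g t k - g t0 k) / (t - t0))) \<longlongrightarrow> ?L * g' k) (at t0)"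
      by (rule tendsto_mult[OF c0])
    then show ?thesis unfolding has_field_derivative_iff cD by simp
  qed
  have "((\<lambda>t. F (Z k t)) has_field_derivative (\<Sum>j<k. partial j F (g t0) * g' j)) (at t0)" if "k \<le> n" for k
    using that
  proof (induction k)
    case (Suc k)
    then show ?case using DERIV_add[OF Suc.IH step[of k]] by simp
  qed (simp add: Z0)
  from this[of n] have "((\<lambda>t. F (Z n t)) has_field_derivative (\<Sum>j<n. partial j F (g t0) * g' j)) (at t0)"
      by simp
  moreover have "\<forall>\<^sub>F t in nhds t0. F (Z n t) = F (g t)" using gE
  proof eventually_elim
    case (elim t)
    have "Z n t = g t" using elim E0 by (auto simp: Z_def fun_eq_iff)
    then show ?case by simp
  qed
  ultimately show ?thesis
    using DERIV_cong_ev[OF refl _ refl, of "\<lambda>t. F (Z n t)" "\<lambda>t. F (g t)" t0] by simp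
qed

text \<open>The derivative of the composition contains the partial derivatives of \<open>F\<close>
  composed with \<open>T\<close>. These are again smooth, so the induction hypothesis, stated for
  every smooth \<open>F\<close>, applies to them.\<close>

lemma Ck_on_compose:
  assumes V: "openin (Euclidean_space n) V" and W: "openin (Euclidean_space n) W"
    and T: "\<And>y. y \<in> W \<Longrightarrow> T y \<in> V"
  shows "smooth_on n V F \<Longrightarrow> (\<And>j. j < n \<Longrightarrow> smooth_on n W (\<lambda>y. T y j)) \<Longrightarrow> Ck_on k n W (\<lambda>y. F (T y))"
proof (induction k arbitrary: F)
  have cont: "continuous_on W (\<lambda>y. F (T y))"
    if F: "smooth_on n V F" and Tj: "\<And>j. j < n \<Longrightarrow> smooth_on n W (\<lambda>y. T y j)" for F
  proof -
    have "continuous_on W (\<lambda>y. T y j)" for j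
    proof (cases "j < n")
      case True then show ?thesis using Tj[OF True] Ck_on_continuous unfolding smooth_on_def by blast
    next
      case False
      have "T y j = 0" if "y \<in> W" for y
        using T[OF that] openin_Eucl_subset[OF V] False by auto
      then show ?thesis using continuous_on_cong[of W W "\<lambda>y. T y j" "\<lambda>y. 0"] by simp
    qed
    then have "continuous_on W T" by (simp add: continuous_on_coordinatewise_then_product)
    moreover have "continuous_on V F" using F Ck_on_continuous unfolding smooth_on_def by blast
    ultimately show ?thesis using T by (auto intro: continuous_on_compose2[of V F])
  qed
  { case 0 then show ?case using cont by simp }
  { case (Suc k)
    show ?case
    proof (rule Ck_on_SucI[OF W, where f' = "\<lambda>i y. \<Sum>j<n. partial j F (T y) * partial i (\<lambda>y. T y j) y"])
      show "continuous_on W (\<lambda>y. F (T y))" using Suc.prems cont by simp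
      fix i assume i: "i < n"
      have sF: "smooth_on n V (partial j F)" if "j < n" for j
        using Suc.prems(1) that Ck_on_SucD(1) unfolding smooth_on_def by blast
      have sT: "Ck_on k n W (partial i (\<lambda>y. T y j))" if "j < n" for j
        using Suc.prems(2)[OF that] i Ck_on_SucD(1) unfolding smooth_on_def by blast
      show "Ck_on k n W (\<lambda>y. \<Sum>j<n. partial j F (T y) * partial i (\<lambda>y. T y j) y)"
        using sF sT Suc.IH Suc.prems(2) by (intro Ck_on_sum[OF W] Ck_on_mult[OF W]) auto
      fix y assume y: "y \<in> W"
      have "((\<lambda>t. F (T (y(i := t)))) has_field_derivative
          (\<Sum>j<n. partial j F (T (y(i := y i))) * partial i (\<lambda>y. T y j) y)) (at (y i))"
      proof (rule C1_chain[OF V])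
        show "Ck_on 1 n V F" using Suc.prems by (auto simp: smooth_on_def)
        show "T (y(i := y i)) \<in> V" using T y by simp
        show "\<forall>\<^sub>F t in nhds (y i). T (y(i := t)) \<in> Eucl n"
          using eventually_upd[OF W y i] by eventually_elim (use T openin_Eucl_subset[OF V] in blast)
        fix j assume "j < n"
        then have "Ck_on (Suc 0) n W (\<lambda>y. T y j)" using Suc.prems(2) unfolding smooth_on_def by blast
        from Ck_on_SucD(2)[OF this i y]
        show "((\<lambda>t. T (y(i := t)) j) has_field_derivative partial i (\<lambda>y. T y j) y) (at (y i))" .
      qed
      then show "((\<lambda>t. F (T (y(i := t)))) has_field_derivative
          (\<Sum>j<n. partial j F (T y) * partial i (\<lambda>y. T y j) y)) (at (y i))" by simp
    qed }
qed

section \<open>Smooth functions on the base\<close>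

lemma has_field_derivative_cong_ev:
  "(f has_field_derivative D) (at x) \<Longrightarrow> \<forall>\<^sub>F t in nhds x. g t = f t \<Longrightarrow> (g has_field_derivative D) (at (x::real))"
  using DERIV_cong_ev[OF refl _ refl] by blast

text \<open>With y = 1/x, the derivative of p(y) exp(-y) with respect to x is y^2 (p(y) - p'(y))
  exp(-y).\<close>

fun flat_poly :: "nat \<Rightarrow> real poly" where
  "flat_poly 0 = 1"
| "flat_poly (Suc k) = [:0, 0, 1:] * (flat_poly k - pderiv (flat_poly k))"

text \<open>The \<open>k\<close>-th derivative of \<open>exp (-1/x)\<close> extended by \<open>0\<close> to \<open>x \<le> 0\<close>.\<close>

definition flat :: "nat \<Rightarrow> real \<Rightarrow> real" where
  "flat k x = (if x > 0 then poly (flat_poly k) (1 / x) * exp (- (1 / x)) else 0)"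

lemma poly_exp_lim: "((\<lambda>t. poly p t * exp (- t)) \<longlongrightarrow> (0::real)) at_top"
proof -
  have "((\<lambda>t. \<Sum>i\<le>degree p. coeff p i * (t ^ i / exp t)) \<longlongrightarrow> (\<Sum>i\<le>degree p. coeff p i * 0)) at_top"
    by (intro tendsto_sum tendsto_mult tendsto_const tendsto_power_div_exp_0)
  then show ?thesis
    by (simp add: poly_altdef sum_distrib_right exp_minus divide_inverse mult.assoc)
qed

lemma flat_deriv: "(flat k has_field_derivative flat (Suc k) x) (at x)"
proof -
  consider "x > 0" | "x < 0" | "x = 0" by linarith
  then show ?thesis
  proof cases
    case 1
    have "((\<lambda>x. poly (flat_poly k) (1 / x) * exp (- (1 / x))) has_field_derivative flat (Suc k) x) (at x)"
      using 1 by (auto intro!: derivative_eq_intros DERIV_chain2[OF poly_DERIV]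
          simp: flat_def field_simps power2_eq_square)
    moreover have "\<forall>\<^sub>F t in nhds x. flat k t = poly (flat_poly k) (1 / t) * exp (- (1 / t))"
      using eventually_nhds_in_open[of "{0<..}" x] 1 by (auto simp: flat_def elim: eventually_mono)
    ultimately show ?thesis by (rule has_field_derivative_cong_ev)
  next
    case 2
    have "((\<lambda>t. 0) has_field_derivative flat (Suc k) x) (at x)" using 2 by (auto simp: flat_def)
    moreover have "\<forall>\<^sub>F t in nhds x. flat k t = 0"
      using eventually_nhds_in_open[of "{..<0}" x] 2 by (auto simp: flat_def elim: eventually_mono)
    ultimately show ?thesis by (rule has_field_derivative_cong_ev)
  next
    case 3
    have "((\<lambda>t. flat k t / t) \<longlongrightarrow> 0) (at_right 0)"
    proof -
      \<comment> \<open>For t > 0 the difference quotient is y p(y) exp(-y) with y = 1/t, whence the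
        extra factor \<open>[:0, 1:]\<close>.\<close>
      have "((\<lambda>t. poly ([:0, 1:] * flat_poly k) (inverse t) * exp (- inverse t)) \<longlongrightarrow> 0) (at_right 0)"
        by (rule filterlim_compose[OF poly_exp_lim filterlim_inverse_at_top_right])
      moreover have "\<forall>\<^sub>F t in at_right 0. poly ([:0, 1:] * flat_poly k) (inverse t) * exp (- inverse t) =
          flat k t / t"
        by (rule eventually_mono[OF eventually_at_right_less]) (auto simp: flat_def field_simps)
      ultimately show ?thesis by (rule Lim_transform_eventually)
    qed
    moreover have "((\<lambda>t. flat k t / t) \<longlongrightarrow> 0) (at_left 0)"
      by (rule tendsto_eventually, rule eventually_at_leftI[of "-1"]) (auto simp: flat_def)
    ultimately show ?thesis using 3
      by (simp add: has_field_derivative_iff flat_def[of _ 0] filterlim_at_split)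
  qed
qed

lemma flat_pos: "x > 0 \<Longrightarrow> flat 0 x > 0" and flat_zero: "x \<le> 0 \<Longrightarrow> flat 0 x = 0"
  by (auto simp: flat_def)

section \<open>Smooth functions and partial derivatives on the manifold\<close>

locale vbun =
  fixes B :: "('m::{t2_space, second_countable_topology}, 'v::real_vector) vbundle" (structure)
  assumes vb: "vector_bundle B"
begin

abbreviation cm :: "'m chart \<Rightarrow> 'm \<Rightarrow> nat \<Rightarrow> real" where "cm ch \<equiv> coord_map (bdim B) ch"
abbreviation icm :: "'m chart \<Rightarrow> (nat \<Rightarrow> real) \<Rightarrow> 'm" where "icm ch \<equiv> inv_into (fst ch) (cm ch)"
abbreviation ic :: "'m chart \<Rightarrow> ('m \<Rightarrow> real) \<Rightarrow> (nat \<Rightarrow> real) \<Rightarrow> real" where "ic ch \<equiv> in_chart (bdim B) ch"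
abbreviation img :: "'m chart \<Rightarrow> 'm set \<Rightarrow> (nat \<Rightarrow> real) set" where "img ch W \<equiv> cm ch ` (fst ch \<inter> W)"

lemma chartD:
  assumes "ch \<in> atlas B"
  shows "open (fst ch)" "openin (Euclidean_space (bdim B)) (cm ch ` fst ch)"
    "homeomorphism (fst ch) (cm ch ` fst ch) (cm ch) (icm ch)"
  using vb assms unfolding vector_bundle_def smooth_manifold_def is_chart_def by auto

lemma atlas_cover: "\<exists>ch\<in>atlas B. q \<in> fst ch"
  using vb unfolding vector_bundle_def smooth_manifold_def by blast

lemma coord_smooth: "ch \<in> atlas B \<Longrightarrow> i < bdim B \<Longrightarrow> smooth_fun B (fst ch) (snd ch i)"
  using vb unfolding vector_bundle_def smooth_manifold_def by blast

lemma icm_cm: "ch \<in> atlas B \<Longrightarrow> q \<in> fst ch \<Longrightarrow> icm ch (cm ch q) = q"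
  using chartD(3) by (auto simp: homeomorphism_def)

lemma ic_cm: "ch \<in> atlas B \<Longrightarrow> q \<in> fst ch \<Longrightarrow> ic ch f (cm ch q) = f q"
  by (simp add: in_chart_def icm_cm)

lemma cm_Eucl: "cm ch q \<in> Eucl (bdim B)"
  by (simp add: coord_map_def)

lemma open_img:
  assumes "ch \<in> atlas B" "open W"
  shows "openin (Euclidean_space (bdim B)) (img ch W)"
proof -
  have "openin (top_of_set (fst ch)) (fst ch \<inter> W)" using assms(2) by auto
  then have "openin (top_of_set (cm ch ` fst ch)) (img ch W)"
    using homeomorphism_imp_open_map[OF chartD(3)[OF assms(1)]] by blast
  then show ?thesis using chartD(2)[OF assms(1)] unfolding Euclidean_space_eq by (rule openin_trans)
qed

lemma smooth_funD: "smooth_fun B W f \<Longrightarrow> ch \<in> atlas B \<Longrightarrow> smooth_on (bdim B) (img ch W) (ic ch f)"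
  by (simp add: smooth_fun_def)

lemma smooth_fun_cong:
  assumes "open W" "\<And>q. q \<in> W \<Longrightarrow> f q = g q" "smooth_fun B W f"
  shows "smooth_fun B W g"
  unfolding smooth_fun_def smooth_on_def
proof (intro ballI allI)
  fix ch k assume ch: "ch \<in> atlas B"
  show "Ck_on k (bdim B) (img ch W) (ic ch g)"
    by (rule Ck_on_cong[OF open_img[OF ch assms(1)], of "ic ch f"])
      (use assms ch ic_cm[OF ch] in \<open>auto simp: smooth_fun_def smooth_on_def\<close>)
qed

lemma smooth_fun_subset: "smooth_fun B W f \<Longrightarrow> W' \<subseteq> W \<Longrightarrow> smooth_fun B W' f"
  unfolding smooth_fun_def smooth_on_def by (meson Ck_on_subset image_mono inf_mono order_refl)

lemma smooth_fun_local:
  assumes "\<And>q. q \<in> W \<Longrightarrow> \<exists>W'. open W' \<and> q \<in> W' \<and> smooth_fun B (W' \<inter> W) f"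
  shows "smooth_fun B W f"
  unfolding smooth_fun_def smooth_on_def
proof (intro ballI allI)
  fix ch k assume ch: "ch \<in> atlas B"
  show "Ck_on k (bdim B) (img ch W) (ic ch f)"
  proof (rule Ck_on_local)
    show "img ch W \<subseteq> Eucl (bdim B)" using cm_Eucl by blast
    fix y assume "y \<in> img ch W"
    then obtain q where q: "q \<in> fst ch" "q \<in> W" "y = cm ch q" by auto
    then obtain W' where W': "open W'" "q \<in> W'" "smooth_fun B (W' \<inter> W) f" using assms by blast
    have "img ch W' \<inter> img ch W \<subseteq> img ch (W' \<inter> W)"
      using icm_cm[OF ch] by (auto simp: image_iff) (metis IntI)
    then have "Ck_on k (bdim B) (img ch W' \<inter> img ch W) (ic ch f)"
      using W'(3) ch Ck_on_subset unfolding smooth_fun_def smooth_on_def by blast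
    then show "\<exists>V. openin (Euclidean_space (bdim B)) V \<and> y \<in> V \<and> Ck_on k (bdim B) (V \<inter> img ch W) (ic ch f)"
      using open_img[OF ch W'(1)] q W' by blast
  qed
qed

lemma smooth_fun_const [simp]: "smooth_fun B W (\<lambda>_. c)"
  by (simp add: smooth_fun_def smooth_on_def in_chart_def comp_def)

lemma smooth_fun_add:
  assumes "open W" "smooth_fun B W f" "smooth_fun B W g"
  shows "smooth_fun B W (\<lambda>q. f q + g q)"
  using assms Ck_on_add[OF open_img[OF _ assms(1)]]
  by (simp add: smooth_fun_def smooth_on_def in_chart_def comp_def)

lemma smooth_fun_mult:
  assumes "open W" "smooth_fun B W f" "smooth_fun B W g"
  shows "smooth_fun B W (\<lambda>q. f q * g q)"
  using assms Ck_on_mult[OF open_img[OF _ assms(1)]]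
  by (simp add: smooth_fun_def smooth_on_def in_chart_def comp_def)

lemma smooth_fun_uminus: "open W \<Longrightarrow> smooth_fun B W f \<Longrightarrow> smooth_fun B W (\<lambda>q. - f q)"
  using smooth_fun_mult[of W "\<lambda>_. -1" f] by simp

lemma smooth_fun_diff:
  "open W \<Longrightarrow> smooth_fun B W f \<Longrightarrow> smooth_fun B W g \<Longrightarrow> smooth_fun B W (\<lambda>q. f q - g q)"
  using smooth_fun_add[of W f "\<lambda>q. - g q"] smooth_fun_uminus by simp

lemma smooth_fun_sum:
  "open W \<Longrightarrow> (\<And>i. i \<in> I \<Longrightarrow> smooth_fun B W (f i)) \<Longrightarrow> smooth_fun B W (\<lambda>q. \<Sum>i\<in>I. f i q)"
  by (induction I rule: infinite_finite_induct) (auto intro: smooth_fun_add)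

lemma smooth_fun_prod:
  "open W \<Longrightarrow> (\<And>i. i \<in> I \<Longrightarrow> smooth_fun B W (f i)) \<Longrightarrow> smooth_fun B W (\<lambda>q. \<Prod>i\<in>I. f i q)"
  by (induction I rule: infinite_finite_induct) (auto intro: smooth_fun_mult)

lemma smooth_fun_flat:
  assumes "open W" "smooth_fun B W f"
  shows "smooth_fun B W (\<lambda>q. flat k (f q))"
  using assms Ck_on_comp_real[OF open_img[OF _ assms(1)], of _ flat] flat_deriv
  by (simp add: smooth_fun_def smooth_on_def in_chart_def comp_def)

text \<open>Smoothness is required in all charts, but on a subset of one chart domain that chart is
  enough: the transition map \<open>T\<close> has smooth components by
  \<open>coord_smooth\<close>.\<close>

lemma smooth_fun_from_chart:
  assumes ch: "ch \<in> atlas B" and W: "open W" "W \<subseteq> fst ch"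
    and f: "smooth_on (bdim B) (img ch W) (ic ch f)"
  shows "smooth_fun B W f"
  unfolding smooth_fun_def smooth_on_def
proof (intro ballI allI)
  fix ch' k assume ch': "ch' \<in> atlas B"
  define T where "T y = cm ch (icm ch' y)" for y
  have "Ck_on k (bdim B) (img ch' W) (\<lambda>y. ic ch f (T y))"
  proof (rule Ck_on_compose[OF open_img[OF ch W(1)] open_img[OF ch' W(1)] _ f])
    show "T y \<in> img ch W" if "y \<in> img ch' W" for y
      using that W icm_cm[OF ch'] by (auto simp: T_def)
    fix j assume j: "j < bdim B"
    have "smooth_on (bdim B) (img ch' W) (ic ch' (snd ch j))"
    proof -
      have sub: "img ch' W \<subseteq> img ch' (fst ch)" using W(2) by auto
      have "\<forall>k. Ck_on k (bdim B) (img ch' (fst ch)) (ic ch' (snd ch j))"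
        using smooth_funD[OF coord_smooth[OF ch j] ch'] unfolding smooth_on_def .
      then show ?thesis unfolding smooth_on_def by (intro allI Ck_on_subset[OF _ sub]) (erule spec)
    qed
    moreover have "ic ch' (snd ch j) = (\<lambda>y. T y j)" using j by (auto simp: in_chart_def T_def coord_map_def)
    ultimately show "smooth_on (bdim B) (img ch' W) (\<lambda>y. T y j)" by simp
  qed
  then show "Ck_on k (bdim B) (img ch' W) (ic ch' f)"
    by (rule Ck_on_cong[OF open_img[OF ch' W(1)], rotated])
      (use W in \<open>auto simp: T_def icm_cm[OF ch'] ic_cm[OF ch'] ic_cm[OF ch] subset_iff\<close>)
qed

lemma pd_deriv:
  assumes ch: "ch \<in> atlas B" and q: "q \<in> fst ch" "q \<in> W" and f: "smooth_fun B W f" and i: "i < bdim B"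
  shows "((\<lambda>t. ic ch f ((cm ch q)(i := t))) has_field_derivative pd B ch i f q) (at (cm ch q i))"
proof -
  have "Ck_on (Suc 0) (bdim B) (img ch W) (ic ch f)" using smooth_funD[OF f ch] unfolding smooth_on_def by blast
  from Ck_on_SucD(2)[OF this i] show ?thesis unfolding pd_def using q by blast
qed

lemma pd_eqI:
  assumes "((\<lambda>t. ic ch f ((cm ch q)(i := t))) has_field_derivative D) (at (cm ch q i))"
  shows "pd B ch i f q = D"
  using assms unfolding pd_def partial_def by (rule DERIV_imp_deriv)

lemma pd_cong:
  assumes ch: "ch \<in> atlas B" and q: "q \<in> fst ch" "q \<in> W" "open W" and i: "i < bdim B"
    and eq: "\<And>p. p \<in> W \<Longrightarrow> f p = g p"
  shows "pd B ch i f q = pd B ch i g q"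
  unfolding pd_def using q ic_cm[OF ch] eq
  by (intro partial_cong(1)[OF open_img[OF ch q(3)] _ i]) auto

lemma pd_const [simp]: "pd B ch i (\<lambda>_. c) q = 0"
  by (rule pd_eqI) (simp add: in_chart_def comp_def)

lemma pd_zero [simp]: "pd B ch i 0 q = 0"
  using pd_const[of ch i 0] by (simp add: zero_fun_def)

context
  fixes ch q W f g i
  assumes ch: "ch \<in> atlas B" and q: "q \<in> fst ch" "q \<in> W" and i: "i < bdim B"
    and f: "smooth_fun B W f" and g: "smooth_fun B W g"
begin

lemma pd_add: "pd B ch i (\<lambda>p. f p + g p) q = pd B ch i f q + pd B ch i g q"
  using DERIV_add[OF pd_deriv[OF ch q f i] pd_deriv[OF ch q g i]]
  by (intro pd_eqI) (simp add: in_chart_def)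

lemma pd_mult: "pd B ch i (\<lambda>p. f p * g p) q = pd B ch i f q * g q + f q * pd B ch i g q"
proof (rule pd_eqI)
  have e: "ic ch (\<lambda>p. f p * g p) y = ic ch f y * ic ch g y" for y by (simp add: in_chart_def)
  show "((\<lambda>t. ic ch (\<lambda>p. f p * g p) ((cm ch q)(i := t))) has_field_derivative
      pd B ch i f q * g q + f q * pd B ch i g q) (at (cm ch q i))"
    unfolding e
    by (rule DERIV_cong[OF DERIV_mult[OF pd_deriv[OF ch q f i] pd_deriv[OF ch q g i]]])
      (simp add: ic_cm[OF ch q(1)])
qed

lemma pd_flat: "pd B ch i (\<lambda>p. flat k (f p)) q = flat (Suc k) (f q) * pd B ch i f q"
proof (rule pd_eqI)
  have e: "ic ch (\<lambda>p. flat k (f p)) y = flat k (ic ch f y)" for y by (simp add: in_chart_def)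
  show "((\<lambda>t. ic ch (\<lambda>p. flat k (f p)) ((cm ch q)(i := t))) has_field_derivative
      flat (Suc k) (f q) * pd B ch i f q) (at (cm ch q i))"
    unfolding e by (rule DERIV_chain2[OF _ pd_deriv[OF ch q f i]]) (simp add: flat_deriv ic_cm[OF ch q(1)])
qed

end

lemma pd_sum:
  assumes "ch \<in> atlas B" "q \<in> fst ch" "q \<in> W" "open W" "i < bdim B" "\<And>j. j \<in> J \<Longrightarrow> smooth_fun B W (f j)"
  shows "pd B ch i (\<lambda>p. \<Sum>j\<in>J. f j p) q = (\<Sum>j\<in>J. pd B ch i (f j) q)"
  using assms(6)
proof (induction J rule: infinite_finite_induct)
  case (insert j J)
  moreover from this have "smooth_fun B W (\<lambda>p. \<Sum>j\<in>J. f j p)" using assms(4) by (intro smooth_fun_sum) auto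
  ultimately show ?case using pd_add[OF assms(1-3,5), of "f j" "\<lambda>p. \<Sum>j\<in>J. f j p"] by simp
qed auto

lemma pd_prod_zero:
  assumes "ch \<in> atlas B" "q \<in> fst ch" "q \<in> W" "open W" "i < bdim B" "\<And>j. j \<in> J \<Longrightarrow> smooth_fun B W (f j)"
    "\<And>j. j \<in> J \<Longrightarrow> pd B ch i (f j) q = 0"
  shows "pd B ch i (\<lambda>p. \<Prod>j\<in>J. f j p) q = 0"
  using assms(6,7)
proof (induction J rule: infinite_finite_induct)
  case (insert j J)
  moreover from this have "smooth_fun B W (\<lambda>p. \<Prod>j\<in>J. f j p)" using assms(4) by (intro smooth_fun_prod) auto
  ultimately show ?case using pd_mult[OF assms(1-3,5), of "f j" "\<lambda>p. \<Prod>j\<in>J. f j p"] by simp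
qed auto

lemma pd_coord:
  assumes "ch \<in> atlas B" "q \<in> fst ch" "i < bdim B" "j < bdim B"
  shows "pd B ch i (snd ch j) q = (if i = j then 1 else 0)"
proof -
  have y: "cm ch q \<in> cm ch ` fst ch" using assms by blast
  have "partial i (ic ch (snd ch j)) (cm ch q) = partial i (\<lambda>y. y j) (cm ch q)"
  proof (rule partial_cong(1)[OF chartD(2)[OF assms(1)] y assms(3)])
    fix z assume "z \<in> cm ch ` fst ch"
    then show "ic ch (snd ch j) z = z j" using ic_cm[OF assms(1)] assms(4) by (auto simp: coord_map_def)
  qed
  also have "\<dots> = (if i = j then 1 else 0)" by (simp add: partial_def)
  finally show ?thesis by (simp add: pd_def)
qed

lemma pd_chain:
  assumes ch: "ch \<in> atlas B" and ch': "ch' \<in> atlas B" and q: "q \<in> fst ch" "q \<in> fst ch'" "q \<in> W" and W: "open W"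
    and f: "smooth_fun B W f" and i: "i < bdim B"
  shows "pd B ch' i f q = (\<Sum>j<bdim B. pd B ch' i (snd ch j) q * pd B ch j f q)"
proof -
  \<comment> \<open>The i-th coordinate line of \<open>ch'\<close> through \<open>q\<close>, seen in
    the chart \<open>ch\<close>. It is meaningful only near \<open>q\<close>, since
    \<open>icm\<close> has arbitrary values outside its domain.\<close>
  define g where "g t = cm ch (icm ch' ((cm ch' q)(i := t)))" for t
  let ?t = "cm ch' q i"
  have g0: "g ?t = cm ch q" by (simp add: g_def icm_cm[OF ch' q(2)])
  have W': "open (fst ch \<inter> W)" using W chartD(1)[OF ch] by blast
  have "((\<lambda>t. ic ch f (g t)) has_field_derivative
     (\<Sum>j<bdim B. partial j (ic ch f) (g ?t) * pd B ch' i (snd ch j) q)) (at ?t)"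
  proof (rule C1_chain[OF open_img[OF ch W]])
    show "Ck_on 1 (bdim B) (img ch W) (ic ch f)" using smooth_funD[OF f ch] by (simp add: smooth_on_def)
    show "g ?t \<in> img ch W" using g0 q by simp
    show "\<forall>\<^sub>F t in nhds ?t. g t \<in> Eucl (bdim B)" using cm_Eucl by (simp add: g_def)
    fix j assume j: "j < bdim B"
    have "(\<lambda>t. g t j) = (\<lambda>t. ic ch' (snd ch j) ((cm ch' q)(i := t)))"
      using j by (auto simp: g_def in_chart_def coord_map_def)
    then show "((\<lambda>t. g t j) has_field_derivative pd B ch' i (snd ch j) q) (at ?t)"
      using pd_deriv[OF ch' q(2,1) coord_smooth[OF ch j] i] by simp
  qed
  moreover have "\<forall>\<^sub>F t in nhds ?t. ic ch f (g t) = ic ch' f ((cm ch' q)(i := t))"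
  proof -
    have "cm ch' q \<in> img ch' (fst ch \<inter> W)" using q by blast
    from eventually_upd[OF open_img[OF ch' W'] this i] show ?thesis
    proof eventually_elim
      case (elim t)
      then obtain p where p: "p \<in> fst ch'" "p \<in> fst ch" "(cm ch' q)(i := t) = cm ch' p" by blast
      then show ?case by (simp add: g_def icm_cm[OF ch'] ic_cm[OF ch'] ic_cm[OF ch])
    qed
  qed
  then have "\<forall>\<^sub>F t in nhds ?t. ic ch' f ((cm ch' q)(i := t)) = ic ch f (g t)"
    by (rule eventually_mono) simp
  ultimately have "((\<lambda>t. ic ch' f ((cm ch' q)(i := t))) has_field_derivative
     (\<Sum>j<bdim B. partial j (ic ch f) (g ?t) * pd B ch' i (snd ch j) q)) (at ?t)"
    by (rule has_field_derivative_cong_ev)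
  from pd_eqI[OF this] show ?thesis by (simp add: g0 pd_def mult.commute)
qed

lemma smooth_fun_pd:
  assumes ch: "ch \<in> atlas B" and W: "open W" "W \<subseteq> fst ch" and f: "smooth_fun B W f" and i: "i < bdim B"
  shows "smooth_fun B W (pd B ch i f)"
proof (rule smooth_fun_from_chart[OF ch W])
  show "smooth_on (bdim B) (img ch W) (ic ch (pd B ch i f))"
    unfolding smooth_on_def
  proof
    fix k
    have "Ck_on (Suc k) (bdim B) (img ch W) (ic ch f)" using smooth_funD[OF f ch] unfolding smooth_on_def
        by blast
    then have "Ck_on k (bdim B) (img ch W) (partial i (ic ch f))" using i by (rule Ck_on_SucD(1))
    then show "Ck_on k (bdim B) (img ch W) (ic ch (pd B ch i f))"
    proof (rule Ck_on_cong[OF open_img[OF ch W(1)], rotated])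
      fix z assume "z \<in> img ch W"
      then obtain q where "q \<in> fst ch" "z = cm ch q" by blast
      then show "partial i (ic ch f) z = ic ch (pd B ch i f) z" by (simp add: ic_cm[OF ch] pd_def)
    qed
  qed
qed

text \<open>The function is a normalized product over the coordinates of \<open>flat 0\<close> at
  d^2 - (x^j - x^j(q))^2, extended by 0. Each argument has derivative 0 at \<open>q\<close>, so the
  product does too; multiplication by the bump then preserves the 1-jet of a function at
  \<open>q\<close>.\<close>

lemma bump:
  assumes ch: "ch \<in> atlas B" and q: "q \<in> fst ch" "q \<in> W" and W: "open W"
  obtains \<beta> C where "smooth_fun B UNIV \<beta>" "closed C" "C \<subseteq> fst ch \<inter> W" "\<And>p. p \<notin> C \<Longrightarrow> \<beta> p = 0"
    "\<beta> q = 1" "\<And>i. i < bdim B \<Longrightarrow> pd B ch i \<beta> q = 0"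
proof -
  let ?n = "bdim B" and ?y = "cm ch q"
  have oW: "open (fst ch \<inter> W)" using W chartD(1)[OF ch] by blast
  have "?y \<in> img ch W" using q by blast
  from openin_Eucl_box[OF open_img[OF ch W] this] obtain e where
    e: "e > 0" "\<And>z. (\<And>j. j < ?n \<Longrightarrow> \<bar>z j - ?y j\<bar> < e) \<Longrightarrow> z \<in> Eucl ?n \<Longrightarrow> z \<in> img ch W" by blast
  define d where "d = e / 2"
  have d: "0 < d" "d < e" using e(1) by (auto simp: d_def)
  \<comment> \<open>Half of \<open>e\<close> keeps the closed box inside the open one. The box is
    compact by Tychonoff, and so is its preimage, which is then closed because the manifold is
    Hausdorff; this is what permits extension by 0.\<close>
  define box where "box = (PiE UNIV (\<lambda>j. if j < ?n then {?y j - d..?y j + d} else {0}))"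
  have box: "z \<in> box \<longleftrightarrow> (\<forall>j<?n. \<bar>z j - ?y j\<bar> \<le> d) \<and> z \<in> Eucl ?n" for z
  proof
    assume z: "z \<in> box"
    have "z j \<in> (if j < ?n then {?y j - d..?y j + d} else {0})" for j using z by (simp add: box_def PiE_iff)
    from this show "(\<forall>j<?n. \<bar>z j - ?y j\<bar> \<le> d) \<and> z \<in> Eucl ?n"
      by (auto simp: abs_le_iff split: if_splits) (smt (verit, best) atLeastAtMost_iff not_less singletonD)+
  next
    assume "(\<forall>j<?n. \<bar>z j - ?y j\<bar> \<le> d) \<and> z \<in> Eucl ?n"
    then show "z \<in> box" by (auto simp: box_def PiE_iff abs_le_iff algebra_simps)
  qed
  have box_img: "box \<subseteq> img ch W"
  proof
    fix z assume "z \<in> box"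
    then show "z \<in> img ch W" using box d(2) by (intro e(2)) force+
  qed
  have "compactin (powertop_real UNIV) box"
    unfolding box_def compactin_PiE by auto
  then have "compact box" by (simp add: euclidean_product_topology)
  moreover have "continuous_on box (icm ch)"
    by (rule continuous_on_subset[of "cm ch ` fst ch"])
      (use chartD(3)[OF ch] box_img in \<open>auto simp: homeomorphism_def\<close>)
  ultimately have "compact (icm ch ` box)" using compact_continuous_image by blast
  define C where "C = icm ch ` box"
  have C: "closed C" using \<open>compact (icm ch ` box)\<close> compact_imp_closed C_def by blast
  have CW: "C \<subseteq> fst ch \<inter> W" using box_img icm_cm[OF ch] by (force simp: C_def)
  have Cin: "p \<in> C" if "p \<in> fst ch" "\<And>j. j < ?n \<Longrightarrow> \<bar>snd ch j p - ?y j\<bar> \<le> d" for p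
  proof -
    have "cm ch p \<in> box" unfolding box using that(2) by (auto simp: coord_map_def)
    then show ?thesis using icm_cm[OF ch that(1)] unfolding C_def by force
  qed
  define h where "h j p = d\<^sup>2 - (snd ch j p - ?y j) * (snd ch j p - ?y j)" for j p
  define b where "b p = (\<Prod>j<?n. flat 0 (h j p))" for p
  define b0 where "b0 p = (if p \<in> fst ch then b p / b q else 0)" for p
  have hs: "smooth_fun B (fst ch) (h j)" if "j < ?n" for j
    unfolding h_def using chartD(1)[OF ch] coord_smooth[OF ch that]
    by (intro smooth_fun_diff smooth_fun_mult) auto
  have bs: "smooth_fun B (fst ch) b"
    unfolding b_def using chartD(1)[OF ch] hs by (intro smooth_fun_prod smooth_fun_flat) auto
  have hq: "h j q = d\<^sup>2" if "j < ?n" for j using that by (simp add: h_def coord_map_def)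
  have "b q > 0" unfolding b_def using hq d(1) by (intro prod_pos) (auto intro: flat_pos)
  have bz: "b p = 0" if pf: "p \<in> fst ch" and pC: "p \<notin> C" for p
  proof -
    obtain j where j: "j < ?n" "\<bar>snd ch j p - ?y j\<bar> > d" using Cin[OF pf] pC by force
    then have "d * d \<le> \<bar>snd ch j p - ?y j\<bar> * \<bar>snd ch j p - ?y j\<bar>" using d(1) by (intro mult_mono) auto
    then have "h j p \<le> 0" by (simp add: h_def power2_eq_square)
    then have "flat 0 (h j p) = 0" by (rule flat_zero)
    then show ?thesis unfolding b_def using j(1) by auto
  qed
  have b0s: "smooth_fun B (fst ch) b0"
    by (rule smooth_fun_cong[OF chartD(1)[OF ch] _
        smooth_fun_mult[OF chartD(1)[OF ch] bs smooth_fun_const[of _ "1 / b q"]]])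
      (simp add: b0_def)
  have b0z: "p \<notin> C \<Longrightarrow> b0 p = 0" for p using bz by (simp add: b0_def)
  \<comment> \<open>A point of \<open>C\<close> has the chart domain as a neighbourhood, where
    \<open>b0\<close> is smooth. Any other point has the complement of \<open>C\<close>, where
    \<open>b0\<close> is 0.\<close>
  have "smooth_fun B UNIV b0"
  proof (rule smooth_fun_local)
    fix p
    show "\<exists>W'. open W' \<and> p \<in> W' \<and> smooth_fun B (W' \<inter> UNIV) b0"
    proof (cases "p \<in> C")
      case True then show ?thesis using CW b0s chartD(1)[OF ch] by auto
    next
      case False
      have "smooth_fun B (- C) b0"
        by (rule smooth_fun_cong[of _ "\<lambda>_. 0"]) (use C b0z in auto)
      then show ?thesis using False C by (intro exI[of _ "- C"]) auto
    qed
  qed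
  moreover have "b0 q = 1" using \<open>b q > 0\<close> q by (simp add: b0_def)
  moreover have "pd B ch i b0 q = 0" if i: "i < ?n" for i
  proof -
    have "pd B ch i (h j) q = 0" if j: "j < ?n" for j
    proof -
      have s: "smooth_fun B (fst ch) (\<lambda>p. snd ch j p - ?y j)"
        using chartD(1)[OF ch] coord_smooth[OF ch j] by (intro smooth_fun_diff) auto
      have s2: "smooth_fun B (fst ch) (\<lambda>p. (- (snd ch j p - ?y j)) * (snd ch j p - ?y j))"
        using chartD(1)[OF ch] s by (intro smooth_fun_mult smooth_fun_uminus) auto
      have z: "snd ch j q - ?y j = 0" using j by (simp add: coord_map_def)
      have "pd B ch i (\<lambda>p. (- (snd ch j p - ?y j)) * (snd ch j p - ?y j)) q = 0"
        using pd_mult[OF ch q(1) q(1) i smooth_fun_uminus[OF chartD(1)[OF ch] s] s] z by simp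
      moreover have "h j = (\<lambda>p. d\<^sup>2 + (- (snd ch j p - ?y j)) * (snd ch j p - ?y j))"
        by (auto simp: h_def algebra_simps)
      ultimately show ?thesis using pd_add[OF ch q(1) q(1) i smooth_fun_const[of _ "d\<^sup>2"] s2] by simp
    qed
    then have "pd B ch i b q = 0"
      unfolding b_def
      using hs i chartD(1)[OF ch] q(1) pd_flat[OF ch q(1) q(1) i hs hs, of _ _ 0]
      by (intro pd_prod_zero[OF ch q(1) q(1) chartD(1)[OF ch] i] smooth_fun_flat) auto
    then have "pd B ch i (\<lambda>p. b p * (1 / b q)) q = 0"
      using pd_mult[OF ch q(1) q(1) i bs smooth_fun_const[of _ "1 / b q"]] by simp
    moreover have "pd B ch i b0 q = pd B ch i (\<lambda>p. b p * (1 / b q)) q"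
      by (rule pd_cong[OF ch q(1) q(1) chartD(1)[OF ch] i]) (simp add: b0_def)
    ultimately show ?thesis by simp
  qed
  ultimately show thesis using that[of b0 C] C CW b0z by blast
qed

end

section \<open>Frames and sections\<close>

lemma sum_double: "(\<Sum>a<2 * r. f a) = (\<Sum>a<r. f a) + (\<Sum>a<(r::nat). f (r + a))"
proof -
  have "(\<Sum>a<r + k. f a) = (\<Sum>a<r. f a) + (\<Sum>a<k. f (r + a))" for k
    by (induction k) (auto simp: add_ac)
  from this[of r] show ?thesis by (simp add: mult_2)
qed

lemma linear_from_sum:
  assumes "linear_from V f" "subspace V" "\<And>i. i \<in> I \<Longrightarrow> v i \<in> V"
  shows "f (\<Sum>i\<in>I. c i *\<^sub>R v i) = (\<Sum>i\<in>I. c i *\<^sub>R f (v i))"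
  using assms(3)
proof (induction I rule: infinite_finite_induct)
  have "f (0 *\<^sub>R 0) = 0 *\<^sub>R f 0" using assms(1,2) unfolding linear_from_def by (meson subspace_0)
  then have z: "f 0 = 0" by simp
  { case (infinite A) then show ?case by (simp add: z) next
    case empty then show ?case by (simp add: z) next
    case (insert i I)
    have "(\<Sum>i\<in>I. c i *\<^sub>R v i) \<in> V" "c i *\<^sub>R v i \<in> V"
      using insert.prems assms(2) by (auto intro!: subspace_sum subspace_scale)
    then have "f (c i *\<^sub>R v i + (\<Sum>i\<in>I. c i *\<^sub>R v i)) = f (c i *\<^sub>R v i) + f (\<Sum>i\<in>I. c i *\<^sub>R v i)"
      using assms(1) unfolding linear_from_def by blast
    moreover have "f (c i *\<^sub>R v i) = c i *\<^sub>R f (v i)"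
      using assms(1) insert.prems unfolding linear_from_def by blast
    ultimately show ?case using insert by simp }
qed

context vbun
begin

section \<open>Frames and components\<close>

lemma frameD:
  assumes "fr \<in> frames B"
  shows "open (fst fr)"
    and "q \<in> fst fr \<Longrightarrow> inj_on (\<lambda>\<alpha>. snd fr \<alpha> q) {..<brank B}"
    and "q \<in> fst fr \<Longrightarrow> independent ((\<lambda>\<alpha>. snd fr \<alpha> q) ` {..<brank B})"
    and "q \<in> fst fr \<Longrightarrow> span ((\<lambda>\<alpha>. snd fr \<alpha> q) ` {..<brank B}) = fibre B q"
  using vb assms unfolding vector_bundle_def by auto

lemma frames_cover: "\<exists>fr\<in>frames B. q \<in> fst fr"
  using vb unfolding vector_bundle_def by blast

lemma frame_change_smooth:
  "fr \<in> frames B \<Longrightarrow> fr' \<in> frames B \<Longrightarrow> \<alpha> < brank B \<Longrightarrow> \<beta> < brank B \<Longrightarrow>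
   smooth_fun B (fst fr \<inter> fst fr') (frame_change B fr fr' \<alpha> \<beta>)"
  using vb unfolding vector_bundle_def frame_change_def by blast

lemma patchD:
  assumes "c \<in> patches B"
  shows "fst c \<in> atlas B" "snd c \<in> frames B" "open (pdom c)" "q \<in> pdom c \<Longrightarrow> q \<in> fst (fst c)"
    "q \<in> pdom c \<Longrightarrow> q \<in> fst (snd c)" "pdom c \<subseteq> fst (fst c)"
  using assms chartD(1) frameD(1) by (auto simp: patches_def pdom_def)

lemma patches_cover: "\<exists>c\<in>patches B. q \<in> pdom c"
proof -
  obtain ch fr where "ch \<in> atlas B" "q \<in> fst ch" "fr \<in> frames B" "q \<in> fst fr"
    using atlas_cover frames_cover by metis
  then show ?thesis by (intro bexI[of _ "(ch, fr)"]) (auto simp: patches_def pdom_def)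
qed

lemma subspace_fibre: "subspace (fibre B q)"
proof -
  obtain fr where "fr \<in> frames B" "q \<in> fst fr" using frames_cover by blast
  from frameD(4)[OF this] show ?thesis by (metis subspace_span)
qed

lemma frame_in_fibre:
  assumes "fr \<in> frames B" "q \<in> fst fr" "\<alpha> < brank B"
  shows "snd fr \<alpha> q \<in> fibre B q"
  unfolding frameD(4)[OF assms(1,2), symmetric] using assms(3) by (intro span_base) auto

lemma dual_frame_linear:
  assumes "fr \<in> frames B" "q \<in> fst fr"
  shows "linear_from (fibre B q) (dual_frame B fr \<alpha> q)"
  unfolding linear_from_def dual_frame_def frameD(4)[OF assms, symmetric]
  using representation_add[OF frameD(3)[OF assms]] representation_scale[OF frameD(3)[OF assms]]
  by (simp add: fun_eq_iff)

lemma dual_frame_frame: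
  assumes "fr \<in> frames B" "q \<in> fst fr" "\<alpha> < brank B" "\<beta> < brank B"
  shows "dual_frame B fr \<alpha> q (snd fr \<beta> q) = (if \<alpha> = \<beta> then 1 else 0)"
proof -
  have "snd fr \<alpha> q = snd fr \<beta> q \<longleftrightarrow> \<alpha> = \<beta>" using frameD(2)[OF assms(1,2)] assms by (auto simp: inj_on_def)
  then show ?thesis unfolding dual_frame_def
    using assms by (subst representation_basis[OF frameD(3)[OF assms(1,2)]]) auto
qed

lemma dual_frame_expand:
  assumes "fr \<in> frames B" "q \<in> fst fr" "v \<in> fibre B q"
  shows "(\<Sum>\<alpha><brank B. dual_frame B fr \<alpha> q v *\<^sub>R snd fr \<alpha> q) = v"
proof -
  let ?E = "(\<lambda>\<alpha>. snd fr \<alpha> q) ` {..<brank B}"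
  have "(\<Sum>b\<in>?E. representation ?E v b *\<^sub>R b) = v"
    using assms frameD(3,4)[OF assms(1,2)] by (intro sum_representation_eq) auto
  then show ?thesis unfolding dual_frame_def
    by (subst (asm) sum.reindex[OF frameD(2)[OF assms(1,2)]]) simp
qed

lemma linear_expand:
  fixes f :: "'v \<Rightarrow> 'b::real_vector"
  assumes "fr \<in> frames B" "q \<in> fst fr" "v \<in> fibre B q" "linear_from (fibre B q) f"
  shows "f v = (\<Sum>\<alpha><brank B. dual_frame B fr \<alpha> q v *\<^sub>R f (snd fr \<alpha> q))"
  using linear_from_sum[OF assms(4) subspace_fibre, of "{..<brank B}" "\<lambda>\<alpha>. snd fr \<alpha> q"
      "\<lambda>\<alpha>. dual_frame B fr \<alpha> q v"]
    frame_in_fibre[OF assms(1,2)] dual_frame_expand[OF assms(1-3)] by simp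

text \<open>The components of a section of \<open>A \<oplus> A\<^sup>*\<close>: \<open>\<xi>\<^sub>\<alpha>\<close> for \<open>a = \<alpha>\<close> and \<open>X\<^sup>\<alpha>\<close> for \<open>a = r + \<alpha>\<close>.\<close>

definition ecomp :: "('m, 'v) frame \<Rightarrow> ('m, 'v) esec \<Rightarrow> nat \<Rightarrow> 'm \<Rightarrow> real" where
  "ecomp fr u a q = (if a < brank B then snd u q (snd fr a q) else dual_frame B fr (a - brank B) q (fst u q))"

lemma sec_el_zeta: "sec_el B u = on_patches B (\<lambda>c. \<Sum>a<2 * brank B. smul (ecomp (snd c) u a) (zeta a))"
  unfolding sec_el_def sum_double sum.distrib
proof (intro arg_cong[of _ _ "on_patches B"] ext)
  fix c :: "('m, 'v) patch" and m q
  have "ecomp (snd c) u \<alpha> q = snd u q (snd (snd c) \<alpha> q)"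
    "ecomp (snd c) u (brank B + \<alpha>) q = dual_frame B (snd c) \<alpha> q (fst u q)" if "\<alpha> < brank B" for \<alpha>
    using that by (simp_all add: ecomp_def)
  then show "((\<Sum>\<alpha><brank B. smul (\<lambda>q. dual_frame B (snd c) \<alpha> q (fst u q)) (mon_el ({brank B + \<alpha>}, {#}))) +
       (\<Sum>\<alpha><brank B. smul (\<lambda>q. snd u q (snd (snd c) \<alpha> q)) (mon_el ({\<alpha>}, {#})))) m q =
    ((\<Sum>a<brank B. smul (ecomp (snd c) u a) (zeta a)) +
     (\<Sum>a<brank B. smul (ecomp (snd c) u (brank B + a)) (zeta (brank B + a)))) m q"
    by (simp add: loc_sum_apply smul_apply zeta_def)
qed

lemma sum_zeta_apply:
  "(\<Sum>a<2 * brank B. smul (f a) (zeta a)) (S, K) q = (\<Sum>a<2 * brank B. if S = {a} \<and> K = {#} then f a q else 0)"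
  unfolding loc_sum_apply by (intro sum.cong) (auto simp: smul_apply zeta_def mon_el_def)

lemma sec_el_ecomp:
  "c \<in> patches B \<Longrightarrow> q \<in> pdom c \<Longrightarrow> a < 2 * brank B \<Longrightarrow> sec_el B u c ({a}, {#}) q = ecomp (snd c) u a q"
  by (simp add: sec_el_zeta on_patches_def sum_zeta_apply)

lemma sec_el_supp:
  assumes "sec_el B u c m q \<noteq> 0"
  shows "c \<in> patches B \<and> q \<in> pdom c \<and> (\<exists>a<2 * brank B. m = ({a}, {#}))"
proof -
  have c: "c \<in> patches B \<and> q \<in> pdom c" using assms unfolding sec_el_def on_patches_def by presburger
  obtain S K where m: "m = (S, K)" by (metis surj_pair)
  have "(\<Sum>a<2 * brank B. if S = {a} \<and> K = {#} then ecomp (snd c) u a q else 0) \<noteq> 0"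
    using assms c unfolding m by (simp add: sec_el_zeta on_patches_def sum_zeta_apply)
  then have "\<exists>a<2 * brank B. S = {a} \<and> K = {#}"
    by (rule contrapos_np) (auto intro!: sum.neutral)
  then show ?thesis using c m by auto
qed

lemma pfree_odd_change: "pfree 1 (odd_change B c c' a)"
  unfolding odd_change_def by (auto intro!: pfree_sum pfree_linear pfree_mon_el)

lemma smul_mon_el_apply: "smul f (mon_el m) m' q = (if m' = m then f q else 0)"
  by (simp add: smul_apply mon_el_def)

text \<open>The matrix of the change of odd coordinates is block diagonal, with the frame change on
  the \<tau> and its inverse transpose on the \<theta>.\<close>

lemma odd_change_apply:
  assumes "a < 2 * brank B" "b < 2 * brank B"
  shows "odd_change B c c' a ({b}, {#}) q =
    (if a < brank B then (if b < brank B then frame_change B (snd c) (snd c') a b q else 0)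
     else if b < brank B then 0 else frame_change B (snd c') (snd c) (b - brank B) (a - brank B) q)"
proof (cases "a < brank B")
  case True
  have "odd_change B c c' a ({b}, {#}) q =
      (\<Sum>\<beta><brank B. if \<beta> = b then frame_change B (snd c) (snd c') a b q else 0)"
    unfolding odd_change_def if_P[OF True] loc_sum_apply smul_mon_el_apply by (intro sum.cong) auto
  then show ?thesis using True by simp
next
  case False
  have "odd_change B c c' a ({b}, {#}) q =
      (\<Sum>\<beta><brank B. if b = brank B + \<beta> then frame_change B (snd c') (snd c) \<beta> (a - brank B) q else 0)"
    unfolding odd_change_def if_not_P[OF False] loc_sum_apply smul_mon_el_apply by (intro sum.cong) auto
  also have "\<dots> = (if b < brank B then 0 else frame_change B (snd c') (snd c) (b - brank B) (a - brank B) q)"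
  proof (cases "b < brank B")
    case False
    have "(\<Sum>\<beta><brank B. if b = brank B + \<beta> then frame_change B (snd c') (snd c) \<beta> (a - brank B) q else 0) =
      (\<Sum>\<beta><brank B. if \<beta> = b - brank B then frame_change B (snd c') (snd c) (b - brank B)
          (a - brank B) q else 0)"
      using False by (intro sum.cong) auto
    then show ?thesis using False assms by simp
  qed (auto intro!: sum.neutral)
  finally show ?thesis using False by simp
qed

lemma graded_trans:
  assumes "F \<in> graded B k" "c \<in> patches B" "c' \<in> patches B" "q \<in> pdom c" "q \<in> pdom c'"
  shows "F c m q = (\<Sum>m'\<in>monomials B k. F c' m' q * monomial_change B c c' m' m q)"
  using assms unfolding graded_def by blast

lemma sum_monomials1: "(\<Sum>m\<in>monomials B 1. f m) = (\<Sum>a<2 * brank B. f ({a}, {#}))"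
proof -
  have "monomials B 1 = (\<lambda>a. ({a}, {#})) ` {..<2 * brank B}"
    using monomials1[of _ B] by auto
  then show ?thesis by (simp add: sum.reindex inj_on_def)
qed

lemma monomial_change1: "a < 2 * brank B \<Longrightarrow> monomial_change B c c' ({a}, {#}) = odd_change B c c' a"
  using lmul_one(2)[OF pfree_finsupp[OF pfree_odd_change]] by (simp add: monomial_change_def)

text \<open>In other words, the combination of the odd coordinates with the components of
  \<open>u\<close> does not depend on the patch. Each of the two blocks is an expansion in the frame
  of the other patch.\<close>

lemma ecomp_trans:
  assumes u: "u \<in> sections_E B" and c: "c \<in> patches B" "c' \<in> patches B" "q \<in> pdom c" "q \<in> pdom c'"
      and b: "b < 2 * brank B"
  shows "ecomp (snd c) u b q = (\<Sum>a<2 * brank B. ecomp (snd c') u a q * odd_change B c c' a ({b}, {#}) q)"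
proof -
  note fr = patchD(2)[OF c(1)] patchD(5)[OF c(1,3)] and fr' = patchD(2)[OF c(2)] patchD(5)[OF c(2,4)]
  have X: "fst u q \<in> fibre B q" and xi: "snd u q \<in> dual_fibre B q"
    using u by (auto simp: sections_E_def sections_A_def sections_As_def)
  show ?thesis
  proof (cases "b < brank B")
    case True
    have "snd u q (snd (snd c) b q) =
        (\<Sum>\<alpha><brank B. dual_frame B (snd c') \<alpha> q (snd (snd c) b q) *\<^sub>R snd u q (snd (snd c') \<alpha> q))"
      using xi frame_in_fibre[OF fr True] by (intro linear_expand[OF fr']) (auto simp: dual_fibre_def)
    then show ?thesis unfolding sum_double using True b
      by (simp add: ecomp_def odd_change_apply frame_change_def mult.commute)
  next
    case False
    have "dual_frame B (snd c) (b - brank B) q (fst u q) =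
        (\<Sum>\<alpha><brank B. dual_frame B (snd c') \<alpha> q (fst u q) *\<^sub>R dual_frame B (snd c) (b - brank B) q
            (snd (snd c') \<alpha> q))"
      by (intro linear_expand[OF fr' X] dual_frame_linear fr)
    then show ?thesis unfolding sum_double using False b
      by (simp add: ecomp_def odd_change_apply frame_change_def mult.commute)
  qed
qed

lemma ecomp_smooth:
  "u \<in> sections_E B \<Longrightarrow> fr \<in> frames B \<Longrightarrow> a < 2 * brank B \<Longrightarrow> smooth_fun B (fst fr) (ecomp fr u a)"
  unfolding ecomp_def by (cases "a < brank B") (auto simp: sections_E_def sections_A_def sections_As_def)

lemma sec_el_smooth:
  assumes u: "u \<in> sections_E B" and c: "c \<in> patches B" and a: "a < 2 * brank B"
  shows "smooth_fun B (pdom c) (sec_el B u c ({a}, {#}))"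
proof (rule smooth_fun_cong[OF patchD(3)[OF c]])
  show "smooth_fun B (pdom c) (ecomp (snd c) u a)"
    by (rule smooth_fun_subset[OF ecomp_smooth[OF u patchD(2)[OF c] a]]) (auto simp: pdom_def)
qed (use sec_el_ecomp[OF c] a in simp)

lemma sec_el_graded: "u \<in> sections_E B \<Longrightarrow> sec_el B u \<in> graded B 1"
  unfolding graded_def
proof (intro CollectI conjI allI ballI impI)
  assume u: "u \<in> sections_E B"
  fix c m q
  show "c \<in> patches B" "q \<in> pdom c" "m \<in> monomials B 1" if "sec_el B u c m q \<noteq> 0"
    using sec_el_supp[OF that] unfolding monomials1 by auto
  fix c' assume c: "c \<in> patches B" "c' \<in> patches B"
  show "smooth_fun B (pdom c) (sec_el B u c m)" if "m \<in> monomials B 1"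
    using that sec_el_smooth[OF u c(1)] unfolding monomials1 by auto
  assume q: "q \<in> pdom c \<inter> pdom c'"
  show "sec_el B u c m q = (\<Sum>m'\<in>monomials B 1. sec_el B u c' m' q * monomial_change B c c' m' m q)"
  proof (cases "\<exists>b<2 * brank B. m = ({b}, {#})")
    case True
    then show ?thesis unfolding sum_monomials1 using ecomp_trans[OF u c] q
      by (auto simp: monomial_change1 sec_el_ecomp c)
  next
    case False
    have z: "odd_change B c c' a m q = 0" if a: "a < 2 * brank B" for a
    proof (cases "a < brank B")
      case True
      show ?thesis unfolding odd_change_def if_P[OF True] loc_sum_apply smul_mon_el_apply
        using \<open>\<not> (\<exists>b<2 * brank B. m = ({b}, {#}))\<close> by (intro sum.neutral) auto
    next
      case False
      show ?thesis unfolding odd_change_def if_not_P[OF False] loc_sum_apply smul_mon_el_apply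
        using \<open>\<not> (\<exists>b<2 * brank B. m = ({b}, {#}))\<close> by (intro sum.neutral) auto
    qed
    have "sec_el B u c m q = 0" using sec_el_supp[of u c m q] False by blast
    then show ?thesis unfolding sum_monomials1 by (simp add: monomial_change1 z)
  qed
qed

text \<open>The section is read off pointwise from the coefficients in a chosen patch. The
  transformation law makes the result independent of the choice, and smoothness in a frame is then
  checked locally in patches with that frame.\<close>

lemma graded1_section:
  assumes F: "F \<in> graded B 1"
  obtains u where "u \<in> sections_E B" "sec_el B u = F"
proof -
  \<comment> \<open>One patch chosen around every point, with no regularity in the choice.\<close>
  obtain pt where pt: "\<And>q. pt q \<in> patches B" "\<And>q. q \<in> pdom (pt q)" using patches_cover by metis
  note fr = patchD(2)[OF pt(1)] patchD(5)[OF pt]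
  define X where "X q = (\<Sum>\<alpha><brank B. F (pt q) ({brank B + \<alpha>}, {#}) q *\<^sub>R snd (snd (pt q)) \<alpha> q)" for q
  define \<xi> where "\<xi> q v = (if v \<in> fibre B q then
      \<Sum>\<alpha><brank B. F (pt q) ({\<alpha>}, {#}) q * dual_frame B (snd (pt q)) \<alpha> q v else 0)" for q v
  have X: "X q \<in> fibre B q" for q
    unfolding X_def by (intro subspace_sum subspace_scale subspace_fibre frame_in_fibre fr) auto
  have xi: "\<xi> q \<in> dual_fibre B q" for q
    using dual_frame_linear[OF fr[of q]] subspace_fibre[of q] unfolding dual_fibre_def linear_from_def \<xi>_def
    by (auto simp: subspace_add subspace_scale sum.distrib[symmetric] sum_distrib_left algebra_simps)
  have cF: "ecomp (snd c) (X, \<xi>) a q = F c ({a}, {#}) q" if c: "c \<in> patches B" "q \<in> pdom c"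
      and a: "a < 2 * brank B" for c q a
  proof -
    note frc = patchD(2)[OF c(1)] patchD(5)[OF c]
    have F': "F c ({a}, {#}) q = (\<Sum>b<2 * brank B. F (pt q) ({b}, {#}) q * odd_change B c (pt q) b ({a}, {#}) q)"
      using graded_trans[OF F c(1) pt(1) c(2) pt(2)]
          by (simp add: sum_monomials1 monomial_change1 flip: One_nat_def)
    show ?thesis
    proof (cases "a < brank B")
      case True
      then show ?thesis unfolding F' sum_double using a frame_in_fibre[OF frc True]
        by (simp add: ecomp_def \<xi>_def odd_change_apply frame_change_def)
    next
      case False
      have "dual_frame B (snd c) (a - brank B) q (X q) =
        (\<Sum>\<alpha><brank B. F (pt q) ({brank B + \<alpha>}, {#}) q *\<^sub>R dual_frame B (snd c) (a - brank B) q
            (snd (snd (pt q)) \<alpha> q))"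
        unfolding X_def by (intro linear_from_sum[OF dual_frame_linear[OF frc] subspace_fibre] frame_in_fibre
            fr) auto
      then show ?thesis unfolding F' sum_double using a False
        by (simp add: ecomp_def odd_change_apply frame_change_def)
    qed
  qed
  have sm: "smooth_fun B (fst fr) (ecomp fr (X, \<xi>) a)" if fr: "fr \<in> frames B" and a: "a < 2 * brank B" for fr a
  proof (rule smooth_fun_local)
    fix q assume "q \<in> fst fr"
    obtain ch where ch: "ch \<in> atlas B" "q \<in> fst ch" using atlas_cover by blast
    have c: "(ch, fr) \<in> patches B" using ch fr by (simp add: patches_def)
    have "smooth_fun B (pdom (ch, fr)) (F (ch, fr) ({a}, {#}))"
      using F c a monomials1[of "({a}, {#})" B] unfolding graded_def by blast
    then have "smooth_fun B (pdom (ch, fr)) (ecomp fr (X, \<xi>) a)"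
      by (rule smooth_fun_cong[OF patchD(3)[OF c], rotated]) (use cF[OF c _ a] in simp)
    then show "\<exists>W'. open W' \<and> q \<in> W' \<and> smooth_fun B (W' \<inter> fst fr) (ecomp fr (X, \<xi>) a)"
      using ch chartD(1)[OF ch(1)] by (auto simp: pdom_def)
  qed
  have "(X, \<xi>) \<in> sections_E B"
  proof -
    have "smooth_fun B (fst fr) (\<lambda>q. dual_frame B fr \<alpha> q (X q))" "smooth_fun B (fst fr) (\<lambda>q. \<xi> q (snd fr \<alpha> q))"
      if "fr \<in> frames B" "\<alpha> < brank B" for fr \<alpha>
      using sm[OF that(1), of "brank B + \<alpha>"] sm[OF that(1), of \<alpha>] that(2) by (simp_all add: ecomp_def[abs_def])
    then show ?thesis unfolding sections_E_def sections_A_def sections_As_def using X xi by simp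
  qed
  moreover have "sec_el B (X, \<xi>) = F"
  proof (intro ext)
    fix c m q
    show "sec_el B (X, \<xi>) c m q = F c m q"
    proof (cases "c \<in> patches B \<and> q \<in> pdom c \<and> m \<in> monomials B 1")
      case True
      then obtain a where "a < 2 * brank B" "m = ({a}, {#})" unfolding monomials1 by blast
      then show ?thesis using True cF by (simp add: sec_el_ecomp)
    next
      case False
      then have "F c m q = 0" using F unfolding graded_def by blast
      moreover have "sec_el B (X, \<xi>) c m q = 0" using sec_el_supp[of _ c m q] False unfolding monomials1
          by blast
      ultimately show ?thesis by simp
    qed
  qed
  ultimately show thesis using that by blast
qed

lemma sec_el_inj: "inj_on (sec_el B) (sections_E B)"
proof (rule inj_onI)
  fix u v assume u: "u \<in> sections_E B" and v: "v \<in> sections_E B" and eq: "sec_el B u = sec_el B v"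
  have "fst u q = fst v q \<and> snd u q = snd v q" for q
  proof -
    obtain c where c: "c \<in> patches B" "q \<in> pdom c" using patches_cover by blast
    note fr = patchD(2)[OF c(1)] patchD(5)[OF c]
    have cc: "ecomp (snd c) u a q = ecomp (snd c) v a q" if "a < 2 * brank B" for a
      using sec_el_ecomp[OF c that] eq by metis
    have X: "fst u q \<in> fibre B q" "fst v q \<in> fibre B q"
        and xi: "snd u q \<in> dual_fibre B q" "snd v q \<in> dual_fibre B q"
      using u v by (auto simp: sections_E_def sections_A_def sections_As_def)
    have "dual_frame B (snd c) \<alpha> q (fst u q) = dual_frame B (snd c) \<alpha> q (fst v q)" if "\<alpha> < brank B" for \<alpha>
      using cc[of "brank B + \<alpha>"] that by (simp add: ecomp_def)
    then have "fst u q = fst v q"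
      using dual_frame_expand[OF fr X(1)] dual_frame_expand[OF fr X(2)]
          by (metis (no_types, lifting) lessThan_iff sum.cong)
    moreover have "snd u q w = snd v q w" for w
    proof (cases "w \<in> fibre B q")
      case True
      have "snd u q (snd (snd c) \<alpha> q) = snd v q (snd (snd c) \<alpha> q)" if "\<alpha> < brank B" for \<alpha>
        using cc[of \<alpha>] that by (simp add: ecomp_def)
      then show ?thesis
        using linear_expand[OF fr True, of "snd u q"] linear_expand[OF fr True, of "snd v q"] xi
        by (simp add: dual_fibre_def)
    qed (use xi in \<open>auto simp: dual_fibre_def\<close>)
    ultimately show ?thesis by auto
  qed
  then show "u = v" by (simp add: prod_eq_iff fun_eq_iff)
qed

section \<open>Sections with a prescribed 1-jet at a point\<close>

lemma cutoff_smooth: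
  assumes b: "smooth_fun B UNIV b" and C: "closed C" "C \<subseteq> W" "\<And>p. p \<notin> C \<Longrightarrow> b p = 0"
    and W: "open W" "open V" and h: "smooth_fun B (W \<inter> V) h"
  shows "smooth_fun B V (\<lambda>p. if p \<in> W then b p * h p else 0)"
proof (rule smooth_fun_local)
  fix p assume p: "p \<in> V"
  show "\<exists>W'. open W' \<and> p \<in> W' \<and> smooth_fun B (W' \<inter> V) (\<lambda>p. if p \<in> W then b p * h p else 0)"
  proof (cases "p \<in> C")
    case True
    have "smooth_fun B (W \<inter> V) (\<lambda>p. if p \<in> W then b p * h p else 0)"
      by (rule smooth_fun_cong[OF _ _ smooth_fun_mult[OF _ smooth_fun_subset[OF b] h]]) (use W in auto)
    then show ?thesis using True C W by blast
  next
    case False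
    have "smooth_fun B (- C \<inter> V) (\<lambda>p. if p \<in> W then b p * h p else 0)"
      by (rule smooth_fun_cong[of _ "\<lambda>_. 0"]) (use C W in auto)
    then show ?thesis using False C by (intro exI[of _ "- C"]) auto
  qed
qed

text \<open>The section is \<open>b * g\<close> times the basis element with index \<open>a\<close>
  on the patch and 0 elsewhere. In any other frame its components are \<open>b * g\<close> times an
  entry of the frame change or 0, so \<open>cutoff_smooth\<close> applies.\<close>

lemma cutoff_section:
  assumes c: "c \<in> patches B" and b: "smooth_fun B UNIV b" and C: "closed C" "C \<subseteq> pdom c" "\<And>p. p \<notin> C \<Longrightarrow> b p = 0"
    and g: "smooth_fun B (pdom c) g" and a: "a < 2 * brank B"
  obtains u where "u \<in> sections_E B"
    "\<And>p e. p \<in> pdom c \<Longrightarrow> e < 2 * brank B \<Longrightarrow> sec_el B u c ({e}, {#}) p = (if e = a then b p * g p else 0)"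
proof -
  let ?fr = "snd c"
  note fr = patchD(2)[OF c] patchD(5)[OF c]
  define X where "X p = (if p \<in> pdom c \<and> \<not> a < brank B then (b p * g p) *\<^sub>R snd ?fr (a - brank B) p else 0)"
      for p
  define \<xi> where "\<xi> p v = (if p \<in> pdom c \<and> v \<in> fibre B p \<and>
      a < brank B then b p * g p * dual_frame B ?fr a p v else 0)" for p v
  have X: "X p \<in> fibre B p" for p
    unfolding X_def using a fr by (auto intro!: subspace_scale subspace_fibre frame_in_fibre subspace_0)
  have xi: "\<xi> p \<in> dual_fibre B p" for p
    using dual_frame_linear[OF fr, of p] subspace_fibre[of p] unfolding dual_fibre_def linear_from_def \<xi>_def
    by (auto simp: subspace_add subspace_scale algebra_simps)
  have cut: "smooth_fun B (fst fr') (\<lambda>p. if p \<in> pdom c then b p * (g p * h p) else 0)"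
    if "fr' \<in> frames B" "smooth_fun B (fst ?fr \<inter> fst fr') h" for fr' h
  proof (rule cutoff_smooth[OF b C])
    show "smooth_fun B (pdom c \<inter> fst fr') (\<lambda>p. g p * h p)"
      using that frameD(1)[OF that(1)] patchD(3)[OF c]
      by (intro smooth_fun_mult smooth_fun_subset[OF g] smooth_fun_subset[OF that(2)]) (auto simp: pdom_def)
  qed (use frameD(1)[OF that(1)] patchD(3)[OF c] in auto)
  have dz: "dual_frame B fr' \<alpha> p 0 = 0" if "fr' \<in> frames B" "p \<in> fst fr'" for fr' \<alpha> p
    using dual_frame_linear[OF that, of \<alpha>] subspace_0[OF subspace_fibre] unfolding linear_from_def
    by (metis mult_zero_left real_scaleR_def scale_zero_left)
  have "X \<in> sections_A B"
    unfolding sections_A_def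
  proof (intro CollectI conjI allI ballI impI X)
    fix fr' \<alpha> assume fr': "fr' \<in> frames B" and \<alpha>: "\<alpha> < brank B"
    show "smooth_fun B (fst fr') (\<lambda>p. dual_frame B fr' \<alpha> p (X p))"
    proof (cases "a < brank B")
      case True
      show ?thesis
        by (rule smooth_fun_cong[OF frameD(1)[OF fr'], of "\<lambda>_. 0"]) (use True in \<open>auto simp: X_def dz[OF fr']\<close>)
    next
      case False
      then have a': "a - brank B < brank B" using a by simp
      show ?thesis
      proof (rule smooth_fun_cong[OF frameD(1)[OF fr'] _ cut[OF fr' frame_change_smooth[OF fr(1) fr' \<alpha> a']]])
        fix p assume p: "p \<in> fst fr'"
        show "(if p \<in> pdom c then b p * (g p * frame_change B ?fr fr' \<alpha> (a - brank B) p) else 0) =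
            dual_frame B fr' \<alpha> p (X p)"
          using dual_frame_linear[OF fr' p, of \<alpha>] dz[OF fr' p] frame_in_fibre[OF fr(1) _ a', of p] fr False
          unfolding linear_from_def by (auto simp: X_def frame_change_def)
      qed
    qed
  qed
  moreover have "\<xi> \<in> sections_As B"
    unfolding sections_As_def
  proof (intro CollectI conjI allI ballI impI xi)
    fix fr' \<alpha> assume fr': "fr' \<in> frames B" and \<alpha>: "\<alpha> < brank B"
    show "smooth_fun B (fst fr') (\<lambda>p. \<xi> p (snd fr' \<alpha> p))"
    proof (cases "a < brank B")
      case False
      show ?thesis
        by (rule smooth_fun_cong[OF frameD(1)[OF fr'], of "\<lambda>_. 0"]) (use False in \<open>auto simp: \<xi>_def\<close>)
    next
      case True
      have s: "smooth_fun B (fst ?fr \<inter> fst fr') (frame_change B fr' ?fr a \<alpha>)"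
        using frame_change_smooth[OF fr' fr(1) True \<alpha>] by (simp add: Int_commute)
      show ?thesis
      proof (rule smooth_fun_cong[OF frameD(1)[OF fr'] _ cut[OF fr' s]])
        fix p assume p: "p \<in> fst fr'"
        show "(if p \<in> pdom c then b p * (g p * frame_change B fr' ?fr a \<alpha> p) else 0) = \<xi> p (snd fr' \<alpha> p)"
          using frame_in_fibre[OF fr' p \<alpha>] True by (simp add: \<xi>_def frame_change_def)
      qed
    qed
  qed
  ultimately have "(X, \<xi>) \<in> sections_E B" by (simp add: sections_E_def)
  moreover have "sec_el B (X, \<xi>) c ({e}, {#}) p = (if e = a then b p * g p else 0)"
    if p: "p \<in> pdom c" and e: "e < 2 * brank B" for p e
  proof -
    note frp = fr(1) fr(2)[OF p]
    show ?thesis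
    proof (cases "e < brank B")
      case True
      then show ?thesis using dual_frame_frame[OF frp _ True, of a] frame_in_fibre[OF frp True] p e
        by (auto simp: sec_el_ecomp[OF c p e] ecomp_def \<xi>_def)
    next
      case False
      have "\<not> a < brank B \<Longrightarrow> dual_frame B ?fr (e - brank B) p (X p) = (if e = a then b p * g p else 0)"
      proof -
        assume a': "\<not> a < brank B"
        then have "dual_frame B ?fr (e - brank B) p (X p) =
            (b p * g p) * dual_frame B ?fr (e - brank B) p (snd ?fr (a - brank B) p)"
          using dual_frame_linear[OF frp, of "e - brank B"] frame_in_fibre[OF frp, of "a - brank B"] a p
          unfolding linear_from_def by (simp add: X_def)
        also have "\<dots> = (if e = a then b p * g p else 0)"
          using a a' e False dual_frame_frame[OF frp, of "e - brank B" "a - brank B"] by auto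
        finally show ?thesis .
      qed
      moreover have "a < brank B \<Longrightarrow> dual_frame B ?fr (e - brank B) p (X p) = 0 \<and> e \<noteq> a"
        using False by (auto simp: X_def dz[OF frp])
      ultimately show ?thesis using False
        by (cases "a < brank B") (auto simp: sec_el_ecomp[OF c p e] ecomp_def)
    qed
  qed
  ultimately show thesis using that by blast
qed

text \<open>A bump function times a basis element: the value is that of the basis element, and the
  derivatives vanish with those of the bump. Such sections detect the odd derivatives of a
  function.\<close>

lemma jet_section0:
  assumes c: "c \<in> patches B" and q: "q \<in> pdom c" and a: "a < 2 * brank B"
  obtains u where "u \<in> sections_E B"
    "\<And>e. e < 2 * brank B \<Longrightarrow> sec_el B u c ({e}, {#}) q = (if e = a then 1 else 0)"
    "\<And>e i. e < 2 * brank B \<Longrightarrow> i < bdim B \<Longrightarrow> pd B (fst c) i (sec_el B u c ({e}, {#})) q = 0"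
proof -
  note ch = patchD(1)[OF c] patchD(4)[OF c q]
  obtain b C where b: "smooth_fun B UNIV b" "closed C" "C \<subseteq> fst (fst c) \<inter> pdom c" "\<And>p. p \<notin> C \<Longrightarrow> b p = 0"
    "b q = 1" "\<And>i. i < bdim B \<Longrightarrow> pd B (fst c) i b q = 0"
    using bump[OF ch q patchD(3)[OF c]] by blast
  obtain u where u: "u \<in> sections_E B"
    "\<And>p e. p \<in> pdom c \<Longrightarrow> e < 2 * brank B \<Longrightarrow> sec_el B u c ({e}, {#}) p = (if e = a then b p * 1 else 0)"
    using cutoff_section[OF c b(1,2) _ b(4) smooth_fun_const[of "pdom c" 1] a] b(3) by blast
  have "pd B (fst c) i (sec_el B u c ({e}, {#})) q = 0" if e: "e < 2 * brank B" and i: "i < bdim B" for e i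
  proof -
    have "pd B (fst c) i (sec_el B u c ({e}, {#})) q = pd B (fst c) i (if e = a then b else (\<lambda>_. 0)) q"
      by (rule pd_cong[OF ch q patchD(3)[OF c] i]) (use u(2) e in auto)
    then show ?thesis using b(6)[OF i] by simp
  qed
  then show thesis using that u q b(5) by auto
qed

text \<open>Here the bump function is multiplied by x^j - x^j(q). Such sections detect the
  derivatives with respect to the momenta.\<close>

lemma jet_section1:
  assumes c: "c \<in> patches B" and q: "q \<in> pdom c" and a: "a < 2 * brank B" and j: "j < bdim B"
  obtains u where "u \<in> sections_E B"
    "\<And>e. e < 2 * brank B \<Longrightarrow> sec_el B u c ({e}, {#}) q = 0"
    "\<And>e i. e < 2 * brank B \<Longrightarrow> i < bdim B \<Longrightarrow>
       pd B (fst c) i (sec_el B u c ({e}, {#})) q = (if e = a \<and> i = j then 1 else 0)"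
proof -
  note ch = patchD(1)[OF c] patchD(4)[OF c q]
  obtain b C where b: "smooth_fun B UNIV b" "closed C" "C \<subseteq> fst (fst c) \<inter> pdom c" "\<And>p. p \<notin> C \<Longrightarrow> b p = 0"
    "b q = 1" "\<And>i. i < bdim B \<Longrightarrow> pd B (fst c) i b q = 0"
    using bump[OF ch q patchD(3)[OF c]] by blast
  define g where "g p = snd (fst c) j p + (- snd (fst c) j q)" for p
  have cs: "smooth_fun B (pdom c) (snd (fst c) j)"
    by (rule smooth_fun_subset[OF coord_smooth[OF ch(1) j] patchD(6)[OF c]])
  have g: "smooth_fun B (pdom c) g"
    unfolding g_def by (intro smooth_fun_add[OF patchD(3)[OF c] cs]) simp
  obtain u where u: "u \<in> sections_E B"
    "\<And>p e. p \<in> pdom c \<Longrightarrow> e < 2 * brank B \<Longrightarrow> sec_el B u c ({e}, {#}) p = (if e = a then b p * g p else 0)"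
    using cutoff_section[OF c b(1,2) _ b(4) g a] b(3) by blast
  have "pd B (fst c) i (sec_el B u c ({e}, {#})) q = (if e = a \<and> i = j then 1 else 0)"
    if e: "e < 2 * brank B" and i: "i < bdim B" for e i
  proof -
    have "pd B (fst c) i (sec_el B u c ({e}, {#})) q =
        pd B (fst c) i (if e = a then (\<lambda>p. b p * g p) else (\<lambda>_. 0)) q"
      by (rule pd_cong[OF ch q patchD(3)[OF c] i]) (use u(2) e in auto)
    moreover have "pd B (fst c) i (\<lambda>p. b p * g p) q = pd B (fst c) i g q"
      using pd_mult[OF ch q i smooth_fun_subset[OF b(1)] g] b(5) b(6)[OF i] by simp
    moreover have "pd B (fst c) i g q = (if i = j then 1 else 0)"
      unfolding g_def pd_add[OF ch q i cs smooth_fun_const] using pd_coord[OF ch i j] by simp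
    ultimately show ?thesis by (cases "e = a"; cases "i = j") auto
  qed
  then show thesis using that u q by (auto simp: g_def)
qed

end

section \<open>Gradings and brackets of homogeneous functions\<close>

definition supp :: "(mon \<Rightarrow> bool) \<Rightarrow> 'm loc \<Rightarrow> bool" where
  "supp P F \<longleftrightarrow> (\<forall>m q. F m q \<noteq> 0 \<longrightarrow> P m)"

lemma suppD: "supp P F \<Longrightarrow> F m q \<noteq> 0 \<Longrightarrow> P m"
  unfolding supp_def by blast

lemma suppI: "(\<And>S K q. F (S, K) q \<noteq> 0 \<Longrightarrow> P (S, K)) \<Longrightarrow> supp P F"
  unfolding supp_def by auto

lemma supp_mono: "supp P F \<Longrightarrow> (\<And>m. P m \<Longrightarrow> Q m) \<Longrightarrow> supp Q F"
  unfolding supp_def by blast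

lemma supp_zero [simp]: "supp P 0"
  by (simp add: supp_def)

lemma supp_combine:
  assumes "supp P F" "supp P G" "\<And>m q. F m q = 0 \<Longrightarrow> G m q = 0 \<Longrightarrow> H m q = 0"
  shows "supp P H"
proof (rule suppI)
  fix S K q assume "H (S, K) q \<noteq> 0"
  then have "F (S, K) q \<noteq> 0 \<or> G (S, K) q \<noteq> 0" using assms(3)[of "(S, K)" q] by auto
  then show "P (S, K)" using suppD[OF assms(1)] suppD[OF assms(2)] by auto
qed

lemma supp_add: "supp P F \<Longrightarrow> supp P G \<Longrightarrow> supp P (F + G)"
  by (erule supp_combine) auto

lemma supp_diff: "supp P F \<Longrightarrow> supp P G \<Longrightarrow> supp P (F - G)"
  by (erule supp_combine) auto

lemma supp_sum: "(\<And>i. i \<in> I \<Longrightarrow> supp P (F i)) \<Longrightarrow> supp P (\<Sum>i\<in>I. F i)"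
  by (induction I rule: infinite_finite_induct) (simp_all add: supp_add del: plus_fun_apply zero_fun_apply)

lemma supp_smul: "supp P F \<Longrightarrow> supp P (smul f F)"
  by (rule supp_combine[of P F F]) (auto simp: smul_apply)

lemma lmul_nonzero:
  assumes "lmul F G (S, K) q \<noteq> 0"
  obtains A L where "finite S" "A \<subseteq> S" "L \<subseteq># K" "F (A, L) q \<noteq> 0" "G (S - A, K - L) q \<noteq> 0"
proof -
  have fin: "finite S" using assms lmul_infinite[of S F G K q] by auto
  have "\<exists>A\<in>Pow S. \<exists>L\<in>{L. L \<subseteq># K}. ksign A (S - A) * F (A, L) q * G (S - A, K - L) q \<noteq> 0"
    using assms unfolding lmul_apply by (rule contrapos_np) (auto intro!: sum.neutral)
  then show thesis using that fin by auto
qed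

lemma supp_lmul:
  assumes "supp P F" "supp Q G"
    and "\<And>S K A L. finite S \<Longrightarrow> A \<subseteq> S \<Longrightarrow> L \<subseteq># K \<Longrightarrow> P (A, L) \<Longrightarrow> Q (S - A, K - L) \<Longrightarrow> R (S, K)"
  shows "supp R (lmul F G)"
proof (rule suppI)
  fix S K q assume "lmul F G (S, K) q \<noteq> 0"
  then obtain A L where *: "finite S" "A \<subseteq> S" "L \<subseteq># K" "F (A, L) q \<noteq> 0" "G (S - A, K - L) q \<noteq> 0"
    by (rule lmul_nonzero)
  show "R (S, K)" by (rule assms(3)[OF *(1-3) suppD[OF assms(1) *(4)] suppD[OF assms(2) *(5)]])
qed

text \<open>A grading gives \<open>\<zeta>\<^sub>a\<close> the weight \<open>x a\<close> and every \<open>p\<^sub>i\<close> the weight \<open>y\<close>. The degree is the case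
  \<open>x a = 1\<close>, \<open>y = 2\<close>; counting the \<open>\<theta>\<close> and \<open>p\<close> gives the second degree used to separate \<open>\<mu>\<close> and \<open>\<gamma>\<close>.
  The extra argument \<open>c\<close> records by how much an operator lowers the weight.\<close>

definition weighted :: "('m, 'v) vbundle \<Rightarrow> (nat \<Rightarrow> nat) \<Rightarrow> nat \<Rightarrow> nat \<Rightarrow> nat \<Rightarrow> mon \<Rightarrow> bool" where
  "weighted B x y c w m \<longleftrightarrow> fst m \<subseteq> {..<2 * brank B} \<and> set_mset (snd m) \<subseteq> {..<bdim B} \<and>
     sum x (fst m) + y * size (snd m) + c = w"

lemma weighted_finite: "weighted B x y c w m \<Longrightarrow> finite (fst m)"
  unfolding weighted_def by (auto intro: finite_subset[of _ "{..<2 * brank B}"])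

lemma monomials_weighted: "m \<in> monomials B k \<longleftrightarrow> weighted B (\<lambda>_. 1) 2 0 k m"
  by (cases m) (auto simp: monomials_def weighted_def)

lemma supp_weighted_lmul:
  assumes "supp (weighted B x y c1 w1) F" "supp (weighted B x y c2 w2) G"
  shows "supp (weighted B x y (c1 + c2) (w1 + w2)) (lmul F G)"
proof (rule supp_lmul[OF assms])
  fix S :: "nat set" and K A L
  assume fin: "finite S" and sub: "A \<subseteq> S" "L \<subseteq># K" and P: "weighted B x y c1 w1 (A, L)"
      and Q: "weighted B x y c2 w2 (S - A, K - L)"
  have "sum x S = sum x (S - A) + sum x A" using sub(1) fin by (rule sum.subset_diff)
  moreover have "L + (K - L) = K" using sub by simp
  from arg_cong[OF this, of size] arg_cong[OF this, of set_mset]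
  have "size K = size L + size (K - L)" "set_mset K = set_mset L \<union> set_mset (K - L)"
    by (simp_all only: size_union set_mset_union)
  moreover have "S \<subseteq> A \<union> (S - A)" by auto
  ultimately show "weighted B x y (c1 + c2) (w1 + w2) (S, K)"
    using P Q unfolding weighted_def by (auto simp: distrib_left)
qed

lemma supp_weighted_insert:
  assumes "supp (weighted B x y 0 w) F" "F (insert a S, K) q \<noteq> 0" "a \<notin> S"
  shows "weighted B x y (x a) w (S, K)"
proof -
  from suppD[OF assms(1,2)] have "weighted B x y 0 w (insert a S, K)" .
  moreover from weighted_finite[OF this] have "finite S" by simp
  ultimately show ?thesis using assms(3) by (auto simp: weighted_def)
qed

lemma supp_weighted_d_left: "supp (weighted B x y 0 w) F \<Longrightarrow> supp (weighted B x y (x a) w) (d_left a F)"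
  by (rule suppI) (auto simp: d_left_apply split: if_splits intro: supp_weighted_insert)

lemma supp_weighted_d_right: "supp (weighted B x y 0 w) F \<Longrightarrow> supp (weighted B x y (x a) w) (d_right a F)"
  by (rule suppI) (auto simp: d_right_def split: if_splits intro: supp_weighted_insert)

lemma supp_weighted_d_p:
  assumes "supp (weighted B x y 0 w) F"
  shows "supp (weighted B x y y w) (d_p i F)"
proof (rule suppI)
  fix S K q assume "d_p i F (S, K) q \<noteq> 0"
  then have "F (S, add_mset i K) q \<noteq> 0" by (auto simp: d_p_apply)
  from suppD[OF assms this] show "weighted B x y y w (S, K)" by (auto simp: weighted_def)
qed

text \<open>Freezing the coefficients at a point turns identities of local functions at that point into
  identities of the constant-coefficient algebra.\<close>

definition freeze :: "'m \<Rightarrow> 'm loc \<Rightarrow> 'm loc" where "freeze q F = (\<lambda>m _. F m q)"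

lemma freeze_apply: "freeze q F m p = F m q"
  by (simp add: freeze_def)

lemma freeze_linear: "freeze q (F + G) = freeze q F + freeze q G" "freeze q (F - G) = freeze q F - freeze q G"
  "freeze q (smul f F) = smul (\<lambda>_. f q) (freeze q F)"
  by (rule loc_eqI, simp add: freeze_apply smul_apply)+

lemma freeze_sum: "freeze q (\<Sum>i\<in>I. F i) = (\<Sum>i\<in>I. freeze q (F i))"
  by (rule loc_eqI) (simp add: freeze_apply loc_sum_apply)

lemma freeze_lmul: "freeze q (lmul F G) = lmul (freeze q F) (freeze q G)"
  by (rule loc_eqI) (simp add: freeze_apply lmul_apply)

lemma freeze_d_left: "freeze q (d_left a F) = d_left a (freeze q F)"
  by (rule loc_eqI) (simp add: freeze_apply d_left_apply)

lemma freeze_d_p: "freeze q (d_p a F) = d_p a (freeze q F)"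
  by (rule loc_eqI) (simp add: freeze_apply d_p_apply)

lemma freeze_mon_el [simp]: "freeze q (mon_el m) = mon_el m"
  by (rule loc_eqI) (simp add: freeze_apply mon_el_def)

lemma freeze_Lop: "freeze q (Lop B u U G) = Lop B (\<lambda>a _. u a q) (\<lambda>i. freeze q (U i)) (freeze q G)"
  by (simp add: Lop_def freeze_linear freeze_sum freeze_lmul freeze_d_left freeze_d_p del: plus_fun_apply)

lemma freeze_Dop: "freeze q (Dop B N Nx G) = Dop B (freeze q N) (\<lambda>i. freeze q (Nx i)) (freeze q G)"
  by (simp add: Dop_def freeze_linear freeze_sum freeze_lmul freeze_d_left freeze_d_p del: minus_apply)

lemma pfree_freeze: "pfree k F \<Longrightarrow> pfree k (freeze q F)"
  by (rule pfreeI) (auto simp: freeze_apply dest: pfreeD)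

lemma finsupp_freeze: "finsupp F \<Longrightarrow> finsupp (freeze q F)"
  by (simp add: finsupp_def freeze_apply)

lemma freeze_foldr: "freeze q (foldr lmul Xs Y) = foldr lmul (map (freeze q) Xs) (freeze q Y)"
  by (induction Xs) (simp_all add: freeze_lmul)

lemma freeze_word: "freeze q (word_el oc pc m) = word_el (\<lambda>a. freeze q (oc a)) (\<lambda>i. freeze q (pc i)) m"
  by (simp add: word_el_def freeze_foldr comp_def)

lemma pfree1_eqI:
  assumes "pfree 1 F" "pfree 1 G" "\<And>b q. F ({b}, {#}) q = G ({b}, {#}) q"
  shows "F = G"
proof (rule loc_eqI)
  fix S K q
  show "F (S, K) q = G (S, K) q"
  proof (cases "\<exists>b. S = {b} \<and> K = {#}")
    case False
    then have "\<not> (finite S \<and> card S = 1 \<and> K = {#})" by (auto simp: card_1_singleton_iff)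
    then show ?thesis using assms by (simp add: pfree_zero)
  qed (use assms(3) in auto)
qed

lemma zeta_apply: "zeta a ({b}, {#}) q = (if b = a then 1 else 0)"
  by (auto simp: zeta_def mon_el_def)

lemma lmul_zero_at: "(\<And>m. F m q = 0) \<Longrightarrow> lmul F G m q = 0" "(\<And>m. G m q = 0) \<Longrightarrow> lmul F G m q = 0"
  by (cases m, simp add: lmul_apply)+

lemma par_homogeneous:
  assumes "supp (\<lambda>m. m \<in> monomials B k) F"
  shows "par F = smul (\<lambda>_. (-1) ^ k) F"
proof (rule loc_eqI)
  fix S K q
  show "par F (S, K) q = smul (\<lambda>_. (-1) ^ k) F (S, K) q"
  proof (cases "F (S, K) q = 0")
    case False
    from suppD[OF assms this] have "card S + 2 * size K = k" by (simp add: monomials_def)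
    then have "(-1 :: real) ^ k = (-1) ^ card S" by (auto simp: power_add power_mult)
    then show ?thesis by (simp add: par_apply smul_apply)
  qed (simp add: par_apply smul_apply)
qed

lemma supp_finsupp: "supp (\<lambda>m. m \<in> monomials B k) F \<Longrightarrow> finsupp F"
  unfolding finsupp_def
proof (intro allI impI)
  fix S :: "nat set" and K :: "nat multiset" and q
  assume F: "supp (\<lambda>m. m \<in> monomials B k) F" and "infinite S"
  then have "(S, K) \<notin> monomials B k" using weighted_finite[of B] by (auto simp: monomials_weighted)
  then show "F (S, K) q = 0" using suppD[OF F] by blast
qed

context vbun
begin

section \<open>The bracket of homogeneous functions\<close>

lemma d_x_zero: "(\<And>q. F m q = 0) \<Longrightarrow> d_x B ch i F m q = 0"
proof -
  assume "\<And>q. F m q = 0"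
  then have "F m = 0" by auto
  then show ?thesis by (simp add: d_x_def)
qed

lemma d_x_nonzero: "d_x B ch i F m q \<noteq> 0 \<Longrightarrow> \<exists>p. F m p \<noteq> 0"
  using d_x_zero[of F m ch i q] by auto

lemma supp_d_x:
  assumes "supp P F"
  shows "supp P (d_x B ch i F)"
proof (rule suppI)
  fix S K q assume "d_x B ch i F (S, K) q \<noteq> 0"
  then obtain p where "F (S, K) p \<noteq> 0" using d_x_nonzero by blast
  from suppD[OF assms this] show "P (S, K)" .
qed

lemma pfree_d_x:
  assumes "pfree k F"
  shows "pfree k (d_x B ch i F)"
proof (rule pfreeI)
  fix S K q assume "d_x B ch i F (S, K) q \<noteq> 0"
  then obtain p where "F (S, K) p \<noteq> 0" using d_x_nonzero by blast
  from pfreeD[OF this assms] show "finite S \<and> card S = k \<and> K = {#}" .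
qed

text \<open>The even part of the bracket removes one momentum of weight \<open>y\<close>, the odd
  part a pair of conjugate variables. The assumption on \<open>x\<close> says that both lower the
  weight by the same amount.\<close>

lemma supp_weighted_bracket:
  assumes x: "\<And>a. a < brank B \<Longrightarrow> x a + x (brank B + a) = y"
    and F: "supp (weighted B x y 0 w1) F" and G: "supp (weighted B x y 0 w2) G"
  shows "supp (weighted B x y y (w1 + w2)) (local_bracket B ch F G)"
  unfolding local_bracket_def
proof (intro supp_add supp_sum supp_diff)
  fix i
  show "supp (weighted B x y y (w1 + w2)) (lmul (d_x B ch i F) (d_p i G))"
    using supp_weighted_lmul[OF supp_d_x[OF F] supp_weighted_d_p[OF G]] by simp
  show "supp (weighted B x y y (w1 + w2)) (lmul (d_p i F) (d_x B ch i G))"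
    using supp_weighted_lmul[OF supp_weighted_d_p[OF F] supp_d_x[OF G]] by simp
next
  fix a assume "a \<in> {..<brank B}"
  then have xy: "x a + x (brank B + a) = y" "x (brank B + a) + x a = y" using x by (simp_all add: add.commute)
  show "supp (weighted B x y y (w1 + w2)) (lmul (d_right a F) (d_left (brank B + a) G))"
    using supp_weighted_lmul[OF supp_weighted_d_right[OF F, of a] supp_weighted_d_left[OF G, of "brank B + a"]]
        unfolding xy .
  show "supp (weighted B x y y (w1 + w2)) (lmul (d_right (brank B + a) F) (d_left a G))"
    using supp_weighted_lmul[OF supp_weighted_d_right[OF F, of "brank B + a"] supp_weighted_d_left[OF G, of a]]
        unfolding xy .
qed

lemma supp_bracket:
  assumes "supp (\<lambda>m. m \<in> monomials B k) F" "supp (\<lambda>m. m \<in> monomials B l) G" "k + l = j + 2"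
  shows "supp (\<lambda>m. m \<in> monomials B j) (local_bracket B ch F G)"
proof -
  have "supp (weighted B (\<lambda>_. 1) 2 2 (k + l)) (local_bracket B ch F G)"
    using assms(1,2) unfolding monomials_weighted by (intro supp_weighted_bracket) auto
  then show ?thesis unfolding monomials_weighted by (rule supp_mono) (use assms(3) in \<open>auto simp: weighted_def\<close>)
qed

lemma sum_odd: "(\<Sum>a<brank B. f a (brank B + a) + f (brank B + a) a) = (\<Sum>a<2 * brank B. f a (star B a))"
  unfolding sum_double by (simp add: sum.distrib star_def)

lemma local_bracket_star:
  "local_bracket B ch F G = (\<Sum>i<bdim B. lmul (d_x B ch i F) (d_p i G) - lmul (d_p i F) (d_x B ch i G)) +
     (\<Sum>a<2 * brank B. lmul (d_right a F) (d_left (star B a) G))"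
  unfolding local_bracket_def sum_odd[of "\<lambda>a b. lmul (d_right a F) (d_left b G)"] ..

text \<open>A section contains no momentum, so the terms with derivatives of \<open>G\<close> along
  the base drop out. This is what makes the bracket with a section algebraic in
  \<open>G\<close>.\<close>

lemma bracket_Lop:
  assumes s: "pfree 1 s" and G: "finsupp G"
  shows "local_bracket B ch s G = Lop B (\<lambda>a. s ({a}, {#})) (\<lambda>i. d_x B ch i s) G"
proof -
  have d: "lmul (d_right a s) H = smul (s ({a}, {#})) H" if "finsupp H" for a H
  proof -
    have p0: "pfree 0 (d_left a s)" using pfree_d_left[of 0 s a] s by simp
    have "d_right a s = d_left a s"
      using d_right_eq[OF pfree_finsupp[OF s]] par_pfree[OF p0] by simp
    then have "lmul (d_right a s) H = smul (d_left a s ({}, {#})) H" using lmul_pfree0[OF p0 that] by simp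
    moreover have "d_left a s ({}, {#}) = s ({a}, {#})" by (auto simp: d_left_apply)
    ultimately show ?thesis by simp
  qed
  show ?thesis unfolding local_bracket_star Lop_def
    using G by (simp add: d d_p_pfree[OF s] del: plus_fun_apply)
qed

lemma bracket_Lop_right:
  assumes s: "pfree 1 s" and G: "finsupp G" and par: "par G = G"
  shows "local_bracket B ch G s = - local_bracket B ch s G"
proof -
  have p0: "pfree 0 (d_left a s)" for a using pfree_d_left[of 0 s a] s by simp
  have d: "lmul (d_right a G) (d_left b s) = - smul (s ({b}, {#})) (d_left a G)" for a b
  proof -
    have "d_right a G = - d_left a G" using d_right_eq[OF G] par_d_left[OF G] par by simp
    moreover have "lmul (d_left a G) (d_left b s) = lmul (d_left b s) (d_left a G)"
      by (rule lmul_comm_even[symmetric], rule pfree_zero[OF p0]) auto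
    moreover have "d_left b s ({}, {#}) = s ({b}, {#})" by (auto simp: d_left_apply)
    ultimately show ?thesis using lmul_pfree0[OF p0[of b] finsupp_d_left[OF G, of a]]
        by (simp add: lmul_uminus_left)
  qed
  have e: "lmul (d_p i G) (d_x B ch i s) = lmul (d_x B ch i s) (d_p i G)" for i
  proof -
    have "par (d_p i G) = d_p i (par G)" by (rule loc_eqI) (simp add: par_apply d_p_apply)
    then show ?thesis using lmul_comm1[OF pfree_d_x[OF s], of ch i "d_p i G"] par by simp
  qed
  have "(\<Sum>a<2 * brank B. smul (s ({star B a}, {#})) (d_left a G)) =
      (\<Sum>a<2 * brank B. smul (s ({a}, {#})) (d_left (star B a) G))"
  proof -
    have "(\<Sum>a<2 * brank B. smul (s ({star B a}, {#})) (d_left a G)) =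
        (\<Sum>a<2 * brank B. smul (s ({star B (star B a)}, {#})) (d_left (star B a) G))"
      by (rule sum_star[symmetric])
    also have "\<dots> = (\<Sum>a<2 * brank B. smul (s ({a}, {#})) (d_left (star B a) G))" by (intro sum.cong) auto
    finally show ?thesis .
  qed
  then show ?thesis unfolding bracket_Lop[OF s G] unfolding local_bracket_star Lop_def
    by (simp add: d d_p_pfree[OF s] e sum_negf del: plus_fun_apply uminus_apply)
qed

lemma bracket_Dop:
  assumes N: "pfree 2 N"
  shows "local_bracket B ch N G = Dop B N (\<lambda>i. d_x B ch i N) G"
proof -
  have "d_right a N = - d_left a N" for a
  proof -
    have "pfree 1 (d_left a N)" using pfree_d_left[of 1 N a] N by (simp add: numeral_2_eq_2)
    then show ?thesis using d_right_eq[OF pfree_finsupp[OF N]] par_pfree_odd by metis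
  qed
  then show ?thesis unfolding local_bracket_star Dop_def
    by (simp add: d_p_pfree[OF N] lmul_uminus_left sum_negf del: plus_fun_apply minus_apply uminus_apply)
qed

lemma bracket_Dop_right:
  assumes N: "pfree 2 N" and H: "finsupp H" "par H = - H"
  shows "local_bracket B ch H N = - local_bracket B ch N H"
proof -
  have N1: "pfree 1 (d_left a N)" for a using pfree_d_left[of 1 N a] N by (simp add: numeral_2_eq_2)
  have e: "lmul (d_right a H) (d_left b N) = lmul (d_left b N) (d_left a H)" for a b
  proof -
    have "d_right a H = par (d_left a H)" by (rule d_right_eq[OF H(1)])
    then show ?thesis using lmul_comm1[OF N1, of b "d_left a H"] by simp
  qed
  have f: "lmul (d_p i H) (d_x B ch i N) = lmul (d_x B ch i N) (d_p i H)" for i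
    by (rule lmul_comm2[OF pfree_d_x[OF N], symmetric])
  have "(\<Sum>a<2 * brank B. lmul (d_left (star B a) N) (d_left a H)) =
      (\<Sum>a<2 * brank B. lmul (d_left a N) (d_left (star B a) H))"
  proof -
    have "(\<Sum>a<2 * brank B. lmul (d_left (star B a) N) (d_left a H)) =
        (\<Sum>a<2 * brank B. lmul (d_left (star B (star B a)) N) (d_left (star B a) H))"
      by (rule sum_star[symmetric])
    also have "\<dots> = (\<Sum>a<2 * brank B. lmul (d_left a N) (d_left (star B a) H))" by (intro sum.cong) auto
    finally show ?thesis .
  qed
  then show ?thesis unfolding bracket_Dop[OF N] unfolding local_bracket_star Dop_def
    by (simp add: e f d_p_pfree[OF N] sum_negf del: plus_fun_apply minus_apply uminus_apply)
qed

text \<open>Membership in \<open>\<A>^k\<close> is split into \<open>homog\<close>, which concerns each patch separately, and the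
  transformation law \<open>transforms\<close>.\<close>

definition homog :: "nat \<Rightarrow> ('m, 'v) gfun \<Rightarrow> bool" where
  "homog k F \<longleftrightarrow> (\<forall>c m q. F c m q \<noteq> 0 \<longrightarrow> c \<in> patches B \<and> m \<in> monomials B k \<and> q \<in> pdom c) \<and>
     (\<forall>c\<in>patches B. \<forall>m\<in>monomials B k. smooth_fun B (pdom c) (F c m))"

definition transforms :: "nat \<Rightarrow> ('m, 'v) gfun \<Rightarrow> ('m, 'v) patch \<Rightarrow> ('m, 'v) patch \<Rightarrow> 'm \<Rightarrow> bool" where
  "transforms k F c c' q \<longleftrightarrow> (\<forall>m. F c m q = (\<Sum>m'\<in>monomials B k. F c' m' q * monomial_change B c c' m' m q))"

lemma graded_iff: "F \<in> graded B k \<longleftrightarrow> homog k F \<and>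
    (\<forall>c\<in>patches B. \<forall>c'\<in>patches B. \<forall>q. q \<in> pdom c \<longrightarrow> q \<in> pdom c' \<longrightarrow> transforms k F c c' q)"
proof -
  have eq: "(\<forall>c\<in>patches B. \<forall>c'\<in>patches B. \<forall>m. \<forall>q\<in>pdom c \<inter> pdom c'. E c c' m q) \<longleftrightarrow>
      (\<forall>c\<in>patches B. \<forall>c'\<in>patches B. \<forall>q. q \<in> pdom c \<longrightarrow> q \<in> pdom c' \<longrightarrow> (\<forall>m. E c c' m q))" for E
    by blast
  show ?thesis unfolding graded_def homog_def transforms_def mem_Collect_eq eq conj_assoc ..
qed

lemma homog_supp: "homog k F \<Longrightarrow> supp (\<lambda>m. m \<in> monomials B k) (F c)"
  unfolding homog_def supp_def by blast

lemma homog_outside: "homog k F \<Longrightarrow> \<not> (c \<in> patches B \<and> q \<in> pdom c) \<Longrightarrow> F c m q = 0"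
  unfolding homog_def by blast

lemma homog_smooth: "homog k F \<Longrightarrow> c \<in> patches B \<Longrightarrow> smooth_fun B (pdom c) (F c m)"
proof (cases "m \<in> monomials B k")
  case False
  assume "homog k F" "c \<in> patches B"
  then have "F c m = (\<lambda>_. 0)" using False unfolding homog_def by blast
  then show ?thesis by simp
qed (simp add: homog_def)

text \<open>Every term has a factor that is not differentiated along the base, and this factor
  vanishes at \<open>q\<close>. The other factor need not vanish there, since \<open>d_x\<close> can
  take a meaningless value outside the patch.\<close>

lemma local_bracket_outside:
  assumes "\<And>m. F m q = 0" "\<And>m. G m q = 0"
  shows "local_bracket B ch F G m q = 0"
proof -
  have "d_p i F m q = 0" "d_p i G m q = 0" "d_left a G m q = 0" for i a m
    using assms by (cases m, simp add: d_p_apply d_left_apply)+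
  then show ?thesis
    by (simp add: local_bracket_def loc_sum_apply lmul_zero_at)
qed

lemma smooth_lmul:
  assumes "open W" "\<And>m. smooth_fun B W (F m)" "\<And>m. smooth_fun B W (G m)"
  shows "smooth_fun B W (lmul F G m)"
proof -
  obtain S K where m: "m = (S, K)" by (metis surj_pair)
  have "lmul F G m = (\<lambda>q. \<Sum>A\<in>Pow S. \<Sum>L\<in>{L. L \<subseteq># K}. ksign A (S - A) * F (A, L) q * G (S - A, K - L) q)"
    by (auto simp: m lmul_apply)
  then show ?thesis using assms by (auto intro!: smooth_fun_sum smooth_fun_mult)
qed

lemma smooth_local_bracket:
  assumes c: "c \<in> patches B" and F: "\<And>m. smooth_fun B (pdom c) (F m)" and G: "\<And>m. smooth_fun B (pdom c) (G m)"
  shows "smooth_fun B (pdom c) (local_bracket B (fst c) F G m)"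
proof -
  have o: "open (pdom c)" by (rule patchD(3)[OF c])
  have p: "smooth_fun B (pdom c) (d_p i H m)" if "\<And>m. smooth_fun B (pdom c) (H m)" for i H m
  proof -
    obtain S K where m: "m = (S, K)" by (metis surj_pair)
    have "d_p i H m = (\<lambda>q. real (count K i + 1) * H (S, add_mset i K) q)" by (auto simp: m d_p_apply)
    then show ?thesis using that o by (auto intro!: smooth_fun_mult)
  qed
  have l: "smooth_fun B (pdom c) (d_left a G m)" for a m
  proof -
    obtain S K where m: "m = (S, K)" by (metis surj_pair)
    show ?thesis unfolding m d_left_def using G o by (cases "a \<in> S") (auto intro!: smooth_fun_mult)
  qed
  have r: "smooth_fun B (pdom c) (d_right a F m)" for a m
  proof -
    obtain S K where m: "m = (S, K)" by (metis surj_pair)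
    show ?thesis unfolding m d_right_def using F o by (cases "a \<in> S") (auto intro!: smooth_fun_mult)
  qed
  have x: "smooth_fun B (pdom c) (d_x B (fst c) i H m)" if "\<And>m. smooth_fun B (pdom c) (H m)" "i < bdim B"
      for i H m
    unfolding d_x_def using smooth_fun_pd[OF patchD(1)[OF c] o patchD(6)[OF c] that(1,2)] .
  have "local_bracket B (fst c) F G m = (\<lambda>q. (\<Sum>i<bdim B. lmul (d_x B (fst c) i F) (d_p i G) m q -
      lmul (d_p i F) (d_x B (fst c) i G) m q) +
     (\<Sum>a<2 * brank B. lmul (d_right a F) (d_left (star B a) G) m q))"
    by (auto simp: local_bracket_star loc_sum_apply)
  then show ?thesis using F G
    by (auto intro!: smooth_fun_add smooth_fun_diff smooth_fun_sum smooth_lmul o p l r x)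
qed

lemma homog_bracket:
  assumes F: "homog k F" and G: "homog l G" and kl: "k + l = j + 2"
  shows "homog j \<lbrace>F, G\<rbrace>"
  unfolding homog_def big_bracket_def
proof (intro conjI allI ballI impI)
  fix c m q assume nz: "local_bracket B (fst c) (F c) (G c) m q \<noteq> 0"
  show "m \<in> monomials B j" by (rule suppD[OF supp_bracket[OF homog_supp[OF F] homog_supp[OF G] kl] nz])
  have "c \<in> patches B \<and> q \<in> pdom c"
  proof (rule ccontr)
    assume "\<not> (c \<in> patches B \<and> q \<in> pdom c)"
    then have "local_bracket B (fst c) (F c) (G c) m q = 0"
      using homog_outside[OF F] homog_outside[OF G] by (intro local_bracket_outside) auto
    then show False using nz by simp
  qed
  then show "c \<in> patches B" "q \<in> pdom c" by auto
next
  fix c m assume "c \<in> patches B"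
  then show "smooth_fun B (pdom c) (local_bracket B (fst c) (F c) (G c) m)"
    by (intro smooth_local_bracket homog_smooth[OF F] homog_smooth[OF G])
qed

end

section \<open>Functions are determined by their brackets with sections\<close>

lemma supp_freeze: "supp P F \<Longrightarrow> supp P (freeze q F)"
  by (auto simp: supp_def freeze_apply)

lemma supp_monomials_lmul:
  assumes "supp (\<lambda>m. m \<in> monomials B i) F" "supp (\<lambda>m. m \<in> monomials B j) G"
  shows "supp (\<lambda>m. m \<in> monomials B (i + j)) (lmul F G)"
  using supp_weighted_lmul[of B "\<lambda>_. 1" 2 0 i F 0 j G] assms unfolding monomials_weighted by simp

lemma supp_word_el:
  assumes oc: "\<And>a. a < 2 * brank B \<Longrightarrow> supp (\<lambda>m. m \<in> monomials B 1) (oc a)"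
    and pc: "\<And>i. i < bdim B \<Longrightarrow> supp (\<lambda>m. m \<in> monomials B 2) (pc i)"
    and m: "m \<in> monomials B k"
  shows "supp (\<lambda>m. m \<in> monomials B k) (word_el oc pc m)"
proof -
  have one: "supp (\<lambda>m. m \<in> monomials B 0) one_el"
    by (auto simp: supp_def mon_el_def monomials_def split: if_splits)
  have p: "supp (\<lambda>m. m \<in> monomials B (2 * length ys)) (foldr lmul (map pc ys) one_el)"
    if "set ys \<subseteq> {..<bdim B}" for ys
    using that
  proof (induction ys)
    case (Cons y ys)
    then show ?case using supp_monomials_lmul[OF pc[of y] Cons.IH] by simp
  qed (use one in simp)
  have w: "supp (\<lambda>m. m \<in> monomials B (length xs + 2 * length ys)) (foldr lmul (map oc xs @ map pc ys) one_el)"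
    if "set xs \<subseteq> {..<2 * brank B}" "set ys \<subseteq> {..<bdim B}" for xs ys
    using that(1)
  proof (induction xs)
    case (Cons x xs)
    then show ?case using supp_monomials_lmul[OF oc[of x] Cons.IH] by simp
  qed (use p[OF that(2)] in simp)
  obtain S K where SK: "m = (S, K)" by (metis surj_pair)
  then have S: "S \<subseteq> {..<2 * brank B}" "set_mset K \<subseteq> {..<bdim B}" "card S + 2 * size K = k"
    using m by (auto simp: monomials_def)
  have fin: "finite S" using S(1) finite_subset by blast
  have "length (sorted_list_of_multiset K) = size K" by (metis mset_sorted_list_of_multiset size_mset)
  moreover have "length (sorted_list_of_set S) = card S" by simp
  ultimately show ?thesis
    using w[of "sorted_list_of_set S" "sorted_list_of_multiset K"] S fin by (simp add: SK word_el_def)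
qed

lemma supp_phi:
  assumes "\<And>a. a < 2 * brank B \<Longrightarrow> supp (\<lambda>m. m \<in> monomials B 1) (oc a)"
    and "\<And>i. i < bdim B \<Longrightarrow> supp (\<lambda>m. m \<in> monomials B 2) (pc i)"
  shows "supp (\<lambda>m. m \<in> monomials B k) (phi B k oc pc F)"
  unfolding phi_def by (intro supp_sum supp_smul supp_word_el assms)

context vbun
begin

text \<open>The components of the section at the point \<open>q\<close>, stored as constant
  functions: the form in which \<open>Lop\<close> takes them once its argument is frozen at
  \<open>q\<close>. The derivatives follow in \<open>jet1\<close>.\<close>

definition jet0 :: "('m, 'v) patch \<Rightarrow> 'm \<Rightarrow> ('m, 'v) esec \<Rightarrow> nat \<Rightarrow> 'm \<Rightarrow> real" where
  "jet0 c q u = (\<lambda>a _. sec_el B u c ({a}, {#}) q)"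

definition jet1 :: "('m, 'v) patch \<Rightarrow> 'm \<Rightarrow> ('m, 'v) esec \<Rightarrow> nat \<Rightarrow> 'm loc" where
  "jet1 c q u = (\<lambda>i. freeze q (d_x B (fst c) i (sec_el B u c)))"

lemma pfree_sec: "pfree 1 (sec_el B u c)"
  by (rule pfreeI) (use sec_el_supp in fastforce)

lemma sec_el_index: "\<not> b < 2 * brank B \<Longrightarrow> sec_el B u c ({b}, {#}) = (\<lambda>_. 0)"
proof
  fix q assume "\<not> b < 2 * brank B"
  then show "sec_el B u c ({b}, {#}) q = 0" using sec_el_supp[of u c "({b}, {#})" q] by auto
qed

lemma freeze_bracket_sec:
  "finsupp G \<Longrightarrow> freeze q (local_bracket B (fst c) (sec_el B u c) G) =
      Lop B (jet0 c q u) (jet1 c q u) (freeze q G)"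
  by (simp add: bracket_Lop[OF pfree_sec] freeze_Lop jet0_def jet1_def)

lemma pfree_jet1: "pfree 1 (jet1 c q u i)"
  unfolding jet1_def by (intro pfree_freeze pfree_d_x pfree_sec)

lemma jet1_apply: "jet1 c q u i ({b}, {#}) p = pd B (fst c) i (sec_el B u c ({b}, {#})) q"
  by (simp add: jet1_def freeze_apply d_x_def)

lemma jet1_sum: "jet1 c q u i = (\<Sum>b<2 * brank B. smul (\<lambda>_. pd B (fst c) i (sec_el B u c ({b}, {#})) q)
    (zeta b))"
proof (rule pfree1_eqI[OF pfree_jet1])
  show "pfree 1 (\<Sum>b<2 * brank B. smul (\<lambda>_. pd B (fst c) i (sec_el B u c ({b}, {#})) q) (zeta b))"
    by (intro pfree_sum pfree_linear pfree_zeta)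
  fix b and p :: 'm
  have "(\<Sum>e<2 * brank B. smul (\<lambda>_. pd B (fst c) i (sec_el B u c ({e}, {#})) q) (zeta e)) ({b}, {#}) p =
     (\<Sum>e<2 * brank B. if e = b then pd B (fst c) i (sec_el B u c ({b}, {#})) q else 0)"
    unfolding loc_sum_apply smul_apply zeta_apply by (intro sum.cong) auto
  then show "jet1 c q u i ({b}, {#}) p =
     (\<Sum>e<2 * brank B. smul (\<lambda>_. pd B (fst c) i (sec_el B u c ({e}, {#})) q) (zeta e)) ({b}, {#}) p"
    using sec_el_index[of b u c] by (cases "b < 2 * brank B") (simp_all add: jet1_apply)
qed

lemma freeze_p_change:
  "freeze q (p_change B c c' i) = (\<Sum>j<bdim B. smul (\<lambda>_. pd B (fst c') i (snd (fst c) j) q) (pvar j)) +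
     (\<Sum>\<gamma><brank B. \<Sum>\<delta><brank B. smul (\<lambda>_. \<Sum>\<alpha><brank B. frame_change B (snd c') (snd c) \<gamma> \<alpha> q *
        pd B (fst c') i (frame_change B (snd c) (snd c') \<alpha> \<delta>) q) (lmul (zeta \<delta>) (zeta (brank B + \<gamma>))))"
  unfolding p_change_def freeze_linear freeze_sum
  by (intro arg_cong2[where f = "(+)"] arg_cong2[where f = smul] sum.cong refl) (auto simp: pvar_def zeta2)

lemma supp_odd_change:
  assumes "a < 2 * brank B"
  shows "supp (\<lambda>m. m \<in> monomials B 1) (odd_change B c c' a)"
proof -
  have "supp (\<lambda>m. m \<in> monomials B 1) (mon_el ({b}, {#}) :: 'm loc)" if "b < 2 * brank B" for b
    using that by (auto simp: supp_def mon_el_def monomials_def split: if_splits)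
  then show ?thesis unfolding odd_change_def by (auto intro!: supp_sum supp_smul)
qed

lemma supp_p_change: "supp (\<lambda>m. m \<in> monomials B 2) (p_change B c c' i)"
proof -
  have "supp (\<lambda>m. m \<in> monomials B 2) (mon_el ({}, {#j#}) :: 'm loc)" if "j < bdim B" for j
    using that by (auto simp: supp_def mon_el_def monomials_def split: if_splits)
  moreover have "supp (\<lambda>m. m \<in> monomials B 2) (mon_el ({\<delta>, brank B + \<gamma>}, {#}) :: 'm loc)"
      if "\<gamma> < brank B" "\<delta> < brank B" for \<delta> \<gamma>
    using that by (auto simp: supp_def mon_el_def monomials_def split: if_splits)
  ultimately show ?thesis unfolding p_change_def by (auto intro!: supp_sum supp_smul supp_add)
qed

lemma Lop_zeta_zeta:
  assumes "a < 2 * brank B" "b < 2 * brank B"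
  shows "Lop B (jet0 c q u) (jet1 c q u) (lmul (zeta a) (zeta b)) =
    smul (jet0 c q u (star B a)) (zeta b) - smul (jet0 c q u (star B b)) (zeta a)"
  using assms
  by (simp add: Lop_lmul[OF pfree_zeta(1) pfree_jet1] Lop_zeta par_pfree_odd[OF pfree_zeta(1)] lmul_smul_left
      lmul_smul_right lmul_one smul_uminus lmul_uminus_left del: plus_fun_apply minus_apply uminus_apply)

context
  fixes c c' q u
  assumes c: "c \<in> patches B" "c' \<in> patches B" "q \<in> pdom c" "q \<in> pdom c'" and u: "u \<in> sections_E B"
begin

text \<open>The change of odd coordinates preserves the canonical pairing: its inverse is its
  adjoint with respect to \<open>star\<close>.\<close>

lemma odd_flip:
  "a < 2 * brank B \<Longrightarrow> b < 2 * brank B \<Longrightarrow>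
   odd_change B c c' a ({b}, {#}) q = odd_change B c' c (star B b) ({star B a}, {#}) q"
  by (simp add: odd_change_apply) (auto simp: star_def)

text \<open>The bracket of \<open>u\<close> with an odd coordinate of \<open>c'\<close> is the
  conjugate component of \<open>u\<close> in \<open>c'\<close>. After \<open>odd_flip\<close> this
  is the transformation of components from \<open>c\<close> to \<open>c'\<close>.\<close>

lemma Lop_odd_change:
  assumes a: "a < 2 * brank B"
  shows "Lop B (jet0 c q u) (jet1 c q u) (freeze q (odd_change B c c' a)) =
      smul (jet0 c' q u (star B a)) one_el"
proof (rule loc_eqI)
  fix S K p
  let ?o = "freeze q (odd_change B c c' a)"
  have o: "pfree 1 ?o" by (intro pfree_freeze pfree_odd_change)
  have o0: "pfree 0 (d_left e ?o)" for e using pfree_d_left[of 0 ?o] o by simp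
  show "Lop B (jet0 c q u) (jet1 c q u) ?o (S, K) p = smul (jet0 c' q u (star B a)) one_el (S, K) p"
  proof (cases "S = {} \<and> K = {#}")
    case False
    then have "\<not> (finite S \<and> card S = 0 \<and> K = {#})" by auto
    then have "d_left e ?o (S, K) p = 0" for e using pfree_zero[OF o0] by blast
    then show ?thesis using False by (auto simp: Lop_pfree[OF o] loc_sum_apply smul_apply mon_el_def)
  next
    case True
    have "Lop B (jet0 c q u) (jet1 c q u) ?o (S, K) p =
        (\<Sum>e<2 * brank B. sec_el B u c ({e}, {#}) q * odd_change B c c' a ({star B e}, {#}) q)"
      using True by (simp add: Lop_pfree[OF o] loc_sum_apply smul_apply d_left_apply freeze_apply jet0_def)
    also have "\<dots> = (\<Sum>e<2 * brank B. ecomp (snd c) u e q * odd_change B c' c e ({star B a}, {#}) q)"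
      using a by (intro sum.cong) (auto simp: odd_flip sec_el_ecomp c)
    also have "\<dots> = ecomp (snd c') u (star B a) q"
      using ecomp_trans[OF u c(2,1,4,3), of "star B a"] a by simp
    finally show ?thesis using True a by (simp add: smul_apply mon_el_def jet0_def sec_el_ecomp c)
  qed
qed

lemma open_overlap: "open (pdom c \<inter> pdom c')"
  using patchD(3) c by blast

lemma smooth_odd_change:
  assumes "e < 2 * brank B" "b < 2 * brank B"
  shows "smooth_fun B (pdom c \<inter> pdom c') (odd_change B c c' e ({b}, {#}))"
proof -
  note fr = patchD(2)[OF c(1)] and fr' = patchD(2)[OF c(2)]
  have eq: "odd_change B c c' e ({b}, {#}) =
      (if e < brank B then (if b < brank B then frame_change B (snd c) (snd c') e b else (\<lambda>_. 0))
     else if b < brank B then (\<lambda>_. 0) else frame_change B (snd c') (snd c) (b - brank B) (e - brank B))"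
    using assms by (auto simp: odd_change_apply)
  show ?thesis
    unfolding eq using assms
    by (auto intro!: smooth_fun_subset[OF frame_change_smooth[OF fr fr']]
        smooth_fun_subset[OF frame_change_smooth[OF fr' fr]]
        simp: pdom_def)
qed

lemma pd_ecomp_trans:
  assumes i: "i < bdim B" and b: "b < 2 * brank B"
  shows "pd B (fst c') i (sec_el B u c ({b}, {#})) q = (\<Sum>e<2 * brank B.
     pd B (fst c') i (sec_el B u c' ({e}, {#})) q * odd_change B c c' e ({b}, {#}) q +
     sec_el B u c' ({e}, {#}) q * pd B (fst c') i (odd_change B c c' e ({b}, {#})) q)"
proof -
  let ?W = "pdom c \<inter> pdom c'"
  note ch = patchD(1)[OF c(2)] patchD(4)[OF c(2,4)]
  have qW: "q \<in> ?W" using c by simp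
  have s: "smooth_fun B ?W (sec_el B u c' ({e}, {#}))" if "e < 2 * brank B" for e
    by (rule smooth_fun_subset[OF sec_el_smooth[OF u c(2) that]]) simp
  have "pd B (fst c') i (sec_el B u c ({b}, {#})) q =
      pd B (fst c') i (\<lambda>p. \<Sum>e<2 * brank B. sec_el B u c' ({e}, {#}) p * odd_change B c c' e ({b}, {#}) p) q"
    by (rule pd_cong[OF ch qW open_overlap i]) (use b ecomp_trans[OF u c(1,2)] in \<open>simp add: sec_el_ecomp c\<close>)
  also have "\<dots> = (\<Sum>e<2 * brank B. pd B (fst c') i
      (\<lambda>p. sec_el B u c' ({e}, {#}) p * odd_change B c c' e ({b}, {#}) p) q)"
    using b s smooth_odd_change open_overlap by (intro pd_sum[OF ch qW open_overlap i] smooth_fun_mult) auto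
  also have "\<dots> = (\<Sum>e<2 * brank B. pd B (fst c') i (sec_el B u c' ({e}, {#})) q * odd_change B c c' e ({b},
      {#}) q +
     sec_el B u c' ({e}, {#}) q * pd B (fst c') i (odd_change B c c' e ({b}, {#})) q)"
    using b by (intro sum.cong refl pd_mult[OF ch qW i s smooth_odd_change]) auto
  finally show ?thesis .
qed

lemma odd_change_block:
  assumes "\<alpha> < brank B" "\<beta> < brank B"
  shows "odd_change B c c' \<alpha> ({\<beta>}, {#}) = frame_change B (snd c) (snd c') \<alpha> \<beta>"
    "odd_change B c c' (brank B + \<alpha>) ({\<beta>}, {#}) = (\<lambda>_. 0)"
    "odd_change B c c' \<alpha> ({brank B + \<beta>}, {#}) = (\<lambda>_. 0)"
    "odd_change B c c' (brank B + \<alpha>) ({brank B + \<beta>}, {#}) = frame_change B (snd c') (snd c) \<beta> \<alpha>"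
  using assms by (auto simp: odd_change_apply)

lemma sec_trans_block:
  assumes "\<alpha> < brank B"
  shows "sec_el B u c' ({\<alpha>}, {#}) q = (\<Sum>\<gamma><brank B. sec_el B u c ({\<gamma>}, {#}) q * frame_change B (snd c') (snd c) \<gamma>
      \<alpha> q)"
    "sec_el B u c' ({brank B + \<alpha>}, {#}) q =
      (\<Sum>\<delta><brank B. sec_el B u c ({brank B + \<delta>}, {#}) q * frame_change B (snd c) (snd c') \<alpha> \<delta> q)"
  using ecomp_trans[OF u c(2,1,4,3), of \<alpha>] ecomp_trans[OF u c(2,1,4,3), of "brank B + \<alpha>"] assms
  unfolding sum_double by (simp_all add: sec_el_ecomp c odd_change_apply)

text \<open>The Leibniz rule for the constant product of the two mutually inverse frame
  changes.\<close>

lemma pd_frame_inverse: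
  assumes "\<gamma> < brank B" "\<delta> < brank B" "i < bdim B"
  shows "(\<Sum>\<alpha><brank B. frame_change B (snd c) (snd c') \<alpha> \<delta> q * pd B (fst c') i
      (frame_change B (snd c') (snd c) \<gamma> \<alpha>) q +
     frame_change B (snd c') (snd c) \<gamma> \<alpha> q * pd B (fst c') i (frame_change B (snd c) (snd c') \<alpha> \<delta>) q) = 0"
proof -
  let ?W = "pdom c \<inter> pdom c'"
  note ch = patchD(1)[OF c(2)] patchD(4)[OF c(2,4)]
  have qW: "q \<in> ?W" using c by simp
  note fr = patchD(2)[OF c(1)] and fr' = patchD(2)[OF c(2)]
  have s: "smooth_fun B ?W (frame_change B (snd c) (snd c') \<alpha> \<delta>)"
      "smooth_fun B ?W (frame_change B (snd c') (snd c) \<gamma> \<alpha>)"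
    if "\<alpha> < brank B" for \<alpha>
    using frame_change_smooth[OF fr fr' that assms(2)] frame_change_smooth[OF fr' fr assms(1) that]
    by (auto elim!: smooth_fun_subset simp: pdom_def)
  have "pd B (fst c') i (\<lambda>p. \<Sum>\<alpha><brank B. frame_change B (snd c) (snd c') \<alpha> \<delta> p * frame_change B (snd c') (snd c)
      \<gamma> \<alpha> p) q =
      pd B (fst c') i (\<lambda>p. if \<gamma> = \<delta> then 1 else 0) q"
  proof (rule pd_cong[OF ch qW open_overlap assms(3)])
    fix p assume "p \<in> ?W"
    then have p: "p \<in> fst (snd c)" "p \<in> fst (snd c')" by (auto simp: pdom_def)
    have "dual_frame B (snd c) \<gamma> p (snd (snd c) \<delta> p) =
      (\<Sum>\<alpha><brank B. dual_frame B (snd c') \<alpha> p (snd (snd c) \<delta> p) *\<^sub>R dual_frame B (snd c) \<gamma> p (snd (snd c') \<alpha> p))"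
      by (rule linear_expand[OF fr' p(2) frame_in_fibre[OF fr p(1) assms(2)] dual_frame_linear[OF fr p(1)]])
    then show "(\<Sum>\<alpha><brank B. frame_change B (snd c) (snd c') \<alpha> \<delta> p * frame_change B (snd c') (snd c) \<gamma> \<alpha> p) =
        (if \<gamma> = \<delta> then 1 else 0)"
      using dual_frame_frame[OF fr p(1) assms(1,2)] by (simp add: frame_change_def)
  qed
  moreover have "pd B (fst c') i (\<lambda>p. \<Sum>\<alpha><brank B. frame_change B (snd c) (snd c') \<alpha> \<delta> p * frame_change B
      (snd c') (snd c) \<gamma> \<alpha> p) q =
      (\<Sum>\<alpha><brank B. pd B (fst c') i (\<lambda>p. frame_change B (snd c) (snd c') \<alpha> \<delta> p * frame_change B (snd c') (snd c)
          \<gamma> \<alpha> p) q)"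
    using s by (intro pd_sum[OF ch qW open_overlap assms(3)] smooth_fun_mult open_overlap) auto
  moreover have "\<dots> = (\<Sum>\<alpha><brank B. pd B (fst c') i (frame_change B (snd c) (snd c') \<alpha> \<delta>) q * frame_change B
      (snd c') (snd c) \<gamma> \<alpha> q +
     frame_change B (snd c) (snd c') \<alpha> \<delta> q * pd B (fst c') i (frame_change B (snd c') (snd c) \<gamma> \<alpha>) q)"
    by (intro sum.cong refl pd_mult[OF ch qW assms(3)] s) auto
  ultimately show ?thesis by (simp add: algebra_simps)
qed

text \<open>The bracket of \<open>u\<close> with a momentum of \<open>c'\<close> should be the
  derivative of the components of \<open>u\<close> in \<open>c'\<close>. By the chain rule the
  linear part of \<open>p_change\<close> differentiates the components in \<open>c\<close> instead.
  The quadratic part, collected in \<open>g\<close>, compensates the derivative of the frame change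
  by which the two differ.\<close>

lemma Lop_p_change:
  assumes i: "i < bdim B"
  shows "Lop B (jet0 c q u) (jet1 c q u) (freeze q (p_change B c c' i)) =
    (\<Sum>b<2 * brank B. smul (\<lambda>_. pd B (fst c') i (sec_el B u c' ({b}, {#})) q) (freeze q (odd_change B c c' b)))"
    (is "?L = ?R")
proof (rule pfree1_eqI)
  define G where "G \<gamma> \<delta> = (\<Sum>\<alpha><brank B. frame_change B (snd c') (snd c) \<gamma> \<alpha> q *
        pd B (fst c') i (frame_change B (snd c) (snd c') \<alpha> \<delta>) q)" for \<gamma> \<delta>
  have L: "?L = (\<Sum>j<bdim B. smul (\<lambda>_. pd B (fst c') i (snd (fst c) j) q) (jet1 c q u j)) +
     (\<Sum>\<gamma><brank B. \<Sum>\<delta><brank B. smul (\<lambda>_. G \<gamma> \<delta>)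
        (smul (jet0 c q u (brank B + \<delta>)) (zeta (brank B + \<gamma>)) - smul (jet0 c q u \<gamma>) (zeta \<delta>)))"
    unfolding freeze_p_change G_def[symmetric] Lop_linear Lop_sum
    by (intro arg_cong2[where f = "(+)"] arg_cong2[where f = smul] sum.cong refl)
      (auto simp: Lop_pvar[OF _ pfree_finsupp[OF pfree_jet1]] Lop_zeta_zeta star_def)
  show "pfree 1 ?L" unfolding L by (intro pfree_linear pfree_sum pfree_zeta pfree_jet1)
  show "pfree 1 ?R" by (intro pfree_linear pfree_sum pfree_freeze pfree_odd_change)
  note ch = patchD(1)[OF c(1)] patchD(1)[OF c(2)] patchD(4)[OF c(1,3)] patchD(4)[OF c(2,4)]
  fix b p
  define g where "g = (\<Sum>\<gamma><brank B. \<Sum>\<delta><brank B. G \<gamma> \<delta> *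
        (sec_el B u c ({brank B + \<delta>}, {#}) q * (if b = brank B + \<gamma> then 1 else 0) - sec_el B u c ({\<gamma>}, {#}) q *
            (if b = \<delta> then 1 else 0)))"
  have Lb: "?L ({b}, {#}) p = (\<Sum>j<bdim B. pd B (fst c') i (snd (fst c) j) q * pd B (fst c) j
      (sec_el B u c ({b}, {#})) q) + g"
    unfolding L by (simp add: loc_sum_apply smul_apply jet1_apply zeta_apply jet0_def g_def)
  have Rb: "?R ({b}, {#}) p = (\<Sum>e<2 * brank B. pd B (fst c') i (sec_el B u c' ({e}, {#})) q * odd_change B c c'
      e ({b}, {#}) q)"
    by (simp add: loc_sum_apply smul_apply freeze_apply)
  show "?L ({b}, {#}) p = ?R ({b}, {#}) p"
  proof (cases "b < 2 * brank B")
    case False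
    have "g = 0" unfolding g_def using False by (intro sum.neutral ballI) auto
    moreover have "odd_change B c c' e ({b}, {#}) q = 0" if "e < 2 * brank B" for e
      using suppD[OF supp_odd_change[OF that], of c c' "({b}, {#})" q] False by (auto simp: monomials_def)
    ultimately show ?thesis unfolding Lb Rb using False by (simp add: sec_el_index)
  next
    case b: True
    have "(\<Sum>j<bdim B. pd B (fst c') i (snd (fst c) j) q * pd B (fst c) j (sec_el B u c ({b}, {#})) q) =
        pd B (fst c') i (sec_el B u c ({b}, {#})) q"
      using pd_chain[OF ch(1,2,3,4) c(3) patchD(3)[OF c(1)] sec_el_smooth[OF u c(1) b] i] by simp
    moreover have "(\<Sum>e<2 * brank B. sec_el B u c' ({e},
        {#}) q * pd B (fst c') i (odd_change B c c' e ({b}, {#})) q) + g = 0"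
    proof (cases "b < brank B")
      \<comment> \<open>Covector components: the derivative of the frame change occurs here in the
        same form as in \<open>p_change\<close>, and the terms cancel after exchanging the
        sums.\<close>
      case True
      have "(\<Sum>e<2 * brank B. sec_el B u c' ({e}, {#}) q * pd B (fst c') i (odd_change B c c' e ({b}, {#})) q) =
         (\<Sum>\<alpha><brank B. \<Sum>\<gamma><brank B. sec_el B u c ({\<gamma>}, {#}) q * frame_change B (snd c') (snd c) \<gamma> \<alpha> q *
            pd B (fst c') i (frame_change B (snd c) (snd c') \<alpha> b) q)"
        unfolding sum_double using True by (simp add: odd_change_block sec_trans_block sum_distrib_right)
      moreover have "g = - (\<Sum>\<gamma><brank B. G \<gamma> b * sec_el B u c ({\<gamma>}, {#}) q)"
      proof -
        have "g = (\<Sum>\<gamma><brank B. \<Sum>\<delta><brank B. if \<delta> = b then - (G \<gamma> b * sec_el B u c ({\<gamma>}, {#}) q) else 0)"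
          unfolding g_def using True by (intro sum.cong refl) auto
        then show ?thesis using True by (simp add: sum_negf)
      qed
      ultimately show ?thesis
        by (subst (asm) sum.swap) (simp add: G_def sum_distrib_right sum_distrib_left mult_ac)
    next
      case False
      define \<gamma> where "\<gamma> = b - brank B"
      have \<gamma>: "b = brank B + \<gamma>" "\<gamma> < brank B" using False b by (auto simp: \<gamma>_def)
      have "(\<Sum>e<2 * brank B. sec_el B u c' ({e}, {#}) q * pd B (fst c') i (odd_change B c c' e ({b}, {#})) q) =
         (\<Sum>\<alpha><brank B. \<Sum>\<delta><brank B. sec_el B u c ({brank B + \<delta>}, {#}) q * frame_change B (snd c) (snd c') \<alpha> \<delta> q *
            pd B (fst c') i (frame_change B (snd c') (snd c) \<gamma> \<alpha>) q)"
        unfolding sum_double using \<gamma> by (simp add: odd_change_block sec_trans_block sum_distrib_right)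
      moreover have "g = (\<Sum>\<delta><brank B. G \<gamma> \<delta> * sec_el B u c ({brank B + \<delta>}, {#}) q)"
      proof -
        have "g = (\<Sum>\<epsilon><brank B. if \<epsilon> = \<gamma> then \<Sum>\<delta><brank B. G \<gamma> \<delta> * sec_el B u c ({brank B + \<delta>}, {#}) q else 0)"
          unfolding g_def using \<gamma> by (intro sum.cong refl) auto
        then show ?thesis using \<gamma> by simp
      qed
      \<comment> \<open>Vector components involve the derivative of the inverse frame change,
        whereas \<open>g\<close> contains that of the frame change itself; differentiating their
        product relates the two.\<close>
      moreover have "(\<Sum>\<delta><brank B. sec_el B u c ({brank B + \<delta>}, {#}) q *
          (\<Sum>\<alpha><brank B. frame_change B (snd c) (snd c') \<alpha> \<delta> q * pd B (fst c') i
              (frame_change B (snd c') (snd c) \<gamma> \<alpha>) q +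
     frame_change B (snd c') (snd c) \<gamma> \<alpha> q * pd B (fst c') i (frame_change B (snd c) (snd c') \<alpha> \<delta>) q)) = 0"
        using pd_frame_inverse[OF \<gamma>(2) _ i] by (intro sum.neutral) auto
      ultimately show ?thesis
        by (subst (asm) sum.swap) (simp add: G_def sum_distrib_right sum_distrib_left sum.distrib mult_ac
            distrib_left)
    qed
    ultimately show ?thesis unfolding Lb Rb using pd_ecomp_trans[OF i b] by (simp add: sum.distrib)
  qed
qed

lemma transforms_freeze: "transforms k F c c' q \<longleftrightarrow>
    freeze q (F c) = phi B k (\<lambda>a. freeze q (odd_change B c c' a)) (\<lambda>i. freeze q (p_change B c c' i))
        (freeze q (F c'))"
proof -
  have "phi B k (\<lambda>a. freeze q (odd_change B c c' a)) (\<lambda>i. freeze q (p_change B c c' i)) (freeze q (F c')) m p =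
      (\<Sum>m'\<in>monomials B k. F c' m' q * monomial_change B c c' m' m q)" for m p
    unfolding phi_def loc_sum_apply smul_apply freeze_word[symmetric] monomial_change_word
        by (simp add: freeze_apply)
  then show ?thesis unfolding transforms_def by (auto simp: fun_eq_iff freeze_apply)
qed

lemma Lop_phi_patch:
  assumes F: "supp (\<lambda>m. m \<in> monomials B k) G" and k: "k = 2 \<or> k = 3"
  shows "Lop B (jet0 c q u) (jet1 c q u)
      (phi B k (\<lambda>a. freeze q (odd_change B c c' a)) (\<lambda>i. freeze q (p_change B c c' i)) G) =
    phi B (k - 1) (\<lambda>a. freeze q (odd_change B c c' a)) (\<lambda>i. freeze q (p_change B c c' i)) (Lop B (jet0 c' q u)
        (jet1 c' q u) G)"
proof -
  have "(\<lambda>i. \<Sum>b<2 * brank B. smul (\<lambda>_. pd B (fst c') i (sec_el B u c' ({b}, {#})) q) (zeta b)) = jet1 c' q u"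
    by (rule ext) (rule jet1_sum[symmetric])
  then show ?thesis
    using Lop_phi[where B = B and oc = "\<lambda>a. freeze q (odd_change B c c' a)" and pc =
        "\<lambda>i. freeze q (p_change B c c' i)"
       and u = "jet0 c q u" and U = "jet1 c q u" and u' = "jet0 c' q u" and F = G and k = k and
       V = "\<lambda>i b _. pd B (fst c') i (sec_el B u c' ({b}, {#})) q"]
      pfree_freeze[OF pfree_odd_change] finsupp_freeze[OF supp_finsupp[OF supp_p_change]] pfree_jet1
          Lop_odd_change Lop_p_change
      suppD[OF F] k by simp
qed

lemma transforms_bracket:
  assumes F: "homog k F" and k: "k = 2 \<or> k = 3" and "transforms k F c c' q"
  shows "transforms (k - 1) \<lbrace>sec_el B u, F\<rbrace> c c' q"
  using assms(3) Lop_phi_patch[OF supp_freeze[OF homog_supp[OF F]] k]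
  unfolding transforms_freeze by (simp add: big_bracket_def
      freeze_bracket_sec[OF supp_finsupp[OF homog_supp[OF F]]])

end

text \<open>A monomial of positive degree contains an odd variable or a momentum, and each can be
  removed by bracketing with a suitable section. For a momentum this costs a factor
  \<open>zeta 0\<close>, so there must be an odd variable at all.\<close>

lemma Lop_injective:
  assumes c: "c \<in> patches B" "q \<in> pdom c" and r: "brank B > 0" and k: "k > 0"
    and D: "supp (\<lambda>m. m \<in> monomials B k) D"
    and L: "\<And>u. u \<in> sections_E B \<Longrightarrow> Lop B (jet0 c q u) (jet1 c q u) D = 0"
  shows "D = 0"
proof (rule loc_eqI)
  fix S K p
  have l: "d_left a D = 0" if a: "a < 2 * brank B" for a
  proof -
    \<comment> \<open>With vanishing derivatives and a single nonzero component, \<open>Lop\<close>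
      is one odd derivative.\<close>
    obtain u where u: "u \<in> sections_E B"
      "\<And>e. e < 2 * brank B \<Longrightarrow> sec_el B u c ({e}, {#}) q = (if e = star B a then 1 else 0)"
      "\<And>e i. e < 2 * brank B \<Longrightarrow> i < bdim B \<Longrightarrow> pd B (fst c) i (sec_el B u c ({e}, {#})) q = 0"
      using jet_section0[OF c, of "star B a"] a by auto
    have "jet1 c q u i = 0" if "i < bdim B" for i
      unfolding jet1_sum using u(3) that by (intro sum.neutral) (auto simp: smul_def zero_fun_def)
    moreover have "(\<Sum>e<2 * brank B. smul (jet0 c q u e) (d_left (star B e) D)) =
        (\<Sum>e<2 * brank B. if e = star B a then d_left a D else 0)"
      using u(2) a by (intro sum.cong refl) (auto simp: jet0_def smul_def zero_fun_def)
    ultimately have "Lop B (jet0 c q u) (jet1 c q u) D = d_left a D"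
      unfolding Lop_def using a by (simp del: plus_fun_apply zero_fun_apply)
    then show ?thesis using L[OF u(1)] by simp
  qed
  show "D (S, K) p = 0 (S, K) p"
  proof (rule ccontr)
    assume "D (S, K) p \<noteq> 0 (S, K) p"
    then have nz: "D (S, K) p \<noteq> 0" by simp
    then have m: "S \<subseteq> {..<2 * brank B}" "set_mset K \<subseteq> {..<bdim B}" "card S + 2 * size K = k"
      using suppD[OF D nz] by (auto simp: monomials_def)
    show False
    proof (cases "S = {}")
      case False
      then obtain a where a: "a \<in> S" by blast
      have "d_left a D (S - {a}, K) p = ksign {a} (S - {a}) * D (S, K) p"
        using a by (simp add: d_left_apply insert_absorb)
      then have "D (S, K) p = ksign {a} (S - {a}) * d_left a D (S - {a}, K) p"
        by (simp only: ksign_square)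
      moreover have "a < 2 * brank B" using a m by auto
      ultimately show False using nz by (simp add: l)
    next
      case True
      then obtain i where i: "i \<in># K" using m(3) k
          by (metis add_0 card.empty mult_0_right multiset_nonemptyE not_gr_zero size_empty)
      then have i': "i < bdim B" using m by auto
      \<comment> \<open>With vanishing values and a single nonzero derivative, \<open>Lop\<close> is
        the derivative along one momentum followed by multiplication by
        \<open>zeta 0\<close>.\<close>
      obtain u where u: "u \<in> sections_E B"
        "\<And>e. e < 2 * brank B \<Longrightarrow> sec_el B u c ({e}, {#}) q = 0"
        "\<And>e j. e < 2 * brank B \<Longrightarrow> j < bdim B \<Longrightarrow>
           pd B (fst c) j (sec_el B u c ({e}, {#})) q = (if e = 0 \<and> j = i then 1 else 0)"
        using jet_section1[OF c _ i', of 0] r by auto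
      have "jet1 c q u j = (if j = i then zeta 0 else 0)" if "j < bdim B" for j
      proof -
        have "jet1 c q u j = (\<Sum>b<2 * brank B. if b = 0 \<and> j = i then zeta 0 else 0)"
          unfolding jet1_sum using u(3) that by (intro sum.cong refl) (auto simp: smul_def zero_fun_def)
        then show ?thesis using r by (cases "j = i") (auto simp del: zero_fun_apply)
      qed
      then have "(\<Sum>j<bdim B. lmul (jet1 c q u j) (d_p j D)) =
          (\<Sum>j<bdim B. if j = i then lmul (zeta 0) (d_p i D) else 0)"
        by (intro sum.cong refl) (auto simp del: zero_fun_apply)
      moreover have "(\<Sum>e<2 * brank B. smul (jet0 c q u e) (d_left (star B e) D)) = 0"
        using u(2) by (intro sum.neutral) (auto simp: jet0_def smul_def zero_fun_def)
      ultimately have "Lop B (jet0 c q u) (jet1 c q u) D =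
          (\<Sum>j<bdim B. if j = i then lmul (zeta 0) (d_p i D) else 0)"
        unfolding Lop_def by simp
      then have "lmul (zeta 0) (d_p i D) = 0" using L[OF u(1)] i' by (simp del: zero_fun_apply)
      then have "lmul (zeta 0) (d_p i D) ({0}, K - {#i#}) p = 0" by simp
      then have "d_p i D ({}, K - {#i#}) p = 0" by (simp add: lmul_zeta)
      then show False using nz True i by (simp add: d_p_apply flip: count_greater_zero_iff)
    qed
  qed
qed

lemma sec_bracket_graded:
  assumes F: "F \<in> graded B k" and k: "k = 2 \<or> k = 3" and u: "u \<in> sections_E B"
  shows "\<lbrace>sec_el B u, F\<rbrace> \<in> graded B (k - 1)"
proof -
  have "homog 1 (sec_el B u)" using sec_el_graded[OF u] graded_iff by blast
  moreover have "homog k F" using F graded_iff by blast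
  ultimately show ?thesis
    using k F transforms_bracket[OF _ _ _ _ u \<open>homog k F\<close> k] unfolding graded_iff
        by (auto intro!: homog_bracket)
qed

text \<open>The difference of the two sides of the transformation law is annihilated by the bracket
  with every section. This replaces computations with \<open>monomial_change\<close> in every later
  proof of membership in \<open>graded\<close>. In rank 0 and degree 3 there are no
  monomials.\<close>

lemma gradedI_sections:
  assumes F: "homog k F" and k: "k = 2 \<or> k = 3" and r: "brank B > 0 \<or> k = 3"
    and s: "\<And>u. u \<in> sections_E B \<Longrightarrow> \<lbrace>sec_el B u, F\<rbrace> \<in> graded B (k - 1)"
  shows "F \<in> graded B k"
  unfolding graded_iff
proof (intro conjI ballI allI impI F)
  fix c c' q assume c: "c \<in> patches B" "c' \<in> patches B" "q \<in> pdom c" "q \<in> pdom c'"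
  show "transforms k F c c' q"
  proof (cases "brank B = 0")
    case True
    then have "m \<notin> monomials B k" for m using r by (auto simp: monomials3)
    then have "F d m p = 0" for d m p using suppD[OF homog_supp[OF F]] by blast
    then show ?thesis by (simp add: transforms_def)
  next
    case False
    let ?oc = "\<lambda>a. freeze q (odd_change B c c' a)" and ?pc = "\<lambda>i. freeze q (p_change B c c' i)"
    have "freeze q (F c) - phi B k ?oc ?pc (freeze q (F c')) = 0"
    proof (rule Lop_injective[OF c(1,3)])
      show "supp (\<lambda>m. m \<in> monomials B k) (freeze q (F c) - phi B k ?oc ?pc (freeze q (F c')))"
        by (intro supp_diff supp_freeze homog_supp[OF F] supp_phi supp_odd_change supp_p_change)
      fix u assume u: "u \<in> sections_E B"
      have "transforms (k - 1) \<lbrace>sec_el B u, F\<rbrace> c c' q" using s[OF u] c unfolding graded_iff by blast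
      then show "Lop B (jet0 c q u) (jet1 c q u) (freeze q (F c) - phi B k ?oc ?pc (freeze q (F c'))) = 0"
        unfolding transforms_freeze[OF c u] Lop_linear Lop_phi_patch[OF c u supp_freeze[OF homog_supp[OF F]] k]
        by (simp add: big_bracket_def freeze_bracket_sec[OF supp_finsupp[OF homog_supp[OF F]]])
    qed (use False k in auto)
    moreover have "0 < 2 * brank B" using False by simp
    \<comment> \<open>Any section will do: it only instantiates the context of
      \<open>transforms_freeze\<close>.\<close>
    then obtain u where "u \<in> sections_E B" by (rule jet_section0[OF c(1,3)]) (rule that)
    ultimately show ?thesis using transforms_freeze[OF c] by (metis eq_iff_diff_eq_0)
  qed
qed

lemma gfun_eqI_sections:
  assumes F: "homog k F" and G: "homog k G" and k: "k > 0" and r: "brank B > 0"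
    and s: "\<And>u. u \<in> sections_E B \<Longrightarrow> \<lbrace>sec_el B u, F\<rbrace> = \<lbrace>sec_el B u, G\<rbrace>"
  shows "F = G"
proof (intro ext)
  fix c m q
  show "F c m q = G c m q"
  proof (cases "c \<in> patches B \<and> q \<in> pdom c")
    case False then show ?thesis using homog_outside[OF F] homog_outside[OF G] by simp
  next
    case True
    have "freeze q (F c) - freeze q (G c) = 0"
    proof (rule Lop_injective[of c q, OF _ _ r k])
      show "supp (\<lambda>m. m \<in> monomials B k) (freeze q (F c) - freeze q (G c))"
        by (intro supp_diff supp_freeze homog_supp F G)
      fix u assume "u \<in> sections_E B"
      then have "freeze q (\<lbrace>sec_el B u, F\<rbrace> c) = freeze q (\<lbrace>sec_el B u, G\<rbrace> c)" using s by simp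
      then show "Lop B (jet0 c q u) (jet1 c q u) (freeze q (F c) - freeze q (G c)) = 0"
        by (simp add: Lop_linear big_bracket_def freeze_bracket_sec[OF supp_finsupp[OF homog_supp[OF F]]]
            freeze_bracket_sec[OF supp_finsupp[OF homog_supp[OF G]]])
    qed (use True in auto)
    then have "freeze q (F c) m q = freeze q (G c) m q" by (metis eq_iff_diff_eq_0)
    then show ?thesis by (simp add: freeze_apply)
  qed
qed

end

section \<open>Derived brackets\<close>

text \<open>One operation for sums, differences, negatives and scalar multiples, so that each
  linearity statement is proved once.\<close>

definition gcomb :: "real \<Rightarrow> real \<Rightarrow> ('m, 'v) gfun \<Rightarrow> ('m, 'v) gfun \<Rightarrow> ('m, 'v) gfun" where
  "gcomb a b F G = (\<lambda>c m q. a * F c m q + b * G c m q)"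

definition scomb :: "real \<Rightarrow> real \<Rightarrow> ('m, 'v::real_vector) esec \<Rightarrow> ('m, 'v) esec \<Rightarrow> ('m, 'v) esec" where
  "scomb a b u v = (\<lambda>q. a *\<^sub>R fst u q + b *\<^sub>R fst v q, \<lambda>q w. a * snd u q w + b * snd v q w)"

lemma scomb_plus: "u + v = scomb 1 1 u v" and scomb_minus: "u - v = scomb 1 (-1) u v"
  and scomb_uminus: "- u = scomb (-1) 0 u u"
  by (auto simp: scomb_def prod_eq_iff fun_eq_iff)

lemma gcomb_plus: "F + G = gcomb 1 1 F G" and gcomb_minus: "F - G = gcomb 1 (-1) F G"
    and gcomb_uminus: "- F = gcomb (-1) 0 F F"
  by (auto simp: gcomb_def fun_eq_iff)

lemma gcomb_loc: "gcomb a b F G c = smul (\<lambda>_. a) (F c) + smul (\<lambda>_. b) (G c)"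
  by (auto simp: gcomb_def fun_eq_iff smul_apply)

context vbun
begin

lemma homog_gcomb: "homog k F \<Longrightarrow> homog k G \<Longrightarrow> homog k (gcomb a b F G)"
  unfolding homog_def
proof (intro conjI allI ballI impI)
  assume F: "(\<forall>c m q. F c m q \<noteq> 0 \<longrightarrow> c \<in> patches B \<and> m \<in> monomials B k \<and> q \<in> pdom c) \<and>
     (\<forall>c\<in>patches B. \<forall>m\<in>monomials B k. smooth_fun B (pdom c) (F c m))"
    and G: "(\<forall>c m q. G c m q \<noteq> 0 \<longrightarrow> c \<in> patches B \<and> m \<in> monomials B k \<and> q \<in> pdom c) \<and>
     (\<forall>c\<in>patches B. \<forall>m\<in>monomials B k. smooth_fun B (pdom c) (G c m))"
  { fix c m q assume "gcomb a b F G c m q \<noteq> 0"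
    then have "F c m q \<noteq> 0 \<or> G c m q \<noteq> 0" by (auto simp: gcomb_def)
    with F G have "c \<in> patches B \<and> m \<in> monomials B k \<and> q \<in> pdom c" by blast
    then show "c \<in> patches B" "m \<in> monomials B k" "q \<in> pdom c" by auto }
  fix c m assume "c \<in> patches B" "m \<in> monomials B k"
  then show "smooth_fun B (pdom c) (gcomb a b F G c m)"
    unfolding gcomb_def using F G patchD(3) by (intro smooth_fun_add smooth_fun_mult smooth_fun_const) auto
qed

lemma graded_gcomb: "F \<in> graded B k \<Longrightarrow> G \<in> graded B k \<Longrightarrow> gcomb a b F G \<in> graded B k"
  unfolding graded_iff
proof (intro conjI ballI allI impI homog_gcomb)
  assume F: "homog k F \<and> (\<forall>c\<in>patches B. \<forall>c'\<in>patches B. \<forall>q. q \<in> pdom c \<longrightarrow> q \<in> pdom c' \<longrightarrow> transforms k F c c' q)"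
    and G: "homog k G \<and> (\<forall>c\<in>patches B. \<forall>c'\<in>patches B. \<forall>q. q \<in> pdom c \<longrightarrow> q \<in> pdom c' \<longrightarrow> transforms k G c c' q)"
  show "homog k F" "homog k G" using F G by auto
  fix c c' q assume "c \<in> patches B" "c' \<in> patches B" "q \<in> pdom c" "q \<in> pdom c'"
  then have "transforms k F c c' q" "transforms k G c c' q" using F G by auto
  then show "transforms k (gcomb a b F G) c c' q"
    by (simp add: transforms_def gcomb_def sum.distrib[symmetric] sum_distrib_left algebra_simps)
qed

lemma graded_linear:
  "F \<in> graded B k \<Longrightarrow> G \<in> graded B k \<Longrightarrow> F + G \<in> graded B k" "F \<in> graded B k \<Longrightarrow> - F \<in> graded B k"
  by (simp_all only: gcomb_plus gcomb_uminus graded_gcomb)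

lemma homog_zero: "homog k 0"
  by (simp add: homog_def zero_fun_def)

lemma graded_zero: "0 \<in> graded B k"
  unfolding graded_iff using homog_zero by (simp add: transforms_def)

lemma ecomp_scomb:
  assumes u: "u \<in> sections_E B" and v: "v \<in> sections_E B" and fr: "fr \<in> frames B" "q \<in> fst fr"
  shows "ecomp fr (scomb a b u v) e q = a * ecomp fr u e q + b * ecomp fr v e q"
proof -
  have "fst u q \<in> fibre B q" "fst v q \<in> fibre B q" using u v by (auto simp: sections_E_def sections_A_def)
  then show ?thesis
    using dual_frame_linear[OF fr] subspace_scale[OF subspace_fibre[of q]]
    unfolding linear_from_def ecomp_def scomb_def by simp
qed

lemma scomb_sections:
  assumes u: "u \<in> sections_E B" and v: "v \<in> sections_E B"
  shows "scomb a b u v \<in> sections_E B"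
proof -
  have sm: "smooth_fun B (fst fr) (ecomp fr (scomb a b u v) e)" if fr: "fr \<in> frames B" and e: "e < 2 * brank B"
      for fr e
  proof (rule smooth_fun_cong[OF frameD(1)[OF fr]])
    show "smooth_fun B (fst fr) (\<lambda>q. a * ecomp fr u e q + b * ecomp fr v e q)"
      using frameD(1)[OF fr] ecomp_smooth[OF _ fr e] u v
          by (intro smooth_fun_add smooth_fun_mult smooth_fun_const)
  qed (simp add: ecomp_scomb[OF u v fr])
  have "smooth_fun B (fst fr) (\<lambda>q. dual_frame B fr \<alpha> q (fst (scomb a b u v) q))"
    "smooth_fun B (fst fr) (\<lambda>q. snd (scomb a b u v) q (snd fr \<alpha> q))" if "fr \<in> frames B" "\<alpha> < brank B" for fr \<alpha>
    using sm[OF that(1), of "brank B + \<alpha>"] sm[OF that(1), of \<alpha>] that(2) by (simp_all add: ecomp_def[abs_def])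
  moreover have "fst (scomb a b u v) q \<in> fibre B q" for q
    using u v unfolding scomb_def sections_E_def sections_A_def
    by (auto intro!: subspace_add subspace_scale subspace_fibre)
  moreover have "snd (scomb a b u v) q \<in> dual_fibre B q" for q
  proof -
    have "snd u q \<in> dual_fibre B q" "snd v q \<in> dual_fibre B q" using u v
        by (auto simp: sections_E_def sections_As_def)
    then show ?thesis unfolding scomb_def dual_fibre_def linear_from_def by (auto simp: algebra_simps)
  qed
  ultimately show ?thesis unfolding sections_E_def sections_A_def sections_As_def by (simp add: mem_Times_iff)
qed

lemma sec_el_scomb:
  assumes "u \<in> sections_E B" "v \<in> sections_E B"
  shows "sec_el B (scomb a b u v) = gcomb a b (sec_el B u) (sec_el B v)"
proof (intro ext)
  fix c m q
  show "sec_el B (scomb a b u v) c m q = gcomb a b (sec_el B u) (sec_el B v) c m q"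
  proof (cases "c \<in> patches B \<and> q \<in> pdom c \<and> (\<exists>e<2 * brank B. m = ({e}, {#}))")
    case True
    then have c: "c \<in> patches B" "q \<in> pdom c" by auto
    show ?thesis using True ecomp_scomb[OF assms patchD(2)[OF c(1)] patchD(5)[OF c]]
        by (auto simp: gcomb_def sec_el_ecomp)
  next
    case False
    then have "sec_el B w c m q = 0" for w using sec_el_supp[of w c m q] by blast
    then show ?thesis by (simp add: gcomb_def)
  qed
qed

lemma sections_E_linear:
  assumes "u \<in> sections_E B" "v \<in> sections_E B"
  shows "u + v \<in> sections_E B" "u - v \<in> sections_E B" "- u \<in> sections_E B"
  unfolding scomb_plus scomb_minus scomb_uminus by (intro scomb_sections assms)+

lemma sec_el_linear:
  assumes "u \<in> sections_E B" "v \<in> sections_E B"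
  shows "sec_el B (u + v) = sec_el B u + sec_el B v" "sec_el B (u - v) = sec_el B u - sec_el B v"
    "sec_el B (- u) = - sec_el B u"
  unfolding scomb_plus scomb_minus scomb_uminus gcomb_plus gcomb_minus gcomb_uminus
      by (intro sec_el_scomb assms)+

lemma sec_el_eqD: "u \<in> sections_E B \<Longrightarrow> v \<in> sections_E B \<Longrightarrow> sec_el B u = sec_el B v \<Longrightarrow> u = v"
  using sec_el_inj by (simp add: inj_on_def)

lemma homog_finsupp: "homog k F \<Longrightarrow> finsupp (F c)"
  using homog_supp supp_finsupp by blast

lemma sec_bracket_gcomb:
  assumes "homog k F" "homog k G"
  shows "\<lbrace>sec_el B u, gcomb a b F G\<rbrace> = gcomb a b \<lbrace>sec_el B u, F\<rbrace> \<lbrace>sec_el B u, G\<rbrace>"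
proof
  fix c
  show "\<lbrace>sec_el B u, gcomb a b F G\<rbrace> c = gcomb a b \<lbrace>sec_el B u, F\<rbrace> \<lbrace>sec_el B u, G\<rbrace> c"
    using homog_finsupp[OF assms(1), of c] homog_finsupp[OF assms(2), of c]
    by (simp add: big_bracket_def gcomb_loc bracket_Lop[OF pfree_sec] Lop_linear del: plus_fun_apply)
qed

lemma sec_bracket_linear:
  assumes "homog k F" "homog k G"
  shows "\<lbrace>sec_el B u, F + G\<rbrace> = \<lbrace>sec_el B u, F\<rbrace> + \<lbrace>sec_el B u, G\<rbrace>"
    "\<lbrace>sec_el B u, - F\<rbrace> = - \<lbrace>sec_el B u, F\<rbrace>"
  unfolding gcomb_plus gcomb_uminus by (rule sec_bracket_gcomb[OF assms], rule sec_bracket_gcomb[OF assms(1,1)])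

lemma bracket_sec_right: "homog 2 A \<Longrightarrow> \<lbrace>A, sec_el B v\<rbrace> = - \<lbrace>sec_el B v, A\<rbrace>"
proof
  fix c assume A: "homog 2 A"
  have "par (A c) = A c" using par_homogeneous[OF homog_supp[OF A]] by simp
  then show "\<lbrace>A, sec_el B v\<rbrace> c = (- \<lbrace>sec_el B v, A\<rbrace>) c"
    using bracket_Lop_right[OF pfree_sec homog_finsupp[OF A]] by (simp add: big_bracket_def)
qed

lemma graded_homog: "F \<in> graded B k \<Longrightarrow> homog k F"
  using graded_iff by blast

text \<open>The derived bracket has degree 1 and hence comes from a section, so the
  \<open>inv_into\<close> in \<open>dorfman\<close> is applied within its range. The form with
  \<open>v\<close> on the left is the one to which the operators \<open>Lop\<close> apply.\<close>

lemma dorfman_sec: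
  assumes T: "T \<in> graded B 3" and u: "u \<in> sections_E B" and v: "v \<in> sections_E B"
  shows "dorfman B T u v \<in> sections_E B"
    and "sec_el B (dorfman B T u v) = - \<lbrace>sec_el B v, \<lbrace>sec_el B u, T\<rbrace>\<rbrace>"
    and "sec_el B (dorfman B T u v) = \<lbrace>\<lbrace>sec_el B u, T\<rbrace>, sec_el B v\<rbrace>"
proof -
  have A: "\<lbrace>sec_el B u, T\<rbrace> \<in> graded B 2" using sec_bracket_graded[OF T _ u] by simp
  have eq: "\<lbrace>\<lbrace>sec_el B u, T\<rbrace>, sec_el B v\<rbrace> = - \<lbrace>sec_el B v, \<lbrace>sec_el B u, T\<rbrace>\<rbrace>"
    by (rule bracket_sec_right[OF graded_homog[OF A]])
  have "\<lbrace>sec_el B v, \<lbrace>sec_el B u, T\<rbrace>\<rbrace> \<in> graded B 1" using sec_bracket_graded[OF A _ v] by simp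
  then have "\<lbrace>\<lbrace>sec_el B u, T\<rbrace>, sec_el B v\<rbrace> \<in> graded B 1" unfolding eq by (rule graded_linear)
  then obtain w where w: "w \<in> sections_E B" "sec_el B w = \<lbrace>\<lbrace>sec_el B u, T\<rbrace>, sec_el B v\<rbrace>"
    by (rule graded1_section)
  then have "dorfman B T u v = w" unfolding dorfman_def w(2)[symmetric] by (intro inv_into_f_f sec_el_inj)
  then show "dorfman B T u v \<in> sections_E B" "sec_el B (dorfman B T u v) = \<lbrace>\<lbrace>sec_el B u, T\<rbrace>, sec_el B v\<rbrace>"
    "sec_el B (dorfman B T u v) = - \<lbrace>sec_el B v, \<lbrace>sec_el B u, T\<rbrace>\<rbrace>"
    using w eq by auto
qed

text \<open>The bracket depends linearly on the 1-jet of the section, and taking 1-jets commutes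
  with constant coefficients.\<close>

lemma sec_bracket_scomb:
  assumes u: "u \<in> sections_E B" and v: "v \<in> sections_E B" and F: "homog k F" and k: "k > 0"
  shows "\<lbrace>sec_el B (scomb a b u v), F\<rbrace> = gcomb a b \<lbrace>sec_el B u, F\<rbrace> \<lbrace>sec_el B v, F\<rbrace>"
proof (intro ext)
  fix c m q
  have p: "homog (k - 1) \<lbrace>sec_el B w, F\<rbrace>" if "w \<in> sections_E B" for w
    by (rule homog_bracket[OF graded_homog[OF sec_el_graded[OF that]] F]) (use k in simp)
  show "\<lbrace>sec_el B (scomb a b u v), F\<rbrace> c m q = gcomb a b \<lbrace>sec_el B u, F\<rbrace> \<lbrace>sec_el B v, F\<rbrace> c m q"
  proof (cases "c \<in> patches B \<and> q \<in> pdom c")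
    case False
    then show ?thesis using homog_outside[OF p[OF scomb_sections[OF u v]]]
        homog_outside[OF homog_gcomb[OF p[OF u] p[OF v]]] by simp
  next
    case True
    then have c: "c \<in> patches B" "q \<in> pdom c" by auto
    note ch = patchD(1)[OF c(1)] patchD(4)[OF c]
    have s: "sec_el B (scomb a b u v) c = (\<lambda>m q. a * sec_el B u c m q + b * sec_el B v c m q)"
      using sec_el_scomb[OF u v] by (auto simp: gcomb_def)
    have U: "jet1 c q (scomb a b u v) i = smul (\<lambda>_. a) (jet1 c q u i) + smul (\<lambda>_. b) (jet1 c q v i)"
        if i: "i < bdim B" for i
    proof (rule pfree1_eqI[OF pfree_jet1])
      show "pfree 1 (smul (\<lambda>_. a) (jet1 c q u i) + smul (\<lambda>_. b) (jet1 c q v i))"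
          by (intro pfree_linear pfree_jet1)
      fix e p
      show "jet1 c q (scomb a b u v) i ({e}, {#}) p =
          (smul (\<lambda>_. a) (jet1 c q u i) + smul (\<lambda>_. b) (jet1 c q v i)) ({e}, {#}) p"
      proof (cases "e < 2 * brank B")
        case True
        note su = sec_el_smooth[OF u c(1) True] and sv = sec_el_smooth[OF v c(1) True]
        have "pd B (fst c) i (\<lambda>q. a * sec_el B u c ({e}, {#}) q + b * sec_el B v c ({e}, {#}) q) q =
          a * pd B (fst c) i (sec_el B u c ({e}, {#})) q + b * pd B (fst c) i (sec_el B v c ({e}, {#})) q"
          using pd_add[OF ch c(2) i smooth_fun_mult[OF patchD(3)[OF c(1)] smooth_fun_const su]
             smooth_fun_mult[OF patchD(3)[OF c(1)] smooth_fun_const sv]]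
            pd_mult[OF ch c(2) i smooth_fun_const su] pd_mult[OF ch c(2) i smooth_fun_const sv] by simp
        then show ?thesis by (simp add: jet1_apply smul_apply s)
      qed (simp add: jet1_apply smul_apply sec_el_index)
    qed
    have "Lop B (jet0 c q (scomb a b u v)) (jet1 c q (scomb a b u v)) G =
        smul (\<lambda>_. a) (Lop B (jet0 c q u) (jet1 c q u) G) + smul (\<lambda>_. b) (Lop B (jet0 c q v)
            (jet1 c q v) G)" for G
    proof -
      have "smul (jet0 c q (scomb a b u v) e) X =
          smul (\<lambda>_. a) (smul (jet0 c q u e) X) + smul (\<lambda>_. b) (smul (jet0 c q v e) X)" for e X
        by (rule loc_eqI) (simp add: jet0_def s smul_apply algebra_simps)
      moreover have "(\<Sum>i<bdim B. lmul (jet1 c q (scomb a b u v) i) (d_p i G)) =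
          smul (\<lambda>_. a) (\<Sum>i<bdim B. lmul (jet1 c q u i) (d_p i G)) + smul (\<lambda>_. b) (\<Sum>i<bdim B. lmul (jet1 c q v i)
              (d_p i G))"
        using U by (simp add: smul_sum lmul_add_left lmul_smul_left sum.distrib del: plus_fun_apply)
      ultimately show ?thesis
        unfolding Lop_def by (simp add: smul_sum smul_add sum.distrib add_ac del: plus_fun_apply)
    qed
    moreover have "freeze q (\<lbrace>sec_el B w, F\<rbrace> c) = Lop B (jet0 c q w) (jet1 c q w) (freeze q (F c))" for w
      unfolding big_bracket_def by (rule freeze_bracket_sec[OF homog_finsupp[OF F]])
    ultimately have "freeze q (\<lbrace>sec_el B (scomb a b u v), F\<rbrace> c) =
        smul (\<lambda>_. a) (freeze q (\<lbrace>sec_el B u, F\<rbrace> c)) + smul (\<lambda>_. b) (freeze q (\<lbrace>sec_el B v, F\<rbrace> c))"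
      by metis
    from fun_cong[OF fun_cong[OF this, of m], of q] show ?thesis
        by (simp add: freeze_apply gcomb_def smul_apply)
  qed
qed

lemma dorfman_scomb_right:
  assumes T: "T \<in> graded B 3" and u: "u \<in> sections_E B" and v: "v \<in> sections_E B" "w \<in> sections_E B"
  shows "dorfman B T u (scomb a b v w) = scomb a b (dorfman B T u v) (dorfman B T u w)"
proof (rule sec_el_eqD)
  note A = graded_homog[OF sec_bracket_graded[OF T _ u]]
  show "sec_el B (dorfman B T u (scomb a b v w)) = sec_el B (scomb a b (dorfman B T u v) (dorfman B T u w))"
    using A sec_bracket_scomb[OF v A]
    by (simp add: sec_el_scomb dorfman_sec T u v scomb_sections) (simp add: gcomb_def fun_eq_iff)
qed (intro dorfman_sec scomb_sections T u v)+

lemma dorfman_scomb_left: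
  assumes T: "T \<in> graded B 3" and u: "u \<in> sections_E B" "v \<in> sections_E B" and w: "w \<in> sections_E B"
  shows "dorfman B T (scomb a b u v) w = scomb a b (dorfman B T u w) (dorfman B T v w)"
proof (rule sec_el_eqD)
  have A: "homog 2 \<lbrace>sec_el B x, T\<rbrace>" if "x \<in> sections_E B" for x
    using graded_homog[OF sec_bracket_graded[OF T _ that]] by simp
  show "sec_el B (dorfman B T (scomb a b u v) w) = sec_el B (scomb a b (dorfman B T u w) (dorfman B T v w))"
    using sec_bracket_scomb[OF u graded_homog[OF T]] sec_bracket_gcomb[OF A[OF u(1)] A[OF u(2)]]
    by (simp add: sec_el_scomb dorfman_sec T u w scomb_sections) (simp add: gcomb_def fun_eq_iff)
qed (intro dorfman_sec scomb_sections T u w)+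

lemma sec_sec_bracket:
  assumes u: "u \<in> sections_E B" and v: "v \<in> sections_E B"
  shows "\<lbrace>sec_el B u, sec_el B v\<rbrace> = fun_el B (pairing u v)"
proof (intro ext)
  fix c m q
  have p: "homog 0 \<lbrace>sec_el B u, sec_el B v\<rbrace>"
    by (rule homog_bracket[OF graded_homog[OF sec_el_graded[OF u]] graded_homog[OF sec_el_graded[OF v]]]) simp
  show "\<lbrace>sec_el B u, sec_el B v\<rbrace> c m q = fun_el B (pairing u v) c m q"
  proof (cases "c \<in> patches B \<and> q \<in> pdom c \<and> m = ({}, {#})")
    case False
    have "\<lbrace>sec_el B u, sec_el B v\<rbrace> c m q = 0"
    proof (rule ccontr)
      assume nz: "\<lbrace>sec_el B u, sec_el B v\<rbrace> c m q \<noteq> 0"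
      then have "c \<in> patches B" "q \<in> pdom c" "m \<in> monomials B 0" using p unfolding homog_def by blast+
      moreover from this(3) have "m = ({}, {#})" by (auto simp: monomials_def dest: finite_subset)
      ultimately show False using False by simp
    qed
    then show ?thesis using False by (auto simp: fun_el_def on_patches_def smul_apply mon_el_def)
  next
    case True
    then have c: "c \<in> patches B" "q \<in> pdom c" and m: "m = ({}, {#})" by auto
    note fr = patchD(2)[OF c(1)] patchD(5)[OF c]
    have X: "fst u q \<in> fibre B q" "fst v q \<in> fibre B q" and
      xi: "linear_from (fibre B q) (snd u q)" "linear_from (fibre B q) (snd v q)"
      using u v by (auto simp: sections_E_def sections_A_def sections_As_def dual_fibre_def)
    have "\<lbrace>sec_el B u, sec_el B v\<rbrace> c m q =
        (\<Sum>e<2 * brank B. sec_el B u c ({e}, {#}) q * sec_el B v c ({star B e}, {#}) q)"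
      unfolding m big_bracket_def bracket_Lop[OF pfree_sec pfree_finsupp[OF pfree_sec]] Lop_pfree[OF pfree_sec]
      by (simp add: loc_sum_apply smul_apply d_left_apply)
    also have "\<dots> = (\<Sum>e<2 * brank B. ecomp (snd c) u e q * ecomp (snd c) v (star B e) q)"
      by (intro sum.cong) (auto simp: sec_el_ecomp c)
    also have "\<dots> = snd u q (fst v q) + snd v q (fst u q)"
      unfolding sum_double linear_expand[OF fr X(2) xi(1)] linear_expand[OF fr X(1) xi(2)]
      by (simp add: ecomp_def star_def mult.commute)
    finally show ?thesis using True by (simp add: fun_el_def on_patches_def smul_apply mon_el_def pairing_def)
  qed
qed

text \<open>Sections separate functions of positive degree, and this is used three times, once for
  each argument of the tensor.\<close>

lemma tensor_unique:
  assumes a: "a \<in> graded B 3" "a' \<in> graded B 3"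
    and eq: "\<And>u v w. u \<in> sections_E B \<Longrightarrow> v \<in> sections_E B \<Longrightarrow> w \<in> sections_E B \<Longrightarrow>
      \<lbrace>\<lbrace>\<lbrace>sec_el B u, a\<rbrace>, sec_el B v\<rbrace>, sec_el B w\<rbrace> = \<lbrace>\<lbrace>\<lbrace>sec_el B u, a'\<rbrace>, sec_el B v\<rbrace>, sec_el B w\<rbrace>"
  shows "a = a'"
proof (cases "brank B > 0")
  case False
  then have "m \<notin> monomials B 3" for m by (auto simp: monomials3)
  then have "a c m q = 0" "a' c m q = 0" for c m q
    using suppD[OF homog_supp[OF graded_homog[OF a(1)]]] suppD[OF homog_supp[OF graded_homog[OF a(2)]]]
        by blast+
  then show ?thesis by (intro ext) simp
next
  case r: True
  have A: "\<lbrace>sec_el B u, b\<rbrace> \<in> graded B 2" if "u \<in> sections_E B" "b \<in> graded B 3" for u b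
    using sec_bracket_graded[OF that(2) _ that(1)] by simp
  show ?thesis
  proof (rule gfun_eqI_sections[OF graded_homog[OF a(1)] graded_homog[OF a(2)] _ r])
    fix u assume u: "u \<in> sections_E B"
    show "\<lbrace>sec_el B u, a\<rbrace> = \<lbrace>sec_el B u, a'\<rbrace>"
    proof (rule gfun_eqI_sections[OF graded_homog[OF A[OF u a(1)]] graded_homog[OF A[OF u a(2)]] _ r])
      fix v assume v: "v \<in> sections_E B"
      \<comment> \<open>Expressing the inner bracket by a section turns the last bracket into a
        pairing. The pairing is symmetric, so the test section can be moved to the left.\<close>
      define s where "s = dorfman B a u v"
      define s' where "s' = dorfman B a' u v"
      note s = dorfman_sec[OF a(1) u v, folded s_def] and s' = dorfman_sec[OF a(2) u v, folded s'_def]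
      have "sec_el B s = sec_el B s'"
      proof (rule gfun_eqI_sections[OF graded_homog[OF sec_el_graded[OF s(1)]]
          graded_homog[OF sec_el_graded[OF s'(1)]] _ r])
        fix w assume w: "w \<in> sections_E B"
        have "\<lbrace>sec_el B s, sec_el B w\<rbrace> = \<lbrace>sec_el B s', sec_el B w\<rbrace>"
          unfolding s(3) s'(3) by (rule eq[OF u v w])
        then have "fun_el B (pairing s w) = fun_el B (pairing s' w)" using sec_sec_bracket w s(1) s'(1) by simp
        moreover have "pairing x w = pairing w x" for x by (auto simp: pairing_def)
        ultimately show "\<lbrace>sec_el B w, sec_el B s\<rbrace> = \<lbrace>sec_el B w, sec_el B s'\<rbrace>"
          using sec_sec_bracket w s(1) s'(1) by simp
      qed simp
      then show "\<lbrace>sec_el B v, \<lbrace>sec_el B u, a\<rbrace>\<rbrace> = \<lbrace>sec_el B v, \<lbrace>sec_el B u, a'\<rbrace>\<rbrace>"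
        using s(2) s'(2) by simp
    qed simp
  qed simp
qed

lemma tensor_el_eqI:
  assumes a: "a \<in> graded B 3"
    and eq: "\<And>u v w. u \<in> sections_E B \<Longrightarrow> v \<in> sections_E B \<Longrightarrow> w \<in> sections_E B \<Longrightarrow>
      fun_el B (t u v w) = \<lbrace>\<lbrace>\<lbrace>sec_el B u, a\<rbrace>, sec_el B v\<rbrace>, sec_el B w\<rbrace>"
  shows "tensor_el B t = a"
  unfolding tensor_el_def
proof (rule the_equality)
  fix b assume b: "b \<in> graded B 3 \<and> (\<forall>u\<in>sections_E B. \<forall>v\<in>sections_E B. \<forall>w\<in>sections_E B.
     fun_el B (t u v w) = \<lbrace>\<lbrace>\<lbrace>sec_el B u, b\<rbrace>, sec_el B v\<rbrace>, sec_el B w\<rbrace>)"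
  show "b = a" by (rule tensor_unique) (use a b eq in auto)
qed (use a eq in auto)

end

section \<open>Endomorphisms as functions of degree 2\<close>

context vbun
begin

definition ncoef :: "('m \<Rightarrow> 'v \<Rightarrow> 'v) \<Rightarrow> ('m, 'v) frame \<Rightarrow> nat \<Rightarrow> nat \<Rightarrow> 'm \<Rightarrow> real" where
  "ncoef N fr \<alpha> \<beta> q = dual_frame B fr \<alpha> q (N q (snd fr \<beta> q))"

lemma zero_sections: "0 \<in> sections_A B" "0 \<in> sections_As B"
proof -
  \<comment> \<open>Some section exists because the function 0 comes from one; the zero section is
    then \<open>u - u\<close>.\<close>
  obtain u where u: "u \<in> sections_E B" using graded1_section[OF graded_zero] by blast
  have "u - u \<in> sections_E B" by (rule sections_E_linear[OF u u])
  then have "(0, 0) \<in> sections_E B" by (simp add: zero_prod_def)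
  then show "0 \<in> sections_A B" "0 \<in> sections_As B" by (auto simp: sections_E_def)
qed

lemma bracket_zero: "\<lbrace>F, 0\<rbrace> = 0" "\<lbrace>0, F\<rbrace> = 0"
proof -
  have d: "d_x B ch i 0 = 0" "d_p i 0 = 0" "d_left i 0 = 0" "d_right i 0 = 0" for ch i
    by (rule loc_eqI, simp add: d_x_def d_p_def d_left_def d_right_def)+
  have "local_bracket B ch G 0 = 0" "local_bracket B ch 0 G = 0" for ch G
    unfolding local_bracket_def d lmul_zero by (simp_all del: zero_fun_apply)
  then show "\<lbrace>F, 0\<rbrace> = 0" "\<lbrace>0, F\<rbrace> = 0"
    by (auto simp: big_bracket_def)
qed

end

locale vbun_endo = vbun B for B :: "('m::{t2_space, second_countable_topology}, 'v::real_vector) vbundle"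
    (structure) +
  fixes N :: "'m \<Rightarrow> 'v \<Rightarrow> 'v"
  assumes N: "bundle_endo B N"
begin

abbreviation E where "E \<equiv> endo_el B N"
abbreviation P where "P \<equiv> endo_E B N"

lemma N_linear: "linear_from (fibre B q) (N q)"
  using N by (simp add: bundle_endo_def)

lemma N_fibre: "v \<in> fibre B q \<Longrightarrow> N q v \<in> fibre B q"
  using N by (auto simp: bundle_endo_def)

lemma ncoef_smooth: "fr \<in> frames B \<Longrightarrow> \<alpha> < brank B \<Longrightarrow> \<beta> < brank B \<Longrightarrow> smooth_fun B (fst fr) (ncoef N fr \<alpha> \<beta>)"
  using N unfolding bundle_endo_def ncoef_def by blast

lemma endo_el_sum: "E = on_patches B (\<lambda>c. \<Sum>\<alpha><brank B. \<Sum>\<beta><brank B.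
    smul (ncoef N (snd c) \<alpha> \<beta>) (lmul (zeta \<beta>) (zeta (brank B + \<alpha>))))"
proof -
  have "(mon_el ({\<beta>, brank B + \<alpha>}, {#}) :: 'm loc) = lmul (zeta \<beta>) (zeta (brank B + \<alpha>))" if "\<beta> < brank B"
      for \<alpha> \<beta>
    using that by (simp add: zeta2)
  then show ?thesis unfolding endo_el_def ncoef_def
    by (intro arg_cong[of _ _ "on_patches B"] ext) (simp add: loc_sum_apply smul_apply)
qed

lemma endo_el_apply:
  "E c m q = (if c \<in> patches B \<and> q \<in> pdom c then (\<Sum>\<alpha><brank B. \<Sum>\<beta><brank B.
    ncoef N (snd c) \<alpha> \<beta> q * mon_el ({\<beta>, brank B + \<alpha>}, {#}) m q) else 0)"
  by (simp add: endo_el_def on_patches_def loc_sum_apply smul_apply ncoef_def)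

lemma supp_endo: "supp (\<lambda>m. m \<in> monomials B 2 \<and> snd m = {#}) (E c)"
proof (rule suppI, rule ccontr)
  fix S K q assume nz: "E c (S, K) q \<noteq> 0" and "\<not> ((S, K) \<in> monomials B 2 \<and> snd (S, K) = {#})"
  then have "mon_el ({\<beta>, brank B + \<alpha>}, {#}) (S, K) q = 0" if "\<alpha> < brank B" "\<beta> < brank B" for \<alpha> \<beta>
    using that by (auto simp: mon_el_def monomials_def)
  then show False using nz by (auto simp: endo_el_apply split: if_splits)
qed

lemma pfree_endo: "pfree 2 (E c)"
proof (rule pfreeI)
  fix S K q assume "E c (S, K) q \<noteq> 0"
  from suppD[OF supp_endo this] show "finite S \<and> card S = 2 \<and> K = {#}"
    by (auto simp: monomials_def dest: finite_subset)
qed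

lemma homog_endo: "homog 2 E"
  unfolding homog_def
proof (intro conjI allI ballI impI)
  fix c m q assume nz: "E c m q \<noteq> 0"
  then show "c \<in> patches B" "q \<in> pdom c" by (auto simp: endo_el_apply split: if_splits)
  show "m \<in> monomials B 2" using suppD[OF supp_endo nz] by blast
next
  fix c m assume c: "c \<in> patches B"
  have "smooth_fun B (pdom c) (\<lambda>q. \<Sum>\<alpha><brank B. \<Sum>\<beta><brank B. ncoef N (snd c) \<alpha> \<beta> q * mon_el ({\<beta>, brank B + \<alpha>},
      {#}) m q)"
    unfolding mon_el_def
    by (intro smooth_fun_sum smooth_fun_mult patchD(3)[OF c] smooth_fun_const
        smooth_fun_subset[OF ncoef_smooth[OF patchD(2)[OF c]]]) (auto simp: pdom_def)
  then show "smooth_fun B (pdom c) (E c m)"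
    by (rule smooth_fun_cong[OF patchD(3)[OF c], rotated]) (simp add: endo_el_apply c)
qed

lemma ecomp_endo:
  assumes u: "u \<in> sections_E B" and fr: "fr \<in> frames B" "q \<in> fst fr" and \<alpha>: "\<alpha> < brank B"
  shows "ecomp fr (P u) \<alpha> q = - (\<Sum>\<beta><brank B. ncoef N fr \<beta> \<alpha> q * ecomp fr u \<beta> q)"
    "ecomp fr (P u) (brank B + \<alpha>) q = (\<Sum>\<beta><brank B. ncoef N fr \<alpha> \<beta> q * ecomp fr u (brank B + \<beta>) q)"
proof -
  have X: "fst u q \<in> fibre B q" and xi: "linear_from (fibre B q) (snd u q)"
    using u by (auto simp: sections_E_def sections_A_def sections_As_def dual_fibre_def)
  note e = frame_in_fibre[OF fr]
  have "snd u q (N q (snd fr \<alpha> q)) = (\<Sum>\<beta><brank B. dual_frame B fr \<beta> q (N q (snd fr \<alpha> q)) *\<^sub>R snd u q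
      (snd fr \<beta> q))"
    by (rule linear_expand[OF fr N_fibre[OF e[OF \<alpha>]] xi])
  then show "ecomp fr (P u) \<alpha> q = - (\<Sum>\<beta><brank B. ncoef N fr \<beta> \<alpha> q * ecomp fr u \<beta> q)"
    using \<alpha> e[OF \<alpha>] by (simp add: ecomp_def endo_E_def transpose_A_def ncoef_def fun_Compl_def)
  have "N q (fst u q) = (\<Sum>\<beta><brank B. dual_frame B fr \<beta> q (fst u q) *\<^sub>R N q (snd fr \<beta> q))"
    by (rule linear_expand[OF fr X N_linear])
  moreover have "dual_frame B fr \<alpha> q (\<Sum>\<beta><brank B. dual_frame B fr \<beta> q (fst u q) *\<^sub>R N q (snd fr \<beta> q)) =
      (\<Sum>\<beta><brank B. dual_frame B fr \<beta> q (fst u q) *\<^sub>R dual_frame B fr \<alpha> q (N q (snd fr \<beta> q)))"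
    by (rule linear_from_sum[OF dual_frame_linear[OF fr] subspace_fibre]) (simp add: N_fibre e)
  ultimately have "dual_frame B fr \<alpha> q (N q (fst u q)) =
      (\<Sum>\<beta><brank B. dual_frame B fr \<beta> q (fst u q) *\<^sub>R dual_frame B fr \<alpha> q (N q (snd fr \<beta> q)))"
    by simp
  then show "ecomp fr (P u) (brank B + \<alpha>) q = (\<Sum>\<beta><brank B. ncoef N fr \<alpha> \<beta> q * ecomp fr u (brank B + \<beta>) q)"
    by (simp add: ecomp_def endo_E_def endo_A_def ncoef_def mult.commute)
qed

lemma endo_sections:
  assumes u: "u \<in> sections_E B"
  shows "P u \<in> sections_E B"
proof -
  have "smooth_fun B (fst fr) (ecomp fr (P u) \<alpha>)" "smooth_fun B (fst fr) (ecomp fr (P u) (brank B + \<alpha>))"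
    if fr: "fr \<in> frames B" and \<alpha>: "\<alpha> < brank B" for fr \<alpha>
  proof -
    note o = frameD(1)[OF fr] and s = ncoef_smooth[OF fr] ecomp_smooth[OF u fr]
    have "smooth_fun B (fst fr) (\<lambda>q. - (\<Sum>\<beta><brank B. ncoef N fr \<beta> \<alpha> q * ecomp fr u \<beta> q))"
      using \<alpha> by (intro smooth_fun_uminus smooth_fun_sum smooth_fun_mult o s) auto
    then show "smooth_fun B (fst fr) (ecomp fr (P u) \<alpha>)"
      by (rule smooth_fun_cong[OF o, rotated]) (simp add: ecomp_endo[OF u fr _ \<alpha>])
    have "smooth_fun B (fst fr) (\<lambda>q. \<Sum>\<beta><brank B. ncoef N fr \<alpha> \<beta> q * ecomp fr u (brank B + \<beta>) q)"
      using \<alpha> by (intro smooth_fun_sum smooth_fun_mult o s) auto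
    then show "smooth_fun B (fst fr) (ecomp fr (P u) (brank B + \<alpha>))"
      by (rule smooth_fun_cong[OF o, rotated]) (simp add: ecomp_endo[OF u fr _ \<alpha>])
  qed
  then have "smooth_fun B (fst fr) (\<lambda>q. dual_frame B fr \<alpha> q (fst (P u) q))"
    "smooth_fun B (fst fr) (\<lambda>q. snd (P u) q (snd fr \<alpha> q))" if "fr \<in> frames B" "\<alpha> < brank B" for fr \<alpha>
    using that by (simp_all add: ecomp_def[abs_def])
  moreover have "fst (P u) q \<in> fibre B q" for q
    using u N_fibre by (auto simp: endo_E_def endo_A_def sections_E_def sections_A_def)
  moreover have "snd (P u) q \<in> dual_fibre B q" for q
  proof -
    have "snd u q \<in> dual_fibre B q" using u by (auto simp: sections_E_def sections_As_def)
    then show ?thesis using N_linear[of q] N_fibre[of _ q] subspace_fibre[of q]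
      by (simp add: endo_E_def transpose_A_def dual_fibre_def linear_from_def subspace_add subspace_scale
          fun_Compl_def)
  qed
  ultimately show ?thesis unfolding sections_E_def sections_A_def sections_As_def by (simp add: mem_Times_iff)
qed

text \<open>In {u, \<tau>^\<beta> \<theta>_\<alpha>} the variable \<tau>^\<beta> pairs with the
  vector part of \<open>u\<close> and \<theta>_\<alpha>, with the opposite sign, with the covector
  part. This yields N on A and minus its transpose on the dual.\<close>

lemma sec_endo:
  assumes u: "u \<in> sections_E B"
  shows "sec_el B (P u) = \<lbrace>sec_el B u, E\<rbrace>"
proof (intro ext)
  fix c m q
  have p: "homog 1 \<lbrace>sec_el B u, E\<rbrace>"
    by (rule homog_bracket[OF graded_homog[OF sec_el_graded[OF u]] homog_endo]) simp
  note p' = graded_homog[OF sec_el_graded[OF endo_sections[OF u]]]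
  show "sec_el B (P u) c m q = \<lbrace>sec_el B u, E\<rbrace> c m q"
  proof (cases "c \<in> patches B \<and> q \<in> pdom c")
    case False
    then show ?thesis using homog_outside[OF p] homog_outside[OF p'] by simp
  next
    case True
    then have c: "c \<in> patches B" "q \<in> pdom c" by auto
    note fr = patchD(2)[OF c(1)] patchD(5)[OF c]
    let ?n = "\<lambda>\<alpha> \<beta>. ncoef N (snd c) \<alpha> \<beta> q"
    have freeze: "freeze q (E c) = (\<Sum>\<alpha><brank B. \<Sum>\<beta><brank B. smul (\<lambda>_. ?n \<alpha> \<beta>)
        (lmul (zeta \<beta>) (zeta (brank B + \<alpha>))))"
      unfolding endo_el_sum using c by (intro loc_eqI)
          (simp add: on_patches_def freeze_apply loc_sum_apply smul_apply lmul_apply zeta_def mon_el_def)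
    have L: "freeze q (\<lbrace>sec_el B u, E\<rbrace> c) = (\<Sum>\<alpha><brank B. \<Sum>\<beta><brank B. smul (\<lambda>_. ?n \<alpha> \<beta>)
        (smul (jet0 c q u (brank B + \<beta>)) (zeta (brank B + \<alpha>)) - smul (jet0 c q u \<alpha>) (zeta \<beta>)))"
      unfolding big_bracket_def freeze_bracket_sec[OF homog_finsupp[OF homog_endo]] freeze Lop_linear Lop_sum
      by (intro arg_cong2[where f = smul] sum.cong refl) (auto simp: Lop_zeta_zeta star_def)
    have "freeze q (sec_el B (P u) c) = freeze q (\<lbrace>sec_el B u, E\<rbrace> c)"
    proof (rule pfree1_eqI)
      show "pfree 1 (freeze q (sec_el B (P u) c))" by (intro pfree_freeze pfree_sec)
      show "pfree 1 (freeze q (\<lbrace>sec_el B u, E\<rbrace> c))" unfolding L by (intro pfree_sum pfree_linear pfree_zeta)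
      fix b p
      have R: "freeze q (\<lbrace>sec_el B u, E\<rbrace> c) ({b}, {#}) p = (\<Sum>\<alpha><brank B. \<Sum>\<beta><brank B. ?n \<alpha> \<beta> *
        (sec_el B u c ({brank B + \<beta>}, {#}) q * (if b = brank B + \<alpha> then 1 else 0) - sec_el B u c ({\<alpha>}, {#}) q *
            (if b = \<beta> then 1 else 0)))"
        unfolding L by (simp add: loc_sum_apply smul_apply zeta_apply jet0_def)
      consider "b < brank B" | \<alpha> where "b = brank B + \<alpha>" "\<alpha> < brank B" | "\<not> b < 2 * brank B"
        by (metis add.commute le_add_diff_inverse less_diff_conv2 mult_2 not_le)
      then show "freeze q (sec_el B (P u) c) ({b}, {#}) p = freeze q (\<lbrace>sec_el B u, E\<rbrace> c) ({b}, {#}) p"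
      proof cases
        case 1
        have "(\<Sum>\<alpha><brank B. \<Sum>\<beta><brank B. ?n \<alpha> \<beta> *
          (sec_el B u c ({brank B + \<beta>}, {#}) q * (if b = brank B + \<alpha> then 1 else 0) - sec_el B u c
              ({\<alpha>}, {#}) q * (if b = \<beta> then 1 else 0))) =
          (\<Sum>\<alpha><brank B. \<Sum>\<beta><brank B. if \<beta> = b then - (?n \<alpha> b * ecomp (snd c) u \<alpha> q) else 0)"
          using 1 by (intro sum.cong refl) (auto simp: sec_el_ecomp c)
        then show ?thesis unfolding R using 1 ecomp_endo(1)[OF u fr 1]
          by (simp add: freeze_apply sec_el_ecomp c sum_negf)
      next
        case 2
        have "(\<Sum>\<alpha>'<brank B. \<Sum>\<beta><brank B. ?n \<alpha>' \<beta> *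
          (sec_el B u c ({brank B + \<beta>}, {#}) q * (if b = brank B + \<alpha>' then 1 else 0) - sec_el B u c
              ({\<alpha>'}, {#}) q * (if b = \<beta> then 1 else 0))) =
          (\<Sum>\<alpha>'<brank B. if \<alpha>' = \<alpha> then \<Sum>\<beta><brank B. ?n \<alpha> \<beta> * ecomp (snd c) u (brank B + \<beta>) q else 0)"
          using 2 by (intro sum.cong refl) (auto simp: sec_el_ecomp c)
        then show ?thesis unfolding R using 2 ecomp_endo(2)[OF u fr 2(2)]
          by (simp add: freeze_apply sec_el_ecomp c)
      next
        case 3
        then have "(\<Sum>\<alpha><brank B. \<Sum>\<beta><brank B. ?n \<alpha> \<beta> *
          (sec_el B u c ({brank B + \<beta>}, {#}) q * (if b = brank B + \<alpha> then 1 else 0) - sec_el B u c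
              ({\<alpha>}, {#}) q * (if b = \<beta> then 1 else 0))) = 0"
          by (intro sum.neutral ballI) auto
        then show ?thesis unfolding R using 3 by (simp add: freeze_apply sec_el_index)
      qed
    qed
    from fun_cong[OF fun_cong[OF this, of m], of q] show ?thesis by (simp add: freeze_apply)
  qed
qed

text \<open>The transformation law needs no computation: the brackets with sections are sections
  again, and \<open>gradedI_sections\<close> applies. In rank 0 the element is 0.\<close>

lemma endo_graded: "E \<in> graded B 2"
proof (cases "brank B > 0")
  case True
  show ?thesis
    by (rule gradedI_sections[OF homog_endo])
        (use True sec_endo sec_el_graded endo_sections in \<open>auto simp flip: sec_endo\<close>)
next
  case False
  then have "E = 0" by (intro ext) (simp add: endo_el_apply)
  then show ?thesis using graded_zero by simp
qed

lemma Lop_cong: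
  assumes "\<And>a. a < 2 * brank B \<Longrightarrow> u a = v a" "\<And>i. i < bdim B \<Longrightarrow> U i = V i"
  shows "Lop B u U G = Lop B v V G"
  unfolding Lop_def using assms by simp

lemma pd_d_left:
  assumes "c \<in> patches B" "q \<in> pdom c" "i < bdim B" "\<And>m. smooth_fun B (pdom c) (F m)"
  shows "pd B (fst c) i (d_left a F m) q = d_left a (d_x B (fst c) i F) m q"
proof -
  note ch = patchD(1)[OF assms(1)] patchD(4)[OF assms(1,2)]
  obtain S K where m: "m = (S, K)" by (metis surj_pair)
  show ?thesis
  proof (cases "a \<in> S")
    case True
    then have "d_left a F m = (\<lambda>_. 0)" by (auto simp: m d_left_apply)
    then show ?thesis using True by (simp add: m d_left_apply)
  next
    case False
    then have "d_left a F m = (\<lambda>p. ksign {a} S * F (insert a S, K) p)" by (auto simp: m d_left_apply)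
    then show ?thesis using False pd_mult[OF ch assms(2,3) smooth_fun_const assms(4)]
      by (simp add: m d_left_apply d_x_def)
  qed
qed

lemma endo_jacobi:
  assumes u: "u \<in> sections_E B" and G: "homog k G" and k: "k > 0"
  shows "\<lbrace>sec_el B u, \<lbrace>E, G\<rbrace>\<rbrace> = \<lbrace>sec_el B (P u), G\<rbrace> + \<lbrace>E, \<lbrace>sec_el B u, G\<rbrace>\<rbrace>"
proof (intro ext)
  fix c m q
  note su = graded_homog[OF sec_el_graded[OF u]] and sP = graded_homog[OF sec_el_graded[OF endo_sections[OF u]]]
  have EG: "homog k \<lbrace>E, G\<rbrace>" by (rule homog_bracket[OF homog_endo G]) simp
  have uEG: "homog (k - 1) \<lbrace>sec_el B u, \<lbrace>E, G\<rbrace>\<rbrace>" by (rule homog_bracket[OF su EG]) (use k in simp)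
  have PG: "homog (k - 1) \<lbrace>sec_el B (P u), G\<rbrace>" by (rule homog_bracket[OF sP G]) (use k in simp)
  have uG: "homog (k - 1) \<lbrace>sec_el B u, G\<rbrace>" by (rule homog_bracket[OF su G]) (use k in simp)
  have EuG: "homog (k - 1) \<lbrace>E, \<lbrace>sec_el B u, G\<rbrace>\<rbrace>" by (rule homog_bracket[OF homog_endo uG]) simp
  show "\<lbrace>sec_el B u, \<lbrace>E, G\<rbrace>\<rbrace> c m q = (\<lbrace>sec_el B (P u), G\<rbrace> + \<lbrace>E, \<lbrace>sec_el B u, G\<rbrace>\<rbrace>) c m q"
  proof (cases "c \<in> patches B \<and> q \<in> pdom c")
    case False
    then show ?thesis using homog_outside[OF uEG] homog_outside[OF PG] homog_outside[OF EuG] by simp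
  next
    case True
    then have c: "c \<in> patches B" "q \<in> pdom c" by auto
    note ch = patchD(1)[OF c(1)] patchD(4)[OF c]
    let ?E = "freeze q (E c)" and ?Ex = "\<lambda>i. freeze q (d_x B (fst c) i (E c))" and ?G = "freeze q (G c)"
    have pE: "pfree 2 ?E" and pEx: "pfree 2 (?Ex i)" for i
      by (intro pfree_freeze pfree_d_x pfree_endo)+
    have p1: "pfree 1 (d_left a ?E)" "pfree 1 (d_left a (?Ex i))" for a i
      using pfree_d_left[of 1 ?E] pfree_d_left[of 1 "?Ex i"] pE pEx[of i] by (simp_all add: numeral_2_eq_2)
    have D: "freeze q (\<lbrace>E, H\<rbrace> c) = Dop B ?E ?Ex (freeze q (H c))" for H
      unfolding big_bracket_def bracket_Dop[OF pfree_endo] freeze_Dop ..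
    have S: "freeze q (\<lbrace>sec_el B w, H\<rbrace> c) = Lop B (jet0 c q w) (jet1 c q w) (freeze q (H c))" if "finsupp (H c)"
        for w H
      unfolding big_bracket_def by (rule freeze_bracket_sec[OF that])
    have fG: "finsupp ?G" by (intro finsupp_freeze homog_finsupp[OF G])
    have val: "sec_el B (P u) c ({b}, {#}) p =
        (\<Sum>a<2 * brank B. sec_el B u c ({a}, {#}) p * d_left (star B a) (E c) ({b}, {#}) p)" for b p
      unfolding sec_endo[OF u] big_bracket_def bracket_Lop[OF pfree_sec homog_finsupp[OF homog_endo]]
          Lop_pfree[OF pfree_endo]
      by (simp add: loc_sum_apply smul_apply)
    \<comment> \<open>The 1-jet of \<open>P u\<close> is expressed by the 1-jets of \<open>u\<close>
      and of the endomorphism, in the form in which it occurs in \<open>Lop_Dop\<close>. For the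
      derivatives this is the Leibniz rule followed by a reindexing along
      \<open>star\<close>.\<close>
    have J: "Lop B (jet0 c q (P u)) (jet1 c q (P u)) H = Lop B
      (\<lambda>e p. \<Sum>a<2 * brank B. jet0 c q u a p * d_left e (d_left (star B a) ?E) ({}, {#}) p)
      (\<lambda>i. (\<Sum>a<2 * brank B. smul (jet0 c q u a) (d_left (star B a) (?Ex i))) +
           (\<Sum>e<2 * brank B. smul (d_left (star B e) (jet1 c q u i) ({}, {#})) (d_left e ?E))) H" for H
    proof (rule Lop_cong)
      fix e
      show "jet0 c q (P u) e = (\<lambda>p. \<Sum>a<2 * brank B. jet0 c q u a p * d_left e (d_left (star B a) ?E) ({},
          {#}) p)"
        unfolding jet0_def val by (rule ext) (simp add: d_left_apply freeze_apply cong: if_cong)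
    next
      fix i assume i: "i < bdim B"
      show "jet1 c q (P u) i = (\<Sum>a<2 * brank B. smul (jet0 c q u a) (d_left (star B a) (?Ex i))) +
           (\<Sum>e<2 * brank B. smul (d_left (star B e) (jet1 c q u i) ({}, {#})) (d_left e ?E))"
      proof (rule pfree1_eqI[OF pfree_jet1])
        show "pfree 1 ((\<Sum>a<2 * brank B. smul (jet0 c q u a) (d_left (star B a) (?Ex i))) +
           (\<Sum>e<2 * brank B. smul (d_left (star B e) (jet1 c q u i) ({}, {#})) (d_left e ?E)))"
          by (intro pfree_linear pfree_sum p1)
        fix b p
        have sE: "smooth_fun B (pdom c) (E c m')" for m' by (rule homog_smooth[OF homog_endo c(1)])
        have sdE: "smooth_fun B (pdom c) (d_left a (E c) ({b}, {#}))" for a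
        proof (cases "a = b")
          case True
          then have "d_left a (E c) ({b}, {#}) = (\<lambda>_. 0)" by (auto simp: d_left_apply)
          then show ?thesis by simp
        next
          case False
          then have "d_left a (E c) ({b}, {#}) = (\<lambda>p. ksign {a} {b} * E c ({a, b}, {#}) p)"
              by (auto simp: d_left_apply)
          then show ?thesis using patchD(3)[OF c(1)] sE by (auto intro!: smooth_fun_mult smooth_fun_uminus)
        qed
        have ss: "smooth_fun B (pdom c) (sec_el B u c ({a}, {#}))" if "a < 2 * brank B" for a
          by (rule sec_el_smooth[OF u c(1) that])
        have "jet1 c q (P u) i ({b}, {#}) p =
            pd B (fst c) i (\<lambda>p. \<Sum>a<2 * brank B. sec_el B u c ({a}, {#}) p * d_left (star B a) (E c)
                ({b}, {#}) p) q"
          unfolding jet1_apply by (rule arg_cong[of _ _ "\<lambda>f. pd B (fst c) i f q"]) (rule ext, rule val)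
        also have "\<dots> = (\<Sum>a<2 * brank B. pd B (fst c) i
            (\<lambda>p. sec_el B u c ({a}, {#}) p * d_left (star B a) (E c) ({b}, {#}) p) q)"
          by (rule pd_sum[OF ch c(2) patchD(3)[OF c(1)] i])
              (auto intro!: smooth_fun_mult ss sdE patchD(3)[OF c(1)])
        also have "\<dots> = (\<Sum>a<2 * brank B. pd B (fst c) i (sec_el B u c ({a}, {#})) q * d_left (star B a) (E c)
            ({b}, {#}) q +
            sec_el B u c ({a}, {#}) q * pd B (fst c) i (d_left (star B a) (E c) ({b}, {#})) q)"
          by (intro sum.cong refl pd_mult[OF ch c(2) i ss sdE]) auto
        also have "\<dots> = (\<Sum>a<2 * brank B. pd B (fst c) i (sec_el B u c ({a}, {#})) q * d_left (star B a) (E c)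
            ({b}, {#}) q) +
            (\<Sum>a<2 * brank B. sec_el B u c ({a}, {#}) q * d_left (star B a) (d_x B (fst c) i (E c))
                ({b}, {#}) q)"
          by (simp add: sum.distrib pd_d_left[OF c i sE])
        also have "(\<Sum>a<2 * brank B. pd B (fst c) i (sec_el B u c ({a}, {#})) q * d_left (star B a) (E c) ({b},
            {#}) q) =
            (\<Sum>e<2 * brank B. pd B (fst c) i (sec_el B u c ({star B e}, {#})) q * d_left (star B (star B e))
                (E c) ({b}, {#}) q)"
          by (rule sum_star[symmetric])
        also have "\<dots> = (\<Sum>e<2 * brank B. pd B (fst c) i (sec_el B u c ({star B e}, {#})) q * d_left e (E c) ({b},
            {#}) q)"
          by (intro sum.cong) auto
        finally show "jet1 c q (P u) i ({b}, {#}) p =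
            ((\<Sum>a<2 * brank B. smul (jet0 c q u a) (d_left (star B a) (?Ex i))) +
           (\<Sum>e<2 * brank B. smul (d_left (star B e) (jet1 c q u i) ({}, {#})) (d_left e ?E))) ({b}, {#}) p"
          by (simp add: loc_sum_apply smul_apply jet0_def freeze_apply jet1_apply d_left_apply[of _ _ "{}"]
              freeze_d_left[symmetric])
      qed
    qed
    have "freeze q (\<lbrace>sec_el B u, \<lbrace>E, G\<rbrace>\<rbrace> c) =
        freeze q (\<lbrace>E, \<lbrace>sec_el B u, G\<rbrace>\<rbrace> c) + freeze q (\<lbrace>sec_el B (P u), G\<rbrace> c)"
      unfolding S[OF homog_finsupp[OF EG]] S[OF homog_finsupp[OF G]] D J
      by (rule Lop_Dop[OF pE pEx pfree_jet1 fG])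
    from fun_cong[OF fun_cong[OF this, of m], of q] show ?thesis by (simp add: freeze_apply)
  qed
qed

end

section \<open>The torsion of an endomorphism of constant square\<close>

context vbun_endo
begin

lemma endo_bracket_gcomb: "\<lbrace>E, gcomb a b F G\<rbrace> = gcomb a b \<lbrace>E, F\<rbrace> \<lbrace>E, G\<rbrace>"
  by (rule ext) (simp add: big_bracket_def gcomb_loc bracket_Dop[OF pfree_endo] Dop_linear del: plus_fun_apply)

lemma endo_bracket_sec: "u \<in> sections_E B \<Longrightarrow> \<lbrace>E, sec_el B u\<rbrace> = - sec_el B (P u)"
  using bracket_sec_right[OF homog_endo] sec_endo by simp

lemma endo_scomb:
  assumes u: "u \<in> sections_E B" and v: "v \<in> sections_E B"
  shows "P (scomb a b u v) = scomb a b (P u) (P v)"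
proof (rule sec_el_eqD)
  show "sec_el B (P (scomb a b u v)) = sec_el B (scomb a b (P u) (P v))"
    using sec_bracket_scomb[OF u v homog_endo]
        by (simp add: sec_endo scomb_sections endo_sections u v sec_el_scomb)
qed (intro endo_sections scomb_sections u v)+

lemma endo_linear:
  assumes "u \<in> sections_E B" "v \<in> sections_E B"
  shows "P (u + v) = P u + P v" "P (u - v) = P u - P v" "P (- u) = - P u"
  unfolding scomb_plus scomb_minus scomb_uminus by (intro endo_scomb assms)+

text \<open>By \<open>endo_jacobi\<close> the bracket with a section is expressed through brackets
  already known to transform correctly, since {u, A} is itself a section. Degree 3 is reduced to
  this case in the same way.\<close>

lemma endo_bracket_graded_2:
  assumes A: "A \<in> graded B 2"
  shows "\<lbrace>E, A\<rbrace> \<in> graded B 2"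
proof (cases "brank B > 0")
  case False
  then have "E = 0" by (intro ext) (simp add: endo_el_apply)
  then show ?thesis by (simp only: bracket_zero graded_zero)
next
  case True
  show ?thesis
  proof (rule gradedI_sections)
    show "homog 2 \<lbrace>E, A\<rbrace>" by (rule homog_bracket[OF homog_endo graded_homog[OF A]]) simp
    fix u assume u: "u \<in> sections_E B"
    have "\<lbrace>sec_el B u, A\<rbrace> \<in> graded B 1" using sec_bracket_graded[OF A _ u] by simp
    then obtain s where s: "s \<in> sections_E B" "sec_el B s = \<lbrace>sec_el B u, A\<rbrace>" by (rule graded1_section)
    have "\<lbrace>sec_el B u, \<lbrace>E, A\<rbrace>\<rbrace> = \<lbrace>sec_el B (P u), A\<rbrace> + - sec_el B (P s)"
      using endo_jacobi[OF u graded_homog[OF A]] s(2)[symmetric] endo_bracket_sec[OF s(1)] by simp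
    moreover have "\<lbrace>sec_el B (P u), A\<rbrace> \<in> graded B 1"
      using sec_bracket_graded[OF A _ endo_sections[OF u]] by simp
    then have "\<lbrace>sec_el B (P u), A\<rbrace> + - sec_el B (P s) \<in> graded B 1"
      by (intro graded_linear sec_el_graded endo_sections s(1))
    ultimately show "\<lbrace>sec_el B u, \<lbrace>E, A\<rbrace>\<rbrace> \<in> graded B (2 - 1)" by simp
  qed (use True in auto)
qed

lemma endo_bracket_graded_3:
  assumes T: "T \<in> graded B 3"
  shows "\<lbrace>E, T\<rbrace> \<in> graded B 3"
proof (rule gradedI_sections)
  show "homog 3 \<lbrace>E, T\<rbrace>" by (rule homog_bracket[OF homog_endo graded_homog[OF T]]) simp
  fix u assume u: "u \<in> sections_E B"
  have g: "\<lbrace>sec_el B w, T\<rbrace> \<in> graded B 2" if "w \<in> sections_E B" for w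
    using sec_bracket_graded[OF T _ that] by simp
  have "\<lbrace>sec_el B u, \<lbrace>E, T\<rbrace>\<rbrace> = \<lbrace>sec_el B (P u), T\<rbrace> + \<lbrace>E, \<lbrace>sec_el B u, T\<rbrace>\<rbrace>"
    using endo_jacobi[OF u graded_homog[OF T]] by simp
  moreover have "\<dots> \<in> graded B 2"
    by (intro graded_linear(1) g endo_sections endo_bracket_graded_2 u)
  ultimately show "\<lbrace>sec_el B u, \<lbrace>E, T\<rbrace>\<rbrace> \<in> graded B (3 - 1)" by simp
qed auto

lemma dorfman_endo:
  assumes T: "T \<in> graded B 3" and u: "u \<in> sections_E B" and v: "v \<in> sections_E B"
  shows "dorfman B \<lbrace>E, T\<rbrace> u v = dorfman B T (P u) v + dorfman B T u (P v) - P (dorfman B T u v)"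
proof (rule sec_el_eqD)
  let ?D = "dorfman B T"
  note Pu = endo_sections[OF u] and Pv = endo_sections[OF v] and ET = endo_bracket_graded_3[OF T]
  note D = dorfman_sec[OF T]
  show "dorfman B \<lbrace>E, T\<rbrace> u v \<in> sections_E B" by (rule dorfman_sec[OF ET u v])
  show "?D (P u) v + ?D u (P v) - P (?D u v) \<in> sections_E B"
    by (intro sections_E_linear endo_sections D u v Pu Pv)
  define A where "A = \<lbrace>sec_el B u, T\<rbrace>"
  have A: "A \<in> graded B 2" using sec_bracket_graded[OF T _ u] by (simp add: A_def)
  have C: "\<lbrace>sec_el B (P u), T\<rbrace> \<in> graded B 2" using sec_bracket_graded[OF T _ Pu] by simp
  have EA: "\<lbrace>E, A\<rbrace> \<in> graded B 2" by (rule endo_bracket_graded_2[OF A])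
  \<comment> \<open>The derived bracket has \<open>v\<close> on the right. As \<open>A\<close> has
    even degree, moving \<open>v\<close> to the left changes the sign.\<close>
  have vA: "\<lbrace>sec_el B v, A\<rbrace> = sec_el B (- ?D u v)"
    using D(2)[OF u v] sec_el_linear(3)[OF D(1)[OF u v] u] by (simp add: A_def)
  have "\<lbrace>sec_el B u, \<lbrace>E, T\<rbrace>\<rbrace> = \<lbrace>sec_el B (P u), T\<rbrace> + \<lbrace>E, A\<rbrace>"
    unfolding A_def by (rule endo_jacobi[OF u graded_homog[OF T]]) simp
  then have "\<lbrace>sec_el B v, \<lbrace>sec_el B u, \<lbrace>E, T\<rbrace>\<rbrace>\<rbrace> =
      \<lbrace>sec_el B v, \<lbrace>sec_el B (P u), T\<rbrace>\<rbrace> + \<lbrace>sec_el B v, \<lbrace>E, A\<rbrace>\<rbrace>"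
    using sec_bracket_linear(1)[OF graded_homog[OF C] graded_homog[OF EA]] by simp
  moreover have "\<lbrace>sec_el B v, \<lbrace>E, A\<rbrace>\<rbrace> = \<lbrace>sec_el B (P v), A\<rbrace> + \<lbrace>E, sec_el B (- ?D u v)\<rbrace>"
    using endo_jacobi[OF v graded_homog[OF A]] vA by simp
  moreover have "\<lbrace>E, sec_el B (- ?D u v)\<rbrace> = sec_el B (P (?D u v))"
    using sections_E_linear(3)[OF D(1)[OF u v] u] sec_el_linear(3)[OF endo_sections[OF D(1)[OF u v]] u]
    by (simp add: endo_bracket_sec endo_linear(3)[OF D(1)[OF u v] u])
  ultimately have "sec_el B (dorfman B \<lbrace>E, T\<rbrace> u v) =
     sec_el B (?D (P u) v) + sec_el B (?D u (P v)) - sec_el B (P (?D u v))"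
    unfolding dorfman_sec(2)[OF ET u v] D(2)[OF u Pv] D(2)[OF Pu v] A_def by simp
  then show "sec_el B (dorfman B \<lbrace>E, T\<rbrace> u v) = sec_el B (?D (P u) v + ?D u (P v) - P (?D u v))"
    by (simp add: sec_el_linear sections_E_linear endo_sections D u v Pu Pv)
qed

lemma dorfman_gcomb:
  assumes T: "S \<in> graded B 3" "T \<in> graded B 3" and u: "u \<in> sections_E B" and v: "v \<in> sections_E B"
  shows "dorfman B (gcomb a b S T) u v = scomb a b (dorfman B S u v) (dorfman B T u v)"
proof (rule sec_el_eqD)
  have A: "homog 2 \<lbrace>sec_el B u, X\<rbrace>" if "X \<in> graded B 3" for X
    using graded_homog[OF sec_bracket_graded[OF that _ u]] by simp
  show "sec_el B (dorfman B (gcomb a b S T) u v) = sec_el B (scomb a b (dorfman B S u v) (dorfman B T u v))"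
    using sec_bracket_gcomb[OF graded_homog[OF T(1)] graded_homog[OF T(2)]]
        sec_bracket_gcomb[OF A[OF T(1)] A[OF T(2)]]
    by (simp add: sec_el_scomb dorfman_sec T u v graded_gcomb) (simp add: gcomb_def fun_eq_iff)
qed (intro dorfman_sec scomb_sections graded_gcomb T u v)+

lemma torsion_section:
  assumes T: "T \<in> graded B 3" and u: "u \<in> sections_E B" and v: "v \<in> sections_E B"
  shows "torsion (dorfman B T) P u v \<in> sections_E B"
  unfolding torsion_def by (intro sections_E_linear endo_sections dorfman_sec T u v)

text \<open>For \<open>N\<^sup>2 = l\<close> this is the function representing the torsion.\<close>

definition tor_el :: "real \<Rightarrow> ('m, 'v) gfun \<Rightarrow> ('m, 'v) gfun" where
  "tor_el l T = gcomb (1/2) (- l/2) \<lbrace>E, \<lbrace>E, T\<rbrace>\<rbrace> T"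

lemma tor_el_graded: "T \<in> graded B 3 \<Longrightarrow> tor_el l T \<in> graded B 3"
  unfolding tor_el_def by (intro graded_gcomb endo_bracket_graded_3)

lemma tor_el_plus: "tor_el l (S + T) = tor_el l S + tor_el l T"
  unfolding tor_el_def by (simp only: gcomb_plus endo_bracket_gcomb)
      (simp add: gcomb_def fun_eq_iff algebra_simps)

end

text \<open>To be read with d = [u, v], p = [Pu, Pv], r = P[Pu, v], s = P[u, Pv] and P^2 = l. The
  three groups come from applying \<open>dorfman_endo\<close> twice; their combination is twice the
  torsion plus l d, which explains the coefficients 1/2 and -l/2.\<close>

lemma torsion_algebra:
  fixes d p r s :: "'a::real_vector"
  shows "p - (r + s - l *\<^sub>R d) = (1/2) *\<^sub>R ((l *\<^sub>R d + p - r) + (p + l *\<^sub>R d - s) - (r + s - l *\<^sub>R d)) +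
      (- l/2) *\<^sub>R d"
proof -
  have "(1/2) *\<^sub>R ((l *\<^sub>R d + p - r) + (p + l *\<^sub>R d - s) - (r + s - l *\<^sub>R d)) + (- l/2) *\<^sub>R d =
     (1/2) *\<^sub>R ((l *\<^sub>R d + p - r) + (p + l *\<^sub>R d - s) - (r + s - l *\<^sub>R d) - l *\<^sub>R d)"
    by (simp add: scaleR_diff_right)
  also have "\<dots> = (1/2) *\<^sub>R ((p - (r + s - l *\<^sub>R d)) + (p - (r + s - l *\<^sub>R d)))"
    by (rule arg_cong[of _ _ "scaleR (1/2)"]) (simp add: algebra_simps)
  finally show ?thesis by (simp only: scaleR_half_double)
qed

locale vbun_cps = vbun_endo B N for B ::
    "('m::{t2_space, second_countable_topology}, 'v::real_vector) vbundle" (structure) and N +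
  fixes l :: real
  assumes endo_square: "v \<in> fibre B q \<Longrightarrow> N q (N q v) = l *\<^sub>R v"
begin

lemma endo_E_square:
  assumes u: "u \<in> sections_E B"
  shows "P (P u) = scomb l 0 u u"
proof -
  have X: "fst u q \<in> fibre B q" and xi: "snd u q \<in> dual_fibre B q" for q
    using u by (auto simp: sections_E_def sections_A_def sections_As_def)
  have "snd u q (N q (N q v)) = l * snd u q v" if "v \<in> fibre B q" for q v
    using xi[of q] that by (simp add: endo_square dual_fibre_def linear_from_def)
  then show ?thesis
    using X xi N_fibre by (auto simp: endo_E_def endo_A_def transpose_A_def scomb_def endo_square fun_eq_iff
        fun_Compl_def dual_fibre_def)
qed

lemma dorfman_tor_el:
  assumes T: "T \<in> graded B 3" and u: "u \<in> sections_E B" and v: "v \<in> sections_E B"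
  shows "dorfman B (tor_el l T) u v = torsion (dorfman B T) P u v"
proof -
  let ?D = "dorfman B T"
  note Pu = endo_sections[OF u] and Pv = endo_sections[OF v] and ET = endo_bracket_graded_3[OF T]
  note D = dorfman_sec(1)[OF T]
  define d p r s where "d = ?D u v" "p = ?D (P u) (P v)" "r = P (?D (P u) v)" "s = P (?D u (P v))"
  have PPd: "P (P d) = scomb l 0 d d" unfolding d_p_r_s_def by (intro endo_E_square D u v)
  have Pd: "P (?D (P u) v + ?D u (P v) - P d) = r + s - scomb l 0 d d"
    unfolding PPd[symmetric] unfolding d_p_r_s_def
    by (simp add: endo_linear D u v Pu Pv endo_sections sections_E_linear)
  have tor: "torsion ?D P u v = p - (r + s - scomb l 0 d d)"
    unfolding torsion_def using Pd by (simp add: d_p_r_s_def)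
  have PPu: "?D (P (P u)) v = scomb l 0 d d" "?D u (P (P v)) = scomb l 0 d d"
    unfolding endo_E_square[OF u] endo_E_square[OF v] dorfman_scomb_left[OF T u u v]
        dorfman_scomb_right[OF T u v v] d_p_r_s_def
    by (rule refl)+
  have "dorfman B \<lbrace>E, \<lbrace>E, T\<rbrace>\<rbrace> u v =
      (scomb l 0 d d + p - r) + (p + scomb l 0 d d - s) - (r + s - scomb l 0 d d)"
    unfolding dorfman_endo[OF ET u v] dorfman_endo[OF T u v] dorfman_endo[OF T Pu v] dorfman_endo[OF T u Pv]
    using Pd by (simp add: PPu d_p_r_s_def)
  then have "dorfman B (tor_el l T) u v =
      scomb (1/2) (- l/2) ((scomb l 0 d d + p - r) + (p + scomb l 0 d d - s) - (r + s - scomb l 0 d d)) d"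
    unfolding tor_el_def dorfman_gcomb[OF endo_bracket_graded_3[OF ET] T u v] by (simp add: d_p_r_s_def)
  also have "\<dots> = torsion ?D P u v"
    unfolding tor scomb_def prod_eq_iff fun_eq_iff
    using torsion_algebra[of "fst p q" "fst r q" "fst s q" l "fst d q" for q]
      torsion_algebra[of "snd p q w" "snd r q w" "snd s q w" l "snd d q w" for q w] by simp
  finally show ?thesis .
qed

lemma tensor_el_torsion:
  assumes T: "T \<in> graded B 3"
  shows "tensor_el B (tilde_E (torsion (dorfman B T) P)) = tor_el l T"
proof (rule tensor_el_eqI[OF tor_el_graded[OF T]])
  fix u v w assume u: "u \<in> sections_E B" and v: "v \<in> sections_E B" and w: "w \<in> sections_E B"
  show "fun_el B (tilde_E (torsion (dorfman B T) P) u v w) =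
     \<lbrace>\<lbrace>\<lbrace>sec_el B u, tor_el l T\<rbrace>, sec_el B v\<rbrace>, sec_el B w\<rbrace>"
    unfolding tilde_E_def dorfman_sec(3)[OF tor_el_graded[OF T] u v, symmetric] dorfman_tor_el[OF T u v]
    by (rule sec_sec_bracket[symmetric]) (intro torsion_section T u v w)+
qed

end

section \<open>The torsion as an alternating tensor\<close>

lemma lmul_at_singleton:
  shows "pfree 1 F \<Longrightarrow> lmul F G ({e}, K) q = F ({e}, {#}) q * G ({}, K) q"
    and "pfree 2 F \<Longrightarrow> lmul F G ({e}, K) q = 0"
proof -
  assume F: "pfree 1 F"
  have r: "(\<Sum>L\<in>{L. L \<subseteq># K}. ksign A ({e} - A) * F (A, L) q * G ({e} - A, K - L) q) =
      (if A = {e} then F ({e}, {#}) q * G ({}, K) q else 0)" if "A \<in> {{}, {e}}" for A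
  proof (cases "A = {e}")
    case True
    have "(\<Sum>L\<in>{L. L \<subseteq># K}. ksign A ({e} - A) * F (A, L) q * G ({e} - A, K - L) q) =
        (\<Sum>L\<in>{{#}}. ksign A ({e} - A) * F (A, L) q * G ({e} - A, K - L) q)"
      by (rule sum.mono_neutral_right) (auto simp: pfree_zero[OF F])
    then show ?thesis using True by simp
  next
    case False
    then have "A = {}" using that by simp
    then show ?thesis using pfree_zero[OF F, of "{}"] by simp
  qed
  have "lmul F G ({e}, K) q = (\<Sum>A\<in>Pow {e}. if A = {e} then F ({e}, {#}) q * G ({}, K) q else 0)"
    unfolding lmul_apply by (rule sum.cong[OF refl]) (rule r, auto)
  then show "lmul F G ({e}, K) q = F ({e}, {#}) q * G ({}, K) q" by simp
next
  assume F: "pfree 2 F"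
  have "F (A, L) q = 0" if "A \<subseteq> {e}" for A L
    by (rule pfree_zero[OF F]) (use that card_mono[of "{e}" A] in auto)
  then show "lmul F G ({e}, K) q = 0" by (simp add: lmul_apply)
qed

text \<open>Without momenta the derivatives of the sections do not enter, and the remaining odd
  derivatives anticommute.\<close>

lemma Lop_anticomm:
  assumes X: "pfree (Suc (Suc k)) X"
  shows "Lop B u U (Lop B v V X) = - Lop B v V (Lop B u U X)"
proof -
  have e: "Lop B u U (Lop B v V X) =
      (\<Sum>b<2 * brank B. \<Sum>a<2 * brank B. smul (v b)
          (smul (u a) (d_left (star B a) (d_left (star B b) X))))" for u v U V
    unfolding Lop_pfree[OF X] Lop_sum Lop_linear Lop_pfree[OF pfree_d_left[OF X]] smul_sum ..
  have a: "d_left a (d_left b X) = - d_left b (d_left a X)" for a b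
    by (rule d_left_anticomm) (simp add: pfree_zero[OF X])
  have "smul (v b) (smul (u a) (d_left (star B a) (d_left (star B b) X))) =
      - smul (u a) (smul (v b) (d_left (star B b) (d_left (star B a) X)))" for a b
    unfolding a[of "star B a"] by (rule loc_eqI) (simp add: smul_apply)
  then show ?thesis
    unfolding e[of u U v V] e[of v V u U] by (subst sum.swap) (simp add: sum_negf del: uminus_apply)
qed

context vbun_endo
begin

text \<open>The matrix of the skew endomorphism \<open>P\<close> on the components of sections in
  the patch.\<close>

definition emat :: "('m, 'v) patch \<Rightarrow> 'm \<Rightarrow> nat \<Rightarrow> nat \<Rightarrow> real" where
  "emat c q e a = d_left (star B a) (E c) ({e}, {#}) q"

lemma endo_sec_emat:
  assumes u: "u \<in> sections_E B"
  shows "sec_el B (P u) c ({e}, {#}) q = (\<Sum>a<2 * brank B. emat c q e a * sec_el B u c ({a}, {#}) q)"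
  unfolding sec_endo[OF u] big_bracket_def bracket_Lop[OF pfree_sec homog_finsupp[OF homog_endo]]
      Lop_pfree[OF pfree_endo]
  by (simp add: loc_sum_apply smul_apply emat_def mult.commute)

text \<open>The coefficients of the monomials with one odd variable and one momentum are transformed
  among themselves: the part of \<open>Dop\<close> that differentiates along momenta has a factor
  with two odd variables and cannot contribute to a single one.\<close>

lemma endo_bracket_emat:
  "\<lbrace>E, G\<rbrace> c ({e}, {#i#}) q = - (\<Sum>a<2 * brank B. emat c q e a * G c ({a}, {#i#}) q)"
proof -
  have "lmul (d_left a (E c)) (d_left (star B a) (G c)) ({e}, {#i#}) q =
      d_left a (E c) ({e}, {#}) q * G c ({star B a}, {#i#}) q" for a
    using lmul_at_singleton(1)[OF pfree_d_left[of 1], of "E c"] pfree_endo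
        by (simp add: numeral_2_eq_2 d_left_apply[of "star B a"])
  then have "\<lbrace>E, G\<rbrace> c ({e}, {#i#}) q = -
      (\<Sum>a<2 * brank B. d_left a (E c) ({e}, {#}) q * G c ({star B a}, {#i#}) q)"
    unfolding big_bracket_def bracket_Dop[OF pfree_endo] Dop_def
    by (simp add: loc_sum_apply lmul_at_singleton(2)[OF pfree_d_x[OF pfree_endo]])
  also have "(\<Sum>a<2 * brank B. d_left a (E c) ({e}, {#}) q * G c ({star B a}, {#i#}) q) =
      (\<Sum>a<2 * brank B. d_left (star B a) (E c) ({e}, {#}) q * G c ({star B (star B a)}, {#i#}) q)"
    by (rule sum_star[symmetric])
  also have "\<dots> = (\<Sum>a<2 * brank B. emat c q e a * G c ({a}, {#i#}) q)"
    by (intro sum.cong) (auto simp: emat_def)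
  finally show ?thesis .
qed

end

context vbun_cps
begin

text \<open>The matrix inherits its square from \<open>P\<close>, tested on a section whose value at
  the point is a basis element.\<close>

lemma emat_square:
  assumes c: "c \<in> patches B" "q \<in> pdom c" and b: "b < 2 * brank B"
  shows "(\<Sum>a<2 * brank B. emat c q e a * emat c q a b) = (if e = b then l else 0)"
proof -
  obtain u where u: "u \<in> sections_E B"
    and v: "\<And>e. e < 2 * brank B \<Longrightarrow> sec_el B u c ({e}, {#}) q = (if e = b then 1 else 0)"
    using jet_section0[OF c b] by metis
  have ve: "sec_el B u c ({e}, {#}) q = (if e = b then 1 else 0)" for e
    using v[of e] sec_el_index[of e] b by (cases "e < 2 * brank B") auto
  have "sec_el B (P u) c ({a}, {#}) q = emat c q a b" for a
    unfolding endo_sec_emat[OF u] ve using b by (simp add: if_distrib cong: if_cong)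
  then have "(\<Sum>a<2 * brank B. emat c q e a * emat c q a b) = sec_el B (P (P u)) c ({e}, {#}) q"
    unfolding endo_sec_emat[OF endo_sections[OF u]] by simp
  also have "\<dots> = (if e = b then l else 0)"
    unfolding endo_E_square[OF u] sec_el_scomb[OF u u] gcomb_def ve by simp
  finally show ?thesis .
qed

text \<open>Bracketing twice with the endomorphism multiplies the coefficients of the monomials with
  a momentum by the square of minus \<open>emat\<close>, that is by \<open>l\<close>. Subtracting
  \<open>l\<close> times the original function removes them.\<close>

lemma tor_el_pfree:
  assumes T: "T \<in> graded B 3" and c: "c \<in> patches B" "q \<in> pdom c"
  shows "pfree 3 (freeze q (tor_el l T c))"
proof (rule pfreeI)
  fix S K p assume "freeze q (tor_el l T c) (S, K) p \<noteq> 0"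
  then have nz: "tor_el l T c (S, K) q \<noteq> 0" by (simp add: freeze_apply)
  have "(S, K) \<in> monomials B 3" by (rule suppD[OF homog_supp[OF graded_homog[OF tor_el_graded[OF T]]] nz])
  moreover have "tor_el l T c ({e}, {#i#}) q = 0" if e: "e < 2 * brank B" for e i
  proof -
    let ?g = "\<lambda>a. T c ({a}, {#i#}) q"
    have "\<lbrace>E, \<lbrace>E, T\<rbrace>\<rbrace> c ({e}, {#i#}) q = (\<Sum>a<2 * brank B. \<Sum>b<2 * brank B. emat c q e a * emat c q a b * ?g b)"
      by (simp add: endo_bracket_emat sum_negf sum_distrib_left mult.assoc)
    also have "\<dots> = (\<Sum>b<2 * brank B. (\<Sum>a<2 * brank B. emat c q e a * emat c q a b) * ?g b)"
      by (subst sum.swap) (simp add: sum_distrib_right)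
    also have "\<dots> = (\<Sum>b<2 * brank B. if b = e then l * ?g b else 0)"
      by (intro sum.cong refl) (auto simp: emat_square[OF c])
    also have "\<dots> = l * ?g e" using e by simp
    finally show ?thesis by (simp add: tor_el_def gcomb_def)
  qed
  ultimately show "finite S \<and> card S = 3 \<and> K = {#}"
    using nz unfolding monomials3 by auto
qed

lemma torsion_alternating:
  assumes T: "T \<in> graded B 3" and u: "u \<in> sections_E B" and v: "v \<in> sections_E B" and w: "w \<in> sections_E B"
  shows "pairing (torsion (dorfman B T) P u v) w q = - pairing (torsion (dorfman B T) P v u) w q"
    and "pairing (torsion (dorfman B T) P u v) w q = - pairing (torsion (dorfman B T) P u w) v q"
proof -
  obtain c where c: "c \<in> patches B" "q \<in> pdom c" using patches_cover by blast
  let ?F = "freeze q (tor_el l T c)" and ?L = "\<lambda>x. Lop B (jet0 c q x) (jet1 c q x)"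
  note a = tor_el_graded[OF T, of l]
  have F: "pfree 3 ?F" by (rule tor_el_pfree[OF T c])
  have val: "pairing (torsion (dorfman B T) P x y) z q = - ?L z (?L y (?L x ?F)) ({}, {#}) q"
    if x: "x \<in> sections_E B" and y: "y \<in> sections_E B" and z: "z \<in> sections_E B" for x y z
  proof -
    let ?s = "torsion (dorfman B T) P x y"
    have A: "\<lbrace>sec_el B x, tor_el l T\<rbrace> \<in> graded B 2" using sec_bracket_graded[OF a _ x] by simp
    have C: "\<lbrace>sec_el B y, \<lbrace>sec_el B x, tor_el l T\<rbrace>\<rbrace> \<in> graded B 1" using sec_bracket_graded[OF A _ y] by simp
    have "pairing ?s z q = fun_el B (pairing z ?s) c ({}, {#}) q"
      using c by (simp add: fun_el_def on_patches_def smul_apply mon_el_def pairing_def)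
    also have "\<dots> = \<lbrace>sec_el B z, sec_el B ?s\<rbrace> c ({}, {#}) q"
      unfolding sec_sec_bracket[OF z torsion_section[OF T x y]] ..
    also have "\<dots> = - \<lbrace>sec_el B z, \<lbrace>sec_el B y, \<lbrace>sec_el B x, tor_el l T\<rbrace>\<rbrace>\<rbrace> c ({}, {#}) q"
      unfolding dorfman_tor_el[OF T x y, symmetric] dorfman_sec(2)[OF a x y]
          sec_bracket_linear(2)[OF graded_homog[OF C] graded_homog[OF C]]
      by simp
    also have "\<dots> = - freeze q (\<lbrace>sec_el B z, \<lbrace>sec_el B y, \<lbrace>sec_el B x, tor_el l T\<rbrace>\<rbrace>\<rbrace> c) ({}, {#}) q"
      by (simp add: freeze_apply)
    also have "\<dots> = - ?L z (?L y (?L x ?F)) ({}, {#}) q"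
      using freeze_bracket_sec[OF homog_finsupp[OF graded_homog[OF C], of c], of q c z]
        freeze_bracket_sec[OF homog_finsupp[OF graded_homog[OF A], of c], of q c y]
        freeze_bracket_sec[OF homog_finsupp[OF graded_homog[OF a], of c], of q c x]
      by (simp add: big_bracket_def)
    finally show ?thesis .
  qed
  have F2: "pfree (Suc (Suc 1)) ?F" using F by (simp add: numeral_3_eq_3)
  have LF: "pfree (Suc (Suc 0)) (?L x ?F)" for x
    unfolding Lop_pfree[OF F] using F2 by (intro pfree_sum pfree_linear pfree_d_left) simp
  show "pairing (torsion (dorfman B T) P u v) w q = - pairing (torsion (dorfman B T) P v u) w q"
    unfolding val[OF u v w] val[OF v u w] Lop_anticomm[OF F2, of B "jet0 c q v" "jet1 c q v"] Lop_linear by simp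
  show "pairing (torsion (dorfman B T) P u v) w q = - pairing (torsion (dorfman B T) P u w) v q"
    unfolding val[OF u v w] val[OF u w v] Lop_anticomm[OF LF, of B "jet0 c q w" "jet1 c q w"] by simp
qed

end

section \<open>The double of a Lie bialgebroid\<close>

text \<open>Of the eight terms of the expansion, the one with all arguments in \<open>R\<close>
  vanishes, and so do the four with at least two arguments in \<open>Q\<close>. The other three are
  brought to the stated cyclic form by transpositions.\<close>

lemma alternating_split:
  fixes t :: "'a::ab_group_add \<Rightarrow> 'a \<Rightarrow> 'a \<Rightarrow> real"
  assumes S: "\<And>a b. a \<in> S \<Longrightarrow> b \<in> S \<Longrightarrow> a + b \<in> S"
    and add: "\<And>a b v w. a \<in> S \<Longrightarrow> b \<in> S \<Longrightarrow> v \<in> S \<Longrightarrow> w \<in> S \<Longrightarrow> t (a + b) v w = t a v w + t b v w"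
    and alt: "\<And>u v w. u \<in> S \<Longrightarrow> v \<in> S \<Longrightarrow> w \<in> S \<Longrightarrow> t u v w = - t v u w"
      "\<And>u v w. u \<in> S \<Longrightarrow> v \<in> S \<Longrightarrow> w \<in> S \<Longrightarrow> t u v w = - t u w v"
    and R: "R \<subseteq> S" "\<And>a b c. a \<in> R \<Longrightarrow> b \<in> R \<Longrightarrow> c \<in> R \<Longrightarrow> t a b c = 0"
    and Q: "Q \<subseteq> S" "\<And>a b c. a \<in> Q \<Longrightarrow> b \<in> Q \<Longrightarrow> c \<in> S \<Longrightarrow> t a b c = 0"
    and x: "x \<in> R" "y \<in> R" "z \<in> R" "x' \<in> Q" "y' \<in> Q" "z' \<in> Q"
  shows "t (x + x') (y + y') (z + z') = t x y z' + t y z x' + t z x y'"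
proof -
  have s: "x \<in> S" "y \<in> S" "z \<in> S" "x' \<in> S" "y' \<in> S" "z' \<in> S" using x R(1) Q(1) by auto
  have add2: "t u (a + b) w = t u a w + t u b w" if "u \<in> S" "a \<in> S" "b \<in> S" "w \<in> S" for u a b w
    using alt(1)[of u "a + b" w] alt(1)[of u a w] alt(1)[of u b w] add[of a b u w] S that by simp
  have add3: "t u w (a + b) = t u w a + t u w b" if "u \<in> S" "a \<in> S" "b \<in> S" "w \<in> S" for u a b w
    using alt(2)[of u w "a + b"] alt(2)[of u w a] alt(2)[of u w b] add2[of u a b w] S that by simp
  \<comment> \<open>The assumption on \<open>Q\<close> concerns the first two places; alternation
    carries it to the other pairs of places.\<close>
  have Q3: "t a b c = 0" if "a \<in> S" "b \<in> Q" "c \<in> Q" for a b c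
    using alt(1)[of a b c] alt(2)[of b a c] Q that by auto
  have Q2: "t b a c = 0" if "a \<in> S" "b \<in> Q" "c \<in> Q" for a b c
    using alt(1)[of b a c] Q3[OF that] Q that by auto
  have "t (x + x') (y + y') (z + z') = t x y z' + t x y' z + t x' y z"
    using s x by (simp add: add add2 add3 S R(2) Q(2) Q2 Q3)
  also have "t x y' z = t z x y'" using alt(2)[of x y' z] alt(1)[of x z y'] s by simp
  also have "t x' y z = t y z x'" using alt(1)[of x' y z] alt(2)[of y x' z] s by simp
  finally show ?thesis by simp
qed

text \<open>The weight counting the \<open>\<theta>\<close> and, with \<open>y = 1\<close>, the \<open>p\<close>: \<open>\<mu>\<close> has weight 1 and \<open>\<gamma>\<close> weight 2.\<close>

abbreviation (input) wA :: "('m, 'v) vbundle \<Rightarrow> nat \<Rightarrow> nat" where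
  "wA B a \<equiv> if a < brank B then 0 else 1"

context vbun
begin

section \<open>Weights of sections and of derived brackets\<close>

lemma sec_split: "(X, \<xi>) \<in> sections_E B \<longleftrightarrow> X \<in> sections_A B \<and> \<xi> \<in> sections_As B"
  by (simp add: sections_E_def)

lemma pairing_add:
  assumes s: "s \<in> sections_E B" "s' \<in> sections_E B" "w \<in> sections_E B"
  shows "pairing (s + s') w q = pairing s w q + pairing s' w q"
proof -
  have "fst s q \<in> fibre B q" "fst s' q \<in> fibre B q" "linear_from (fibre B q) (snd w q)"
    using s by (auto simp: sections_E_def sections_A_def sections_As_def dual_fibre_def)
  then show ?thesis by (simp add: pairing_def linear_from_def)
qed

lemma section_As_zero: "\<xi> \<in> sections_As B \<Longrightarrow> \<xi> q 0 = 0"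
proof -
  assume "\<xi> \<in> sections_As B"
  then have "\<xi> q (0 *\<^sub>R 0) = 0 *\<^sub>R \<xi> q 0"
    using subspace_0[OF subspace_fibre[of q]] unfolding sections_As_def dual_fibre_def linear_from_def by blast
  then show "\<xi> q 0 = 0" by simp
qed

lemma supp_sec_A:
  assumes X: "X \<in> sections_A B"
  shows "supp (weighted B (wA B) 1 0 1) (sec_el B (X, 0) c)"
proof (rule suppI)
  fix S K q assume nz: "sec_el B (X, 0) c (S, K) q \<noteq> 0"
  then obtain a where a: "c \<in> patches B" "q \<in> pdom c" "a < 2 * brank B" "(S, K) = ({a}, {#})"
    using sec_el_supp by blast
  with nz have "ecomp (snd c) (X, 0) a q \<noteq> 0" by (simp add: sec_el_ecomp)
  then have "\<not> a < brank B" by (auto simp: ecomp_def)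
  then show "weighted B (wA B) 1 0 1 (S, K)" using a by (auto simp: weighted_def)
qed

lemma supp_sec_As:
  assumes \<xi>: "\<xi> \<in> sections_As B"
  shows "supp (weighted B (wA B) 1 0 0) (sec_el B (0, \<xi>) c)"
proof (rule suppI)
  fix S K q assume nz: "sec_el B (0, \<xi>) c (S, K) q \<noteq> 0"
  then obtain a where a: "c \<in> patches B" "q \<in> pdom c" "a < 2 * brank B" "(S, K) = ({a}, {#})"
    using sec_el_supp by blast
  have "dual_frame B (snd c) \<alpha> q 0 = 0" for \<alpha>
    using dual_frame_linear[OF patchD(2)[OF a(1)] patchD(5)[OF a(1,2)]] subspace_0[OF subspace_fibre[of q]]
    unfolding linear_from_def by (metis scaleR_zero_left mult_zero_left real_scaleR_def)
  with nz a have "a < brank B" by (auto simp: ecomp_def sec_el_ecomp split: if_splits)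
  then show "weighted B (wA B) 1 0 0 (S, K)" using a by (auto simp: weighted_def)
qed

lemma section_fst_zero:
  assumes s: "s \<in> sections_E B"
    and z: "\<And>c q a. a < brank B \<Longrightarrow> sec_el B s c ({brank B + a}, {#}) q = 0"
  shows "fst s = 0"
proof
  fix q
  obtain c where c: "c \<in> patches B" "q \<in> pdom c" using patches_cover by blast
  note fr = patchD(2)[OF c(1)] patchD(5)[OF c]
  have X: "fst s q \<in> fibre B q" using s by (auto simp: sections_E_def sections_A_def)
  have "dual_frame B (snd c) a q (fst s q) = 0" if "a < brank B" for a
    using z[OF that, of c q] that by (simp add: sec_el_ecomp[OF c] ecomp_def)
  then show "fst s q = 0 q" using dual_frame_expand[OF fr X] by simp
qed

lemma section_snd_zero:
  assumes s: "s \<in> sections_E B"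
    and z: "\<And>c q a. a < brank B \<Longrightarrow> sec_el B s c ({a}, {#}) q = 0"
  shows "snd s = 0"
proof (intro ext)
  fix q v
  obtain c where c: "c \<in> patches B" "q \<in> pdom c" using patches_cover by blast
  note fr = patchD(2)[OF c(1)] patchD(5)[OF c]
  have xi: "snd s q \<in> dual_fibre B q" using s by (auto simp: sections_E_def sections_As_def)
  have "snd s q (snd (snd c) a q) = 0" if "a < brank B" for a
    using z[OF that, of c q] that by (simp add: sec_el_ecomp[OF c] ecomp_def)
  then show "snd s q v = 0 q v"
    using linear_expand[OF fr, of v "snd s q"] xi by (cases "v \<in> fibre B q") (auto simp: dual_fibre_def)
qed

text \<open>Each of the two brackets lowers the weight by 1. The weight of \<open>T\<close> is
  written as \<open>Suc k\<close> and the result additively, so that a value of -1 appears as an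
  impossible equation instead of being truncated to 0.\<close>

lemma dorfman_weight:
  assumes T: "T \<in> graded B 3" "\<And>c. supp (weighted B (wA B) 1 0 (Suc k)) (T c)"
    and u: "u \<in> sections_E B" "\<And>c. supp (weighted B (wA B) 1 0 i) (sec_el B u c)"
    and v: "v \<in> sections_E B" "\<And>c. supp (weighted B (wA B) 1 0 j) (sec_el B v c)"
    and nz: "sec_el B (dorfman B T u v) c ({a}, {#}) q \<noteq> 0"
  shows "wA B a + 1 = k + i + j"
proof -
  have x: "\<And>a. a < brank B \<Longrightarrow> wA B a + wA B (brank B + a) = 1" by simp
  have "supp (weighted B (wA B) 1 1 (i + Suc k)) (\<lbrace>sec_el B u, T\<rbrace> c)"
    unfolding big_bracket_def by (rule supp_weighted_bracket[OF x u(2) T(2)])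
  then have "supp (weighted B (wA B) 1 0 (i + k)) (\<lbrace>sec_el B u, T\<rbrace> c)"
    by (rule supp_mono) (simp add: weighted_def)
  from supp_weighted_bracket[OF x this v(2)]
  have "supp (weighted B (wA B) 1 1 (i + k + j)) (\<lbrace>\<lbrace>sec_el B u, T\<rbrace>, sec_el B v\<rbrace> c)"
    by (simp only: big_bracket_def)
  from suppD[OF this nz[unfolded dorfman_sec(3)[OF T(1) u(1) v(1)]]]
  show ?thesis by (simp add: weighted_def)
qed

lemma bracket_A_eq:
  assumes "\<lbrace>\<lbrace>sec_el B (X, 0), T\<rbrace>, sec_el B (Y, 0)\<rbrace> = sec_el B (Z, 0)" "Z \<in> sections_A B"
  shows "bracket_A B T X Y = Z"
proof -
  have "inj_on (\<lambda>Z. sec_el B (Z, 0)) (sections_A B)"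
    by (rule inj_onI, drule sec_el_eqD[rotated 2]) (auto simp: sec_split zero_sections)
  from inv_into_f_f[OF this assms(2)] show ?thesis unfolding bracket_A_def assms(1) .
qed

lemma bracket_As_eq:
  assumes "\<lbrace>\<lbrace>sec_el B (0, \<xi>), T\<rbrace>, sec_el B (0, \<eta>)\<rbrace> = sec_el B (0, \<zeta>)" "\<zeta> \<in> sections_As B"
  shows "bracket_As B T \<xi> \<eta> = \<zeta>"
proof -
  have "inj_on (\<lambda>Z. sec_el B (0, Z)) (sections_As B)"
    by (rule inj_onI, drule sec_el_eqD[rotated 2]) (auto simp: sec_split zero_sections)
  from inv_into_f_f[OF this assms(2)] show ?thesis unfolding bracket_As_def assms(1) .
qed

lemma lie_algebroid_weight: "lie_algebroid B \<mu> \<Longrightarrow> supp (weighted B (wA B) 1 0 (Suc 0)) (\<mu> c)"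
proof (rule suppI)
  fix S K q assume "lie_algebroid B \<mu>" and nz: "\<mu> c (S, K) q \<noteq> 0"
  then consider \<alpha> i where "\<alpha> < brank B" "i < bdim B" "(S, K) = ({\<alpha>}, {#i#})"
    | \<alpha> \<beta> \<delta> where "\<alpha> < brank B" "\<beta> < brank B" "\<delta> < brank B" "\<alpha> \<noteq> \<beta>" "(S, K) = ({\<alpha>, \<beta>, brank B + \<delta>}, {#})"
    unfolding lie_algebroid_def by metis
  then show "weighted B (wA B) 1 0 (Suc 0) (S, K)" by cases (auto simp: weighted_def)
qed

lemma lie_algebroid_dual_weight: "lie_algebroid_dual B \<gamma> \<Longrightarrow> supp (weighted B (wA B) 1 0 (Suc 1)) (\<gamma> c)"
proof (rule suppI)
  fix S K q assume "lie_algebroid_dual B \<gamma>" and nz: "\<gamma> c (S, K) q \<noteq> 0"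
  then consider \<alpha> i where "\<alpha> < brank B" "i < bdim B" "(S, K) = ({brank B + \<alpha>}, {#i#})"
    | \<alpha> \<beta> \<delta> where "\<alpha> < brank B" "\<beta> < brank B" "\<delta> < brank B" "\<alpha> \<noteq> \<beta>"
        "(S, K) = ({brank B + \<alpha>, brank B + \<beta>, \<delta>}, {#})"
    unfolding lie_algebroid_dual_def by metis
  then show "weighted B (wA B) 1 0 (Suc 1) (S, K)" by cases (auto simp: weighted_def)
qed

text \<open>By weight, the bracket of two sections of A has weight 1 and so lies in A, while that of
  two sections of the dual would have weight -1.\<close>

lemma dorfman_mu:
  assumes m: "lie_algebroid B \<mu>"
  shows "X \<in> sections_A B \<Longrightarrow> Y \<in> sections_A B \<Longrightarrow> dorfman B \<mu> (X, 0) (Y, 0) = (bracket_A B \<mu> X Y, 0)"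
    and "\<xi> \<in> sections_As B \<Longrightarrow> \<eta> \<in> sections_As B \<Longrightarrow> dorfman B \<mu> (0, \<xi>) (0, \<eta>) = 0"
proof -
  have g: "\<mu> \<in> graded B 3" using m by (simp add: lie_algebroid_def)
  note W = dorfman_weight[OF g lie_algebroid_weight[OF m]]
  { assume X: "X \<in> sections_A B" and Y: "Y \<in> sections_A B"
    have XE: "(X, 0) \<in> sections_E B" "(Y, 0) \<in> sections_E B" using X Y zero_sections by (auto simp: sec_split)
    define s where "s = dorfman B \<mu> (X, 0) (Y, 0)"
    note s = dorfman_sec(1,3)[OF g XE, folded s_def]
    have "sec_el B s c ({a}, {#}) q = 0" if "a < brank B" for c q a
      using W[OF XE(1) supp_sec_A[OF X] XE(2) supp_sec_A[OF Y], of c a q, folded s_def] that by auto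
    then have "snd s = 0" by (rule section_snd_zero[OF s(1)])
    then have e: "s = (fst s, 0)" by (metis prod.collapse)
    have "bracket_A B \<mu> X Y = fst s"
      by (rule bracket_A_eq) (use s e in \<open>metis\<close>, use s(1) in \<open>auto simp: sections_E_def\<close>)
    with e show "dorfman B \<mu> (X, 0) (Y, 0) = (bracket_A B \<mu> X Y, 0)" by (simp add: s_def) }
  { assume X: "\<xi> \<in> sections_As B" and Y: "\<eta> \<in> sections_As B"
    have XE: "(0, \<xi>) \<in> sections_E B" "(0, \<eta>) \<in> sections_E B" using X Y zero_sections by (auto simp: sec_split)
    define s where "s = dorfman B \<mu> (0, \<xi>) (0, \<eta>)"
    note s = dorfman_sec(1)[OF g XE, folded s_def]
    have "sec_el B s c ({a}, {#}) q = 0" for c q a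
      using W[OF XE(1) supp_sec_As[OF X] XE(2) supp_sec_As[OF Y], of c a q, folded s_def] by auto
    then have "fst s = 0" "snd s = 0" using section_fst_zero[OF s] section_snd_zero[OF s] by auto
    then show "dorfman B \<mu> (0, \<xi>) (0, \<eta>) = 0" by (simp add: s_def prod_eq_iff) }
qed

text \<open>The weights are shifted by 1 against those for \<mu>: two sections of A would give
  weight 2, which no odd variable has, and two sections of the dual give weight 0.\<close>

lemma dorfman_gamma:
  assumes m: "lie_algebroid_dual B \<gamma>"
  shows "X \<in> sections_A B \<Longrightarrow> Y \<in> sections_A B \<Longrightarrow> dorfman B \<gamma> (X, 0) (Y, 0) = 0"
    and "\<xi> \<in> sections_As B \<Longrightarrow> \<eta> \<in> sections_As B \<Longrightarrow> dorfman B \<gamma> (0, \<xi>) (0, \<eta>) = (0, bracket_As B \<gamma> \<xi> \<eta>)"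
proof -
  have g: "\<gamma> \<in> graded B 3" using m by (simp add: lie_algebroid_dual_def)
  note W = dorfman_weight[OF g lie_algebroid_dual_weight[OF m]]
  { assume X: "\<xi> \<in> sections_As B" and Y: "\<eta> \<in> sections_As B"
    have XE: "(0, \<xi>) \<in> sections_E B" "(0, \<eta>) \<in> sections_E B" using X Y zero_sections by (auto simp: sec_split)
    define s where "s = dorfman B \<gamma> (0, \<xi>) (0, \<eta>)"
    note s = dorfman_sec(1,3)[OF g XE, folded s_def]
    have "sec_el B s c ({brank B + a}, {#}) q = 0" if "a < brank B" for c q a
      using W[OF XE(1) supp_sec_As[OF X] XE(2) supp_sec_As[OF Y], of c "brank B + a" q, folded s_def] by auto
    then have "fst s = 0" by (rule section_fst_zero[OF s(1)])
    then have e: "s = (0, snd s)" by (metis prod.collapse)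
    have "bracket_As B \<gamma> \<xi> \<eta> = snd s"
      by (rule bracket_As_eq) (use s e in \<open>metis\<close>, use s(1) in \<open>auto simp: sections_E_def\<close>)
    with e show "dorfman B \<gamma> (0, \<xi>) (0, \<eta>) = (0, bracket_As B \<gamma> \<xi> \<eta>)" by (simp add: s_def) }
  { assume X: "X \<in> sections_A B" and Y: "Y \<in> sections_A B"
    have XE: "(X, 0) \<in> sections_E B" "(Y, 0) \<in> sections_E B" using X Y zero_sections by (auto simp: sec_split)
    define s where "s = dorfman B \<gamma> (X, 0) (Y, 0)"
    note s = dorfman_sec(1)[OF g XE, folded s_def]
    have "sec_el B s c ({a}, {#}) q = 0" for c q a
      using W[OF XE(1) supp_sec_A[OF X] XE(2) supp_sec_A[OF Y], of c a q, folded s_def]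
          by (cases "a < brank B") auto
    then have "fst s = 0" "snd s = 0" using section_fst_zero[OF s] section_snd_zero[OF s] by auto
    then show "dorfman B \<gamma> (X, 0) (Y, 0) = 0" by (simp add: s_def prod_eq_iff) }
qed

lemma tensor_el_cong:
  assumes "\<And>u v w. u \<in> sections_E B \<Longrightarrow> v \<in> sections_E B \<Longrightarrow> w \<in> sections_E B \<Longrightarrow> t u v w = t' u v w"
  shows "tensor_el B t = tensor_el B t'"
  unfolding tensor_el_def using assms by simp

end

context vbun_endo
begin

section \<open>The torsions for the two Lie algebroid structures\<close>

lemma endo_E_A: "P (X, 0) = (endo_A N X, 0)"
  by (auto simp: endo_E_def transpose_A_def fun_eq_iff)

lemma endo_E_As: "P (0, \<xi>) = - (0, transpose_A B N \<xi>)"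
proof -
  have "N q 0 = 0" for q
    using N_linear[of q] subspace_0[OF subspace_fibre[of q]] unfolding linear_from_def
        by (metis scaleR_zero_left)
  then show ?thesis by (simp add: endo_E_def endo_A_def prod_eq_iff fun_eq_iff)
qed

lemma transpose_linear:
  "transpose_A B N (\<xi> + \<eta>) = transpose_A B N \<xi> + transpose_A B N \<eta>"
  "transpose_A B N (\<xi> - \<eta>) = transpose_A B N \<xi> - transpose_A B N \<eta>"
  "transpose_A B N (- \<xi>) = - transpose_A B N \<xi>"
  by (auto simp: transpose_A_def fun_eq_iff)

lemma endo_A_sections: "X \<in> sections_A B \<Longrightarrow> endo_A N X \<in> sections_A B"
  using endo_sections[of "(X, 0)"] zero_sections by (simp add: endo_E_A sec_split)

lemma transpose_sections: "\<xi> \<in> sections_As B \<Longrightarrow> transpose_A B N \<xi> \<in> sections_As B"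
  using endo_sections[of "(0, \<xi>)"] sections_E_linear(3)[of "P (0, \<xi>)" "P (0, \<xi>)"] zero_sections
  by (simp add: endo_E_As sec_split)

lemma torsion_mu:
  assumes m: "lie_algebroid B \<mu>"
  shows "X \<in> sections_A B \<Longrightarrow> Y \<in> sections_A B \<Longrightarrow>
      torsion (dorfman B \<mu>) P (X, 0) (Y, 0) = (torsion (bracket_A B \<mu>) (endo_A N) X Y, 0)"
    and "\<xi> \<in> sections_As B \<Longrightarrow> \<eta> \<in> sections_As B \<Longrightarrow> torsion (dorfman B \<mu>) P (0, \<xi>) (0, \<eta>) = 0"
proof -
  show "torsion (dorfman B \<mu>) P (X, 0) (Y, 0) = (torsion (bracket_A B \<mu>) (endo_A N) X Y, 0)"
    if "X \<in> sections_A B" "Y \<in> sections_A B"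
    using that by (simp add: torsion_def endo_E_A dorfman_mu[OF m] endo_A_sections)
  assume "\<xi> \<in> sections_As B" "\<eta> \<in> sections_As B"
  moreover have "- \<xi> \<in> sections_As B" if "\<xi> \<in> sections_As B" for \<xi>
    using sections_E_linear(3)[of "(0, \<xi>)" "(0, \<xi>)"] that zero_sections by (simp add: sec_split)
  ultimately show "torsion (dorfman B \<mu>) P (0, \<xi>) (0, \<eta>) = 0"
    using endo_E_A[of 0] endo_E_As[of 0]
    by (simp add: torsion_def endo_E_As dorfman_mu[OF m] transpose_sections zero_prod_def
        transpose_linear(2)[of 0 0, simplified])
qed

lemma dorfman_uminus:
  assumes "T \<in> graded B 3" "u \<in> sections_E B" "v \<in> sections_E B"
  shows "dorfman B T (- u) v = - dorfman B T u v" "dorfman B T u (- v) = - dorfman B T u v"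
  unfolding scomb_uminus by (rule dorfman_scomb_left dorfman_scomb_right; fact)+

text \<open>On the dual, \<open>P\<close> is minus the transpose. Every term of the torsion contains
  the endomorphism twice, so the signs cancel and the torsion of the transpose itself
  remains.\<close>

lemma torsion_gamma:
  assumes m: "lie_algebroid_dual B \<gamma>"
  shows "X \<in> sections_A B \<Longrightarrow> Y \<in> sections_A B \<Longrightarrow> torsion (dorfman B \<gamma>) P (X, 0) (Y, 0) = 0"
    and "\<xi> \<in> sections_As B \<Longrightarrow> \<eta> \<in> sections_As B \<Longrightarrow>
      torsion (dorfman B \<gamma>) P (0, \<xi>) (0, \<eta>) = (0, torsion (bracket_As B \<gamma>) (transpose_A B N) \<xi> \<eta>)"
proof -
  have g: "\<gamma> \<in> graded B 3" using m by (simp add: lie_algebroid_dual_def)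
  show "torsion (dorfman B \<gamma>) P (X, 0) (Y, 0) = 0" if "X \<in> sections_A B" "Y \<in> sections_A B"
    using that endo_E_A[of 0] endo_E_As[of 0]
    by (simp add: torsion_def endo_E_A dorfman_gamma[OF m] endo_A_sections zero_prod_def
        transpose_linear(2)[of 0 0, simplified])
  assume x: "\<xi> \<in> sections_As B" "\<eta> \<in> sections_As B"
  let ?t = "transpose_A B N" and ?b = "bracket_As B \<gamma>"
  note tx = transpose_sections[OF x(1)] transpose_sections[OF x(2)]
  have E: "(0, \<zeta>) \<in> sections_E B" if "\<zeta> \<in> sections_As B" for \<zeta> using that zero_sections by (simp add: sec_split)
  note u = dorfman_uminus[OF g] sections_E_linear(3)
  have "dorfman B \<gamma> (P (0, \<xi>)) (P (0, \<eta>)) = (0, ?b (?t \<xi>) (?t \<eta>))"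
    unfolding endo_E_As u(1)[OF E[OF tx(1)] u(3)[OF E[OF tx(2)] E[OF tx(2)]]] u(2)[OF E[OF tx(1)] E[OF tx(2)]]
        dorfman_gamma(2)[OF m tx]
    by simp
  moreover have "dorfman B \<gamma> (P (0, \<xi>)) (0, \<eta>) = (0, - ?b (?t \<xi>) \<eta>)"
    unfolding endo_E_As u(1)[OF E[OF tx(1)] E[OF x(2)]] dorfman_gamma(2)[OF m tx(1) x(2)] by simp
  moreover have "dorfman B \<gamma> (0, \<xi>) (P (0, \<eta>)) = (0, - ?b \<xi> (?t \<eta>))"
    unfolding endo_E_As u(2)[OF E[OF x(1)] E[OF tx(2)]] dorfman_gamma(2)[OF m x(1) tx(2)] by simp
  ultimately show "torsion (dorfman B \<gamma>) P (0, \<xi>) (0, \<eta>) = (0, torsion (bracket_As B \<gamma>) (transpose_A B N) \<xi> \<eta>)"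
    by (simp add: torsion_def dorfman_gamma(2)[OF m x] endo_E_As transpose_linear)
qed

text \<open>Positive rank makes the description unique: without nonzero sections a function linear
  in the momenta cannot be distinguished from 0.\<close>

lemma tilde_endo_eq:
  assumes r: "brank B > 0"
  shows "tilde_endo B P = E"
  unfolding tilde_endo_def
proof (rule the_equality)
  show "E \<in> graded B 2 \<and> (\<forall>u\<in>sections_E B. sec_el B (P u) = \<lbrace>sec_el B u, E\<rbrace>)"
    using endo_graded sec_endo by blast
  fix a assume a: "a \<in> graded B 2 \<and> (\<forall>u\<in>sections_E B. sec_el B (P u) = \<lbrace>sec_el B u, a\<rbrace>)"
  show "a = E"
    by (rule gfun_eqI_sections[OF _ homog_endo _ r]) (use a graded_homog sec_endo in auto)
qed

lemma graded3_rank0: "brank B = 0 \<Longrightarrow> T \<in> graded B 3 \<Longrightarrow> T = 0"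
proof (intro ext)
  fix c m q assume r: "brank B = 0" and T: "T \<in> graded B 3"
  from r have "m \<notin> monomials B 3" by (simp add: monomials3)
  then have "T c m q = 0" using suppD[OF homog_supp[OF graded_homog[OF T]], of c m q] by blast
  then show "T c m q = 0 c m q" by simp
qed

lemma endo_double_bracket:
  assumes T: "T \<in> graded B 3"
  shows "\<lbrace>\<lbrace>E, T\<rbrace>, E\<rbrace> = - \<lbrace>E, \<lbrace>E, T\<rbrace>\<rbrace>"
proof
  fix c
  have p: "homog 3 \<lbrace>E, T\<rbrace>" by (rule graded_homog[OF endo_bracket_graded_3[OF T]])
  have "par (\<lbrace>E, T\<rbrace> c) = - \<lbrace>E, T\<rbrace> c"
    by (intro loc_eqI) (simp add: par_homogeneous[OF homog_supp[OF p]] smul_apply)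
  from bracket_Dop_right[OF pfree_endo homog_finsupp[OF p] this]
  show "\<lbrace>\<lbrace>E, T\<rbrace>, E\<rbrace> c = (- \<lbrace>E, \<lbrace>E, T\<rbrace>\<rbrace>) c" by (simp add: big_bracket_def)
qed

lemma tilde_endo_double_bracket:
  assumes T: "T \<in> graded B 3"
  shows "\<lbrace>\<lbrace>tilde_endo B P, T\<rbrace>, tilde_endo B P\<rbrace> \<in> graded B 3 \<and>
    \<lbrace>\<lbrace>tilde_endo B P, T\<rbrace>, tilde_endo B P\<rbrace> = \<lbrace>\<lbrace>E, T\<rbrace>, E\<rbrace>"
proof (cases "brank B > 0")
  case True
  have "- \<lbrace>E, \<lbrace>E, T\<rbrace>\<rbrace> \<in> graded B 3" by (intro graded_linear endo_bracket_graded_3 T)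
  then show ?thesis unfolding tilde_endo_eq[OF True] using endo_double_bracket[OF T] by simp
next
  case False
  \<comment> \<open>Whatever element \<open>tilde_endo\<close> denotes in rank 0, its bracket with 0
    is 0.\<close>
  then have "T = 0" using graded3_rank0[OF _ T] by simp
  then show ?thesis using bracket_zero graded_zero by metis
qed

end

context vbun_cps
begin

text \<open>The torsion is a bracket derived from \<open>tor_el\<close> and inherits its additivity
  in the sections. Additivity in the structure function, proved next, likewise comes from that of
  \<open>tor_el\<close>.\<close>

lemma torsion_add:
  assumes T: "T \<in> graded B 3" and "a \<in> sections_E B" "b \<in> sections_E B" "v \<in> sections_E B"
  shows "torsion (dorfman B T) P (a + b) v = torsion (dorfman B T) P a v + torsion (dorfman B T) P b v"
  using dorfman_scomb_left[OF tor_el_graded[OF T, of l] assms(2-4), of 1 1] sections_E_linear(1)[OF assms(2,3)]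
      assms(2-4)
  by (simp add: scomb_plus[symmetric] dorfman_tor_el[OF T])

lemma torsion_plus:
  assumes "S \<in> graded B 3" "T \<in> graded B 3" "u \<in> sections_E B" "v \<in> sections_E B"
  shows "torsion (dorfman B (S + T)) P u v = torsion (dorfman B S) P u v + torsion (dorfman B T) P u v"
  using dorfman_gcomb[OF tor_el_graded[OF assms(1), of l] tor_el_graded[OF assms(2), of l] assms(3,4), of 1 1]
  by (simp add: scomb_plus[symmetric] gcomb_plus[symmetric] tor_el_plus[symmetric] dorfman_tor_el assms
      graded_linear)

lemma torsion_split:
  assumes T: "T \<in> graded B 3"
    and R: "R \<subseteq> sections_E B" "\<And>a b c. a \<in> R \<Longrightarrow> b \<in> R \<Longrightarrow> c \<in> R \<Longrightarrow> pairing (torsion (dorfman B T) P a b) c q = 0"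
    and Q: "Q \<subseteq> sections_E B" "\<And>a b. a \<in> Q \<Longrightarrow> b \<in> Q \<Longrightarrow> torsion (dorfman B T) P a b = 0"
    and x: "x \<in> R" "y \<in> R" "z \<in> R" "x' \<in> Q" "y' \<in> Q" "z' \<in> Q"
  shows "pairing (torsion (dorfman B T) P (x + x') (y + y')) (z + z') q =
    pairing (torsion (dorfman B T) P x y) z' q + pairing (torsion (dorfman B T) P y z) x' q +
    pairing (torsion (dorfman B T) P z x) y' q"
proof (rule alternating_split[where S = "sections_E B" and R = R and Q = Q])
  fix a b v w assume s: "a \<in> sections_E B" "b \<in> sections_E B" "v \<in> sections_E B" "w \<in> sections_E B"
  show "pairing (torsion (dorfman B T) P (a + b) v) w q =
      pairing (torsion (dorfman B T) P a v) w q + pairing (torsion (dorfman B T) P b v) w q"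
    unfolding torsion_add[OF T s(1-3)] by
        (rule pairing_add[OF torsion_section[OF T s(1,3)] torsion_section[OF T s(2,3)] s(4)])
next
  fix a b c assume "a \<in> Q" "b \<in> Q" "c \<in> sections_E B"
  then show "pairing (torsion (dorfman B T) P a b) c q = 0"
    using Q(2) section_As_zero by (auto simp: pairing_def sections_E_def)
qed (fact sections_E_linear(1) torsion_alternating[OF T] R Q(1) x)+

text \<open>For \<mu> the torsion of two sections of A lies in A, which is isotropic, and the
  torsion of two sections of the dual is 0. These are the two vanishing conditions of
  \<open>alternating_split\<close>.\<close>

lemma tilde_A_torsion:
  assumes m: "lie_algebroid B \<mu>"
    and s: "X \<in> sections_A B" "Y \<in> sections_A B" "Z \<in> sections_A B" "\<xi> \<in> sections_As B" "\<eta> \<in> sections_As B"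
        "\<zeta> \<in> sections_As B"
  shows "pairing (torsion (dorfman B \<mu>) P (X, \<xi>) (Y, \<eta>)) (Z, \<zeta>) q =
    tilde_A (torsion (bracket_A B \<mu>) (endo_A N)) (X, \<xi>) (Y, \<eta>) (Z, \<zeta>) q"
proof -
  have g: "\<mu> \<in> graded B 3" using m by (simp add: lie_algebroid_def)
  have "pairing (torsion (dorfman B \<mu>) P ((X, 0) + (0, \<xi>)) ((Y, 0) + (0, \<eta>))) ((Z, 0) + (0, \<zeta>)) q =
    pairing (torsion (dorfman B \<mu>) P (X, 0) (Y, 0)) (0, \<zeta>) q + pairing (torsion (dorfman B \<mu>) P (Y, 0) (Z, 0))
        (0, \<xi>) q +
    pairing (torsion (dorfman B \<mu>) P (Z, 0) (X, 0)) (0, \<eta>) q"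
    by (rule torsion_split[OF g, of "sections_A B \<times> {0}" _ "{0} \<times> sections_As B"])
      (use s zero_sections in \<open>auto simp: sections_E_def torsion_mu[OF m] pairing_def\<close>)
  then show ?thesis by (simp add: torsion_mu[OF m] s pairing_def tilde_A_def)
qed

text \<open>The same argument with A and its dual exchanged, hence the summands are taken in the
  other order.\<close>

lemma tilde_As_torsion:
  assumes m: "lie_algebroid_dual B \<gamma>"
    and s: "X \<in> sections_A B" "Y \<in> sections_A B" "Z \<in> sections_A B" "\<xi> \<in> sections_As B" "\<eta> \<in> sections_As B"
        "\<zeta> \<in> sections_As B"
  shows "pairing (torsion (dorfman B \<gamma>) P (X, \<xi>) (Y, \<eta>)) (Z, \<zeta>) q =
    tilde_As (torsion (bracket_As B \<gamma>) (transpose_A B N)) (X, \<xi>) (Y, \<eta>) (Z, \<zeta>) q"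
proof -
  have g: "\<gamma> \<in> graded B 3" using m by (simp add: lie_algebroid_dual_def)
  have "pairing (torsion (dorfman B \<gamma>) P ((0, \<xi>) + (X, 0)) ((0, \<eta>) + (Y, 0))) ((0, \<zeta>) + (Z, 0)) q =
    pairing (torsion (dorfman B \<gamma>) P (0, \<xi>) (0, \<eta>)) (Z, 0) q + pairing (torsion (dorfman B \<gamma>) P (0, \<eta>) (0, \<zeta>))
        (X, 0) q +
    pairing (torsion (dorfman B \<gamma>) P (0, \<zeta>) (0, \<xi>)) (Y, 0) q"
  proof (rule torsion_split[OF g, of "{0} \<times> sections_As B" _ "sections_A B \<times> {0}"])
    fix a b c :: "('m, 'v) esec" assume "a \<in> {0} \<times> sections_As B" "b \<in> {0} \<times> sections_As B"
        "c \<in> {0} \<times> sections_As B"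
    then have e: "a = (0, snd a)" "b = (0, snd b)" "c = (0, snd c)"
      and s: "snd a \<in> sections_As B" "snd b \<in> sections_As B" "snd c \<in> sections_As B"
      by (simp_all add: mem_Times_iff prod_eq_iff)
    have "(0, snd a) \<in> sections_E B" "(0, snd b) \<in> sections_E B" using s zero_sections by (auto simp: sec_split)
    from torsion_section[OF g this]
    have "torsion (bracket_As B \<gamma>) (transpose_A B N) (snd a) (snd b) \<in> sections_As B"
      unfolding torsion_gamma(2)[OF m s(1,2)] by (simp add: sec_split)
    then show "pairing (torsion (dorfman B \<gamma>) P a b) c q = 0"
      using s by (subst e(1), subst e(2), subst e(3))
          (simp add: torsion_gamma(2)[OF m] pairing_def section_As_zero)
  next
    fix a b :: "('m, 'v) esec" assume "a \<in> sections_A B \<times> {0}" "b \<in> sections_A B \<times> {0}"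
    then have "fst a \<in> sections_A B" "fst b \<in> sections_A B" and e: "a = (fst a, 0)" "b = (fst b, 0)"
      by (simp_all add: mem_Times_iff prod_eq_iff)
    from torsion_gamma(1)[OF m this(1,2)] show "torsion (dorfman B \<gamma>) P a b = 0" using e by metis
  next
    show "{0} \<times> sections_As B \<subseteq> sections_E B" "sections_A B \<times> {0} \<subseteq> sections_E B"
      using zero_sections unfolding sections_E_def by blast+
  qed (simp_all add: s)
  then show ?thesis by (simp add: torsion_gamma[OF m] s pairing_def tilde_As_def)
qed

end

theorem theorem4p5:
  fixes B :: "('m::{t2_space, second_countable_topology}, 'v::real_vector) vbundle"
    and \<mu> \<gamma> :: "('m, 'v) gfun" and N :: "'m \<Rightarrow> 'v \<Rightarrow> 'v"
  assumes "vector_bundle B"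
    and "lie_bialgebroid B \<mu> \<gamma>"
    and "bundle_endo B N"
  shows "(let N' = tilde_endo B (endo_E B N)
          in \<lbrace>\<lbrace>N', \<mu> + \<gamma>\<rbrace>\<^bsub>B\<^esub>, N'\<rbrace>\<^bsub>B\<^esub> \<in> graded B 3 \<and>
             \<lbrace>\<lbrace>N', \<mu> + \<gamma>\<rbrace>\<^bsub>B\<^esub>, N'\<rbrace>\<^bsub>B\<^esub> = \<lbrace>\<lbrace>endo_el B N, \<mu> + \<gamma>\<rbrace>\<^bsub>B\<^esub>, endo_el B N\<rbrace>\<^bsub>B\<^esub>) \<and>
         (proportional_to_cps B N \<longrightarrow>
           (let T = torsion (dorfman B (\<mu> + \<gamma>)) (endo_E B N);
                T\<^sub>\<mu> = torsion (bracket_A B \<mu>) (endo_A N);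
                T\<^sub>\<gamma> = torsion (bracket_As B \<gamma>) (transpose_A B N)
            in tensor_el B (tilde_E T) = tensor_el B (tilde_A T\<^sub>\<mu>) + tensor_el B (tilde_As T\<^sub>\<gamma>) \<and>
               (\<forall>X\<in>sections_A B. \<forall>Y\<in>sections_A B. \<forall>Z\<in>sections_A B.
                \<forall>\<xi>\<in>sections_As B. \<forall>\<eta>\<in>sections_As B. \<forall>\<zeta>\<in>sections_As B. \<forall>q.
                  pairing (T (X, \<xi>) (Y, \<eta>)) (Z, \<zeta>) q =
                    \<zeta> q (T\<^sub>\<mu> X Y q) + \<xi> q (T\<^sub>\<mu> Y Z q) + \<eta> q (T\<^sub>\<mu> Z X q) +
                    T\<^sub>\<gamma> \<xi> \<eta> q (Z q) + T\<^sub>\<gamma> \<eta> \<zeta> q (X q) + T\<^sub>\<gamma> \<zeta> \<xi> q (Y q))))"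
proof -
  interpret vbun_endo B N by unfold_locales fact+
  have m: "lie_algebroid B \<mu>" and n: "lie_algebroid_dual B \<gamma>" using assms(2) by (auto simp: lie_bialgebroid_def)
  have g: "\<mu> \<in> graded B 3" "\<gamma> \<in> graded B 3" using m n by (auto simp: lie_algebroid_def lie_algebroid_dual_def)
  note gs = graded_linear(1)[OF g]
  show ?thesis unfolding Let_def
  proof (intro conjI impI)
    show "\<lbrace>\<lbrace>tilde_endo B P, \<mu> + \<gamma>\<rbrace>\<^bsub>B\<^esub>, tilde_endo B P\<rbrace>\<^bsub>B\<^esub> \<in> graded B 3"
      "\<lbrace>\<lbrace>tilde_endo B P, \<mu> + \<gamma>\<rbrace>\<^bsub>B\<^esub>, tilde_endo B P\<rbrace>\<^bsub>B\<^esub> = \<lbrace>\<lbrace>E, \<mu> + \<gamma>\<rbrace>\<^bsub>B\<^esub>, E\<rbrace>\<^bsub>B\<^esub>"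
      using tilde_endo_double_bracket[OF gs] by auto
    assume "proportional_to_cps B N"
    then obtain N\<^sub>0 c \<epsilon> where N\<^sub>0: "bundle_endo B N\<^sub>0" and \<epsilon>: "\<And>q v. v \<in> fibre B q \<Longrightarrow> N\<^sub>0 q (N\<^sub>0 q v) = \<epsilon> *\<^sub>R v"
      and c: "\<And>q v. v \<in> fibre B q \<Longrightarrow> N q v = c *\<^sub>R N\<^sub>0 q v"
      unfolding proportional_to_cps_def almost_cps_def by blast
    \<comment> \<open>The square of c times an almost cps structure with square \<epsilon> is c^2
      \<epsilon>.\<close>
    interpret vbun_cps B N "c * (c * \<epsilon>)"
    proof
      fix v q assume v: "v \<in> fibre B q"
      have w: "N\<^sub>0 q v \<in> fibre B q" using N\<^sub>0 v unfolding bundle_endo_def by blast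
      have l: "N\<^sub>0 q (c *\<^sub>R N\<^sub>0 q v) = c *\<^sub>R N\<^sub>0 q (N\<^sub>0 q v)"
        using N\<^sub>0 w unfolding bundle_endo_def linear_from_def by blast
      show "N q (N q v) = (c * (c * \<epsilon>)) *\<^sub>R v"
        unfolding c[OF v] c[OF subspace_scale[OF subspace_fibre w]] l \<epsilon>[OF v] by simp
    qed
    let ?T = "torsion (dorfman B (\<mu> + \<gamma>)) P" and ?M = "torsion (bracket_A B \<mu>) (endo_A N)"
      and ?G = "torsion (bracket_As B \<gamma>) (transpose_A B N)"
    \<comment> \<open>On sections the two tensors on the right agree with the full torsions for
      \<mu> and for \<gamma>. The claimed identity then becomes additivity of the functions
      representing the torsions.\<close>
    have A: "tensor_el B (tilde_A ?M) = tensor_el B (tilde_E (torsion (dorfman B \<mu>) P))"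
    proof (rule tensor_el_cong)
      fix u v w assume "u \<in> sections_E B" "v \<in> sections_E B" "w \<in> sections_E B"
      then show "tilde_A ?M u v w = tilde_E (torsion (dorfman B \<mu>) P) u v w"
        by (cases u; cases v; cases w) (simp add: tilde_E_def tilde_A_torsion[OF m] sec_split fun_eq_iff)
    qed
    have As: "tensor_el B (tilde_As ?G) = tensor_el B (tilde_E (torsion (dorfman B \<gamma>) P))"
    proof (rule tensor_el_cong)
      fix u v w assume "u \<in> sections_E B" "v \<in> sections_E B" "w \<in> sections_E B"
      then show "tilde_As ?G u v w = tilde_E (torsion (dorfman B \<gamma>) P) u v w"
        by (cases u; cases v; cases w) (simp add: tilde_E_def tilde_As_torsion[OF n] sec_split fun_eq_iff)
    qed
    show "tensor_el B (tilde_E ?T) = tensor_el B (tilde_A ?M) + tensor_el B (tilde_As ?G)"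
      unfolding A As tensor_el_torsion[OF gs] tensor_el_torsion[OF g(1)] tensor_el_torsion[OF g(2)]
          by (rule tor_el_plus)
    show "\<forall>X\<in>sections_A B. \<forall>Y\<in>sections_A B. \<forall>Z\<in>sections_A B.
        \<forall>\<xi>\<in>sections_As B. \<forall>\<eta>\<in>sections_As B. \<forall>\<zeta>\<in>sections_As B. \<forall>q.
          pairing (?T (X, \<xi>) (Y, \<eta>)) (Z, \<zeta>) q =
            \<zeta> q (?M X Y q) + \<xi> q (?M Y Z q) + \<eta> q (?M Z X q) +
            ?G \<xi> \<eta> q (Z q) + ?G \<eta> \<zeta> q (X q) + ?G \<zeta> \<xi> q (Y q)"
    proof (intro ballI allI)
      fix X Y Z \<xi> \<eta> \<zeta> q
      assume s: "X \<in> sections_A B" "Y \<in> sections_A B" "Z \<in> sections_A B" "\<xi> \<in> sections_As B" "\<eta> \<in> sections_As B"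
          "\<zeta> \<in> sections_As B"
      then have e: "(X, \<xi>) \<in> sections_E B" "(Y, \<eta>) \<in> sections_E B" "(Z, \<zeta>) \<in> sections_E B"
          by (auto simp: sec_split)
      note t = torsion_section[OF g(1) e(1,2)] torsion_section[OF g(2) e(1,2)]
      have "pairing (?T (X, \<xi>) (Y, \<eta>)) (Z, \<zeta>) q =
         pairing (torsion (dorfman B \<mu>) P (X, \<xi>) (Y, \<eta>)) (Z, \<zeta>) q + pairing (torsion (dorfman B \<gamma>) P (X, \<xi>)
             (Y, \<eta>)) (Z, \<zeta>) q"
        unfolding torsion_plus[OF g e(1,2)] by (rule pairing_add[OF t e(3)])
      then show "pairing (?T (X, \<xi>) (Y, \<eta>)) (Z, \<zeta>) q =
            \<zeta> q (?M X Y q) + \<xi> q (?M Y Z q) + \<eta> q (?M Z X q) +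
            ?G \<xi> \<eta> q (Z q) + ?G \<eta> \<zeta> q (X q) + ?G \<zeta> \<xi> q (Y q)"
        unfolding tilde_A_torsion[OF m s] tilde_As_torsion[OF n s] by (simp add: tilde_A_def tilde_As_def)
    qed
  qed
qed

end
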